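(* Let $w\in\widetilde{\mathrm{Sp}}(2n)$. Then: (i) If $w$ lies in the closure of $\widetilde{\mathrm{Sp}}^+_{\mathrm{ell}}(2n)$, then $\pi(w)$ has spectrum $\{e^{\pm i\theta_1},\dots,e^{\pm i\theta_n}\}$ with $\theta_j\in[0,\pi]$ for every $j$, and $$\mathrm{dist}_G(\mathrm{id},w)\le\frac{2\pi}{n}\mu(w)=\frac1n\sum_{j=1}^n\theta_j.$$ (ii) If there is a timelike curve from $\mathrm{id}$ to $w$ and $w$ is not in the closure of $\widetilde{\mathrm{Sp}}^+_{\mathrm{ell}}(2n)$, then $\mathrm{dist}_G(\mathrm{id},w)=+\infty$.
   Context: $\omega_0=\sum_j\mathrm{d}x_j\wedge\mathrm{d}y_j$ on $\mathbb{R}^{2n}$, $J_0$ the standard complex structure with $\omega_0(u,v)=J_0u\cdot v$; $\mathrm{Sp}(2n)$, $\mathrm{sp}(2n)=\{X:(u,v)\mapsto\omega_0(u,Xv)\text{ symmetric}\}$, $\mathrm{sp}^+(2n)$ those with this form positive definite, $G(X)=(\det X)^{1/(2n)}$ on $\mathrm{sp}^+(2n)$, extended by $0$ to its boundary. $\widetilde{\mathrm{Sp}}(2n)$ is the universal cover (homotopy classes of paths from $\mathrm{id}$), $\pi(w)=w(1)$. A $C^1$ curve is timelike if $W'W^{-1}\in\mathrm{sp}^+(2n)$ and causal if $W'W^{-1}$ is nonzero and in the closure of $\mathrm{sp}^+(2n)$ (for curves in $\widetilde{\mathrm{Sp}}(2n)$, via projection); $\mathrm{length}_G(W)=\int G(W'W^{-1})\,\mathrm{d}t$.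 Write $w_0\le w_1$ if $w_0=w_1$ or there is a causal curve from $w_0$ to $w_1$ in $\widetilde{\mathrm{Sp}}(2n)$ (a partial order). $\mathrm{dist}_G(w_0,w_1)=\sup\mathrm{length}_G(\gamma)$ over causal curves $\gamma$ from $w_0$ to $w_1$ if $w_0\le w_1$, and $0$ otherwise. Krein form: $\kappa(w,w')=\langle -iJ_0w,w'\rangle$ on $\mathbb{C}^{2n}$ with $\langle a,b\rangle=\sum a_k\overline{b_k}$. For an eigenvalue $\lambda$ on the unit circle $\mathbb{U}$ of $W\in\mathrm{Sp}(2n)$, its Krein signature $(p(\lambda),q(\lambda))$ is the signature of $\kappa$ on the generalized eigenspace; $\lambda$ is Krein-positive if $\kappa$ is positive definite there. $\mathrm{Sp}^+_{\mathrm{ell}}(2n)$ is the set of $W$ all of whose eigenvalues lie in $\mathbb{U}\setminus\{\pm1\}$, with those of positive imaginary part Krein-positive; $\widetilde{\mathrm{Sp}}^+_{\mathrm{ell}}(2n)$ is the set of classes of paths $w$ with $w(0)=\mathrm{id}$, $w((0,1])\subset\mathrm{Sp}^+_{\mathrm{ell}}(2n)$. Let $\upsilon(W)=(-1)^m\prod_{\lambda\in\sigma(W)\cap\mathbb{U}\setminus\{\pm1\}}\lambda^{p(\lambda)}$, with $2m$ the total algebraic multiplicity of negative real eigenvalues of $W$. The homogeneous Maslov quasimorphism $\mu:\widetilde{\mathrm{Sp}}(2n)\to\mathbb{R}$ is the unique continuous function with $e^{2\pi i\mu(w)}=\upsilon(\pi(w))$ and $\mu(\mathrm{id})=0$. 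*)

theory Defs
  imports "HOL-Analysis.Analysis"
begin

text \<open>Conventions. The phase space is R^{2n} realised as real^('n + 'n) with
  coordinates x_j = Inl j and y_j = Inr j (j :: 'n), so n = CARD('n) >= 1.\<close>

type_synonym 'n sqm = "real^('n + 'n)^('n + 'n)"
type_synonym 'n cvec = "complex^('n + 'n)"

definition omega0 :: "real^('n::finite + 'n) \<Rightarrow> real^('n + 'n) \<Rightarrow> real" where
  "omega0 u v = (\<Sum>j\<in>UNIV. u $ Inl j * v $ Inr j - u $ Inr j * v $ Inl j)"

text \<open>Standard complex structure J0, characterised by omega0 u v = (J0 u) . v.\<close>
definition J0 :: "'n::finite sqm" where
  "J0 = (\<chi> i k. case i of Inl j \<Rightarrow> (if k = Inr j then -1 else 0)
                         | Inr j \<Rightarrow> (if k = Inl j then 1 else 0))"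

definition Sp :: "'n::finite sqm set" where
  "Sp = {W. \<forall>u v. omega0 (W *v u) (W *v v) = omega0 u v}"

definition sp :: "'n::finite sqm set" where
  "sp = {X. \<forall>u v. omega0 u (X *v v) = omega0 v (X *v u)}"

definition sp_plus :: "'n::finite sqm set" where
  "sp_plus = {X. X \<in> sp \<and> (\<forall>u. u \<noteq> 0 \<longrightarrow> omega0 u (X *v u) > 0)}"

definition G :: "'n::finite sqm \<Rightarrow> real" where
  "G X = (if X \<in> sp_plus then det X powr (1 / real CARD('n + 'n)) else 0)"

definition cplx :: "'n::finite sqm \<Rightarrow> complex^('n + 'n)^('n + 'n)" where
  "cplx W = (\<chi> i k. complex_of_real (W $ i $ k))"

definition charpoly :: "'n::finite sqm \<Rightarrow> complex \<Rightarrow> complex" where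
  "charpoly W z = det ((\<chi> i k. if i = k then z else 0) - cplx W)"

definition eigenvalues :: "'n::finite sqm \<Rightarrow> complex set" where
  "eigenvalues W = {z. charpoly W z = 0}"

definition geneig :: "'n::finite sqm \<Rightarrow> complex \<Rightarrow> 'n cvec set" where
  "geneig W l = {v. ((\<lambda>x. cplx W *v x - l *s x) ^^ CARD('n + 'n)) v = 0}"

definition krein :: "'n::finite cvec \<Rightarrow> 'n cvec \<Rightarrow> complex" where
  "krein w w' = (\<Sum>k\<in>UNIV. (- \<i> * (cplx J0 *v w) $ k) * cnj (w' $ k))"

definition krein_posdef_on :: "'n::finite cvec set \<Rightarrow> bool" where
  "krein_posdef_on V \<longleftrightarrow>
     (\<forall>v\<in>V. v \<noteq> 0 \<longrightarrow> Im (krein v v) = 0 \<and> Re (krein v v) > 0)"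

text \<open>p(lambda): positive index of inertia of kappa on the generalised eigenspace,
  i.e. the maximal complex dimension of a complex subspace on which kappa is
  positive definite.\<close>
definition krein_p :: "'n::finite sqm \<Rightarrow> complex \<Rightarrow> nat" where
  "krein_p W l = Max {vec.dim V | V. vec.subspace V \<and> V \<subseteq> geneig W l \<and> krein_posdef_on V}"

definition krein_positive :: "'n::finite sqm \<Rightarrow> complex \<Rightarrow> bool" where
  "krein_positive W l \<longleftrightarrow> krein_posdef_on (geneig W l)"

definition Sp_ell_plus :: "'n::finite sqm set" where
  "Sp_ell_plus = {W. W \<in> Sp \<and>
     (\<forall>l\<in>eigenvalues W. cmod l = 1 \<and> l \<noteq> 1 \<and> l \<noteq> -1 \<and>
        (Im l > 0 \<longrightarrow> krein_positive W l))}"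

definition neg_mult :: "'n::finite sqm \<Rightarrow> nat" where
  "neg_mult W = (\<Sum>l\<in>{l\<in>eigenvalues W. l \<in> \<real> \<and> Re l < 0}. vec.dim (geneig W l))"

definition upsilon :: "'n::finite sqm \<Rightarrow> complex" where
  "upsilon W = (-1) ^ (neg_mult W div 2) *
     (\<Prod>l\<in>{l\<in>eigenvalues W. cmod l = 1 \<and> l \<noteq> 1 \<and> l \<noteq> -1}. l ^ krein_p W l)"

subsection \<open>The universal cover as homotopy classes of paths from id\<close>

definition sp_path :: "(real \<Rightarrow> 'n::finite sqm) \<Rightarrow> bool" where
  "sp_path g \<longleftrightarrow> path g \<and> path_image g \<subseteq> Sp \<and> pathstart g = mat 1"

definition cls :: "(real \<Rightarrow> 'n::finite sqm) \<Rightarrow> (real \<Rightarrow> 'n sqm) set" where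
  "cls g = {h. sp_path h \<and> homotopic_paths Sp g h}"

definition SpT :: "(real \<Rightarrow> 'n::finite sqm) set set" where
  "SpT = {cls g | g. sp_path g}"

definition idT :: "(real \<Rightarrow> 'n::finite sqm) set" where
  "idT = cls (\<lambda>t. mat 1)"

definition proj :: "(real \<Rightarrow> 'n::finite sqm) set \<Rightarrow> 'n sqm" where
  "proj w = pathfinish (SOME g. g \<in> w)"

definition nbhd :: "(real \<Rightarrow> 'n::finite sqm) set \<Rightarrow> 'n sqm set \<Rightarrow> (real \<Rightarrow> 'n sqm) set set" where
  "nbhd w V = {cls (g +++ d) | g d. g \<in> w \<and> path d \<and> path_image d \<subseteq> V \<inter> Sp
                                  \<and> pathstart d = pathfinish g}"

definition SpT_top :: "(real \<Rightarrow> 'n::finite sqm) set topology" where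
  "SpT_top = topology (\<lambda>U. U \<subseteq> SpT \<and>
      (\<forall>w\<in>U. \<exists>V. open V \<and> proj w \<in> V \<and> nbhd w V \<subseteq> U))"

definition SpT_ell_plus :: "(real \<Rightarrow> 'n::finite sqm) set set" where
  "SpT_ell_plus = {w \<in> SpT. \<exists>g\<in>w. \<forall>t\<in>{0<..1}. g t \<in> Sp_ell_plus}"

text \<open>Homogeneous Maslov quasimorphism: the unique continuous function on the
  universal cover with exp(2 pi i mu) = upsilon o pi and mu(id) = 0
  (normalised to 0 off the carrier to make it unique as a HOL function).\<close>
definition maslov :: "(real \<Rightarrow> 'n::finite sqm) set \<Rightarrow> real" where
  "maslov = (THE f. continuous_map SpT_top euclideanreal f
      \<and> (\<forall>w\<in>SpT. exp (2 * pi * \<i> * complex_of_real (f w)) = upsilon (proj w))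
      \<and> f idT = 0 \<and> (\<forall>w. w \<notin> SpT \<longrightarrow> f w = 0))"

definition C1_curve :: "(real \<Rightarrow> 'n::finite sqm) \<Rightarrow> bool" where
  "C1_curve c \<longleftrightarrow> (\<forall>t\<in>{0..1}. c differentiable (at t within {0..1}))
      \<and> continuous_on {0..1} (\<lambda>t. vector_derivative c (at t within {0..1}))"

definition logder :: "(real \<Rightarrow> 'n::finite sqm) \<Rightarrow> real \<Rightarrow> 'n sqm" where
  "logder c t = vector_derivative c (at t within {0..1}) ** matrix_inv (c t)"

definition causal_curve :: "(real \<Rightarrow> 'n::finite sqm) \<Rightarrow> bool" where
  "causal_curve c \<longleftrightarrow> C1_curve c \<and> (\<forall>t\<in>{0..1}. c t \<in> Sp)
      \<and> (\<forall>t\<in>{0..1}. logder c t \<noteq> 0 \<and> logder c t \<in> closure sp_plus)"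

definition timelike_curve :: "(real \<Rightarrow> 'n::finite sqm) \<Rightarrow> bool" where
  "timelike_curve c \<longleftrightarrow> C1_curve c \<and> (\<forall>t\<in>{0..1}. c t \<in> Sp)
      \<and> (\<forall>t\<in>{0..1}. logder c t \<in> sp_plus)"

definition lengthG :: "(real \<Rightarrow> 'n::finite sqm) \<Rightarrow> real" where
  "lengthG c = integral {0..1} (\<lambda>t. G (logder c t))"

text \<open>c, a curve in Sp, lifts to a curve in the universal cover from w0 to w1.\<close>
definition curve_from_to ::
  "(real \<Rightarrow> 'n::finite sqm) \<Rightarrow> (real \<Rightarrow> 'n sqm) set \<Rightarrow> (real \<Rightarrow> 'n sqm) set \<Rightarrow> bool" where
  "curve_from_to c w0 w1 \<longleftrightarrow> (\<exists>g\<in>w0. c 0 = pathfinish g \<and> g +++ c \<in> w1)"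

definition causal_le :: "(real \<Rightarrow> 'n::finite sqm) set \<Rightarrow> (real \<Rightarrow> 'n sqm) set \<Rightarrow> bool" where
  "causal_le w0 w1 \<longleftrightarrow> w0 = w1 \<or> (\<exists>c. causal_curve c \<and> curve_from_to c w0 w1)"

definition distG :: "(real \<Rightarrow> 'n::finite sqm) set \<Rightarrow> (real \<Rightarrow> 'n sqm) set \<Rightarrow> ereal" where
  "distG w0 w1 = (if causal_le w0 w1
      then Sup ({0} \<union> {ereal (lengthG c) | c. causal_curve c \<and> curve_from_to c w0 w1})
      else 0)"

end

theory Submission
  imports Defs "HOL-Computational_Algebra.Fundamental_Theorem_Algebra"
begin

text \<open>
  Write \<open>\<omega>\<close> for the symplectic form. A symplectic \<open>W\<close> lies in \<open>Sp_ell_plus\<close> iff \<open>\<omega>(v, W v) > 0\<close> for all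
  \<open>v \<noteq> 0\<close> (the set \<open>Sp_pos\<close>); \<open>Sp_nonneg\<close> is given by the weak inequality. By Brouwer's theorem every \<open>W\<close> has an
  invariant maximal Krein-nonnegative subspace \<open>V\<close>, and \<open>upsilon W\<close> is the phase of the determinant of \<open>W\<close> on \<open>V\<close>;
  hence \<open>upsilon\<close> is continuous and \<open>maslov\<close> exists. A matrix in \<open>Sp_pos\<close> is symplectically conjugate to a rotation with
  angles in \<open>(0, \<pi>)\<close>, which identifies \<open>2 \<pi> maslov\<close> with the sum of the angles.

  For the upper bound, let \<open>R a = cos a + J sin a\<close>. Along a causal curve the argument of \<open>det (W - R a)\<close>, \<open>Im a > 0\<close>, does
  not decrease. As \<open>a\<close> tends to a point of \<open>(\<pi>, 2 \<pi>)\<close> its lift tends to \<open>0\<close> over the closure of the elliptic set, but it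
  jumps at every \<open>b\<close> for which \<open>W - R b\<close> is singular, and such \<open>b\<close> exists if \<open>W\<close> is not in \<open>Sp_nonneg\<close>; so a causal curve
  from the identity to a point of the closure stays in \<open>Sp_nonneg\<close>. After pushing it into \<open>Sp_pos\<close> by a fractional linear map,
  the sum of the angles is approximated by \<open>tr P((W + W\<^sup>-\<^sup>1) / 2) / 2\<close> with polynomials \<open>P\<close> close to \<open>arccos\<close>, whose
  derivative along the curve is at least about \<open>n G\<close> by the inequality of arithmetic and geometric means.

  For the second part, a timelike curve leaving \<open>Sp_pos\<close> does so at some \<open>W\<close> with \<open>W u = - u\<close>. Then
  \<open>(1 - r N) W\<close>, with \<open>N y = - \<omega>(u, y) u\<close>, lies in \<open>Sp_nonneg\<close> for every \<open>r \<ge> 0\<close>, and undoing the shear while moving along the rest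
  of the curve gives timelike curves in the same class whose length tends to infinity with \<open>r\<close>.
\<close>

section \<open>Matrix analysis\<close>

lemma matrix_inv_right: "invertible A \<Longrightarrow> A ** matrix_inv A = mat 1"
  and matrix_inv_left: "invertible A \<Longrightarrow> matrix_inv A ** A = mat 1"
  for A :: "'a::field^'n^'n"
  unfolding invertible_def matrix_inv_def by (metis (mono_tags, lifting) someI_ex)+

interpretation matrix_mult: bounded_bilinear
  "(**) :: 'a::{euclidean_space,real_normed_field}^'n^'m \<Rightarrow> 'a^'p^'n \<Rightarrow> 'a^'p^'m"
  unfolding bilinear_conv_bounded_bilinear[symmetric] bilinear_def
  by (auto intro!: linearI simp: matrix_matrix_mult_def vec_eq_iff sum.distrib algebra_simps
      scaleR_sum_right)

interpretation matrix_vec_mult: bounded_bilinear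
  "(*v) :: 'a::{euclidean_space,real_normed_field}^'n^'m \<Rightarrow> 'a^'n \<Rightarrow> 'a^'m"
  unfolding bilinear_conv_bounded_bilinear[symmetric] bilinear_def
  by (auto intro!: linearI simp: matrix_vector_mult_def vec_eq_iff sum.distrib algebra_simps
      scaleR_sum_right)

lemmas matrix_vec_linear =
  matrix_vec_mult.add_left matrix_vec_mult.add_right matrix_vec_mult.diff_left matrix_vec_mult.diff_right
  matrix_vec_mult.minus_left matrix_vec_mult.minus_right matrix_vec_mult.scaleR_left matrix_vec_mult.scaleR_right

lemma continuous_on_det:
  fixes f :: "'b::topological_space \<Rightarrow> 'a::real_normed_field^'n^'n"
  assumes "continuous_on S f"
  shows "continuous_on S (\<lambda>x. det (f x))"
  unfolding det_def by (intro continuous_intros assms)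

lemma tendsto_det:
  fixes f :: "'b \<Rightarrow> 'a::real_normed_field^'n^'n"
  assumes "(f \<longlongrightarrow> A) F"
  shows "((\<lambda>x. det (f x)) \<longlongrightarrow> det A) F"
  unfolding det_def by (intro tendsto_intros assms)

lemma matrix_vector_mult_axis: "(A *v axis j 1) $ i = (A $ i $ j :: 'a::semiring_1)"
  by (simp add: matrix_vector_mult_def axis_def if_distrib cong: if_cong)

lemma mat_vec: "mat k *v x = (k :: 'a::semiring_1) *s x"
  by (simp add: mat_def matrix_vector_mult_def vec_eq_iff if_distrib if_distribR cong: if_cong)

lemma matrix_inv_cramer:
  fixes A :: "'a::field^'n^'n"
  assumes "invertible A"
  shows "matrix_inv A = (\<chi> i j. det (\<chi> k l. if l = i then axis j 1 $ k else A $ k $ l) / det A)"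
proof -
  have d: "det A \<noteq> 0" using assms invertible_det_nz by blast
  have "A *v (matrix_inv A *v axis j 1) = axis j 1" for j
    by (simp add: matrix_vector_mul_assoc matrix_inv_right assms)
  then have "matrix_inv A *v axis j 1
      = (\<chi> k. det (\<chi> i l. if l = k then axis j 1 $ i else A $ i $ l) / det A)" for j
    using cramer[OF d] by blast
  then have "matrix_inv A $ i $ j = det (\<chi> k l. if l = i then axis j 1 $ k else A $ k $ l) / det A" for i j
    by (simp add: vec_eq_iff matrix_vector_mult_axis)
  then show ?thesis by (simp add: vec_eq_iff)
qed

lemma continuous_on_matrix_inv:
  fixes f :: "'b::topological_space \<Rightarrow> 'a::real_normed_field^'n^'n"
  assumes "continuous_on S f" "\<And>x. x \<in> S \<Longrightarrow> invertible (f x)"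
  shows "continuous_on S (\<lambda>x. matrix_inv (f x))"
proof -
  have "continuous_on S (\<lambda>x. \<chi> i j. det (\<chi> k l. if l = i then axis j 1 $ k else f x $ k $ l) / det (f x))"
  proof (intro continuous_on_vec_lambda continuous_on_divide continuous_on_det assms)
    show "\<forall>x\<in>S. det (f x) \<noteq> 0" using assms(2) invertible_det_nz by blast
    show "continuous_on S (\<lambda>x. if l = i then axis j 1 $ k else f x $ k $ l)" for i j k l
      by (cases "l = i") (auto intro!: continuous_intros assms)
  qed
  then show ?thesis
    by (rule continuous_on_eq) (simp add: matrix_inv_cramer assms)
qed

lemma has_vector_derivative_within_iff_tendsto:
  "(f has_vector_derivative D) (at t within S)
    \<longleftrightarrow> ((\<lambda>s. (f s - f t) /\<^sub>R (s - t)) \<longlongrightarrow> D) (at t within S)"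
proof -
  have "norm (f s - f t - (s - t) *\<^sub>R D) / norm (s - t) = norm ((f s - f t) /\<^sub>R (s - t) - D)"
    if "s \<noteq> t" for s
  proof -
    have "(f s - f t) /\<^sub>R (s - t) - D = (f s - f t - (s - t) *\<^sub>R D) /\<^sub>R (s - t)"
      by (subst scaleR_diff_right) (use that in simp)
    then show ?thesis using that by (simp add: divide_inverse mult.commute)
  qed
  then have "((\<lambda>s. norm (f s - f t - (s - t) *\<^sub>R D) / norm (s - t)) \<longlongrightarrow> 0) (at t within S)
     \<longleftrightarrow> ((\<lambda>s. norm ((f s - f t) /\<^sub>R (s - t) - D)) \<longlongrightarrow> 0) (at t within S)"
    by (intro tendsto_cong) (auto simp: eventually_at_filter)
  then show ?thesis
    unfolding has_vector_derivative_def has_derivative_iff_norm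
    by (simp add: bounded_linear_scaleR_left tendsto_norm_zero_iff LIM_zero_iff)
qed

lemma has_vector_derivative_matrix_inv:
  fixes M :: "real \<Rightarrow> 'a::{euclidean_space,real_normed_field}^'n^'n"
  assumes D: "(M has_vector_derivative D) (at t within S)" and t: "t \<in> S"
    and inv: "\<And>s. s \<in> S \<Longrightarrow> invertible (M s)" and cont: "continuous_on S M"
  shows "((\<lambda>s. matrix_inv (M s)) has_vector_derivative
           - (matrix_inv (M t) ** D ** matrix_inv (M t))) (at t within S)"
proof -
  have eq: "(matrix_inv (M s) - matrix_inv (M t)) /\<^sub>R (s - t)
      = - (matrix_inv (M s) ** ((M s - M t) /\<^sub>R (s - t)) ** matrix_inv (M t))" if "s \<in> S" for s
  proof -
    have "matrix_inv (M s) ** (M s - M t) ** matrix_inv (M t)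
        = matrix_inv (M t) - matrix_inv (M s)"
      using inv[OF that] inv[OF t]
      by (simp add: matrix_mult.diff_left matrix_mult.diff_right matrix_inv_left
          matrix_mul_assoc[symmetric] matrix_inv_right)
    then show ?thesis
      by (simp add: matrix_mult.scaleR_left matrix_mult.scaleR_right flip: scaleR_minus_right)
  qed
  have "((\<lambda>s. matrix_inv (M s)) \<longlongrightarrow> matrix_inv (M t)) (at t within S)"
    using continuous_on_matrix_inv[OF cont inv] t by (auto simp: continuous_on_def)
  moreover have "((\<lambda>s. (M s - M t) /\<^sub>R (s - t)) \<longlongrightarrow> D) (at t within S)"
    using D by (simp add: has_vector_derivative_within_iff_tendsto)
  ultimately have "((\<lambda>s. - (matrix_inv (M s) ** ((M s - M t) /\<^sub>R (s - t)) ** matrix_inv (M t)))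
      \<longlongrightarrow> - (matrix_inv (M t) ** D ** matrix_inv (M t))) (at t within S)"
    by (intro tendsto_intros matrix_mult.tendsto)
  then show ?thesis
    unfolding has_vector_derivative_within_iff_tendsto
    by (rule Lim_transform_eventually) (auto simp: eventually_at_filter eq)
qed

lemma has_vector_derivative_vec_nth:
  "(f has_vector_derivative D) F \<Longrightarrow> ((\<lambda>x. f x $ i) has_vector_derivative D $ i) F"
  by (rule bounded_linear.has_vector_derivative[OF bounded_linear_vec_nth])

lemma has_vector_derivative_det_at_one:
  fixes L :: "real \<Rightarrow> 'a::real_normed_field^'n^'n"
  assumes D: "(L has_vector_derivative D) (at t within S)" and L: "L t = mat 1"
  shows "((\<lambda>s. det (L s)) has_vector_derivative trace D) (at t within S)"
proof -
  let ?U = "UNIV :: 'n set"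
  let ?PU = "{p. p permutes ?U}"
  have entries: "((\<lambda>s. L s $ i $ j) has_derivative (\<lambda>y. y *\<^sub>R D $ i $ j)) (at t within S)" for i j
    using has_vector_derivative_vec_nth[OF has_vector_derivative_vec_nth[OF D, of i], of j]
    by (simp add: has_vector_derivative_def)
  have der: "((\<lambda>s. det (L s)) has_derivative (\<lambda>y. \<Sum>p\<in>?PU. of_int (sign p) *
      (\<Sum>i\<in>?U. y *\<^sub>R D $ i $ p i * (\<Prod>j\<in>?U - {i}. L t $ j $ p j)))) (at t within S)"
    unfolding det_def by (auto intro!: derivative_eq_intros entries)
  have vanish: "(\<Prod>j\<in>?U - {i}. L t $ j $ p j) = 0" if p: "p permutes ?U" "p \<noteq> id" for p i
  proof -
    obtain a where a: "p a \<noteq> a" using p by (auto simp: fun_eq_iff)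
    have inj: "inj p" using p(1) by (simp add: permutes_inj)
    obtain j where "j \<noteq> i" "p j \<noteq> j"
      using a inj by (metis injD)
    then have "\<exists>a\<in>?U - {i}. L t $ a $ p a = 0" by (intro bexI[of _ j]) (auto simp: L mat_def)
    then show ?thesis by (simp add: prod_zero)
  qed
  have "(\<Sum>p\<in>?PU. of_int (sign p) * (\<Sum>i\<in>?U. y *\<^sub>R D $ i $ p i * (\<Prod>j\<in>?U - {i}. L t $ j $ p j)))
      = (\<Sum>p\<in>{id}. of_int (sign p) * (\<Sum>i\<in>?U. y *\<^sub>R D $ i $ p i * (\<Prod>j\<in>?U - {i}. L t $ j $ p j)))" for y
    by (rule sum.mono_neutral_right) (auto simp: finite_permutations permutes_id vanish)
  also have "\<dots> y = y *\<^sub>R trace D" for y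
    by (simp add: L mat_def trace_def scaleR_sum_right)
  finally show ?thesis
    using der by (simp add: has_vector_derivative_def)
qed

lemma has_vector_derivative_det:
  fixes M :: "real \<Rightarrow> 'a::{euclidean_space,real_normed_field}^'n^'n"
  assumes D: "(M has_vector_derivative D) (at t within S)" and inv: "invertible (M t)"
  shows "((\<lambda>s. det (M s)) has_vector_derivative det (M t) * trace (matrix_inv (M t) ** D)) (at t within S)"
proof -
  have eq: "det (M s) = det (M t) * det (matrix_inv (M t) ** M s)" for s
    by (metis det_mul inv matrix_inv_right matrix_mul_assoc matrix_mul_lid)
  have "((\<lambda>s. matrix_inv (M t) ** M s) has_vector_derivative matrix_inv (M t) ** D) (at t within S)"
    by (rule bounded_linear.has_vector_derivative[OF matrix_mult.bounded_linear_right D])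
  from has_vector_derivative_det_at_one[OF this matrix_inv_left[OF inv]]
  have "((\<lambda>s. det (M t) * det (matrix_inv (M t) ** M s)) has_vector_derivative
     det (M t) * trace (matrix_inv (M t) ** D)) (at t within S)"
    by (rule has_vector_derivative_mult_right)
  then show ?thesis by (simp add: eq[symmetric])
qed

lemma psd_form_kernel:
  fixes f :: "'a::real_vector \<Rightarrow> 'a \<Rightarrow> real"
  assumes f: "bilinear f" and S: "subspace S" and psd: "\<And>u. u \<in> S \<Longrightarrow> 0 \<le> f u u"
    and v: "v \<in> S" "f v v = 0" and u: "u \<in> S"
  shows "f v u + f u v = 0"
proof (rule ccontr)
  assume nonzero: "\<not> ?thesis"
  define s where "s = - (f u u + 1) / (f v u + f u v)"
  have "f (u + s *\<^sub>R v) (u + s *\<^sub>R v) = f u u + s * (f v u + f u v)"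
    using v(2) by (simp add: bilinear_ladd[OF f] bilinear_radd[OF f] bilinear_lmul[OF f] bilinear_rmul[OF f] algebra_simps)
  also have "s * (f v u + f u v) = - (f u u + 1)" using nonzero by (simp add: s_def)
  finally have "f (u + s *\<^sub>R v) (u + s *\<^sub>R v) < 0" by simp
  then show False using psd[of "u + s *\<^sub>R v"] S u v(1) by (simp add: subspace_add subspace_scale)
qed

definition symmetric_matrix :: "real^'m^'m \<Rightarrow> bool" where
  "symmetric_matrix Q \<longleftrightarrow> (\<forall>u v. u \<bullet> (Q *v v) = v \<bullet> (Q *v u))"

definition psd_matrix :: "real^'m^'m \<Rightarrow> bool" where
  "psd_matrix Q \<longleftrightarrow> symmetric_matrix Q \<and> (\<forall>u. 0 \<le> u \<bullet> (Q *v u))"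

text \<open>A maximiser \<open>v\<close> of the Rayleigh quotient, with maximum \<open>l\<close>, is a null vector of the form
  \<open>l (u \<bullet> x) - u \<bullet> Q x\<close>, which is positive semidefinite on \<open>S\<close>.\<close>
lemma symmetric_eigenvector_exists:
  fixes Q :: "real^'m^'m"
  assumes Q: "symmetric_matrix Q" and S: "subspace S" "S \<noteq> {0}"
    and inv: "\<And>v. v \<in> S \<Longrightarrow> Q *v v \<in> S"
  obtains v l where "v \<in> S" "norm v = 1" "Q *v v = l *\<^sub>R v"
proof -
  let ?K = "S \<inter> sphere 0 1"
  have "compact ?K"
    by (simp add: S(1) closed_subspace closed_Int_compact)
  moreover have "?K \<noteq> {}"
  proof -
    obtain x where x: "x \<in> S" "x \<noteq> 0" using S subspace_0 by blast
    then have "x /\<^sub>R norm x \<in> ?K" by (simp add: S(1) subspace_scale)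
    then show ?thesis by blast
  qed
  moreover have "continuous_on ?K (\<lambda>v. v \<bullet> (Q *v v))"
    by (intro continuous_intros matrix_vec_mult.continuous_on)
  ultimately have "\<exists>v\<in>?K. \<forall>x\<in>?K. x \<bullet> (Q *v x) \<le> v \<bullet> (Q *v v)"
    by (rule continuous_attains_sup)
  then obtain v where v: "v \<in> ?K" and max: "\<forall>x\<in>?K. x \<bullet> (Q *v x) \<le> v \<bullet> (Q *v v)" ..
  define l where "l = v \<bullet> (Q *v v)"
  define f where "f u x = l * (u \<bullet> x) - u \<bullet> (Q *v x)" for u x
  have "bilinear f"
    unfolding bilinear_def f_def by (auto intro!: linearI simp: matrix_vec_linear inner_simps algebra_simps)
  moreover have "0 \<le> f x x" if "x \<in> S" for x
  proof (cases "x = 0")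
    case False
    have "(x /\<^sub>R norm x) \<bullet> (Q *v (x /\<^sub>R norm x)) \<le> l"
      unfolding l_def by (rule bspec[OF max]) (use that False S in \<open>simp add: subspace_scale\<close>)
    then have "(x \<bullet> (Q *v x)) / (x \<bullet> x) \<le> l"
      by (simp add: matrix_vec_mult.scaleR_right dot_square_norm power2_eq_square divide_inverse mult_ac)
    then show ?thesis using False by (simp add: f_def divide_simps)
  qed (simp add: f_def)
  moreover have "f v v = 0" using v by (simp add: f_def l_def dot_square_norm)
  moreover define r where "r = Q *v v - l *\<^sub>R v"
  then have "r \<in> S" using v inv S(1) by (simp add: subspace_diff subspace_scale)
  ultimately have "f v r + f r v = 0"
    using psd_form_kernel[of f S v r] S(1) v by blast
  moreover have "v \<bullet> (Q *v r) = r \<bullet> (Q *v v)"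
    using Q by (simp add: symmetric_matrix_def)
  ultimately have "r \<bullet> (Q *v v - l *\<^sub>R v) = 0"
    by (simp add: f_def inner_diff_right inner_commute)
  then have "Q *v v = l *\<^sub>R v" by (simp flip: r_def) (simp add: r_def)
  then show ?thesis using v by (intro that) auto
qed

lemma symmetric_orthonormal_eigenbasis:
  fixes Q :: "real^'m^'m"
  assumes Q: "symmetric_matrix Q"
  shows "subspace S \<Longrightarrow> (\<And>v. v \<in> S \<Longrightarrow> Q *v v \<in> S) \<Longrightarrow>
    \<exists>B. B \<subseteq> S \<and> finite B \<and> card B = dim S \<and> pairwise orthogonal B \<and>
      (\<forall>b\<in>B. norm b = 1 \<and> (\<exists>l. Q *v b = l *\<^sub>R b))"
proof (induction "dim S" arbitrary: S)
  case 0
  then show ?case by (intro exI[of _ "{}"]) (auto simp: pairwise_def)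
next
  case (Suc d)
  have "S \<noteq> {0}" using Suc.hyps(2) by auto
  from symmetric_eigenvector_exists[OF Q Suc.prems(1) this Suc.prems(2)]
  obtain v l where v: "v \<in> S" "norm v = 1" "Q *v v = l *\<^sub>R v" by metis
  define T where "T = {x \<in> S. orthogonal v x}"
  have T: "subspace T"
    using Suc.prems(1) unfolding T_def subspace_def
    by (auto simp: orthogonal_def inner_add_right)
  have "v \<bullet> (Q *v x) = x \<bullet> (l *\<^sub>R v)" for x using Q v(3) by (metis symmetric_matrix_def)
  then have T_invariant: "Q *v x \<in> T" if "x \<in> T" for x
    using that Suc.prems(2) by (auto simp: T_def orthogonal_def inner_commute)
  have "x \<in> span (insert v T)" if x: "x \<in> S" for x
  proof -
    have "x - (v \<bullet> x) *\<^sub>R v \<in> T"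
      using x v Suc.prems(1)
      by (auto simp: T_def subspace_diff subspace_scale orthogonal_def inner_diff_right norm_eq_1)
    then have "(x - (v \<bullet> x) *\<^sub>R v) + (v \<bullet> x) *\<^sub>R v \<in> span (insert v T)"
      by (intro span_add span_scale span_base) auto
    then show ?thesis by simp
  qed
  moreover have "span (insert v T) \<subseteq> S"
    by (rule span_minimal) (use v Suc.prems(1) in \<open>auto simp: T_def\<close>)
  ultimately have "S = span (insert v T)" by blast
  moreover have v_notin: "v \<notin> span T"
    using v(2) T by (auto simp: span_eq_iff[THEN iffD2] T_def orthogonal_def norm_eq_1)
  ultimately have dim_S: "dim S = Suc (dim T)"
    by (simp add: dim_insert)
  then obtain B where B: "B \<subseteq> T" "finite B" "card B = dim T" "pairwise orthogonal B"
      "\<forall>b\<in>B. norm b = 1 \<and> (\<exists>l. Q *v b = l *\<^sub>R b)"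
    using Suc.hyps(1)[of T] Suc.hyps(2) T T_invariant by auto
  have "v \<notin> B" using v_notin B(1) span_base by blast
  then show ?case using B v dim_S
    by (intro exI[of _ "insert v B"])
      (auto simp: T_def pairwise_insert orthogonal_commute subset_iff)
qed

definition diag_matrix :: "('m \<Rightarrow> 'a::zero) \<Rightarrow> 'a^'m^'m" where
  "diag_matrix d = (\<chi> i j. if i = j then d i else 0)"

lemma diag_matrix_vec: "(diag_matrix d *v u) $ i = d i * (u $ i :: 'a::semiring_1)"
  by (simp add: diag_matrix_def matrix_vector_mult_def if_distrib if_distribR cong: if_cong)

lemma matrix_mult_diag: "(B ** diag_matrix d) $ i $ j = B $ i $ j * (d j :: 'a::semiring_1)"
  by (simp add: diag_matrix_def matrix_matrix_mult_def if_distrib cong: if_cong)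

lemma diag_matrix_mult: "diag_matrix a ** diag_matrix b = diag_matrix (\<lambda>i. a i * b i :: 'a::field)"
  unfolding matrix_eq by (simp add: vec_eq_iff diag_matrix_vec mult.assoc flip: matrix_vector_mul_assoc)

lemma diag_matrix_1: "diag_matrix (\<lambda>i. 1) = mat 1"
  by (simp add: diag_matrix_def mat_def)

lemma det_diag_matrix: "det (diag_matrix d) = (\<Prod>i\<in>UNIV. d i :: 'a::comm_ring_1)"
  unfolding diag_matrix_def by (subst det_diagonal) auto

lemma trace_diag_matrix_mult: "trace (diag_matrix d ** Q) = (\<Sum>i\<in>UNIV. d i * Q $ i $ i :: 'a::semiring_1)"
  by (simp add: diag_matrix_def trace_def matrix_matrix_mult_def if_distrib if_distribR cong: if_cong)

lemma det_scaleR_matrix: "det (k *\<^sub>R A) = k ^ CARD('m) * det A" for A :: "real^'m^'m"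
proof -
  have "k *\<^sub>R A = diag_matrix (\<lambda>i. k) ** A"
    by (simp add: diag_matrix_def vec_eq_iff matrix_matrix_mult_def if_distrib if_distribR cong: if_cong)
  then show ?thesis by (simp add: det_mul det_diag_matrix)
qed

lemma column_matrix_mult: "column i (A ** U) = A *v column i U"
  by (simp add: column_def matrix_matrix_mult_def matrix_vector_mult_def vec_eq_iff)

lemma symmetric_diagonalization:
  fixes Q :: "real^'m^'m"
  assumes Q: "symmetric_matrix Q"
  obtains U :: "real^'m^'m" and d :: "'m \<Rightarrow> real"
  where "orthogonal_matrix U" "Q = U ** diag_matrix d ** transpose U"
    "\<And>i. column i U \<bullet> (Q *v column i U) = d i" "\<And>i. norm (column i U) = 1"
proof -
  obtain B where B: "finite B" "card B = CARD('m)" "pairwise orthogonal B"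
      "\<forall>b\<in>B. norm b = 1 \<and> (\<exists>l. Q *v b = l *\<^sub>R b)"
    using symmetric_orthonormal_eigenbasis[OF Q, of UNIV] by (auto simp: dim_UNIV)
  obtain e where e: "bij_betw e (UNIV::'m set) B"
    using B(1,2) finite_same_card_bij[of "UNIV::'m set" B] by auto
  have e_in_B: "e i \<in> B" for i using e by (auto simp: bij_betw_def)
  then have "\<forall>i. \<exists>l. Q *v e i = l *\<^sub>R e i" using B(4) by blast
  then obtain d where d: "\<And>i. Q *v e i = d i *\<^sub>R e i" by metis
  have orthonormal: "e i \<bullet> e j = (if i = j then 1 else 0)" for i j
  proof (cases "i = j")
    case False
    then have "e i \<noteq> e j" using e by (auto simp: bij_betw_def dest: injD)
    then show ?thesis using B(3) e_in_B False unfolding pairwise_def orthogonal_def by auto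
  qed (use B(4) e_in_B in \<open>simp add: norm_eq_1\<close>)
  define U where "U = (\<chi> i j. e j $ i)"
  have column: "column j U = e j" for j by (simp add: column_def U_def vec_eq_iff)
  have U: "orthogonal_matrix U"
    unfolding orthogonal_matrix
    by (simp add: vec_eq_iff matrix_mult_transpose_dot_column column orthonormal mat_def)
  have "(Q ** U) $ i $ j = (Q *v e j) $ i" for i j
    by (simp add: matrix_matrix_mult_def matrix_vector_mult_def U_def)
  then have "Q ** U = U ** diag_matrix d"
    by (simp add: vec_eq_iff matrix_mult_diag d U_def mult.commute)
  moreover have "Q = Q ** (U ** transpose U)"
    using U by (simp add: orthogonal_matrix_def)
  ultimately have "Q = U ** diag_matrix d ** transpose U"
    by (simp add: matrix_mul_assoc)
  then show ?thesis using that U d orthonormal B(4) e_in_B by (auto simp: column)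
qed

lemma inner_transpose: "(transpose A *v u) \<bullet> v = u \<bullet> (A *v v)" "u \<bullet> (transpose A *v v) = (A *v u) \<bullet> v"
  for A :: "real^'n^'n"
  using dot_lmul_matrix[of u A v] dot_lmul_matrix[of v A u] by (simp_all add: inner_commute)

lemma det_orthogonal_conj:
  fixes U :: "real^'m^'m"
  assumes "orthogonal_matrix U"
  shows "det (U ** D ** transpose U) = det D"
proof -
  have "det U * det U = 1"
    using det_orthogonal_matrix[OF assms] by auto
  then show ?thesis
    by (simp add: det_mul mult.commute mult.left_commute)
qed

lemma trace_mult_orthogonal_conj:
  fixes A U :: "real^'m^'m"
  shows "trace (A ** (U ** diag_matrix d ** transpose U)) = (\<Sum>i\<in>UNIV. d i * (column i U \<bullet> (A *v column i U)))"
proof -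
  have "trace (A ** (U ** diag_matrix d ** transpose U)) = trace (diag_matrix d ** (transpose U ** (A ** U)))"
    using trace_mul_sym[of "A ** U" "diag_matrix d ** transpose U"] by (simp add: matrix_mul_assoc)
  moreover have "(transpose U ** B) $ i $ i = column i U \<bullet> column i B" for B :: "real^'m^'m" and i
    by (simp add: matrix_matrix_mult_def transpose_def column_def inner_vec_def)
  ultimately show ?thesis by (simp add: trace_diag_matrix_mult column_matrix_mult)
qed

lemma psd_det_le_trace:
  fixes Q :: "real^'m^'m"
  assumes "psd_matrix Q"
  shows "det Q \<ge> 0" "det Q powr (1 / real CARD('m)) \<le> trace Q / real CARD('m)"
proof -
  obtain U d where U: "orthogonal_matrix U" "Q = U ** diag_matrix d ** transpose U"
    and d: "\<And>i. column i U \<bullet> (Q *v column i U) = d i" and unit: "\<And>i. norm (column i U) = 1"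
    using assms unfolding psd_matrix_def by (elim conjE symmetric_diagonalization) (rule that)
  have d_nonneg: "d i \<ge> 0" for i
    using assms d[of i] unfolding psd_matrix_def by metis
  have det: "det Q = (\<Prod>i\<in>UNIV. d i)" unfolding U(2) det_orthogonal_conj[OF U(1)] det_diag_matrix ..
  have trace: "trace Q = (\<Sum>i\<in>UNIV. d i)"
    using trace_mult_orthogonal_conj[of "mat 1" U d] unit by (simp add: dot_square_norm flip: U(2))
  show "det Q \<ge> 0" unfolding det by (intro prod_nonneg) (auto simp: d_nonneg)
  show "det Q powr (1 / real CARD('m)) \<le> trace Q / real CARD('m)"
    using arith_geom_mean[of "UNIV :: 'm set" d] d_nonneg by (simp add: det trace sum_divide_distrib)
qed

lemma symmetric_det_lower_bound:
  fixes Q :: "real^'m^'m"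
  assumes Q: "symmetric_matrix Q" and m: "\<And>u. u \<bullet> (Q *v u) \<ge> m * (u \<bullet> u)" "m > 0"
    and K: "v \<bullet> (Q *v v) \<ge> K * (v \<bullet> v)" "v \<noteq> 0"
  shows "det Q \<ge> m ^ (CARD('m) - 1) * K"
proof -
  obtain U d where U: "orthogonal_matrix U" "Q = U ** diag_matrix d ** transpose U"
    and d: "\<And>i. column i U \<bullet> (Q *v column i U) = d i" and unit: "\<And>i. norm (column i U) = 1"
    by (rule symmetric_diagonalization[OF Q]) (rule that)
  have d_ge: "d i \<ge> m" for i
    using m(1)[of "column i U"] unit[of i] by (simp add: d norm_eq_1)
  have det: "det Q = (\<Prod>i\<in>UNIV. d i)" unfolding U(2) det_orthogonal_conj[OF U(1)] det_diag_matrix ..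
  define y where "y = transpose U *v v"
  have v: "v = U *v y"
    using U(1) by (simp add: y_def matrix_vector_mul_assoc orthogonal_matrix_def del: transpose_matrix_vector)
  have "v \<bullet> (Q *v v) = y \<bullet> (diag_matrix d *v y)"
    unfolding U(2) matrix_vector_mul_assoc[symmetric] y_def[symmetric] by (simp only: inner_transpose(1)[symmetric] y_def)
  also have "\<dots> = (\<Sum>i\<in>UNIV. d i * (y $ i)\<^sup>2)"
    by (simp add: inner_vec_def diag_matrix_vec power2_eq_square mult_ac)
  finally have form: "v \<bullet> (Q *v v) = (\<Sum>i\<in>UNIV. d i * (y $ i)\<^sup>2)" .
  have "v \<bullet> v = y \<bullet> y" by (subst (2) v) (simp add: y_def inner_transpose inner_commute del: transpose_matrix_vector)
  then have norm: "v \<bullet> v = (\<Sum>i\<in>UNIV. (y $ i)\<^sup>2)" by (simp add: inner_vec_def power2_eq_square)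
  have "\<exists>i. d i \<ge> K"
  proof (rule ccontr)
    assume "\<not> ?thesis"
    then have less: "d i < K" for i by (meson not_le)
    have "y \<noteq> 0" using v K(2) by auto
    then obtain i where "y $ i \<noteq> 0" by (auto simp: vec_eq_iff)
    then have "(\<Sum>i\<in>UNIV. d i * (y $ i)\<^sup>2) < (\<Sum>i\<in>UNIV. K * (y $ i)\<^sup>2)"
      by (intro sum_strict_mono_ex1 bexI[of _ i]) (auto simp: less mult_right_mono less_imp_le)
    then show False using K(1) by (simp add: form norm sum_distrib_left)
  qed
  then obtain i where i: "d i \<ge> K" ..
  have "m ^ (CARD('m) - 1) = (\<Prod>j\<in>UNIV - {i}. m)" by simp
  also have "\<dots> \<le> (\<Prod>j\<in>UNIV - {i}. d j)" by (rule prod_mono) (use d_ge m in auto)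
  finally have others: "m ^ (CARD('m) - 1) \<le> (\<Prod>j\<in>UNIV - {i}. d j)" .
  have "m ^ (CARD('m) - 1) * K \<le> m ^ (CARD('m) - 1) * d i" using i m(2) by simp
  also have "\<dots> \<le> (\<Prod>j\<in>UNIV - {i}. d j) * d i"
    using others d_ge[of i] m(2) by (intro mult_right_mono) auto
  also have "\<dots> = det Q" unfolding det by (simp add: prod.remove[of UNIV i] mult.commute)
  finally show ?thesis .
qed

lemma trace_psd_mult_nonneg:
  fixes Q A :: "real^'m^'m"
  assumes "psd_matrix Q" and A: "\<And>u. u \<bullet> (A *v u) \<ge> 0"
  shows "trace (A ** Q) \<ge> 0"
proof -
  obtain U d where "orthogonal_matrix U" and U: "Q = U ** diag_matrix d ** transpose U"
    and d: "\<And>i. column i U \<bullet> (Q *v column i U) = d i" and "\<And>i. norm (column i U) = 1"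
    using assms(1) unfolding psd_matrix_def by (elim conjE symmetric_diagonalization) (rule that)
  have "d i \<ge> 0" for i
    using assms(1) d[of i] unfolding psd_matrix_def by metis
  then show ?thesis unfolding U trace_mult_orthogonal_conj by (intro sum_nonneg mult_nonneg_nonneg A)
qed

section \<open>The symplectic group and causal curves\<close>

lemma sum_UNIV_Plus:
  "(\<Sum>k\<in>(UNIV::('a::finite + 'b::finite) set). f k) = (\<Sum>j\<in>UNIV. f (Inl j)) + (\<Sum>j\<in>UNIV. f (Inr j))"
  by (subst UNIV_Plus_UNIV[symmetric]) (simp add: sum.Plus del: UNIV_Plus_UNIV)

lemma prod_UNIV_Plus:
  "(\<Prod>k\<in>(UNIV::('a::finite + 'b::finite) set). f k) = (\<Prod>j\<in>UNIV. f (Inl j)) * (\<Prod>j\<in>UNIV. f (Inr j))"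
  by (subst UNIV_Plus_UNIV[symmetric]) (simp add: prod.Plus del: UNIV_Plus_UNIV)

lemma J0_mult_vec:
  "(J0 *v u) $ Inl j = - (u $ Inr j)" "(J0 *v u) $ Inr j = u $ Inl j"
  by (simp_all add: J0_def matrix_vector_mult_def if_distribR sum_UNIV_Plus if_distrib sum.delta cong: if_cong)

lemma vec_sum_eq_iff: "u = v \<longleftrightarrow> (\<forall>j. u $ Inl j = v $ Inl j) \<and> (\<forall>j. u $ Inr j = v $ Inr j)"
  by (simp add: vec_eq_iff split_sum_all)

lemma J0_J0 [simp]: "J0 *v (J0 *v u) = - u"
  by (simp add: vec_sum_eq_iff J0_mult_vec)

lemma J0_mult_J0: "J0 ** J0 = - mat 1"
  by (rule matrix_eq[THEN iffD2])
    (simp add: matrix_vec_mult.minus_left flip: matrix_vector_mul_assoc)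

lemma omega0_inner: "omega0 u v = (J0 *v u) \<bullet> v"
  by (simp add: omega0_def inner_vec_def sum_UNIV_Plus J0_mult_vec sum_subtractf sum_negf)

interpretation omega: bounded_bilinear omega0
  unfolding omega0_inner bilinear_conv_bounded_bilinear[symmetric] bilinear_def
  by (auto intro!: linearI simp: inner_add_left inner_add_right matrix_vec_linear)

lemmas omega_linear =
  omega.add_left omega.add_right omega.diff_left omega.diff_right
  omega.minus_left omega.minus_right omega.scaleR_left omega.scaleR_right

lemma omega0_antisym: "omega0 u v = - omega0 v u"
  by (simp add: omega0_def sum_negf[symmetric] mult.commute)

lemma omega0_self [simp]: "omega0 u u = 0"
  using omega0_antisym[of u u] by simp

lemma omega0_J0_right: "omega0 u (J0 *v v) = u \<bullet> v"
proof -
  have "omega0 u (J0 *v v) = - omega0 (J0 *v v) u" by (rule omega0_antisym)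
  then show ?thesis by (simp add: omega0_inner inner_commute)
qed

lemma omega0_J0_left: "omega0 (J0 *v u) v = - (u \<bullet> v)"
  by (simp add: omega0_inner)

lemma omega0_J0_J0: "omega0 (J0 *v u) (J0 *v v) = omega0 u v"
  by (simp only: omega0_J0_right) (simp add: omega0_inner)

lemma omega0_nondegenerate: "(\<And>v. omega0 u v = 0) \<Longrightarrow> u = 0"
  using omega0_J0_right[of u u] by simp

lemmas omega_simps = omega_linear omega0_J0_left omega0_J0_right omega0_self

lemma inner_J0_self [simp]: "u \<bullet> (J0 *v u) = 0" "(J0 *v u) \<bullet> u = 0"
proof -
  have "(J0 *v u) \<bullet> u = omega0 u u" by (simp only: omega0_inner)
  then show "(J0 *v u) \<bullet> u = 0" by simp
  then show "u \<bullet> (J0 *v u) = 0" by (simp add: inner_commute)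
qed

lemma norm_J0 [simp]: "norm (J0 *v u) = norm u"
  using omega0_J0_J0[of u "J0 *v u"] omega0_J0_right[of u u]
  by (simp add: norm_eq_sqrt_inner omega0_inner)

lemma omega0_le_norm: "\<bar>omega0 u v\<bar> \<le> norm u * norm v"
  unfolding omega0_inner using Cauchy_Schwarz_ineq2[of "J0 *v u" v] by simp

lemma Sp_omega0: "W \<in> Sp \<Longrightarrow> omega0 (W *v u) (W *v v) = omega0 u v"
  by (simp add: Sp_def)

lemma Sp_one [simp]: "mat 1 \<in> Sp" by (simp add: Sp_def)

lemma Sp_mult: "W \<in> Sp \<Longrightarrow> V \<in> Sp \<Longrightarrow> W ** V \<in> Sp"
  by (simp add: Sp_def flip: matrix_vector_mul_assoc)

lemma Sp_vec_eq_0: "W \<in> Sp \<Longrightarrow> W *v u = 0 \<longleftrightarrow> u = 0"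
  using Sp_omega0[of W u "J0 *v u"] by (auto simp: omega0_J0_right omega.zero_left)

lemma invertible_iff_kernel: "invertible A \<longleftrightarrow> (\<forall>x. A *v x = 0 \<longrightarrow> x = 0)" for A :: "'a::field^'n^'n"
  by (simp add: invertible_left_inverse matrix_left_invertible_ker)

lemma Sp_invertible: "W \<in> Sp \<Longrightarrow> invertible W"
  by (simp add: invertible_iff_kernel Sp_vec_eq_0)

lemma matrix_inv_cancel:
  fixes A :: "'a::field^'n^'n"
  assumes "invertible A"
  shows "A *v (matrix_inv A *v x) = x" "matrix_inv A *v (A *v x) = x"
  using assms by (simp_all add: matrix_vector_mul_assoc matrix_inv_left matrix_inv_right)

lemma Sp_inv: "W \<in> Sp \<Longrightarrow> matrix_inv W \<in> Sp"
proof -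
  assume W: "W \<in> Sp"
  have "omega0 (matrix_inv W *v u) (matrix_inv W *v v) = omega0 u v" for u v
    using Sp_omega0[OF W, of "matrix_inv W *v u" "matrix_inv W *v v"]
    by (simp add: matrix_inv_cancel Sp_invertible[OF W])
  then show ?thesis by (simp add: Sp_def)
qed

lemma closed_Sp: "closed Sp"
proof -
  have "Sp = (\<Inter>u. \<Inter>v. {W. omega0 (W *v u) (W *v v) = omega0 u v})" by (auto simp: Sp_def)
  also have "closed \<dots>"
    by (intro closed_INT ballI closed_Collect_eq omega.continuous_on matrix_vec_mult.continuous_on
        continuous_on_id continuous_on_const)
  finally show ?thesis .
qed

lemma det_sign_path:
  fixes A :: "real \<Rightarrow> real^'m^'m"
  assumes "continuous_on {0..1} A" "\<And>t. t \<in> {0..1} \<Longrightarrow> det (A t) \<noteq> 0" "det (A 0) > 0"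
  shows "det (A 1) > 0"
proof (rule ccontr)
  assume "\<not> ?thesis"
  then have "det (A 1) \<le> 0" by simp
  then obtain x where "0 \<le> x" "x \<le> 1" "det (A x) = 0"
    using IVT2'[of "\<lambda>t. det (A t)" 1 0 0] assms(3) continuous_on_det[OF assms(1)] by auto
  then show False using assms(2) by auto
qed

lemma matrix_eqI_inner:
  fixes A B :: "real^'n^'m"
  assumes "\<And>u v. u \<bullet> (A *v v) = u \<bullet> (B *v v)"
  shows "A = B"
  unfolding matrix_eq using assms vector_eq_ldot by blast

lemma det_J0: "det (J0 :: 'n::finite sqm) = 1"
proof -
  let ?A = "\<lambda>s::real. (1 - s) *\<^sub>R mat 1 + s *\<^sub>R (J0 :: 'n sqm)"
  have "det (?A 1) > 0"
  proof (rule det_sign_path[of ?A])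
    show "continuous_on {0..1} ?A" by (intro continuous_intros)
    fix t :: real assume "t \<in> {0..1}"
    show "det (?A t) \<noteq> 0"
      unfolding invertible_det_nz[symmetric] invertible_iff_kernel
    proof (intro allI impI)
      fix x assume x: "?A t *v x = 0"
      then have kernel: "(1 - t) *\<^sub>R x + t *\<^sub>R (J0 *v x) = 0"
        by (simp add: matrix_vec_linear)
      have inner_x: "x \<bullet> ((1 - t) *\<^sub>R x + t *\<^sub>R (J0 *v x)) = (1 - t) * (x \<bullet> x)"
        by (simp add: inner_add_right)
      have inner_Jx: "(J0 *v x) \<bullet> ((1 - t) *\<^sub>R x + t *\<^sub>R (J0 *v x)) = t * (x \<bullet> x)"
        using omega0_J0_right[of x x] by (simp add: inner_add_right omega0_inner)
      have "(1 - t) * (x \<bullet> x) = 0" "t * (x \<bullet> x) = 0" using inner_x inner_Jx unfolding kernel by simp_all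
      then show "x = 0" by auto
    qed
  qed simp
  moreover have "det (J0 :: 'n sqm) * det (J0 :: 'n sqm) = det (- mat 1 :: 'n sqm)"
    by (simp add: det_mul[symmetric] J0_mult_J0)
  moreover have "det (- mat 1 :: 'n sqm) = 1"
    using det_scaleR_matrix[of "-1" "mat 1 :: 'n sqm"] by simp
  ultimately show ?thesis by (simp add: square_eq_1_iff)
qed

definition form_matrix :: "'n::finite sqm \<Rightarrow> 'n sqm" where "form_matrix X = - (J0 ** X)"

lemma form_matrix_inner: "u \<bullet> (form_matrix X *v v) = omega0 u (X *v v)"
proof -
  have "u \<bullet> (form_matrix X *v v) = - (u \<bullet> (J0 *v (X *v v)))"
    by (simp add: form_matrix_def matrix_vec_mult.minus_left matrix_vector_mul_assoc)
  then show ?thesis using omega0_antisym[of u "X *v v"] by (simp add: omega0_inner inner_commute)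
qed

lemma det_form_matrix: "det (form_matrix X) = det (X :: 'n::finite sqm)"
proof -
  have "form_matrix X = (- J0) ** X"
    by (simp add: form_matrix_def matrix_mult.minus_left)
  moreover have "(- J0 :: 'n sqm) = transpose J0"
  proof (rule matrix_eqI_inner)
    fix u v :: "real^('n+'n)"
    show "u \<bullet> (- J0 *v v) = u \<bullet> (transpose J0 *v v)"
      using omega0_antisym[of u v]
      by (simp add: inner_transpose omega0_inner matrix_vec_mult.minus_left inner_commute del: transpose_matrix_vector)
  qed
  ultimately show ?thesis by (simp add: det_mul det_J0)
qed

lemma transpose_mult_J0_mult_Sp: "W \<in> Sp \<Longrightarrow> transpose W ** J0 ** W = J0"
proof (rule matrix_eqI_inner)
  fix u v
  assume W: "W \<in> Sp"
  have "u \<bullet> ((transpose W ** J0 ** W) *v v) = (W *v u) \<bullet> (J0 *v (W *v v))"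
    unfolding matrix_vector_mul_assoc[symmetric] by (simp only: inner_transpose)
  also have "\<dots> = omega0 (W *v v) (W *v u)" by (simp add: omega0_inner inner_commute)
  also have "\<dots> = u \<bullet> (J0 *v v)" by (simp add: Sp_omega0[OF W]) (simp add: omega0_inner inner_commute)
  finally show "u \<bullet> ((transpose W ** J0 ** W) *v v) = u \<bullet> (J0 *v v)" .
qed

lemma J0_mult_matrix_inv_Sp: "W \<in> Sp \<Longrightarrow> J0 ** matrix_inv W = transpose W ** J0"
  using transpose_mult_J0_mult_Sp[of W] matrix_inv_right[OF Sp_invertible, of W]
  by (metis matrix_mul_assoc matrix_mul_rid)

lemma Sp_det_sq: "W \<in> Sp \<Longrightarrow> det W * det W = 1"
  using arg_cong[OF transpose_mult_J0_mult_Sp, of W det] by (simp add: det_J0 det_mul)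

lemma Sp_orthogonal_image_imp_0:
  assumes W: "W \<in> Sp" and "\<And>u. omega0 (W *v u) z = 0"
  shows "z = 0"
  using assms(2)[of "matrix_inv W *v (J0 *v z)"] Sp_invertible[OF W] by (simp add: matrix_inv_cancel omega0_J0_left)

lemma omega0_form_kernel:
  assumes "\<And>u. 0 \<le> omega0 u (W *v u)" "omega0 v (W *v v) = 0"
  shows "omega0 v (W *v u) + omega0 u (W *v v) = 0"
proof (rule psd_form_kernel[where f = "\<lambda>u v. omega0 u (W *v v)" and S = UNIV])
  show "bilinear (\<lambda>u v. omega0 u (W *v v))"
    unfolding bilinear_def by (auto intro!: linearI simp: matrix_vec_linear omega_linear)
qed (use assms in auto)

lemma symmetric_form_matrix: "symmetric_matrix (form_matrix X) \<longleftrightarrow> X \<in> sp"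
  by (simp add: symmetric_matrix_def form_matrix_inner sp_def)

lemma closed_sp_nonneg: "closed {X \<in> (sp :: 'n::finite sqm set). \<forall>u. omega0 u (X *v u) \<ge> 0}"
proof -
  have "{X \<in> (sp :: 'n sqm set). \<forall>u. omega0 u (X *v u) \<ge> 0} =
     (\<Inter>u. \<Inter>v. {X. omega0 u (X *v v) = omega0 v (X *v u)}) \<inter> (\<Inter>u. {X. omega0 u (X *v u) \<ge> 0})"
    by (auto simp: sp_def)
  also have "closed \<dots>"
  proof -
    have form_cont: "continuous_on UNIV (\<lambda>X. omega0 u (X *v v))" for u v :: "real^('n+'n)"
      by (intro omega.continuous_on matrix_vec_mult.continuous_on continuous_on_id continuous_on_const)
    show ?thesis
      by (intro closed_Int closed_INT ballI closed_Collect_eq[OF form_cont form_cont] closed_Collect_le[OF continuous_on_const form_cont])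
  qed
  finally show ?thesis .
qed

lemma closure_sp_plus: "closure sp_plus = {X \<in> sp. \<forall>u. omega0 u (X *v u) \<ge> 0}"
proof
  show "closure sp_plus \<subseteq> {X \<in> sp. \<forall>u. omega0 u (X *v u) \<ge> 0}"
    by (rule closure_minimal[OF _ closed_sp_nonneg])
      (auto simp: sp_plus_def intro: less_imp_le[of 0] dest: spec[of _ 0], metis less_imp_le matrix_vec_mult.zero_right omega0_self order_refl)
  show "{X \<in> sp. \<forall>u. omega0 u (X *v u) \<ge> 0} \<subseteq> closure sp_plus"
  proof
    fix X :: "'n::finite sqm" assume X: "X \<in> {X \<in> sp. \<forall>u. omega0 u (X *v u) \<ge> 0}"
    let ?f = "\<lambda>k. X + (1 / real (Suc k)) *\<^sub>R J0"
    have "?f k \<in> sp_plus" for k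
      using X unfolding sp_plus_def sp_def
      by (auto simp: matrix_vec_linear omega.add_right omega.scaleR_right
          omega0_J0_right inner_commute intro!: add_nonneg_pos)
    moreover have "?f \<longlonglongrightarrow> X + 0 *\<^sub>R J0"
      by (intro tendsto_intros LIMSEQ_Suc lim_1_over_n)
    ultimately show "X \<in> closure sp_plus" unfolding closure_sequential by (intro exI[of _ ?f]) simp
  qed
qed

lemma psd_form_matrix: "psd_matrix (form_matrix X) \<longleftrightarrow> X \<in> closure sp_plus"
  by (simp add: psd_matrix_def symmetric_form_matrix form_matrix_inner closure_sp_plus)

lemma closure_sp_plus_det:
  fixes X :: "'n::finite sqm"
  assumes X: "X \<in> closure sp_plus"
  shows "det X \<ge> 0" "G X = det X powr (1 / real CARD('n + 'n))"
proof -
  have sp: "X \<in> sp" and nonneg: "\<And>u. omega0 u (X *v u) \<ge> 0" using X by (auto simp: closure_sp_plus)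
  show d: "det X \<ge> 0"
    using psd_det_le_trace(1)[of "form_matrix X"] X by (simp add: psd_form_matrix det_form_matrix)
  show "G X = det X powr (1 / real CARD('n + 'n))"
  proof (cases "X \<in> sp_plus")
    case False
    then obtain v where v: "v \<noteq> 0" "omega0 v (X *v v) = 0"
      using sp nonneg by (force simp: sp_plus_def less_le)
    have "omega0 (X *v v) u = 0" for u
    proof -
      have "omega0 v (X *v u) = omega0 u (X *v v)" using sp by (simp add: sp_def)
      then show ?thesis using omega0_form_kernel[OF nonneg v(2), of u] omega0_antisym[of "X *v v" u] by simp
    qed
    then have "X *v v = 0" by (rule omega0_nondegenerate)
    then have "\<not> invertible X" using v(1) by (auto simp: invertible_iff_kernel)
    then have "det X = 0" by (simp add: invertible_det_nz)
    then show ?thesis using False by (simp add: G_def)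
  qed (simp add: G_def)
qed

lemma continuous_on_G: "continuous_on (closure sp_plus) (G :: 'n::finite sqm \<Rightarrow> real)"
proof -
  have "continuous_on (closure sp_plus) (\<lambda>X :: 'n sqm. det X powr (1 / real CARD('n + 'n)))"
    by (rule continuous_on_powr') (auto intro!: continuous_on_det continuous_intros closure_sp_plus_det)
  then show ?thesis by (rule continuous_on_eq) (simp add: closure_sp_plus_det)
qed

lemma G_lower_bound:
  fixes X :: "'n::finite sqm"
  assumes X: "X \<in> sp" and m: "\<And>u. omega0 u (X *v u) \<ge> m * (u \<bullet> u)" "m > 0"
    and K: "omega0 v (X *v v) \<ge> K * (v \<bullet> v)" "v \<noteq> 0" "K \<ge> 0"
  shows "G X \<ge> (m ^ (CARD('n + 'n) - 1) * K) powr (1 / real CARD('n + 'n))"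
proof -
  have nonneg: "omega0 u (X *v u) \<ge> 0" for u
    using m(1)[of u] m(2) by (meson inner_ge_zero mult_nonneg_nonneg less_imp_le order_trans)
  have "X \<in> closure sp_plus" using X nonneg by (simp add: closure_sp_plus)
  moreover have "det X \<ge> m ^ (CARD('n + 'n) - 1) * K"
    using symmetric_det_lower_bound[of "form_matrix X" m K v] X m K
    by (simp add: symmetric_form_matrix form_matrix_inner det_form_matrix)
  ultimately show ?thesis
    using m(2) K(3) by (simp add: closure_sp_plus_det powr_mono2)
qed

lemma G_le_trace:
  fixes X :: "'n::finite sqm"
  assumes X: "X \<in> closure sp_plus" and M: "M \<in> Sp"
  shows "real CARD('n + 'n) * G X \<le> trace (transpose M ** form_matrix X ** M)"
proof -
  let ?P = "transpose M ** form_matrix X ** M"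
  have "u \<bullet> (?P *v v) = (M *v u) \<bullet> (form_matrix X *v (M *v v))" for u v
    by (simp add: matrix_vector_mul_assoc[symmetric] inner_transpose del: transpose_matrix_vector)
  then have "psd_matrix ?P"
    using X unfolding psd_form_matrix[symmetric] psd_matrix_def symmetric_matrix_def by simp
  then have "det ?P powr (1 / real CARD('n + 'n)) \<le> trace ?P / real CARD('n + 'n)"
    by (rule psd_det_le_trace(2))
  moreover have "det ?P = det X" using Sp_det_sq[OF M] by (simp add: det_mul det_form_matrix)
  ultimately show ?thesis using X
    by (simp add: closure_sp_plus_det field_simps)
qed

definition Sp_curve :: "(real \<Rightarrow> 'n::finite sqm) \<Rightarrow> (real \<Rightarrow> 'n sqm) \<Rightarrow> bool" where
  "Sp_curve c D \<longleftrightarrow> (\<forall>t\<in>{0..1}. (c has_vector_derivative D t) (at t within {0..1}) \<and> c t \<in> Sp)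
     \<and> continuous_on {0..1} D"

lemma Sp_curveD:
  assumes "Sp_curve c D"
  shows "C1_curve c" "\<And>t. t \<in> {0..1} \<Longrightarrow> c t \<in> Sp" "\<And>t. t \<in> {0..1} \<Longrightarrow> logder c t = D t ** matrix_inv (c t)"
    "continuous_on {0..1} c" "continuous_on {0..1} D"
    "\<And>t. t \<in> {0..1} \<Longrightarrow> (c has_vector_derivative D t) (at t within {0..1})"
proof -
  have deriv: "(c has_vector_derivative D t) (at t within {0..1})" if "t \<in> {0..1}" for t
    using assms that by (auto simp: Sp_curve_def)
  have vector_deriv: "vector_derivative c (at t within {0..1}) = D t" if "t \<in> {0..1}" for t
    using vector_derivative_within_closed_interval[OF _ _ deriv[OF that]] that by auto
  show "continuous_on {0..1} D" using assms by (simp add: Sp_curve_def)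
  then have "continuous_on {0..1} (\<lambda>t. vector_derivative c (at t within {0..1}))"
    by (rule continuous_on_eq) (simp add: vector_deriv)
  then show "C1_curve c" unfolding C1_curve_def
    using differentiableI_vector[OF deriv] by blast
  show "\<And>t. t \<in> {0..1} \<Longrightarrow> c t \<in> Sp" using assms by (auto simp: Sp_curve_def)
  show "\<And>t. t \<in> {0..1} \<Longrightarrow> logder c t = D t ** matrix_inv (c t)" by (simp add: logder_def vector_deriv)
  show "continuous_on {0..1} c"
    by (meson continuous_on_eq_continuous_within deriv has_vector_derivative_continuous)
qed (use assms in \<open>auto simp: Sp_curve_def\<close>)

lemma C1_curve_Sp_curve:
  assumes "C1_curve c" "\<forall>t\<in>{0..1}. c t \<in> Sp"
  shows "Sp_curve c (\<lambda>t. vector_derivative c (at t within {0..1}))"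
  using assms by (simp add: Sp_curve_def C1_curve_def vector_derivative_works)

lemma Sp_curve_antisym:
  assumes "Sp_curve c D" "t \<in> {0..1}"
  shows "omega0 (c t *v u) (D t *v v) = omega0 (c t *v v) (D t *v u)"
proof -
  have deriv: "((\<lambda>s. c s *v x) has_vector_derivative D t *v x) (at t within {0..1})" for x
    by (rule bounded_linear.has_vector_derivative[OF matrix_vec_mult.bounded_linear_left])
      (use assms in \<open>auto simp: Sp_curve_def\<close>)
  have "((\<lambda>s. omega0 (c s *v u) (c s *v v)) has_vector_derivative
      (omega0 (c t *v u) (D t *v v) + omega0 (D t *v u) (c t *v v))) (at t within {0..1})"
    by (rule omega.has_vector_derivative[OF deriv deriv])
  moreover have "((\<lambda>s. omega0 (c s *v u) (c s *v v)) has_vector_derivative 0) (at t within {0..1})"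
    by (rule has_vector_derivative_transform[where f = "\<lambda>_. omega0 u v"])
      (use assms in \<open>auto simp: Sp_curve_def Sp_omega0\<close>)
  ultimately have "omega0 (c t *v u) (D t *v v) + omega0 (D t *v u) (c t *v v) = 0"
    using vector_derivative_unique_within_closed_interval[of 0 1 t] assms(2) by simp
  then show ?thesis using omega0_antisym[of "D t *v u" "c t *v v"] by simp
qed

lemma logder_form:
  assumes "Sp_curve c D" "t \<in> {0..1}"
  shows "omega0 (c t *v u) (logder c t *v (c t *v v)) = omega0 (c t *v u) (D t *v v)"
  using Sp_curveD[OF assms(1)] assms(2) Sp_invertible[of "c t"]
  by (simp add: matrix_vector_mul_assoc[symmetric] matrix_inv_cancel)

lemma omega0_logder:
  assumes "Sp_curve c D" "t \<in> {0..1}"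
  shows "omega0 u (logder c t *v v) = omega0 (c t *v (matrix_inv (c t) *v u)) (D t *v (matrix_inv (c t) *v v))"
  using logder_form[OF assms, of "matrix_inv (c t) *v u" "matrix_inv (c t) *v v"]
    Sp_curveD[OF assms(1)] assms(2) Sp_invertible[of "c t"]
  by (simp add: matrix_inv_cancel)

lemma logder_sp:
  assumes "Sp_curve c D" "t \<in> {0..1}"
  shows "logder c t \<in> sp"
  unfolding sp_def using omega0_logder[OF assms] Sp_curve_antisym[OF assms] by auto

text \<open>\<open>Sp_curve c D\<close> carries the derivative \<open>D\<close> of \<open>c\<close> explicitly; as \<open>c t\<close> is symplectic, the form
  \<open>\<omega>(c v, D v)\<close> is that of \<open>logder c t\<close> at \<open>c t v\<close>.\<close>
definition weakly_causal :: "(real \<Rightarrow> 'n::finite sqm) \<Rightarrow> (real \<Rightarrow> 'n sqm) \<Rightarrow> bool" where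
  "weakly_causal c D \<longleftrightarrow> Sp_curve c D \<and> (\<forall>t\<in>{0..1}. \<forall>v. omega0 (c t *v v) (D t *v v) \<ge> 0)"

lemma weakly_causal_logder:
  assumes "Sp_curve c D"
  shows "weakly_causal c D \<longleftrightarrow> (\<forall>t\<in>{0..1}. logder c t \<in> closure sp_plus)"
proof
  assume "weakly_causal c D"
  then show "\<forall>t\<in>{0..1}. logder c t \<in> closure sp_plus"
    using logder_sp[OF assms] by (auto simp: weakly_causal_def closure_sp_plus omega0_logder[OF assms])
next
  assume *: "\<forall>t\<in>{0..1}. logder c t \<in> closure sp_plus"
  have "omega0 (c t *v v) (D t *v v) \<ge> 0" if "t \<in> {0..1}" for t v
    using * that unfolding closure_sp_plus logder_form[OF assms that, symmetric] by auto
  then show "weakly_causal c D" using assms by (auto simp: weakly_causal_def)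
qed

definition timelike :: "(real \<Rightarrow> 'n::finite sqm) \<Rightarrow> (real \<Rightarrow> 'n sqm) \<Rightarrow> bool" where
  "timelike c D \<longleftrightarrow> Sp_curve c D \<and> (\<forall>t\<in>{0..1}. \<forall>v. v \<noteq> 0 \<longrightarrow> omega0 (c t *v v) (D t *v v) > 0)"

lemma timelike_logder:
  assumes "Sp_curve c D"
  shows "timelike c D \<longleftrightarrow> (\<forall>t\<in>{0..1}. logder c t \<in> sp_plus)"
proof -
  have "logder c t \<in> sp_plus \<longleftrightarrow> (\<forall>v. v \<noteq> 0 \<longrightarrow> omega0 (c t *v v) (D t *v v) > 0)" if t: "t \<in> {0..1}" for t
  proof -
    have "c t \<in> Sp" "matrix_inv (c t) \<in> Sp" using Sp_curveD[OF assms] t Sp_inv by auto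
    then show ?thesis
      using logder_sp[OF assms t] omega0_logder[OF assms t] logder_form[OF assms t]
      unfolding sp_plus_def by (auto simp: Sp_vec_eq_0) (metis Sp_vec_eq_0)
  qed
  then show ?thesis using assms by (simp add: timelike_def)
qed

lemma timelike_imp_weakly_causal: "timelike c D \<Longrightarrow> weakly_causal c D"
  unfolding timelike_def weakly_causal_def
  by (metis less_imp_le matrix_vec_mult.zero_right omega.zero_right order_refl)

lemma continuous_on_logder:
  assumes "Sp_curve c D"
  shows "continuous_on {0..1} (logder c)"
proof -
  have "continuous_on {0..1} (\<lambda>t. D t ** matrix_inv (c t))"
    using Sp_curveD[OF assms]
    by (intro matrix_mult.continuous_on continuous_on_matrix_inv) (auto simp: Sp_invertible)
  then show ?thesis
    by (rule continuous_on_eq) (simp add: Sp_curveD[OF assms])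
qed

lemma continuous_on_G_logder:
  assumes "weakly_causal c D"
  shows "continuous_on {0..1} (\<lambda>t. G (logder c t))"
proof -
  have "Sp_curve c D" using assms by (simp add: weakly_causal_def)
  then show ?thesis
    using weakly_causal_logder[of c D] assms
    by (intro continuous_on_compose2[OF continuous_on_G continuous_on_logder]) auto
qed

lemma weakly_causal_mult:
  assumes a: "weakly_causal a A" and b: "weakly_causal b B"
  shows "weakly_causal (\<lambda>t. a t ** b t) (\<lambda>t. a t ** B t + A t ** b t)"
    and "t \<in> {0..1} \<Longrightarrow> omega0 ((a t ** b t) *v v) ((a t ** B t + A t ** b t) *v v)
       = omega0 (b t *v v) (B t *v v) + omega0 (a t *v (b t *v v)) (A t *v (b t *v v))"
proof -
  have a_curve: "Sp_curve a A" and b_curve: "Sp_curve b B" using a b by (auto simp: weakly_causal_def)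
  note A = Sp_curveD[OF a_curve] and B = Sp_curveD[OF b_curve]
  show eq: "omega0 ((a t ** b t) *v v) ((a t ** B t + A t ** b t) *v v)
       = omega0 (b t *v v) (B t *v v) + omega0 (a t *v (b t *v v)) (A t *v (b t *v v))" if "t \<in> {0..1}" for t v
    using A(2)[OF that]
    by (simp add: matrix_vec_mult.add_left omega.add_right matrix_vector_mul_assoc[symmetric] Sp_omega0)
  have "Sp_curve (\<lambda>t. a t ** b t) (\<lambda>t. a t ** B t + A t ** b t)"
    unfolding Sp_curve_def using A B
    by (auto intro!: matrix_mult.has_vector_derivative Sp_mult continuous_intros matrix_mult.continuous_on)
  then show "weakly_causal (\<lambda>t. a t ** b t) (\<lambda>t. a t ** B t + A t ** b t)"
    using a b eq by (auto simp: weakly_causal_def)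
qed

lemma fractional_Sp:
  fixes De :: "'n::finite sqm"
  assumes inv: "invertible De" and eq: "\<And>u v. omega0 (Nu *v u) (Nu *v v) = omega0 (De *v u) (De *v v)"
  shows "Nu ** matrix_inv De \<in> Sp"
  unfolding Sp_def using inv by (simp add: matrix_vector_mul_assoc[symmetric] eq matrix_inv_cancel)

lemma fractional_curve:
  fixes Nu De :: "real \<Rightarrow> 'n::finite sqm"
  assumes Nu: "\<And>t. t \<in> {0..1} \<Longrightarrow> (Nu has_vector_derivative Nu' t) (at t within {0..1})"
    and De: "\<And>t. t \<in> {0..1} \<Longrightarrow> (De has_vector_derivative De' t) (at t within {0..1})"
    and cont: "continuous_on {0..1} Nu'" "continuous_on {0..1} De'"
    and inv: "\<And>t. t \<in> {0..1} \<Longrightarrow> invertible (De t)"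
    and eq: "\<And>t u v. t \<in> {0..1} \<Longrightarrow> omega0 (Nu t *v u) (Nu t *v v) = omega0 (De t *v u) (De t *v v)"
  defines "C \<equiv> \<lambda>t. Nu t ** matrix_inv (De t)"
  defines "D \<equiv> \<lambda>t. Nu t ** (- (matrix_inv (De t) ** De' t ** matrix_inv (De t))) + Nu' t ** matrix_inv (De t)"
  shows "Sp_curve C D"
    and "\<And>t u v. t \<in> {0..1} \<Longrightarrow> omega0 (C t *v (De t *v u)) (D t *v (De t *v v))
        = omega0 (Nu t *v u) (Nu' t *v v) - omega0 (De t *v u) (De' t *v v)"
proof -
  have Nu_cont: "continuous_on {0..1} Nu" and De_cont: "continuous_on {0..1} De"
    by (meson continuous_on_eq_continuous_within Nu De has_vector_derivative_continuous)+
  have C_Sp: "C t \<in> Sp" if "t \<in> {0..1}" for t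
    unfolding C_def by (rule fractional_Sp) (use that inv eq in auto)
  show "Sp_curve C D"
    unfolding Sp_curve_def
  proof (intro conjI ballI)
    fix t :: real assume t: "t \<in> {0..1}"
    show "(C has_vector_derivative D t) (at t within {0..1})"
      unfolding C_def D_def
      by (intro matrix_mult.has_vector_derivative has_vector_derivative_matrix_inv Nu De t inv De_cont)
    show "C t \<in> Sp" by (rule C_Sp[OF t])
  next
    show "continuous_on {0..1} D"
      unfolding D_def
      by (intro continuous_intros matrix_mult.continuous_on continuous_on_matrix_inv Nu_cont De_cont cont inv)
  qed
  fix t u v assume t: "t \<in> {0..1::real}"
  have C_De: "C t *v (De t *v x) = Nu t *v x" for x
    using inv[OF t] by (simp add: C_def matrix_vector_mul_assoc[symmetric] matrix_inv_cancel)
  have "D t *v (De t *v v) = Nu' t *v v - C t *v (De' t *v v)"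
    using inv[OF t]
    by (simp add: D_def C_def matrix_vec_linear matrix_mult.minus_right
        matrix_vector_mul_assoc[symmetric] matrix_inv_cancel)
  then show "omega0 (C t *v (De t *v u)) (D t *v (De t *v v))
        = omega0 (Nu t *v u) (Nu' t *v v) - omega0 (De t *v u) (De' t *v v)"
    using Sp_omega0[OF C_Sp[OF t], of "De t *v u" "De' t *v v"]
    by (simp add: omega.diff_right C_De)
qed

section \<open>Generalised eigenspaces\<close>

definition shift :: "complex^'m^'m \<Rightarrow> complex \<Rightarrow> complex^'m \<Rightarrow> complex^'m" where
  "shift M l x = M *v x - l *s x"

definition gen_eigenspace :: "complex^'m^'m \<Rightarrow> complex \<Rightarrow> (complex^'m) set" where
  "gen_eigenspace M l = {v. (shift M l ^^ CARD('m)) v = 0}"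

lemma geneig_eq_gen_eigenspace: "geneig W l = gen_eigenspace (cplx W) l"
  by (simp add: geneig_def gen_eigenspace_def shift_def[abs_def])

lemma shift_add: "shift M l (x + y) = shift M l x + shift M l y"
  by (simp add: shift_def vec.add vec.scale_right_distrib)

lemma shift_scale: "shift M l (c *s x) = c *s shift M l x"
  by (simp add: shift_def vec.scale vec.scale_right_diff_distrib mult.commute)

lemma shift_zero [simp]: "shift M l 0 = 0" by (simp add: shift_def)

lemma shift_pow_add: "(shift M l ^^ k) (x + y) = (shift M l ^^ k) x + (shift M l ^^ k) y"
  by (induct k) (simp_all add: shift_add)

lemma shift_pow_scale: "(shift M l ^^ k) (c *s x) = c *s (shift M l ^^ k) x"
  by (induct k) (simp_all add: shift_scale)

lemma shift_pow_zero [simp]: "(shift M l ^^ k) 0 = 0"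
  by (induct k) simp_all

lemma shift_comm: "shift M a (shift M b x) = shift M b (shift M a x)"
  by (simp add: shift_def vec.diff vec.scale vec.scale_right_diff_distrib mult.commute)

lemma shift_pow_comm: "shift M a ((shift M b ^^ k) x) = (shift M b ^^ k) (shift M a x)"
proof (induct k)
  case (Suc k)
  then show ?case using shift_comm[of M a b "(shift M b ^^ k) x"] by simp
qed simp

lemma shift_pow_mult: "M *v ((shift M b ^^ k) x) = (shift M b ^^ k) (M *v x)"
  using shift_pow_comm[where a = 0 and M = M and b = b and k = k and x = x] by (simp add: shift_def[of M 0])

lemma subspace_chain_stabilizes:
  fixes K :: "nat \<Rightarrow> (complex^'m) set"
  assumes K: "\<And>i. vec.subspace (K i)" and mono: "\<And>i. K i \<subseteq> K (Suc i)"
  obtains i where "i \<le> CARD('m)" "K i = K (Suc i)"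
proof (rule ccontr)
  assume "\<not> thesis"
  then have strict: "K i \<subset> K (Suc i)" if "i \<le> CARD('m)" for i
    using that mono[of i] \<open>\<And>i. i \<le> CARD('m) \<Longrightarrow> K i = K (Suc i) \<Longrightarrow> thesis\<close> by blast
  have "i \<le> Suc CARD('m) \<Longrightarrow> i \<le> vec.dim (K i)" for i
  proof (induction i)
    case (Suc i)
    have "vec.dim (K i) < vec.dim (K (Suc i))"
      by (rule vec.dim_psubset) (use K strict[of i] Suc.prems in \<open>simp add: vec.span_eq_iff[THEN iffD2]\<close>)
    then show ?case using Suc by simp
  qed simp
  from this[of "Suc CARD('m)"] have "Suc CARD('m) \<le> vec.dim (K (Suc CARD('m)))" by simp
  moreover have "vec.dim (K (Suc CARD('m))) \<le> CARD('m)"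
    using vec.dim_subset_UNIV[of "K (Suc CARD('m))"] by (simp add: vec.dimension_def card_cart_basis)
  ultimately show False by simp
qed

lemma shift_kernel_stable:
  fixes M :: "complex^'m^'m"
  assumes "(shift M l ^^ k) x = 0"
  shows "x \<in> gen_eigenspace M l"
proof -
  define K where "K i = {x. (shift M l ^^ i) x = 0}" for i
  have K_Suc: "x \<in> K (Suc i) \<longleftrightarrow> shift M l x \<in> K i" for x i
    by (simp add: K_def shift_pow_comm)
  have mono: "i \<le> j \<Longrightarrow> K i \<subseteq> K j" for i j
    by (rule lift_Suc_mono_le[of K]) (auto simp: K_def)
  have "vec.subspace (K i)" "K i \<subseteq> K (Suc i)" for i
    by (auto simp: vec.subspace_def K_def shift_pow_add shift_pow_scale)
  then obtain i where i: "i \<le> CARD('m)" "K i = K (Suc i)"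
    by (rule subspace_chain_stabilizes[of K]) (rule that)
  have "K (Suc j) = K (Suc (Suc j))" if "K j = K (Suc j)" for j
    using that K_Suc by blast
  then have "K (i + j) = K i \<and> K (Suc (i + j)) = K i" for j
    using i(2) by (induction j) auto
  then have "K k \<subseteq> K i" using mono[of k i] by (metis le_add_diff_inverse nat_le_linear order_refl)
  then show ?thesis using assms mono[OF i(1)] by (auto simp: K_def gen_eigenspace_def)
qed

lemma gen_eigenspace_subspace: "vec.subspace (gen_eigenspace M l)"
  by (auto simp: vec.subspace_def gen_eigenspace_def shift_pow_add shift_pow_scale)

lemma gen_eigenspace_shift: "x \<in> gen_eigenspace M l \<Longrightarrow> shift M a x \<in> gen_eigenspace M l"
  by (simp add: gen_eigenspace_def flip: shift_pow_comm)

lemma gen_eigenspace_mult: "x \<in> gen_eigenspace M l \<Longrightarrow> M *v x \<in> gen_eigenspace M l"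
  by (simp add: gen_eigenspace_def flip: shift_pow_mult)

lemma gen_eigenspace_shift_pow: "x \<in> gen_eigenspace M l \<Longrightarrow> (shift M a ^^ k) x \<in> gen_eigenspace M l"
  by (induct k) (auto simp: gen_eigenspace_shift)

lemma eigenvector_gen_eigenspace: "M *v x = l *s x \<Longrightarrow> x \<in> gen_eigenspace M l"
  by (rule shift_kernel_stable[where k = 1]) (simp add: shift_def)

lemma gen_eigenspace_shift_inj:
  assumes "x \<in> gen_eigenspace M m" "shift M a x = 0" "a \<noteq> m"
  shows "x = 0"
proof -
  have "shift M m x = (a - m) *s x" using assms(2) by (simp add: shift_def vec.scale_left_diff_distrib)
  then have "(shift M m ^^ k) x = (a - m) ^ k *s x" for k
  proof (induct k)
    case (Suc k)
    have "(shift M m ^^ Suc k) x = shift M m ((a - m) ^ k *s x)" by (simp only: funpow.simps o_apply Suc)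
    also have "\<dots> = (a - m) ^ k *s ((a - m) *s x)"
      by (simp only: shift_scale \<open>shift M m x = (a - m) *s x\<close>)
    finally show ?case by (simp only: vec.scale_scale power_Suc mult.commute)
  qed simp
  then show ?thesis using assms(1,3) by (simp add: gen_eigenspace_def)
qed

lemma gen_eigenspace_shift_pow_inj:
  assumes "x \<in> gen_eigenspace M m" "(shift M a ^^ k) x = 0" "a \<noteq> m"
  shows "x = 0"
  using assms(2)
proof (induct k)
  case (Suc k)
  have "(shift M a ^^ k) x = 0"
    by (rule gen_eigenspace_shift_inj[OF gen_eigenspace_shift_pow[OF assms(1)] _ assms(3)]) (use Suc.prems in simp)
  then show ?case by (rule Suc.hyps)
qed simp

lemma gen_eigenspace_shift_surj:
  assumes "u \<in> gen_eigenspace M m" "a \<noteq> m"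
  shows "\<exists>s\<in>gen_eigenspace M m. shift M a s = u"
proof -
  let ?E = "gen_eigenspace M m"
  have E: "vec.subspace ?E" by (rule gen_eigenspace_subspace)
  have linear: "Vector_Spaces.linear (*s) (*s) (shift M a)"
    by (intro Vector_Spaces.linear_iff[THEN iffD2] conjI allI)
      (auto simp: shift_add shift_scale vec.vector_space_axioms)
  have "inj_on (shift M a) ?E"
    using vec.linear_inj_on_iff_eq_0[OF linear E] gen_eigenspace_shift_inj[OF _ _ assms(2)] by blast
  then have "vec.dim (shift M a ` ?E) = vec.dim ?E"
    using E by (intro vec.dim_image_eq[OF linear]) (simp add: vec.span_eq_iff[THEN iffD2])
  then have "shift M a ` ?E = ?E"
    using vec.linear_subspace_image[OF linear E] E
    by (intro vec.subspace_dim_equal) (auto intro: gen_eigenspace_shift)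
  then show ?thesis using assms(1) by (metis imageE)
qed

lemma span_gen_eigenspace_lift:
  assumes "shift M a v \<in> vec.span (\<Union>l. gen_eigenspace M l)"
  shows "v \<in> vec.span (\<Union>l. gen_eigenspace M l)"
proof -
  let ?S = "vec.span (\<Union>l. gen_eigenspace M l)"
  have "\<exists>s g. s \<in> ?S \<and> g \<in> gen_eigenspace M a \<and> u = shift M a s + g" if "u \<in> ?S" for u
    using that
  proof (induction rule: vec.span_induct_alt)
    case base
    show ?case using gen_eigenspace_subspace[of M a] by (intro exI[of _ 0]) (auto simp: vec.subspace_0 vec.span_zero)
  next
    case (step c x y)
    obtain s g where sg: "s \<in> ?S" "g \<in> gen_eigenspace M a" "y = shift M a s + g" using step by blast
    obtain m where m: "x \<in> gen_eigenspace M m" using step by blast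
    have "\<exists>s' g'. s' \<in> ?S \<and> g' \<in> gen_eigenspace M a \<and> x = shift M a s' + g'"
    proof (cases "m = a")
      case True
      then show ?thesis using m by (intro exI[of _ 0] exI[of _ x]) (auto simp: vec.span_zero)
    next
      case False
      then obtain s' where "s' \<in> gen_eigenspace M m" "shift M a s' = x"
        using gen_eigenspace_shift_surj m by metis
      then show ?thesis using gen_eigenspace_subspace[of M a]
        by (intro exI[of _ s'] exI[of _ 0]) (auto simp: vec.subspace_0 intro: vec.span_base)
    qed
    then obtain s' g' where s': "s' \<in> ?S" "g' \<in> gen_eigenspace M a" "x = shift M a s' + g'" by blast
    show ?case
      by (intro exI[of _ "c *s s' + s"] exI[of _ "c *s g' + g"])
        (use sg s' gen_eigenspace_subspace[of M a] in \<open>auto simp: shift_add shift_scale vec.scale_right_distrib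
          vec.span_add vec.span_scale vec.subspace_add vec.subspace_scale\<close>)
  qed
  from this[OF assms] obtain s g where s: "s \<in> ?S" "g \<in> gen_eigenspace M a" "shift M a v = shift M a s + g" by blast
  have "shift M a (v - s) = g" using shift_add[of M a "v - s" s] s(3) by simp
  then have "(shift M a ^^ Suc CARD('a)) (v - s) = 0" using s(2) by (simp add: gen_eigenspace_def shift_pow_comm)
  then have "v - s \<in> gen_eigenspace M a" by (rule shift_kernel_stable)
  then have "(v - s) + s \<in> ?S" by (intro vec.span_add s(1) vec.span_base) auto
  then show ?thesis by simp
qed

definition poly_act :: "complex^'m^'m \<Rightarrow> complex poly \<Rightarrow> complex^'m \<Rightarrow> complex^'m" where
  "poly_act M p x = (\<Sum>i\<le>degree p. coeff p i *s (shift M 0 ^^ i) x)"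

lemma poly_act_le: "degree p \<le> n \<Longrightarrow> poly_act M p x = (\<Sum>i\<le>n. coeff p i *s (shift M 0 ^^ i) x)"
  unfolding poly_act_def by (rule sum.mono_neutral_left) (auto simp: coeff_eq_0)

lemma shift_0: "shift M 0 x = M *v x" by (simp add: shift_def)

lemma poly_act_root_factor: "poly_act M ([:- a, 1:] * q) x = poly_act M q (shift M a x)"
proof -
  let ?n = "Suc (degree q)"
  let ?P = "\<lambda>i. (shift M 0 ^^ i)"
  have degree: "degree ([:- a, 1:] * q) \<le> ?n"
    using degree_mult_le[of "[:- a, 1:]" q] by simp
  have coeffs: "coeff ([:- a, 1:] * q) i = (case i of 0 \<Rightarrow> 0 | Suc j \<Rightarrow> coeff q j) - a * coeff q i" for i
    by (simp add: coeff_pCons split: nat.split)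
  have "poly_act M ([:- a, 1:] * q) x = (\<Sum>i\<le>?n. (case i of 0 \<Rightarrow> 0 | Suc j \<Rightarrow> coeff q j) *s ?P i x)
      - (\<Sum>i\<le>?n. (a * coeff q i) *s ?P i x)"
    unfolding poly_act_le[OF degree] coeffs by (simp only: vec.scale_left_diff_distrib sum_subtractf)
  also have "(\<Sum>i\<le>?n. (case i of 0 \<Rightarrow> 0 | Suc j \<Rightarrow> coeff q j) *s ?P i x) = (\<Sum>i\<le>degree q. coeff q i *s ?P i (M *v x))"
    by (subst sum.atMost_Suc_shift) (simp add: shift_pow_comm shift_0)
  also have "(\<Sum>i\<le>?n. (a * coeff q i) *s ?P i x) = (\<Sum>i\<le>degree q. coeff q i *s ?P i (a *s x))"
    by (simp add: shift_pow_scale mult.commute coeff_eq_0)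
  finally have e: "poly_act M ([:- a, 1:] * q) x = poly_act M q (M *v x) - poly_act M q (a *s x)"
    by (simp add: poly_act_def)
  have "poly_act M q (u + v) = poly_act M q u + poly_act M q v" for u v
    by (simp add: poly_act_def shift_pow_add vec.scale_right_distrib sum.distrib)
  from this[of "shift M a x" "a *s x"] have "poly_act M q (M *v x) = poly_act M q (shift M a x) + poly_act M q (a *s x)"
    by (simp add: shift_def[of M a])
  then show ?thesis unfolding e by simp
qed

lemma annihilating_poly:
  fixes M :: "complex^'m^'m"
  obtains p where "p \<noteq> 0" "poly_act M p x = 0"
proof -
  let ?P = "\<lambda>i. (shift M 0 ^^ i) x"
  let ?N = "CARD('m)"
  have "\<exists>c. (\<exists>i\<le>?N. c i \<noteq> 0) \<and> (\<Sum>i\<le>?N. c i *s ?P i) = 0"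
  proof (cases "inj_on ?P {..?N}")
    case True
    have "card (?P ` {..?N}) = Suc ?N" using True by (simp add: card_image)
    moreover have "vec.dim (?P ` {..?N}) \<le> ?N"
      using vec.dim_subset_UNIV[of "?P ` {..?N}"] by (simp add: vec.dimension_def card_cart_basis)
    ultimately have "vec.dependent (?P ` {..?N})"
      by (intro vec.dependent_biggerset_general) auto
    then obtain u where u: "\<exists>v\<in>?P ` {..?N}. u v \<noteq> 0" "(\<Sum>v\<in>?P ` {..?N}. u v *s v) = 0"
      using vec.dependent_finite[of "?P ` {..?N}"] by auto
    show ?thesis
      by (intro exI[of _ "\<lambda>i. u (?P i)"]) (use u in \<open>auto simp: sum.reindex[OF True]\<close>)
  next
    case False
    then obtain i j where ij: "i \<le> ?N" "j \<le> ?N" "i \<noteq> j" "?P i = ?P j" by (auto simp: inj_on_def)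
    let ?c = "\<lambda>k. if k = i then 1 else if k = j then -1 else (0::complex)"
    have "(\<Sum>k\<le>?N. ?c k *s ?P k) = (\<Sum>k\<in>{i, j}. ?c k *s ?P k)"
      by (rule sum.mono_neutral_right) (use ij in auto)
    also have "\<dots> = 0" using ij by simp
    finally show ?thesis using ij(1) by (intro exI[of _ ?c]) auto
  qed
  then obtain c where c: "\<exists>i\<le>?N. c i \<noteq> 0" "(\<Sum>i\<le>?N. c i *s ?P i) = 0" by blast
  define p where "p = (\<Sum>i\<le>?N. monom (c i) i)"
  have coeffs: "coeff p i = (if i \<le> ?N then c i else 0)" for i
    by (simp add: p_def coeff_sum if_distrib cong: if_cong)
  have "degree p \<le> ?N" by (rule degree_le) (simp add: coeffs)
  then have "poly_act M p x = 0" using c(2) by (simp add: poly_act_le coeffs)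
  moreover have "p \<noteq> 0" using c(1) coeffs by (metis coeff_0)
  ultimately show ?thesis using that by blast
qed

lemma shift_induct [case_names zero shift]:
  assumes zero: "P 0" and shift: "\<And>a v. P (shift M a v) \<Longrightarrow> P v"
  shows "P v"
proof -
  obtain p where p: "p \<noteq> 0" "poly_act M p v = 0" by (rule annihilating_poly)
  have "P x" if "poly_act M (smult c (\<Prod>a\<in>#A. [:- a, 1:])) x = 0" "c \<noteq> 0" for c A x
    using that(1)
  proof (induction A arbitrary: x)
    case empty
    then have "x = 0" using \<open>c \<noteq> 0\<close> by (simp add: poly_act_def)
    then show ?case by (simp add: zero)
  next
    case (add a A)
    have factor: "smult c (\<Prod>a\<in>#add_mset a A. [:- a, 1:]) = [:- a, 1:] * smult c (\<Prod>a\<in>#A. [:- a, 1:])"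
      by (simp only: image_mset_add_mset prod_mset.add_mset mult_smult_right)
    show ?case using add.prems unfolding factor poly_act_root_factor by (rule shift[OF add.IH])
  qed
  from this[of "lead_coeff p" "proots p" v] show ?thesis using p by (simp add: complex_poly_decompose_multiset)
qed

lemma gen_eigenspace_span: "vec.span (\<Union>l. gen_eigenspace M l) = UNIV"
proof -
  have "v \<in> vec.span (\<Union>l. gen_eigenspace M l)" for v
    by (induction v rule: shift_induct[where M = M]) (auto intro: vec.span_zero span_gen_eigenspace_lift)
  then show ?thesis by auto
qed

lemma eigenvector_in_invariant_subspace:
  fixes M :: "complex^'m^'m"
  assumes S: "vec.subspace S" "S \<noteq> {0}" and inv: "\<And>x. x \<in> S \<Longrightarrow> M *v x \<in> S"
  obtains x l where "x \<in> S" "x \<noteq> 0" "M *v x = l *s x"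
proof -
  have "v \<in> S \<Longrightarrow> v \<noteq> 0 \<Longrightarrow> \<exists>x\<in>S. x \<noteq> 0 \<and> (\<exists>l. M *v x = l *s x)" for v
  proof (induction v rule: shift_induct[where M = M])
    case (shift a v)
    have "shift M a v \<in> S"
      using S(1) inv shift.prems by (simp add: shift_def vec.subspace_diff vec.subspace_scale)
    then show ?case using shift by (cases "shift M a v = 0") (auto simp: shift_def)
  qed simp
  moreover obtain v where "v \<in> S" "v \<noteq> 0" using S vec.subspace_0 by blast
  ultimately show ?thesis using that by metis
qed

lemma gen_eigenspace_independent:
  assumes "finite A" "\<And>a. a \<in> A \<Longrightarrow> x a \<in> gen_eigenspace M a" "(\<Sum>a\<in>A. x a) = 0" "a \<in> A"
  shows "x a = 0"
  using assms
proof (induction A arbitrary: x a rule: finite_induct)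
  case (insert b A)
  let ?f = "shift M b ^^ CARD('a)"
  have image_sum: "?f (\<Sum>a\<in>A. x a) = (\<Sum>a\<in>A. ?f (x a))"
    using insert.hyps(1) by (induction A rule: finite_induct) (simp_all add: shift_pow_add)
  have "?f (x b) = 0" using insert.prems(1)[of b] by (simp add: gen_eigenspace_def)
  then have "(\<Sum>a\<in>A. ?f (x a)) = ?f (\<Sum>a\<in>insert b A. x a)"
    using insert.hyps by (simp add: shift_pow_add image_sum)
  also have "\<dots> = 0" using insert.prems(2) by simp
  finally have zero_sum: "(\<Sum>a\<in>A. ?f (x a)) = 0" .
  have zero: "x c = 0" if "c \<in> A" for c
  proof -
    have "?f (x c) = 0"
      by (rule insert.IH[OF _ zero_sum that]) (use insert.prems(1) in \<open>auto intro: gen_eigenspace_shift_pow\<close>)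
    then show ?thesis using gen_eigenspace_shift_pow_inj[where x = "x c" and M = M and m = c and a = b] insert.prems(1)[of c] that insert.hyps(2) by auto
  qed
  then have "x b = 0" using insert.prems(2) insert.hyps by simp
  then show ?case using zero insert.prems(3) by auto
qed simp

lemma span_UN_sum:
  fixes x :: "complex^'m"
  assumes "finite A" "\<And>a. a \<in> A \<Longrightarrow> vec.subspace (S a)" "x \<in> vec.span (\<Union>a\<in>A. S a)"
  shows "\<exists>y. (\<forall>a\<in>A. y a \<in> S a) \<and> x = (\<Sum>a\<in>A. y a)"
  using assms
proof (induction A arbitrary: x rule: finite_induct)
  case (insert b A)
  have "x \<in> {u + v | u v. u \<in> vec.span (S b) \<and> v \<in> vec.span (\<Union>a\<in>A. S a)}"
    using insert.prems(2) by (simp add: vec.span_Un)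
  then obtain u v where uv: "x = u + v" "u \<in> S b" "v \<in> vec.span (\<Union>a\<in>A. S a)"
    using insert.prems(1) by (auto simp: vec.span_eq_iff[THEN iffD2])
  obtain y where y: "\<forall>a\<in>A. y a \<in> S a" "v = (\<Sum>a\<in>A. y a)"
    using insert.IH[OF _ uv(3)] insert.prems(1) by auto
  have "(\<Sum>a\<in>A. (y(b := u)) a) = (\<Sum>a\<in>A. y a)"
    by (rule sum.cong) (use insert.hyps in auto)
  then show ?case using insert.hyps uv y
    by (intro exI[of _ "y(b := u)"]) (auto simp: fun_upd_def)
qed simp

lemma dim_span_gen_eigenspace:
  assumes "finite A" "\<And>a. a \<in> A \<Longrightarrow> vec.subspace (S a) \<and> S a \<subseteq> gen_eigenspace M a"
  shows "vec.dim (vec.span (\<Union>a\<in>A. S a)) = (\<Sum>a\<in>A. vec.dim (S a))"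
  using assms
proof (induction A rule: finite_induct)
  case (insert b A)
  let ?T = "vec.span (\<Union>a\<in>A. S a)"
  have S_b: "vec.subspace (S b)" using insert.prems by simp
  have "S b \<inter> ?T = {0}"
  proof -
    have "u = 0" if u: "u \<in> S b" "u \<in> ?T" for u
    proof -
      obtain y where y: "\<forall>a\<in>A. y a \<in> S a" "u = (\<Sum>a\<in>A. y a)"
        using span_UN_sum[of A S u] insert u(2) by auto
      let ?x = "y(b := - u)"
      have sums: "(\<Sum>a\<in>A. ?x a) = (\<Sum>a\<in>A. y a)" by (rule sum.cong) (use insert.hyps in auto)
      have "?x b = 0"
      proof (rule gen_eigenspace_independent[where A = "insert b A" and M = M and x = ?x and a = b])
        show "(\<Sum>a\<in>insert b A. ?x a) = 0" using insert.hyps sums y(2) by simp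
        fix a assume a: "a \<in> insert b A"
        have "- u \<in> S b" using S_b u(1) by (simp add: vec.subspace_neg)
        then show "?x a \<in> gen_eigenspace M a" using a y(1) insert.prems by (cases "a = b") auto
      qed (use insert.hyps in auto)
      then show ?thesis by simp
    qed
    then show ?thesis using S_b by (auto simp: vec.subspace_0 vec.span_zero)
  qed
  then have "vec.dim {u + v | u v. u \<in> S b \<and> v \<in> ?T} = vec.dim (S b) + vec.dim ?T"
    using vec.dim_sums_Int[OF S_b vec.subspace_span, of "\<Union>a\<in>A. S a"] by simp
  moreover have "vec.span (\<Union>a\<in>insert b A. S a) = {u + v | u v. u \<in> S b \<and> v \<in> ?T}"
    using S_b by (simp add: vec.span_Un vec.span_eq_iff[THEN iffD2])
  ultimately show ?case using insert by simp
qed simp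

definition spectrum :: "complex^'m^'m \<Rightarrow> complex set" where
  "spectrum M = {l. gen_eigenspace M l \<noteq> {0}}"

lemma spectrum_iff_dim: "l \<in> spectrum M \<longleftrightarrow> vec.dim (gen_eigenspace M l) \<noteq> 0"
  using gen_eigenspace_subspace[of M l] vec.subspace_0 by (auto simp: spectrum_def)

lemma finite_spectrum: "finite (spectrum M)" and card_spectrum: "card (spectrum M) \<le> CARD('m)" for M :: "complex^'m^'m"
proof -
  have card_bound: "card A \<le> CARD('m)" if "finite A" "A \<subseteq> spectrum M" for A
  proof -
    have "card A = (\<Sum>a\<in>A. 1)" by simp
    also have "\<dots> \<le> (\<Sum>a\<in>A. vec.dim (gen_eigenspace M a))"
      by (rule sum_mono) (use that spectrum_iff_dim[of _ M] in \<open>force simp: Suc_le_eq\<close>)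
    also have "\<dots> = vec.dim (vec.span (\<Union>a\<in>A. gen_eigenspace M a))"
      by (rule dim_span_gen_eigenspace[symmetric]) (use that gen_eigenspace_subspace in auto)
    also have "\<dots> \<le> CARD('m)"
      using vec.dim_subset_UNIV[of "vec.span (\<Union>a\<in>A. gen_eigenspace M a)"] by (simp add: vec.dimension_def card_cart_basis)
    finally show ?thesis .
  qed
  then show "finite (spectrum M)" using infinite_arbitrarily_large[of "spectrum M" "Suc CARD('m)"]
    by (metis Suc_n_not_le_n)
  then show "card (spectrum M) \<le> CARD('m)" using card_bound by auto
qed

lemma span_gen_eigenspace_spectrum: "vec.span (\<Union>l\<in>spectrum M. gen_eigenspace M l) = UNIV"
proof -
  have "(\<Union>l. gen_eigenspace M l) \<subseteq> insert 0 (\<Union>l\<in>spectrum M. gen_eigenspace M l)" by (auto simp: spectrum_def)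
  then have "vec.span (\<Union>l. gen_eigenspace M l) \<subseteq> vec.span (\<Union>l\<in>spectrum M. gen_eigenspace M l)"
    using vec.span_mono by (metis vec.span_insert_0)
  then show ?thesis by (auto simp: gen_eigenspace_span)
qed

lemma sum_dim_gen_eigenspace: "(\<Sum>l\<in>spectrum M. vec.dim (gen_eigenspace M l)) = CARD('m)" for M :: "complex^'m^'m"
  using dim_span_gen_eigenspace[of "spectrum M" "gen_eigenspace M" M] finite_spectrum[of M] gen_eigenspace_subspace[of M]
  by (simp add: span_gen_eigenspace_spectrum vec.dimension_def card_cart_basis del: vec.dim_span)

lemma spectrum_iff_eigenvector: "l \<in> spectrum M \<longleftrightarrow> (\<exists>x. x \<noteq> 0 \<and> M *v x = l *s x)"
proof
  assume "l \<in> spectrum M"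
  then have "gen_eigenspace M l \<noteq> {0}" by (simp add: spectrum_def)
  from eigenvector_in_invariant_subspace[OF gen_eigenspace_subspace this gen_eigenspace_mult]
  obtain x a where x: "x \<in> gen_eigenspace M l" "x \<noteq> 0" "M *v x = a *s x" by metis
  then have "a = l" using gen_eigenspace_shift_inj[of x M l a] by (auto simp: shift_def)
  then show "\<exists>x. x \<noteq> 0 \<and> M *v x = l *s x" using x by blast
next
  assume "\<exists>x. x \<noteq> 0 \<and> M *v x = l *s x"
  then show "l \<in> spectrum M" using eigenvector_gen_eigenspace[of M _ l] by (auto simp: spectrum_def)
qed

lemma poly_det: "poly (det A) z = det (\<chi> i j. poly (A $ i $ j) z)" for A :: "complex poly^'m^'m"
  by (simp add: det_def poly_sum poly_prod)

lemma gen_eigenspace_Int: "l \<noteq> m \<Longrightarrow> x \<in> gen_eigenspace M l \<Longrightarrow> x \<in> gen_eigenspace M m \<Longrightarrow> x = 0"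
  using gen_eigenspace_shift_pow_inj[where x = x and m = m and a = l] by (simp add: gen_eigenspace_def[of _ l])

lemma invertible_spanning_columns:
  fixes e :: "'m \<Rightarrow> complex^'m"
  assumes "vec.span (range e) = UNIV"
  shows "invertible (\<chi> i j. e j $ i)"
proof -
  let ?S = "\<chi> i j. e j $ i"
  have "?S *v axis j 1 = e j" for j by (simp add: vec_eq_iff matrix_vector_mult_axis)
  then have "range e \<subseteq> range ((*v) ?S)" by (metis image_subsetI rangeI)
  then have "vec.span (range e) \<subseteq> range ((*v) ?S)"
    by (rule vec.span_minimal) (simp add: vec.linear_subspace_image[OF matrix_vector_mul_linear_gen])
  then have "surj ((*v) ?S)" using assms by auto
  then show ?thesis by (metis invertible_right_inverse matrix_right_invertible_surjective)
qed

lemma gen_eigenbasis_exists: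
  fixes M :: "complex^'m^'m"
  obtains e :: "'m \<Rightarrow> complex^'m" and lam
  where "invertible (\<chi> i j. e j $ i)" "\<And>i. lam i \<in> spectrum M"
    "\<And>l. gen_eigenspace M l = vec.span (e ` {i. lam i = l})"
    "\<And>l. card {i. lam i = l} = vec.dim (gen_eigenspace M l)"
proof -
  have "\<forall>l. \<exists>B. finite B \<and> B \<subseteq> gen_eigenspace M l \<and> vec.independent B \<and> vec.span B = gen_eigenspace M l
      \<and> card B = vec.dim (gen_eigenspace M l)"
    using vec.basis_subspace_exists[OF gen_eigenspace_subspace] vec.finiteI_independent by metis
  then obtain B where B: "\<And>l. finite (B l)" "\<And>l. B l \<subseteq> gen_eigenspace M l" "\<And>l. vec.independent (B l)"
      "\<And>l. vec.span (B l) = gen_eigenspace M l" "\<And>l. card (B l) = vec.dim (gen_eigenspace M l)" by metis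
  have disjoint: "B l \<inter> B m = {}" if "l \<noteq> m" for l m
    using gen_eigenspace_Int[OF that] B(2,3) vec.dependent_zero by blast
  define U where "U = (\<Union>l\<in>spectrum M. B l)"
  have "finite U" "card U = CARD('m)"
    unfolding U_def using finite_spectrum[of M] B(1) disjoint
    by (simp_all add: card_UN_disjoint B(5) sum_dim_gen_eigenspace)
  then obtain e where e: "bij_betw e (UNIV::'m set) U"
    using finite_same_card_bij[of "UNIV::'m set" U] by auto
  then have "\<forall>i. \<exists>l. l \<in> spectrum M \<and> e i \<in> B l" unfolding U_def bij_betw_def by blast
  then obtain lam where lam: "\<And>i. lam i \<in> spectrum M" "\<And>i. e i \<in> B (lam i)" by metis
  have image: "e ` {i. lam i = l} = B l" for l
  proof
    show "B l \<subseteq> e ` {i. lam i = l}"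
    proof
      fix b assume b: "b \<in> B l"
      then have "l \<in> spectrum M"
        using B(1)[of l] B(5)[of l] spectrum_iff_dim[of l M] by (auto simp del: vec.dim_eq_0)
      then obtain i where "b = e i" using b e unfolding U_def bij_betw_def by blast
      then show "b \<in> e ` {i. lam i = l}" using b lam(2)[of i] disjoint by blast
    qed
  qed (use lam(2) in auto)
  show ?thesis
  proof (rule that[of e lam])
    show "card {i. lam i = l} = vec.dim (gen_eigenspace M l)" for l
      using card_image[of e "{i. lam i = l}"] e inj_on_subset[of e UNIV] by (simp add: image B(5) bij_betw_def)
    have "gen_eigenspace M l \<subseteq> vec.span (range e)" for l
      unfolding B(4)[symmetric] image[symmetric] by (intro vec.span_mono) auto
    then have "vec.span (\<Union>l. gen_eigenspace M l) \<subseteq> vec.span (range e)"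
      by (intro vec.span_minimal vec.subspace_span UN_least)
    then show "invertible (\<chi> i j. e j $ i)" by (intro invertible_spanning_columns) (auto simp: gen_eigenspace_span)
  qed (simp_all add: lam image B(4))
qed

lemma semisimple_part_exists:
  fixes M :: "complex^'m^'m"
  obtains D where "\<And>x l. x \<in> gen_eigenspace M l \<Longrightarrow> D *v x = l *s x"
    "det D = (\<Prod>l\<in>spectrum M. l ^ vec.dim (gen_eigenspace M l))"
proof -
  obtain e lam where S: "invertible (\<chi> i j. e j $ i)" and lam: "\<And>i::'m. lam i \<in> spectrum M"
    "\<And>l. gen_eigenspace M l = vec.span (e ` {i. lam i = l})"
    "\<And>l. card {i. lam i = l} = vec.dim (gen_eigenspace M l)"
    by (rule gen_eigenbasis_exists[of M]) (rule that)
  define S where "S = (\<chi> i j. e j $ i)"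
  have S_axis: "S *v axis j 1 = e j" for j by (simp add: S_def vec_eq_iff matrix_vector_mult_axis)
  define D where "D = S ** diag_matrix lam ** matrix_inv S"
  have D_basis: "D *v e i = lam i *s e i" for i
  proof -
    have "matrix_inv S *v e i = axis i 1" using matrix_inv_cancel(2)[OF S, of "axis i 1"] by (simp add: S_axis flip: S_def)
    moreover have "diag_matrix lam *v axis i 1 = lam i *s axis i 1"
      by (simp add: vec_eq_iff diag_matrix_vec) (simp add: axis_def)
    ultimately show ?thesis by (simp add: D_def vec.scale S_axis flip: matrix_vector_mul_assoc)
  qed
  show ?thesis
  proof (rule that[of D])
    fix x l assume "x \<in> gen_eigenspace M l"
    then have "x \<in> vec.span (e ` {i. lam i = l})" by (simp add: lam(2))
    then show "D *v x = l *s x"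
      by (induction rule: vec.span_induct_alt)
        (auto simp: vec.add vec.scale D_basis vec.scale_right_distrib mult.commute)
  next
    have "det S * det (matrix_inv S) = 1" using S by (metis S_def det_I det_mul matrix_inv_right)
    then have "det D = (\<Prod>i\<in>UNIV. lam i)" by (simp add: D_def det_mul det_diag_matrix)
    also have "\<dots> = (\<Prod>l\<in>spectrum M. \<Prod>i | i \<in> UNIV \<and> lam i = l. lam i)"
      by (rule prod.group[symmetric]) (use lam(1) finite_spectrum in auto)
    also have "\<dots> = (\<Prod>l\<in>spectrum M. l ^ vec.dim (gen_eigenspace M l))"
      by (rule prod.cong) (simp_all add: lam(3))
    finally show "det D = (\<Prod>l\<in>spectrum M. l ^ vec.dim (gen_eigenspace M l))" .
  qed
qed

text \<open>The matrices \<open>D + z (M - D)\<close> interpolate between the semisimple part and \<open>M\<close> with constant spectrum.\<close>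
lemma invertible_semisimple_deformation:
  assumes nonzero: "0 \<notin> spectrum M" and D: "\<And>x l. x \<in> gen_eigenspace M l \<Longrightarrow> D *v x = l *s x"
  shows "invertible (D + mat z ** (M - D))"
  unfolding invertible_iff_kernel
proof (intro allI impI)
  fix x assume x: "(D + mat z ** (M - D)) *v x = 0"
  have "x \<in> vec.span (\<Union>l\<in>spectrum M. gen_eigenspace M l)" by (simp add: span_gen_eigenspace_spectrum)
  from span_UN_sum[OF finite_spectrum gen_eigenspace_subspace this]
  obtain y where y: "\<And>l. l \<in> spectrum M \<Longrightarrow> y l \<in> gen_eigenspace M l" "x = (\<Sum>l\<in>spectrum M. y l)" by blast
  let ?w = "\<lambda>l. l *s y l + z *s shift M l (y l)"
  have "(D + mat z ** (M - D)) *v x = (\<Sum>l\<in>spectrum M. (D + mat z ** (M - D)) *v y l)"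
    unfolding y(2) by (rule vec.sum)
  also have "\<dots> = (\<Sum>l\<in>spectrum M. ?w l)"
    by (rule sum.cong)
      (simp_all add: D[OF y(1)] shift_def mat_vec matrix_vec_mult.add_left matrix_vec_mult.diff_left flip: matrix_vector_mul_assoc)
  finally have sum_0: "(\<Sum>l\<in>spectrum M. ?w l) = 0" using x by simp
  have "y l = 0" if l: "l \<in> spectrum M" for l
  proof -
    have w_0: "?w l = 0"
      by (rule gen_eigenspace_independent[OF finite_spectrum[of M] _ sum_0 l, where M = M])
        (use y(1) gen_eigenspace_subspace[of M] in \<open>auto intro!: vec.subspace_add vec.subspace_scale gen_eigenspace_shift\<close>)
    have "l \<noteq> 0" using nonzero l by auto
    show ?thesis
    proof (cases "z = 0")
      case False
      have "shift M (l - l / z) (y l) = (1 / z) *s ?w l"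
        using False by (simp add: shift_def vec.scale_right_distrib vec.scale_right_diff_distrib vec.scale_left_diff_distrib)
      then show ?thesis
        using gen_eigenspace_shift_inj[of "y l" M l "l - l / z"] y(1)[OF l] \<open>l \<noteq> 0\<close> False w_0 by simp
    qed (use w_0 \<open>l \<noteq> 0\<close> in simp)
  qed
  then show "x = 0" using y(2) by simp
qed

lemma det_eq_prod_gen_eigenspace:
  fixes M :: "complex^'m^'m"
  assumes nonzero: "0 \<notin> spectrum M"
  shows "det M = (\<Prod>l\<in>spectrum M. l ^ vec.dim (gen_eigenspace M l))"
proof -
  obtain D where D: "\<And>x l. x \<in> gen_eigenspace M l \<Longrightarrow> D *v x = l *s x"
    "det D = (\<Prod>l\<in>spectrum M. l ^ vec.dim (gen_eigenspace M l))"
    by (rule semisimple_part_exists[of M]) (rule that)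
  define p where "p = det (\<chi> i j. [:D $ i $ j, M $ i $ j - D $ i $ j:])"
  have "(mat z ** A) $ i $ j = z * A $ i $ j" for z i j and A :: "complex^'m^'m"
    by (simp add: mat_def matrix_matrix_mult_def if_distrib if_distribR cong: if_cong)
  then have p: "poly p z = det (D + mat z ** (M - D))" for z
    unfolding p_def poly_det by (intro arg_cong[where f = det]) (simp add: vec_eq_iff)
  then have "constant (poly p)"
    using fundamental_theorem_of_algebra[of p] invertible_semisimple_deformation[OF nonzero D(1)]
    by (auto simp: invertible_det_nz)
  then have "poly p 0 = poly p 1" by (simp add: constant_def)
  then show ?thesis using D(2) by (simp add: p)
qed

section \<open>The Krein form\<close>

definition Re_vec :: "complex^'m \<Rightarrow> real^'m" where "Re_vec x = (\<chi> i. Re (x $ i))"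

definition Im_vec :: "complex^'m \<Rightarrow> real^'m" where "Im_vec x = (\<chi> i. Im (x $ i))"

definition cnj_vec :: "complex^'m \<Rightarrow> complex^'m" where "cnj_vec x = (\<chi> i. cnj (x $ i))"

definition of_real_vec :: "real^'m \<Rightarrow> complex^'m" where "of_real_vec u = (\<chi> i. complex_of_real (u $ i))"

lemma cnj_vec_cnj_vec [simp]: "cnj_vec (cnj_vec x) = x" by (simp add: cnj_vec_def vec_eq_iff)

lemma cnj_vec_add: "cnj_vec (x + y) = cnj_vec x + cnj_vec y" by (simp add: cnj_vec_def vec_eq_iff)

lemma cnj_vec_scale: "cnj_vec (c *s x) = cnj c *s cnj_vec x" by (simp add: cnj_vec_def vec_eq_iff)

lemma cnj_vec_0 [simp]: "cnj_vec 0 = 0" by (simp add: cnj_vec_def vec_eq_iff)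

lemma cnj_vec_eq_0 [simp]: "cnj_vec x = 0 \<longleftrightarrow> x = 0" by (simp add: cnj_vec_def vec_eq_iff)

lemma cnj_vec_diff: "cnj_vec (x - y) = cnj_vec x - cnj_vec y" by (simp add: cnj_vec_def vec_eq_iff)

lemma cplx_cnj_vec: "cplx W *v cnj_vec x = cnj_vec (cplx W *v x)"
  by (simp add: cplx_def cnj_vec_def vec_eq_iff matrix_vector_mult_def)

lemma cplx_of_real_vec: "cplx W *v of_real_vec u = of_real_vec (W *v u)"
  by (simp add: cplx_def of_real_vec_def vec_eq_iff matrix_vector_mult_def)



lemma Re_vec_cnj_vec [simp]: "Re_vec (cnj_vec x) = Re_vec x" and Im_vec_cnj_vec [simp]: "Im_vec (cnj_vec x) = - Im_vec x"
  by (simp_all add: Re_vec_def Im_vec_def cnj_vec_def vec_eq_iff)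

lemma Re_vec_cplx: "Re_vec (cplx W *v x) = W *v Re_vec x" and Im_vec_cplx: "Im_vec (cplx W *v x) = W *v Im_vec x"
  by (simp_all add: Re_vec_def Im_vec_def cplx_def vec_eq_iff matrix_vector_mult_def)

lemma Re_Im_vec_eq_0: "Re_vec x = 0 \<Longrightarrow> Im_vec x = 0 \<Longrightarrow> x = 0"
  by (simp add: Re_vec_def Im_vec_def vec_eq_iff complex_eq_iff)

lemma of_real_vec_eq_0 [simp]: "of_real_vec u = 0 \<longleftrightarrow> u = 0"
  by (simp add: of_real_vec_def vec_eq_iff)

lemma cplx_mult: "cplx (A ** B) = cplx A ** cplx B"
  by (simp add: cplx_def vec_eq_iff matrix_matrix_mult_def)

lemma cplx_one: "cplx (mat 1) = mat 1"
  by (simp add: cplx_def vec_eq_iff mat_def)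

lemma cplx_J0_vec: "(cplx J0 *v x) $ Inl j = - (x $ Inr j)" "(cplx J0 *v x) $ Inr j = x $ Inl j"
  by (simp_all add: cplx_def J0_def matrix_vector_mult_def if_distribR sum_UNIV_Plus if_distrib sum.delta cong: if_cong)

lemma krein_expand: "krein x y = (\<Sum>j\<in>UNIV. \<i> * (x $ Inr j * cnj (y $ Inl j) - x $ Inl j * cnj (y $ Inr j)))"
  by (simp add: krein_def sum_UNIV_Plus cplx_J0_vec algebra_simps flip: sum.distrib)

lemma krein_add_left: "krein (x + y) z = krein x z + krein y z"
  by (simp add: krein_expand algebra_simps flip: sum.distrib)

lemma krein_add_right: "krein x (y + z) = krein x y + krein x z"
  by (simp add: krein_expand algebra_simps flip: sum.distrib)

lemma krein_scale_left: "krein (c *s x) z = c * krein x z"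
  by (simp add: krein_expand algebra_simps sum_distrib_left)

lemma krein_scale_right: "krein x (c *s z) = cnj c * krein x z"
  by (simp add: krein_expand algebra_simps sum_distrib_left)

lemma krein_0 [simp]: "krein 0 z = 0" "krein z 0 = 0"
  by (simp_all add: krein_expand)

lemma krein_diff_left: "krein (x - y) z = krein x z - krein y z"
  using krein_add_left[of "x - y" y z] by simp

lemma krein_diff_right: "krein z (x - y) = krein z x - krein z y"
  using krein_add_right[of z "x - y" y] by simp

lemma krein_sym: "krein y x = cnj (krein x y)"
  by (simp add: krein_expand algebra_simps)

lemma krein_cnj_vec: "krein (cnj_vec x) (cnj_vec y) = - cnj (krein x y)"
  by (simp add: krein_expand cnj_vec_def algebra_simps flip: sum_negf)

lemma krein_of_real_vec: "krein (of_real_vec u) (of_real_vec v) = - \<i> * complex_of_real (omega0 u v)"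
  by (simp add: krein_expand of_real_vec_def omega0_def sum_distrib_left algebra_simps)

lemma krein_Re_Im:
  "krein x y = Complex (omega0 (Im_vec x) (Re_vec y) - omega0 (Re_vec x) (Im_vec y))
     (- (omega0 (Re_vec x) (Re_vec y) + omega0 (Im_vec x) (Im_vec y)))"
  by (simp add: complex_eq_iff krein_expand omega0_def Re_vec_def Im_vec_def algebra_simps
      flip: sum.distrib sum_subtractf sum_negf)

lemma krein_Sp: "W \<in> Sp \<Longrightarrow> krein (cplx W *v x) (cplx W *v y) = krein x y"
  by (simp add: krein_Re_Im Re_vec_cplx Im_vec_cplx Sp_omega0)

definition pos_part :: "'n::finite cvec \<Rightarrow> complex^'n" where "pos_part x = (\<chi> j. (x $ Inl j + \<i> * x $ Inr j) / 2)"

definition neg_part :: "'n::finite cvec \<Rightarrow> complex^'n" where "neg_part x = (\<chi> j. (x $ Inl j - \<i> * x $ Inr j) / 2)"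

definition of_parts :: "complex^'n \<Rightarrow> complex^'n \<Rightarrow> 'n::finite cvec" where
  "of_parts a b = (\<chi> k. case k of Inl j \<Rightarrow> a $ j + b $ j | Inr j \<Rightarrow> - \<i> * (a $ j - b $ j))"

lemma pos_part_of_parts [simp]: "pos_part (of_parts a b) = a" and neg_part_of_parts [simp]: "neg_part (of_parts a b) = b"
  by (simp_all add: pos_part_def neg_part_def of_parts_def vec_eq_iff algebra_simps)

lemma of_parts_collapse: "of_parts (pos_part x) (neg_part x) = x"
  by (simp add: vec_sum_eq_iff pos_part_def neg_part_def of_parts_def field_simps)

lemma pos_part_add: "pos_part (x + y) = pos_part x + pos_part y" and neg_part_add: "neg_part (x + y) = neg_part x + neg_part y"
  and pos_part_scale: "pos_part (c *s x) = c *s pos_part x" and neg_part_scale: "neg_part (c *s x) = c *s neg_part x"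
  by (simp_all add: pos_part_def neg_part_def vec_eq_iff field_simps)

lemma pos_part_sum: "pos_part (\<Sum>j\<in>A. f j) = (\<Sum>j\<in>A. pos_part (f j))"
  and neg_part_sum: "neg_part (\<Sum>j\<in>A. f j) = (\<Sum>j\<in>A. neg_part (f j))"
  by (simp_all add: pos_part_def neg_part_def vec_eq_iff sum.distrib sum_subtractf sum_divide_distrib sum_distrib_left
      add_divide_distrib diff_divide_distrib)

lemma of_parts_add: "of_parts (a + a') (b + b') = of_parts a b + of_parts a' b'"
  and of_parts_scale: "of_parts (c *s a) (c *s b) = c *s of_parts a b"
  by (simp_all add: of_parts_def vec_eq_iff algebra_simps split: sum.split)

lemma of_parts_0 [simp]: "of_parts 0 0 = 0" by (simp add: of_parts_def vec_eq_iff split: sum.split)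

lemma krein_parts_sum: "krein x y = 2 * (\<Sum>j\<in>UNIV. pos_part x $ j * cnj (pos_part y $ j) - neg_part x $ j * cnj (neg_part y $ j))"
  unfolding krein_expand sum_distrib_left
  by (rule sum.cong) (simp_all add: pos_part_def neg_part_def field_simps)

lemma norm_cvec_sq: "(norm (a::complex^'m))\<^sup>2 = (\<Sum>j\<in>UNIV. (cmod (a $ j))\<^sup>2)"
  by (simp add: norm_vec_def L2_set_def sum_nonneg)

lemma krein_self_norms: "krein x x = complex_of_real (2 * ((norm (pos_part x))\<^sup>2 - (norm (neg_part x))\<^sup>2))"
  by (simp add: krein_parts_sum norm_cvec_sq sum_subtractf flip: complex_norm_square)

definition krein_sq :: "'n::finite cvec \<Rightarrow> real" where "krein_sq x = Re (krein x x)"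

lemma krein_sq_eq: "krein_sq x = 2 * ((norm (pos_part x))\<^sup>2 - (norm (neg_part x))\<^sup>2)"
  by (simp add: krein_sq_def krein_self_norms)

lemma krein_self: "krein x x = complex_of_real (krein_sq x)"
  by (simp add: krein_sq_eq krein_self_norms)

lemma krein_sq_Sp: "W \<in> Sp \<Longrightarrow> krein_sq (cplx W *v x) = krein_sq x"
  by (simp add: krein_sq_def krein_Sp)

lemma krein_sq_cnj_vec: "krein_sq (cnj_vec x) = - krein_sq x"
  by (simp add: krein_sq_def krein_cnj_vec)

lemma krein_sq_add: "krein_sq (x + y) = krein_sq x + krein_sq y + 2 * Re (krein x y)"
  by (simp add: krein_sq_def krein_add_left krein_add_right krein_sym[of y x])

lemma krein_sq_scale: "krein_sq (c *s x) = (cmod c)\<^sup>2 * krein_sq x"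
proof -
  have "krein (c *s x) (c *s x) = (c * cnj c) * krein x x" by (simp add: krein_scale_left krein_scale_right)
  also have "c * cnj c = complex_of_real ((cmod c)\<^sup>2)" by (rule complex_norm_square[symmetric])
  also have "complex_of_real ((cmod c)\<^sup>2) * krein x x = complex_of_real ((cmod c)\<^sup>2 * krein_sq x)"
    by (simp add: krein_self)
  finally show ?thesis by (simp only: krein_sq_def[of "c *s x"] Re_complex_of_real)
qed

lemma krein_posdef_on_iff: "krein_posdef_on V \<longleftrightarrow> (\<forall>v\<in>V. v \<noteq> 0 \<longrightarrow> krein_sq v > 0)"
  by (simp add: krein_posdef_on_def krein_self)

lemma krein_nondegenerate: "(\<And>y. krein x y = 0) \<Longrightarrow> x = 0"
proof -
  assume *: "\<And>y. krein x y = 0"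
  have "krein x (of_parts (pos_part x) (- neg_part x)) = complex_of_real (2 * ((norm (pos_part x))\<^sup>2 + (norm (neg_part x))\<^sup>2))"
    by (simp add: krein_parts_sum norm_cvec_sq sum.distrib flip: complex_norm_square)
  then have "(norm (pos_part x))\<^sup>2 + (norm (neg_part x))\<^sup>2 = 0" using * by (metis mult_eq_0_iff of_real_eq_0_iff zero_neq_numeral)
  then have "pos_part x = 0" "neg_part x = 0" by (auto simp: add_nonneg_eq_0_iff)
  then show "x = 0" using of_parts_collapse[of x] by simp
qed

lemma krein_gen_eigenspace_orthogonal:
  assumes W: "W \<in> Sp" and x: "x \<in> gen_eigenspace (cplx W) l" and y: "y \<in> gen_eigenspace (cplx W) m" and ne: "l * cnj m \<noteq> 1"
  shows "krein x y = 0"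
proof -
  let ?M = "cplx W"
  have "(shift ?M l ^^ j) x = 0 \<Longrightarrow> (shift ?M m ^^ k) y = 0 \<Longrightarrow> krein x y = 0" for j k x y
  proof (induction "j + k" arbitrary: j k x y rule: less_induct)
    case less
    show ?case
    proof (cases j)
      case 0 then show ?thesis using less.prems by simp
    next
      case (Suc j')
      show ?thesis
      proof (cases k)
        case 0 then show ?thesis using less.prems by simp
      next
        case (Suc k')
        note j = \<open>j = Suc j'\<close> and k = Suc
        define x' where "x' = shift ?M l x"
        define y' where "y' = shift ?M m y"
        have x': "(shift ?M l ^^ j') x' = 0" using less.prems(1) by (simp add: j x'_def shift_pow_comm)
        have y': "(shift ?M m ^^ k') y' = 0" using less.prems(2) by (simp add: k y'_def shift_pow_comm)
        have products: "krein x y' = 0" "krein x' y = 0" "krein x' y' = 0"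
          using less.hyps[of j k' x y'] less.hyps[of j' k x' y] less.hyps[of j' k' x' y'] less.prems x' y' j k by simp_all
        have "krein x y = krein (l *s x + x') (m *s y + y')"
          using krein_Sp[OF W, of x y] by (simp add: x'_def y'_def shift_def)
        also have "\<dots> = l * cnj m * krein x y"
          by (simp add: krein_add_left krein_add_right krein_scale_left krein_scale_right products)
        finally show ?thesis using ne by simp
      qed
    qed
  qed
  then show ?thesis using x y unfolding gen_eigenspace_def by blast
qed

lemma krein_span_zero:
  assumes "\<And>b. b \<in> B \<Longrightarrow> krein x b = 0" "y \<in> vec.span B"
  shows "krein x y = 0"
  using assms(2) by (induction rule: vec.span_induct_alt) (use assms(1) in \<open>auto simp: krein_add_right krein_scale_right\<close>)

lemma dim_krein_orthogonal:
  assumes "finite B" "vec.subspace S"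
  shows "vec.dim S \<le> vec.dim {x \<in> S. \<forall>b\<in>B. krein x b = 0} + card B"
    and "vec.subspace {x \<in> S. \<forall>b\<in>B. krein x b = 0}"
proof -
  show sub: "vec.subspace {x \<in> S. \<forall>b\<in>B. krein x b = 0}" for B
    using assms(2) by (auto simp: vec.subspace_def krein_add_left krein_scale_left)
  show "vec.dim S \<le> vec.dim {x \<in> S. \<forall>b\<in>B. krein x b = 0} + card B"
    using assms(1)
  proof (induction B rule: finite_induct)
    case (insert b B)
    let ?S = "{x \<in> S. \<forall>b\<in>B. krein x b = 0}"
    let ?T = "{x \<in> S. \<forall>b\<in>insert b B. krein x b = 0}"
    have "vec.dim ?S \<le> vec.dim ?T + 1"
    proof (cases "\<forall>x\<in>?S. krein x b = 0")
      case True
      then have "?S = ?T" by auto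
      then show ?thesis by (metis le_add1)
    next
      case False
      then obtain s where s: "s \<in> ?S" "krein s b \<noteq> 0" by blast
      have "?S \<subseteq> vec.span (insert s ?T)"
      proof
        fix x assume x: "x \<in> ?S"
        define c where "c = krein x b / krein s b"
        have "x - c *s s \<in> ?T"
          using x s vec.subspace_diff[OF sub[of B] x vec.subspace_scale[OF sub[of B] s(1), of c]]
          by (auto simp: krein_diff_left krein_scale_left c_def)
        then have "(x - c *s s) + c *s s \<in> vec.span (insert s ?T)"
          by (intro vec.span_add vec.span_scale vec.span_base) auto
        then show "x \<in> vec.span (insert s ?T)" by simp
      qed
      then have "vec.dim ?S \<le> vec.dim (insert s ?T)" by (rule vec.dim_mono)
      also have "\<dots> \<le> vec.dim ?T + 1" by (simp add: vec.dim_insert)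
      finally show ?thesis .
    qed
    then show ?case using insert by simp
  qed simp
qed

lemma krein_orthogonal_exists:
  assumes "finite B" "vec.subspace S" "card B < vec.dim S"
  obtains x where "x \<in> S" "x \<noteq> 0" "\<And>b. b \<in> B \<Longrightarrow> krein x b = 0"
proof -
  have "vec.dim {x \<in> S. \<forall>b\<in>B. krein x b = 0} \<noteq> 0"
    using dim_krein_orthogonal(1)[OF assms(1,2)] assms(3) by linarith
  then have "\<not> {x \<in> S. \<forall>b\<in>B. krein x b = 0} \<subseteq> {0}" by simp
  then show ?thesis using that by blast
qed

lemma subspace_basis:
  fixes P :: "(complex^'m) set"
  assumes "vec.subspace P"
  obtains B where "finite B" "B \<subseteq> P" "vec.span B = P" "card B = vec.dim P"
  using vec.basis_subspace_exists[OF assms] vec.finiteI_independent by metis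

lemma krein_projection:
  assumes P: "vec.subspace P" "krein_posdef_on P"
  obtains q where "q \<in> P" "\<And>b. b \<in> P \<Longrightarrow> krein (y - q) b = 0"
proof (cases "y \<in> P")
  case True
  then show ?thesis using that[of y] by simp
next
  case False
  obtain B where B: "finite B" "B \<subseteq> P" "vec.span B = P" "card B = vec.dim P" using subspace_basis[OF P(1)] by metis
  have span_P: "vec.span P = P" using P(1) by (simp add: vec.span_eq_iff)
  have "vec.dim (vec.span (insert y P)) = vec.dim P + 1"
    using False by (simp add: vec.dim_insert span_P)
  then obtain x where x: "x \<in> vec.span (insert y P)" "x \<noteq> 0" "\<And>b. b \<in> B \<Longrightarrow> krein x b = 0"
    using krein_orthogonal_exists[OF B(1) vec.subspace_span, of "insert y P"] B(4) by auto
  have orth: "krein x b = 0" if "b \<in> P" for b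
    using krein_span_zero[OF x(3)] that B(3) by blast
  obtain k where k: "x - k *s y \<in> P" using x(1) span_P by (auto simp: vec.span_breakdown_eq)
  have "k \<noteq> 0"
  proof
    assume "k = 0"
    then have "x \<in> P" using k by simp
    then have "krein_sq x > 0" "krein x x = 0" using P(2) x(2) orth by (auto simp: krein_posdef_on_iff)
    then show False by (simp add: krein_sq_def)
  qed
  define q where "q = (- 1 / k) *s (x - k *s y)"
  have "q \<in> P" unfolding q_def by (rule vec.subspace_scale[OF P(1) k])
  moreover have "y - q = (1 / k) *s x" using \<open>k \<noteq> 0\<close> by (simp add: q_def vec_eq_iff field_simps)
  ultimately show ?thesis using that[of q] orth by (simp add: krein_scale_left)
qed

definition krein_p_subspace :: "'n::finite sqm \<Rightarrow> complex \<Rightarrow> 'n cvec set \<Rightarrow> bool" where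
  "krein_p_subspace W l P \<longleftrightarrow> vec.subspace P \<and> P \<subseteq> gen_eigenspace (cplx W) l \<and> krein_posdef_on P
     \<and> vec.dim P = krein_p W l"

lemma krein_p_subspace_exists: "\<exists>P. krein_p_subspace W l P"
  and dim_le_krein_p: "vec.subspace V \<Longrightarrow> V \<subseteq> gen_eigenspace (cplx W) l \<Longrightarrow> krein_posdef_on V \<Longrightarrow> vec.dim V \<le> krein_p W l"
  for W :: "'n::finite sqm"
proof -
  let ?D = "{vec.dim V | V. vec.subspace V \<and> V \<subseteq> geneig W l \<and> krein_posdef_on V}"
  have "?D \<subseteq> {..CARD('n + 'n)}"
    using vec.dim_subset_UNIV[where 'a = complex and 'b = "'n + 'n"] by (auto simp: vec.dimension_def card_cart_basis)
  then have fin: "finite ?D" by (rule finite_subset) simp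
  have "vec.dim {0::'n cvec} \<in> ?D"
    using gen_eigenspace_subspace[of "cplx W" l] by (intro CollectI exI[of _ "{0}"])
      (auto simp: krein_posdef_on_def vec.subspace_def geneig_eq_gen_eigenspace)
  then have "Max ?D \<in> ?D" using fin by (intro Max_in) auto
  then show "\<exists>P. krein_p_subspace W l P"
    unfolding krein_p_subspace_def krein_p_def geneig_eq_gen_eigenspace by force
  show "vec.dim V \<le> krein_p W l" if "vec.subspace V" "V \<subseteq> gen_eigenspace (cplx W) l" "krein_posdef_on V"
    unfolding krein_p_def using fin that by (intro Max_ge) (auto simp: geneig_eq_gen_eigenspace)
qed

lemma dim_krein_nonneg_le:
  fixes V :: "'n::finite cvec set"
  assumes V: "vec.subspace V" and nn: "\<And>x. x \<in> V \<Longrightarrow> krein_sq x \<ge> 0"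
  shows "vec.dim V \<le> CARD('n)"
proof -
  have lin: "Vector_Spaces.linear (*s) (*s) (pos_part :: 'n cvec \<Rightarrow> complex^'n)"
    by (intro Vector_Spaces.linear_iff[THEN iffD2] conjI allI) (auto simp: pos_part_add pos_part_scale vec.vector_space_axioms)
  have "x = 0" if "x \<in> V" "pos_part x = 0" for x
  proof -
    have "norm (neg_part x) = 0" using nn[OF that(1)] that(2) by (simp add: krein_sq_eq)
    then show ?thesis using of_parts_collapse[of x] that(2) by simp
  qed
  then have "inj_on pos_part (vec.span V)"
    using V vec.linear_inj_on_iff_eq_0[OF lin V] by (simp add: vec.span_eq_iff[THEN iffD2])
  then have "vec.dim (pos_part ` V) = vec.dim V" by (rule vec.dim_image_eq[OF lin])
  then show ?thesis using vec.dim_subset_UNIV[of "pos_part ` V"] by (simp add: vec.dimension_def card_cart_basis)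
qed

lemma gen_eigenspace_pairing_nondegenerate:
  assumes W: "W \<in> Sp" and lm: "l * cnj m = 1" and x: "x \<in> gen_eigenspace (cplx W) l"
    and z: "\<And>y. y \<in> gen_eigenspace (cplx W) m \<Longrightarrow> krein x y = 0"
  shows "x = 0"
proof (rule krein_nondegenerate)
  fix y
  have "krein x b = 0" if hb: "b \<in> (\<Union>m. gen_eigenspace (cplx W) m)" for b
  proof -
    obtain m' where m': "b \<in> gen_eigenspace (cplx W) m'" using hb by blast
    show ?thesis
    proof (cases "m' = m")
      case True then show ?thesis using z m' by simp
    next
      case False
      have "l \<noteq> 0" using lm by auto
      have "l * cnj m' \<noteq> 1" using False lm \<open>l \<noteq> 0\<close> by (metis complex_cnj_cancel_iff mult_left_cancel)
      then show ?thesis using krein_gen_eigenspace_orthogonal[OF W x m'] by simp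
    qed
  qed
  then show "krein x y = 0" by (rule krein_span_zero[where B = "\<Union>m. gen_eigenspace (cplx W) m"]) (simp_all add: gen_eigenspace_span)
qed

lemma dim_gen_eigenspace_dual:
  assumes W: "W \<in> Sp" and lm: "l * cnj m = 1"
  shows "vec.dim (gen_eigenspace (cplx W) l) = vec.dim (gen_eigenspace (cplx W) m)"
proof -
  have dim_le: "vec.dim (gen_eigenspace (cplx W) l) \<le> vec.dim (gen_eigenspace (cplx W) m)" if lm: "l * cnj m = 1" for l m
  proof (rule ccontr)
    assume "\<not> ?thesis"
    then have lt: "vec.dim (gen_eigenspace (cplx W) m) < vec.dim (gen_eigenspace (cplx W) l)" by simp
    obtain B where B: "finite B" "vec.span B = gen_eigenspace (cplx W) m" "card B = vec.dim (gen_eigenspace (cplx W) m)"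
      using subspace_basis[OF gen_eigenspace_subspace[of "cplx W" m]] by metis
    obtain x where x: "x \<in> gen_eigenspace (cplx W) l" "x \<noteq> 0" "\<And>b. b \<in> B \<Longrightarrow> krein x b = 0"
      using krein_orthogonal_exists[OF B(1) gen_eigenspace_subspace[of "cplx W" l]] lt B(3) by metis
    then show False using gen_eigenspace_pairing_nondegenerate[OF W lm x(1)] krein_span_zero[OF x(3)] B(2) by blast
  qed
  have "m * cnj l = 1" using lm by (metis complex_cnj_cnj complex_cnj_mult complex_cnj_one mult.commute)
  then show ?thesis using dim_le lm by (intro antisym) auto
qed

lemma shift_cnj_vec: "shift (cplx W) (cnj l) (cnj_vec x) = cnj_vec (shift (cplx W) l x)"
  by (simp add: shift_def cplx_cnj_vec cnj_vec_diff cnj_vec_scale)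

lemma gen_eigenspace_cnj_vec: "x \<in> gen_eigenspace (cplx W) l \<Longrightarrow> cnj_vec x \<in> gen_eigenspace (cplx W) (cnj l)"
proof -
  have "(shift (cplx W) (cnj l) ^^ k) (cnj_vec x) = cnj_vec ((shift (cplx W) l ^^ k) x)" for k
    by (induct k) (simp_all add: shift_cnj_vec)
  then show "x \<in> gen_eigenspace (cplx W) l \<Longrightarrow> cnj_vec x \<in> gen_eigenspace (cplx W) (cnj l)" by (simp add: gen_eigenspace_def)
qed

lemma subspace_cnj_vec: "vec.subspace S \<Longrightarrow> vec.subspace (cnj_vec ` S)"
proof -
  assume S: "vec.subspace S"
  have scale: "c *s cnj_vec x = cnj_vec (cnj c *s x)" for c and x :: "complex^'a" by (simp add: cnj_vec_scale)
  have "0 \<in> cnj_vec ` S" using vec.subspace_0[OF S] by (metis cnj_vec_0 image_eqI)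
  moreover have "cnj_vec x + cnj_vec y \<in> cnj_vec ` S" if "x \<in> S" "y \<in> S" for x y
    using vec.subspace_add[OF S that] by (simp flip: cnj_vec_add)
  moreover have "c *s cnj_vec x \<in> cnj_vec ` S" if "x \<in> S" for c x
    unfolding scale using vec.subspace_scale[OF S that] by blast
  ultimately show ?thesis unfolding vec.subspace_def by blast
qed

lemma dim_cnj_vec: assumes "vec.subspace S" shows "vec.dim (cnj_vec ` S) = vec.dim S"
proof -
  have dim_le: "vec.dim (cnj_vec ` S) \<le> vec.dim S" if S: "vec.subspace S" for S :: "(complex^'a) set"
  proof -
    obtain B where B: "finite B" "vec.span B = S" "card B = vec.dim S" using subspace_basis[OF S] by metis
    have "cnj_vec x \<in> vec.span (cnj_vec ` B)" if "x \<in> vec.span B" for x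
      using that
    proof (induction rule: vec.span_induct_alt)
      case (step c x y)
      have "cnj_vec x \<in> vec.span (cnj_vec ` B)" using step by (intro vec.span_base) auto
      then show ?case using step by (simp add: cnj_vec_add cnj_vec_scale vec.span_add vec.span_scale)
    qed (simp add: vec.span_zero)
    then have "cnj_vec ` S \<subseteq> vec.span (cnj_vec ` B)" using B(2) by blast
    then have "vec.dim (cnj_vec ` S) \<le> card (cnj_vec ` B)" by (rule vec.dim_le_card) (simp add: B)
    also have "\<dots> \<le> card B" using B(1) by (rule card_image_le)
    finally show ?thesis using B by simp
  qed
  have "cnj_vec ` (cnj_vec ` S) = S" by (simp add: image_image)
  then show ?thesis using dim_le[OF assms] dim_le[OF subspace_cnj_vec[OF assms]] by simp
qed

lemma gen_eigenspace_cnj_vec_image: "cnj_vec ` gen_eigenspace (cplx W) l = gen_eigenspace (cplx W) (cnj l)"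
proof
  show "cnj_vec ` gen_eigenspace (cplx W) l \<subseteq> gen_eigenspace (cplx W) (cnj l)" using gen_eigenspace_cnj_vec by blast
  show "gen_eigenspace (cplx W) (cnj l) \<subseteq> cnj_vec ` gen_eigenspace (cplx W) l"
  proof
    fix x assume "x \<in> gen_eigenspace (cplx W) (cnj l)"
    then have "cnj_vec x \<in> gen_eigenspace (cplx W) l" using gen_eigenspace_cnj_vec[of x W "cnj l"] by simp
    then show "x \<in> cnj_vec ` gen_eigenspace (cplx W) l" by (metis cnj_vec_cnj_vec image_eqI)
  qed
qed

lemma dim_gen_eigenspace_cnj: "vec.dim (gen_eigenspace (cplx W) (cnj l)) = vec.dim (gen_eigenspace (cplx W) l)"
  using dim_cnj_vec[OF gen_eigenspace_subspace[of "cplx W" l]] by (simp add: gen_eigenspace_cnj_vec_image)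

lemma krein_p_subspace_orthogonal_nonpos:
  assumes "krein_p_subspace W l P" and z: "z \<in> gen_eigenspace (cplx W) l" "\<And>b. b \<in> P \<Longrightarrow> krein z b = 0"
  shows "krein_sq z \<le> 0"
proof (rule ccontr)
  have P: "vec.subspace P" "P \<subseteq> gen_eigenspace (cplx W) l" "krein_posdef_on P" "vec.dim P = krein_p W l"
    using assms(1) by (auto simp: krein_p_subspace_def)
  assume "\<not> ?thesis"
  then have pos: "krein_sq z > 0" by simp
  have "z \<notin> P" using z(2)[of z] pos by (auto simp: krein_sq_def)
  moreover have span_P: "vec.span P = P" using P(1) by (simp add: vec.span_eq_iff)
  ultimately have "vec.dim (vec.span (insert z P)) = krein_p W l + 1" using P(4) by (simp add: vec.dim_insert span_P)
  moreover have "vec.dim (vec.span (insert z P)) \<le> krein_p W l"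
  proof (rule dim_le_krein_p[OF vec.subspace_span])
    show "vec.span (insert z P) \<subseteq> gen_eigenspace (cplx W) l"
      by (rule vec.span_minimal) (use z P gen_eigenspace_subspace in auto)
    show "krein_posdef_on (vec.span (insert z P))"
      unfolding krein_posdef_on_iff
    proof (intro ballI impI)
      fix v assume v: "v \<in> vec.span (insert z P)" "v \<noteq> 0"
      obtain k where k: "v - k *s z \<in> P" using v(1) span_P by (auto simp: vec.span_breakdown_eq)
      define b where "b = v - k *s z"
      have v_split: "v = k *s z + b" by (simp add: b_def)
      have "krein_sq v = (cmod k)\<^sup>2 * krein_sq z + krein_sq b"
      proof -
        have "krein z b = 0" using z(2) k by (simp add: b_def)
        then show ?thesis by (subst v_split) (simp add: krein_sq_add krein_sq_scale krein_scale_left)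
      qed
      moreover have "krein_sq b \<ge> 0" "b \<noteq> 0 \<Longrightarrow> krein_sq b > 0"
        using P(3) k unfolding krein_posdef_on_iff b_def[symmetric]
        by (cases "b = 0"; force simp: krein_sq_def intro: less_imp_le)+
      ultimately show "krein_sq v > 0"
        using pos v(2) by (cases "k = 0") (auto simp: v_split add_pos_nonneg)
    qed
  qed
  ultimately show False by simp
qed

lemma dim_krein_nonneg_le_krein_p:
  assumes W: "W \<in> Sp" and l: "cmod l = 1"
    and F: "vec.subspace F" "F \<subseteq> gen_eigenspace (cplx W) l" "\<And>x. x \<in> F \<Longrightarrow> krein_sq x \<ge> 0"
  shows "vec.dim F \<le> krein_p W l"
proof (rule ccontr)
  assume nle: "\<not> ?thesis"
  obtain P where max: "krein_p_subspace W l P" using krein_p_subspace_exists by blast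
  then have P: "vec.subspace P" "P \<subseteq> gen_eigenspace (cplx W) l" "krein_posdef_on P" "vec.dim P = krein_p W l"
    by (auto simp: krein_p_subspace_def)
  obtain B where B: "finite B" "vec.span B = P" "card B = vec.dim P" using subspace_basis[OF P(1)] by metis
  obtain x where x: "x \<in> F" "x \<noteq> 0" "\<And>b. b \<in> B \<Longrightarrow> krein x b = 0"
    using krein_orthogonal_exists[OF B(1) F(1)] nle B(3) P(4) by (metis not_le)
  have x_orth: "krein x b = 0" if "b \<in> P" for b using krein_span_zero[OF x(3)] B(2) that by blast
  have x_gen: "x \<in> gen_eigenspace (cplx W) l" using x(1) F(2) by blast
  have unit: "l * cnj l = 1" using l by (simp add: complex_norm_square[symmetric])
  have "krein_sq x \<le> 0" using krein_p_subspace_orthogonal_nonpos[OF max x_gen x_orth] by simp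
  then have x_null: "krein_sq x = 0" using F(3)[OF x(1)] by simp
  obtain y where y: "y \<in> gen_eigenspace (cplx W) l" "krein x y \<noteq> 0"
    using gen_eigenspace_pairing_nondegenerate[OF W unit x_gen] x(2) by blast
  obtain q where q: "q \<in> P" "\<And>b. b \<in> P \<Longrightarrow> krein (y - q) b = 0" using krein_projection[OF P(1,3)] by metis
  define c where "c = krein x (y - q)"
  have "c \<noteq> 0" using y(2) x_orth[OF q(1)] by (simp add: c_def krein_diff_right)
  define R where "R = \<bar>krein_sq (y - q)\<bar> + 1"
  define s where "s = complex_of_real R / c"
  define z where "z = s *s x + (y - q)"
  have diff_gen: "y - q \<in> gen_eigenspace (cplx W) l" using y(1) q(1) P(2) gen_eigenspace_subspace by (intro vec.subspace_diff) auto
  have "z \<in> gen_eigenspace (cplx W) l"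
    unfolding z_def using diff_gen x_gen gen_eigenspace_subspace[of "cplx W" l] by (intro vec.subspace_add vec.subspace_scale) auto
  moreover have "krein z b = 0" if "b \<in> P" for b
    using x_orth that q(2) by (simp add: z_def krein_add_left krein_scale_left)
  ultimately have "krein_sq z \<le> 0" using krein_p_subspace_orthogonal_nonpos[OF max] by blast
  moreover have "krein_sq z = krein_sq (y - q) + 2 * R"
    using \<open>c \<noteq> 0\<close> by (simp add: z_def krein_sq_add krein_sq_scale x_null krein_scale_left c_def[symmetric] s_def)
  ultimately show False by (simp add: R_def)
qed

lemma dim_gen_eigenspace_minus_one:
  assumes W: "W \<in> Sp"
  shows "vec.dim (gen_eigenspace (cplx W) (-1)) = 2 * krein_p W (-1)"
proof (rule antisym)
  let ?E = "gen_eigenspace (cplx W) (-1)"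
  obtain P where max: "krein_p_subspace W (-1) P" using krein_p_subspace_exists by blast
  then have P: "vec.subspace P" "P \<subseteq> ?E" "krein_posdef_on P" "vec.dim P = krein_p W (-1)"
    by (auto simp: krein_p_subspace_def)
  have cnj_image: "cnj_vec ` ?E = ?E" using gen_eigenspace_cnj_vec_image[of W "-1"] by simp
  obtain B where B: "finite B" "B \<subseteq> P" "vec.span B = P" "card B = vec.dim P" using subspace_basis[OF P(1)] by metis
  let ?Q = "{x \<in> ?E. \<forall>b\<in>B. krein x b = 0}"
  have Q: "vec.dim ?E \<le> vec.dim ?Q + krein_p W (-1)" "vec.subspace ?Q"
    using dim_krein_orthogonal[OF B(1) gen_eigenspace_subspace[of "cplx W" "-1"]] B(4) P(4) by simp_all
  have "vec.dim (cnj_vec ` ?Q) \<le> krein_p W (-1)"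
  proof (rule dim_krein_nonneg_le_krein_p[OF W])
    show "vec.subspace (cnj_vec ` ?Q)" by (rule subspace_cnj_vec[OF Q(2)])
    show "cnj_vec ` ?Q \<subseteq> ?E" using cnj_image by blast
    fix x assume "x \<in> cnj_vec ` ?Q"
    then obtain z where z: "x = cnj_vec z" "z \<in> ?Q" by blast
    then have "krein z b = 0" if "b \<in> P" for b using krein_span_zero[of B z b] B(3) that by auto
    then have "krein_sq z \<le> 0" using krein_p_subspace_orthogonal_nonpos[OF max] z(2) by blast
    then show "krein_sq x \<ge> 0" by (simp add: z krein_sq_cnj_vec)
  qed simp
  then show "vec.dim ?E \<le> 2 * krein_p W (-1)" using Q dim_cnj_vec[OF Q(2)] by simp
  have "P \<inter> cnj_vec ` P = {0}"
  proof -
    have "x = 0" if "x \<in> P" "x = cnj_vec z" "z \<in> P" for x z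
      using P(3) that krein_sq_cnj_vec[of z] unfolding krein_posdef_on_iff by (metis cnj_vec_eq_0 less_asym neg_0_less_iff_less)
    then show ?thesis using vec.subspace_0[OF P(1)] by (auto simp: image_iff intro!: bexI[of _ 0])
  qed
  then have "vec.dim {x + y | x y. x \<in> P \<and> y \<in> cnj_vec ` P} = 2 * krein_p W (-1)"
    using vec.dim_sums_Int[OF P(1) subspace_cnj_vec[OF P(1)]] dim_cnj_vec[OF P(1)] P(4) by simp
  moreover have "{x + y | x y. x \<in> P \<and> y \<in> cnj_vec ` P} \<subseteq> ?E"
    using P(2) cnj_image gen_eigenspace_subspace[of "cplx W" "-1"] by (auto intro!: vec.subspace_add)
  then have "vec.dim {x + y | x y. x \<in> P \<and> y \<in> cnj_vec ` P} \<le> vec.dim ?E" by (rule vec.dim_subset)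
  ultimately show "2 * krein_p W (-1) \<le> vec.dim ?E" by simp
qed

section \<open>Continuity of the rotation function\<close>

definition graph_vec :: "complex^'n^'n \<Rightarrow> complex^'n \<Rightarrow> 'n::finite cvec" where
  "graph_vec K a = of_parts a (K *v a)"

definition graph_pos :: "'n::finite sqm \<Rightarrow> complex^'n^'n \<Rightarrow> complex^'n^'n" where
  "graph_pos W K = matrix (\<lambda>a. pos_part (cplx W *v graph_vec K a))"

definition graph_neg :: "'n::finite sqm \<Rightarrow> complex^'n^'n \<Rightarrow> complex^'n^'n" where
  "graph_neg W K = matrix (\<lambda>a. neg_part (cplx W *v graph_vec K a))"

lemma graph_vec_add: "graph_vec K (a + b) = graph_vec K a + graph_vec K b"
  by (simp add: graph_vec_def vec.add of_parts_add)

lemma graph_vec_scale: "graph_vec K (c *s a) = c *s graph_vec K a"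
  by (simp add: graph_vec_def vec.scale of_parts_scale)

lemma pos_part_graph_vec [simp]: "pos_part (graph_vec K a) = a" and neg_part_graph_vec [simp]: "neg_part (graph_vec K a) = K *v a"
  by (simp_all add: graph_vec_def)

lemma graph_vec_0 [simp]: "graph_vec K 0 = 0" by (simp add: graph_vec_def)

lemma graph_vec_eq_0 [simp]: "graph_vec K a = 0 \<longleftrightarrow> a = 0"
proof
  assume "graph_vec K a = 0"
  then have "pos_part (graph_vec K a) = pos_part 0" by simp
  also have "pos_part 0 = (0 :: complex^'a)" by (simp add: pos_part_def vec_eq_iff)
  finally show "a = 0" by simp
qed simp

lemma linear_graph_vec: "Vector_Spaces.linear (*s) (*s) (graph_vec K)"
  by (intro Vector_Spaces.linear_iff[THEN iffD2] conjI allI) (auto simp: graph_vec_add graph_vec_scale vec.vector_space_axioms)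

lemma graph_pos_vec: "graph_pos W K *v a = pos_part (cplx W *v graph_vec K a)"
  unfolding graph_pos_def by (rule matrix_works)
    (intro Vector_Spaces.linear_iff[THEN iffD2] conjI allI, auto simp: graph_vec_add graph_vec_scale vec.add vec.scale pos_part_add pos_part_scale vec.vector_space_axioms)

lemma graph_neg_vec: "graph_neg W K *v a = neg_part (cplx W *v graph_vec K a)"
  unfolding graph_neg_def by (rule matrix_works)
    (intro Vector_Spaces.linear_iff[THEN iffD2] conjI allI, auto simp: graph_vec_add graph_vec_scale vec.add vec.scale neg_part_add neg_part_scale vec.vector_space_axioms)

lemma graph_vec_axis_continuous: "continuous_on UNIV (\<lambda>p. graph_vec (snd p) (axis j 1) $ k)"
  by (cases k) (auto simp: graph_vec_def of_parts_def matrix_vector_mult_axis intro!: continuous_intros)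

lemma graph_pos_continuous: "continuous_on UNIV (\<lambda>p. graph_pos (fst p) (snd p))"
  and graph_neg_continuous: "continuous_on UNIV (\<lambda>p. graph_neg (fst p) (snd p))"
  unfolding graph_pos_def graph_neg_def matrix_def pos_part_def neg_part_def matrix_vector_mult_def cplx_def
  by (auto intro!: continuous_on_vec_lambda continuous_intros graph_vec_axis_continuous)

definition contractions :: "(complex^'n^'n) set" where
  "contractions = {K. \<forall>a. norm (K *v a) \<le> norm a}"

lemma krein_sq_graph_vec: "K \<in> contractions \<Longrightarrow> krein_sq (graph_vec K a) \<ge> 0"
  by (simp add: krein_sq_eq contractions_def power_mono)

lemma graph_neg_le_graph_pos:
  assumes "W \<in> Sp" "K \<in> contractions"
  shows "norm (graph_neg W K *v a) \<le> norm (graph_pos W K *v a)"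
proof -
  have "krein_sq (cplx W *v graph_vec K a) \<ge> 0" using krein_sq_graph_vec[OF assms(2)] krein_sq_Sp[OF assms(1)] by simp
  then show ?thesis by (simp add: krein_sq_eq graph_pos_vec graph_neg_vec power2_le_iff_abs_le)
qed

lemma cplx_Sp_kernel:
  assumes "W \<in> Sp" "cplx W *v x = 0" shows "x = 0"
  using krein_nondegenerate[of x] krein_Sp[OF assms(1), of x] assms(2) by simp

lemma graph_pos_invertible:
  assumes W: "W \<in> Sp" and K: "K \<in> contractions"
  shows "invertible (graph_pos W K)"
  unfolding invertible_iff_kernel
proof (intro allI impI)
  fix a assume a: "graph_pos W K *v a = 0"
  then have "graph_neg W K *v a = 0" using graph_neg_le_graph_pos[OF W K, of a] by simp
  then have "cplx W *v graph_vec K a = 0"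
    using of_parts_collapse[of "cplx W *v graph_vec K a"] a by (simp add: graph_pos_vec graph_neg_vec)
  then have "graph_vec K a = 0" by (rule cplx_Sp_kernel[OF W])
  then show "a = 0" by simp
qed

lemma contractions_compact: "compact (contractions :: (complex^'n^'n) set)"
proof -
  have "contractions = (\<Inter>a. {K :: complex^'n^'n. norm (K *v a) \<le> norm a})" by (auto simp: contractions_def)
  also have "closed \<dots>"
    by (intro closed_INT ballI closed_Collect_le continuous_on_norm matrix_vec_mult.continuous_on
        continuous_on_id continuous_on_const)
  finally have "closed (contractions :: (complex^'n^'n) set)" .
  moreover have "norm K \<le> real CARD('n) * real CARD('n)" if K: "K \<in> contractions" for K :: "complex^'n^'n"
  proof -
    have entries: "cmod (K $ i $ j) \<le> 1" for i j
    proof -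
      have "cmod (K $ i $ j) \<le> norm (K *v axis j 1)"
        using Finite_Cartesian_Product.norm_nth_le[of "K *v axis j 1" i] by (simp add: matrix_vector_mult_axis)
      also have "\<dots> \<le> norm (axis j (1::complex))" using K unfolding contractions_def by blast
      finally show ?thesis by simp
    qed
    have "norm K \<le> (\<Sum>i\<in>UNIV. norm (K $ i))" unfolding norm_vec_def by (rule L2_set_le_sum) simp
    also have "\<dots> \<le> (\<Sum>i\<in>(UNIV::'n set). real CARD('n))"
    proof (rule sum_mono)
      fix i
      have "norm (K $ i) \<le> (\<Sum>j\<in>UNIV. cmod (K $ i $ j))" unfolding norm_vec_def by (rule L2_set_le_sum) simp
      also have "\<dots> \<le> (\<Sum>j\<in>(UNIV::'n set). 1)" by (intro sum_mono entries)
      finally show "norm (K $ i) \<le> real CARD('n)" by simp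
    qed
    finally show ?thesis by simp
  qed
  then have "bounded (contractions :: (complex^'n^'n) set)" by (auto simp: bounded_iff)
  ultimately show ?thesis by (simp add: compact_eq_bounded_closed)
qed

lemma contractions_convex: "convex contractions"
  unfolding convex_def contractions_def
proof (intro ballI allI impI CollectI, elim CollectE)
  fix K L :: "complex^'n^'n" and u v :: real and a
  assume K: "\<forall>a. norm (K *v a) \<le> norm a" and L: "\<forall>a. norm (L *v a) \<le> norm a" and uv: "0 \<le> u" "0 \<le> v" "u + v = 1"
  have "norm ((u *\<^sub>R K + v *\<^sub>R L) *v a) \<le> norm (u *\<^sub>R (K *v a)) + norm (v *\<^sub>R (L *v a))"
    unfolding matrix_vec_linear by (rule norm_triangle_ineq)
  also have "\<dots> \<le> u * norm a + v * norm a" using K L uv by (auto intro!: add_mono mult_left_mono)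
  finally show "norm ((u *\<^sub>R K + v *\<^sub>R L) *v a) \<le> norm a" using uv by (simp flip: distrib_right)
qed

text \<open>The graph \<open>{a + K a}\<close> of \<open>K\<close> is a Krein-nonnegative \<open>n\<close>-dimensional subspace invariant under \<open>W\<close>.\<close>
definition invariant_graph :: "'n::finite sqm \<Rightarrow> complex^'n^'n \<Rightarrow> bool" where
  "invariant_graph W K \<longleftrightarrow> K \<in> contractions \<and> graph_neg W K = K ** graph_pos W K"

lemma invariant_graph_exists:
  assumes W: "W \<in> Sp"
  obtains K where "invariant_graph W K"
proof -
  define f where "f K = graph_neg W K ** matrix_inv (graph_pos W K)" for K
  have pos_cont: "continuous_on contractions (\<lambda>K. graph_pos W K)"
    using continuous_on_compose2[OF graph_pos_continuous, of contractions "\<lambda>K. (W, K)"] by (simp add: continuous_intros)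
  have neg_cont: "continuous_on contractions (\<lambda>K. graph_neg W K)"
    using continuous_on_compose2[OF graph_neg_continuous, of contractions "\<lambda>K. (W, K)"] by (simp add: continuous_intros)
  have f_cont: "continuous_on contractions f"
    unfolding f_def by (intro matrix_mult.continuous_on continuous_on_matrix_inv neg_cont pos_cont graph_pos_invertible W)
  have "f K \<in> contractions" if K: "K \<in> contractions" for K
    unfolding contractions_def
  proof (intro CollectI allI)
    fix a
    show "norm (f K *v a) \<le> norm a"
      using graph_neg_le_graph_pos[OF W K, of "matrix_inv (graph_pos W K) *v a"]
      by (simp add: f_def matrix_inv_cancel[OF graph_pos_invertible[OF W K]] flip: matrix_vector_mul_assoc)
  qed
  moreover have "(0 :: complex^'n^'n) \<in> contractions" by (simp add: contractions_def)
  ultimately obtain K where K: "K \<in> contractions" "f K = K"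
    using brouwer[OF contractions_compact contractions_convex _ f_cont] by blast
  have "graph_neg W K = f K ** graph_pos W K"
    by (simp add: f_def matrix_mul_assoc[symmetric] matrix_inv_left graph_pos_invertible[OF W K(1)])
  then show ?thesis using that K by (simp add: invariant_graph_def)
qed

lemma charpoly_mat: "charpoly W z = det (mat z - cplx W)"
  by (simp add: charpoly_def mat_def)

lemma eigenvalues_eq_spectrum: "eigenvalues W = spectrum (cplx W)"
proof -
  have "charpoly W z = 0 \<longleftrightarrow> (\<exists>x. x \<noteq> 0 \<and> (mat z - cplx W) *v x = 0)" for z
    using invertible_det_nz[of "mat z - cplx W"] invertible_iff_kernel[of "mat z - cplx W"]
    by (auto simp: charpoly_mat)
  moreover have "(mat z - cplx W) *v x = 0 \<longleftrightarrow> cplx W *v x = z *s x" for z x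
    by (auto simp: matrix_vec_mult.diff_left mat_vec)
  ultimately show ?thesis by (auto simp: eigenvalues_def spectrum_iff_eigenvector)
qed

lemma krein_sum_left: "krein (\<Sum>a\<in>A. x a) y = (\<Sum>a\<in>A. krein (x a) y)"
  by (induction A rule: infinite_finite_induct) (simp_all add: krein_add_left)

lemma krein_sum_right: "krein y (\<Sum>a\<in>A. x a) = (\<Sum>a\<in>A. krein y (x a))"
  by (induction A rule: infinite_finite_induct) (simp_all add: krein_add_right)

lemma sgn_prod_complex: "sgn (\<Prod>a\<in>A. f a) = (\<Prod>a\<in>A. sgn (f a :: complex))"
  by (induction A rule: infinite_finite_induct) (simp_all add: sgn_mult)

lemma sgn_power_complex: "sgn (z ^ k) = sgn (z::complex) ^ k"
  by (induction k) (simp_all add: sgn_mult)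

lemma mult_cnj_norm: "z * cnj z = complex_of_real ((cmod z)\<^sup>2)"
  by (rule complex_norm_square[symmetric])

lemma mult_cnj_eq_1_iff: "z * cnj z = 1 \<longleftrightarrow> cmod z = 1"
  unfolding mult_cnj_norm by (metis norm_ge_zero of_real_eq_1_iff one_power2 power2_eq_imp_eq zero_le_one)

lemma gen_eigenspace_isotropic:
  assumes "W \<in> Sp" "cmod l \<noteq> 1" "x \<in> gen_eigenspace (cplx W) l"
  shows "krein_sq x = 0"
  using krein_gen_eigenspace_orthogonal[OF assms(1,3,3)] assms(2) by (simp add: krein_sq_def mult_cnj_eq_1_iff)

lemma krein_sq_nonneg_on_posdef: "krein_posdef_on P \<Longrightarrow> x \<in> P \<Longrightarrow> 0 \<le> krein_sq x"
  by (cases "x = 0") (auto simp: krein_posdef_on_iff krein_sq_def intro: less_imp_le)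

lemma krein_sq_sum_gen_eigenspaces:
  assumes W: "W \<in> Sp" and A: "finite A" "\<And>l. l \<in> A \<Longrightarrow> 1 \<le> cmod l"
    and y: "\<And>l. l \<in> A \<Longrightarrow> y l \<in> gen_eigenspace (cplx W) l"
  shows "krein_sq (\<Sum>l\<in>A. y l) = (\<Sum>l\<in>A. krein_sq (y l))"
proof -
  have orthogonal: "krein (y l) (y m) = (if l = m then krein (y l) (y l) else 0)" if lm: "l \<in> A" "m \<in> A" for l m
  proof (cases "l * cnj m = 1")
    case True
    then have "cmod l * cmod m = 1" by (metis complex_mod_cnj norm_mult norm_one)
    then have "cmod m = 1" using A(2)[OF lm(1)] A(2)[OF lm(2)] by (smt (verit, best) mult_le_cancel_right1 mult_cancel_right1)
    then have "m * cnj m = 1" by (simp add: mult_cnj_eq_1_iff)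
    then have "l = m" using True by (metis mult_right_cancel mult_zero_right zero_neq_one)
    then show ?thesis by simp
  next
    case False
    then show ?thesis using krein_gen_eigenspace_orthogonal[OF W y y] lm by auto
  qed
  have "krein (\<Sum>l\<in>A. y l) (\<Sum>l\<in>A. y l) = (\<Sum>l\<in>A. \<Sum>m\<in>A. krein (y l) (y m))"
    unfolding krein_sum_left krein_sum_right by (rule sum.swap)
  also have "\<dots> = (\<Sum>l\<in>A. \<Sum>m\<in>A. if l = m then krein (y l) (y l) else 0)"
    by (intro sum.cong orthogonal) auto
  also have "\<dots> = (\<Sum>l\<in>A. krein (y l) (y l))" using A(1) by simp
  finally show ?thesis by (simp add: krein_sq_def)
qed

definition unit_spectrum :: "'n::finite sqm \<Rightarrow> complex set" where
  "unit_spectrum W = {l \<in> spectrum (cplx W). cmod l = 1}"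

definition outer_spectrum :: "'n::finite sqm \<Rightarrow> complex set" where
  "outer_spectrum W = {l \<in> spectrum (cplx W). cmod l > 1}"

lemma finite_unit_spectrum: "finite (unit_spectrum W)" and finite_outer_spectrum: "finite (outer_spectrum W)"
  using finite_spectrum[of "cplx W"] by (auto simp: unit_spectrum_def outer_spectrum_def)

lemma krein_index_bound:
  fixes W :: "'n::finite sqm"
  assumes W: "W \<in> Sp"
  shows "(\<Sum>l\<in>unit_spectrum W. krein_p W l) + (\<Sum>l\<in>outer_spectrum W. vec.dim (gen_eigenspace (cplx W) l)) \<le> CARD('n)"
proof -
  let ?E = "gen_eigenspace (cplx W)" and ?A = "unit_spectrum W \<union> outer_spectrum W"
  have finite: "finite ?A" using finite_unit_spectrum finite_outer_spectrum by blast
  obtain P where P: "\<And>l. krein_p_subspace W l (P l)" using krein_p_subspace_exists by metis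
  define S where "S l = (if cmod l = 1 then P l else ?E l)" for l
  have S: "vec.subspace (S l) \<and> S l \<subseteq> ?E l" for l
    using P[of l] gen_eigenspace_subspace by (auto simp: S_def krein_p_subspace_def)
  have "(\<Sum>l\<in>unit_spectrum W. krein_p W l) = (\<Sum>l\<in>unit_spectrum W. vec.dim (S l))"
    using P by (intro sum.cong) (auto simp: S_def unit_spectrum_def krein_p_subspace_def)
  moreover have "(\<Sum>l\<in>outer_spectrum W. vec.dim (?E l)) = (\<Sum>l\<in>outer_spectrum W. vec.dim (S l))"
    by (rule sum.cong) (auto simp: S_def outer_spectrum_def)
  moreover have "(\<Sum>l\<in>?A. vec.dim (S l)) = (\<Sum>l\<in>unit_spectrum W. vec.dim (S l)) + (\<Sum>l\<in>outer_spectrum W. vec.dim (S l))"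
    using finite by (intro sum.union_disjoint) (auto simp: unit_spectrum_def outer_spectrum_def)
  moreover have "(\<Sum>l\<in>?A. vec.dim (S l)) = vec.dim (vec.span (\<Union>l\<in>?A. S l))"
    by (rule dim_span_gen_eigenspace[OF finite, symmetric]) (use S in auto)
  moreover have "vec.dim (vec.span (\<Union>l\<in>?A. S l)) \<le> CARD('n)"
  proof (rule dim_krein_nonneg_le[OF vec.subspace_span])
    fix x assume "x \<in> vec.span (\<Union>l\<in>?A. S l)"
    then obtain y where y: "\<And>l. l \<in> ?A \<Longrightarrow> y l \<in> S l" "x = (\<Sum>l\<in>?A. y l)"
      using span_UN_sum[OF finite, of S x] S by blast
    have "krein_sq (y l) \<ge> 0" if l: "l \<in> ?A" for l
    proof (cases "cmod l = 1")
      case True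
      then show ?thesis
        using y(1)[OF l] P[of l] krein_sq_nonneg_on_posdef[of "P l" "y l"] by (simp add: S_def krein_p_subspace_def)
    next
      case False
      then show ?thesis using gen_eigenspace_isotropic[OF W False] y(1)[OF l] by (simp add: S_def)
    qed
    moreover have "krein_sq x = (\<Sum>l\<in>?A. krein_sq (y l))" unfolding y(2)
      by (rule krein_sq_sum_gen_eigenspaces[OF W finite])
        (use S y(1) in \<open>auto simp: unit_spectrum_def outer_spectrum_def\<close>)
    ultimately show "krein_sq x \<ge> 0" by (simp only: sum_nonneg)
  qed
  ultimately show ?thesis by linarith
qed

lemma krein_null_orthogonal:
  assumes null: "krein_sq x = 0" "krein_sq y = 0" and nonneg: "\<And>c. 0 \<le> krein_sq (c *s y + x)"
  shows "krein y x = 0"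
proof (rule ccontr)
  assume "krein y x \<noteq> 0"
  then have "krein_sq ((- 1 / krein y x) *s y + x) = - 2"
    by (simp only: krein_sq_add krein_sq_scale krein_scale_left null) simp
  then show False using nonneg[of "- 1 / krein y x"] by simp
qed

lemma dim_krein_orthogonal_pair_le:
  assumes W: "W \<in> Sp" and ml: "m * cnj l = 1"
    and F: "vec.subspace F" "F \<subseteq> gen_eigenspace (cplx W) l" "vec.subspace F'" "F' \<subseteq> gen_eigenspace (cplx W) m"
    and orthogonal: "\<And>x y. x \<in> F \<Longrightarrow> y \<in> F' \<Longrightarrow> krein y x = 0"
  shows "vec.dim F + vec.dim F' \<le> vec.dim (gen_eigenspace (cplx W) l)"
proof (rule ccontr)
  let ?E = "gen_eigenspace (cplx W) l"
  assume not_le: "\<not> ?thesis"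
  obtain C where C: "finite C" "C \<subseteq> F" "card C = vec.dim F" "vec.independent C"
    using vec.basis_subspace_exists[OF F(1)] vec.finiteI_independent by metis
  obtain B where B: "C \<subseteq> B" "B \<subseteq> ?E" "vec.independent B" "?E \<subseteq> vec.span B"
    using vec.maximal_independent_subset_extend[of C ?E] C F(2) by (metis subset_trans)
  have finite: "finite B" using B(3) vec.finiteI_independent by blast
  have "card B = vec.dim ?E" using vec.basis_card_eq_dim[OF B(2,4,3)] .
  then have "card (B - C) < vec.dim F'"
    using not_le C(1,3) B(1) card_mono[OF finite B(1)] by (simp add: card_Diff_subset)
  then obtain y where y: "y \<in> F'" "y \<noteq> 0" "\<And>b. b \<in> B - C \<Longrightarrow> krein y b = 0"
    using krein_orthogonal_exists[OF _ F(3), of "B - C"] finite by (metis finite_Diff)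
  then have "krein y b = 0" if "b \<in> B" for b using orthogonal[of b y] C(2) that by blast
  then have "krein y x = 0" if "x \<in> ?E" for x using krein_span_zero[of B y x] B(4) that by blast
  then have "y = 0" using gen_eigenspace_pairing_nondegenerate[OF W ml] F(4) y(1) by blast
  then show False using y(2) by simp
qed

lemma graph_vec_intertwines:
  assumes "invariant_graph W K"
  shows "cplx W *v graph_vec K a = graph_vec K (graph_pos W K *v a)"
proof -
  have "neg_part (cplx W *v graph_vec K a) = K *v (graph_pos W K *v a)"
    using assms graph_neg_vec[of W K a] by (simp add: invariant_graph_def matrix_vector_mul_assoc)
  then show ?thesis
    using of_parts_collapse[of "cplx W *v graph_vec K a"]
    by (simp add: graph_vec_def[of K "pos_part (cplx W *v graph_vec K a)"] graph_pos_vec)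
qed

lemma graph_vec_image_gen_eigenspace:
  assumes "invariant_graph W K"
  defines "F \<equiv> \<lambda>l. graph_vec K ` gen_eigenspace (graph_pos W K) l"
  shows "vec.subspace (F l)" "F l \<subseteq> gen_eigenspace (cplx W) l"
    "vec.dim (F l) = vec.dim (gen_eigenspace (graph_pos W K) l)"
proof -
  let ?T = "graph_pos W K"
  have "shift (cplx W) l (graph_vec K a) = graph_vec K (shift ?T l a)" for a
  proof -
    have "graph_vec K (?T *v a) = graph_vec K (shift ?T l a + l *s a)" by (simp add: shift_def)
    then show ?thesis
      by (simp add: shift_def[of "cplx W"] graph_vec_intertwines[OF assms(1)] graph_vec_add graph_vec_scale)
  qed
  then have shift: "(shift (cplx W) l ^^ k) (graph_vec K a) = graph_vec K ((shift ?T l ^^ k) a)" for k a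
    by (induct k) simp_all
  show "F l \<subseteq> gen_eigenspace (cplx W) l"
    unfolding F_def using shift by (auto simp: gen_eigenspace_def[of ?T] intro: shift_kernel_stable)
  show "vec.subspace (F l)"
    unfolding F_def by (rule vec.linear_subspace_image[OF linear_graph_vec gen_eigenspace_subspace])
  have "inj_on (graph_vec K) (gen_eigenspace ?T l)"
    by (simp add: vec.linear_inj_on_iff_eq_0[OF linear_graph_vec gen_eigenspace_subspace])
  then show "vec.dim (F l) = vec.dim (gen_eigenspace ?T l)" unfolding F_def
    using gen_eigenspace_subspace[of ?T l]
    by (intro vec.dim_image_eq[OF linear_graph_vec]) (simp add: vec.span_eq_iff[THEN iffD2])
qed

lemma invariant_graph_dims:
  fixes W :: "'n::finite sqm"
  assumes W: "W \<in> Sp" and K: "invariant_graph W K"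
  defines "f \<equiv> \<lambda>l. vec.dim (gen_eigenspace (graph_pos W K) l)"
  shows "cmod l = 1 \<Longrightarrow> f l \<le> krein_p W l"
    and "cmod l > 1 \<Longrightarrow> f l + f (1 / cnj l) \<le> vec.dim (gen_eigenspace (cplx W) l)"
    and "spectrum (graph_pos W K) \<subseteq> spectrum (cplx W)"
proof -
  define F where "F l = graph_vec K ` gen_eigenspace (graph_pos W K) l" for l
  note F = graph_vec_image_gen_eigenspace[OF K, folded F_def f_def]
  have nonneg: "krein_sq (graph_vec K a) \<ge> 0" for a
    using K krein_sq_graph_vec[of K a] by (simp add: invariant_graph_def)
  show "f l \<le> krein_p W l" if "cmod l = 1" for l
    using dim_krein_nonneg_le_krein_p[OF W that F(1,2)] nonneg F(3) by (auto simp: F_def f_def)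
  show "spectrum (graph_pos W K) \<subseteq> spectrum (cplx W)"
  proof
    fix l assume "l \<in> spectrum (graph_pos W K)"
    then have "vec.dim (F l) \<noteq> 0" by (simp only: spectrum_iff_dim F(3) not_False_eq_True)
    then show "l \<in> spectrum (cplx W)"
      using vec.dim_subset[OF F(2)[of l]] by (simp add: spectrum_iff_dim del: vec.dim_eq_0)
  qed
  show "f l + f (1 / cnj l) \<le> vec.dim (gen_eigenspace (cplx W) l)" if l: "cmod l > 1" for l
    unfolding f_def F(3)[symmetric]
  proof (rule dim_krein_orthogonal_pair_le[OF W _ F(1,2) F(1,2)])
    show "1 / cnj l * cnj l = 1" using l by auto
    fix x y assume x: "x \<in> F l" and y: "y \<in> F (1 / cnj l)"
    have "cmod (1 / cnj l) \<noteq> 1" using l by (simp add: norm_divide)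
    then have "krein_sq x = 0" "krein_sq y = 0"
      using gen_eigenspace_isotropic[OF W] F(2) x y l by (metis less_irrefl subsetD)+
    moreover obtain a b where "x = graph_vec K a" "y = graph_vec K b" using x y by (auto simp: F_def)
    then have "0 \<le> krein_sq (c *s y + x)" for c by (simp add: nonneg flip: graph_vec_scale graph_vec_add)
    ultimately show "krein y x = 0" by (rule krein_null_orthogonal)
  qed
qed

lemma Sp_spectrum_nonzero: "W \<in> Sp \<Longrightarrow> l \<in> spectrum (cplx W) \<Longrightarrow> l \<noteq> 0"
  by (metis cplx_Sp_kernel spectrum_iff_eigenvector vec.scale_zero_left)

lemma spectrum_inverse_cnj:
  assumes "W \<in> Sp" "l \<noteq> 0"
  shows "vec.dim (gen_eigenspace (cplx W) (1 / cnj l)) = vec.dim (gen_eigenspace (cplx W) l)"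
    "1 / cnj l \<in> spectrum (cplx W) \<longleftrightarrow> l \<in> spectrum (cplx W)"
proof -
  show dim: "vec.dim (gen_eigenspace (cplx W) (1 / cnj l)) = vec.dim (gen_eigenspace (cplx W) l)"
    by (rule dim_gen_eigenspace_dual[OF assms(1)]) (use assms(2) in simp)
  show "1 / cnj l \<in> spectrum (cplx W) \<longleftrightarrow> l \<in> spectrum (cplx W)"
    unfolding spectrum_iff_dim dim ..
qed

lemma spectrum_split:
  assumes W: "W \<in> Sp"
  defines "\<iota> \<equiv> \<lambda>l. 1 / cnj l"
  shows "spectrum (cplx W) = unit_spectrum W \<union> (outer_spectrum W \<union> \<iota> ` outer_spectrum W)"
    "inj_on \<iota> (outer_spectrum W)" "unit_spectrum W \<inter> (outer_spectrum W \<union> \<iota> ` outer_spectrum W) = {}"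
    "outer_spectrum W \<inter> \<iota> ` outer_spectrum W = {}"
proof -
  have "l \<in> \<iota> ` outer_spectrum W" if "l \<in> spectrum (cplx W)" "cmod l < 1" for l
  proof (rule image_eqI)
    have "l \<noteq> 0" using Sp_spectrum_nonzero[OF W that(1)] .
    then show "l = \<iota> (\<iota> l)" "\<iota> l \<in> outer_spectrum W"
      using that spectrum_inverse_cnj(2)[OF W, of l]
      by (auto simp: \<iota>_def outer_spectrum_def norm_divide)
  qed
  moreover have "\<iota> l \<in> spectrum (cplx W) \<and> cmod (\<iota> l) < 1" if "l \<in> outer_spectrum W" for l
  proof -
    have "l \<noteq> 0" "cmod l > 1" using that by (auto simp: outer_spectrum_def)
    then show ?thesis
      using that spectrum_inverse_cnj(2)[OF W, of l] by (simp add: \<iota>_def outer_spectrum_def norm_divide)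
  qed
  ultimately show "spectrum (cplx W) = unit_spectrum W \<union> (outer_spectrum W \<union> \<iota> ` outer_spectrum W)"
    "unit_spectrum W \<inter> (outer_spectrum W \<union> \<iota> ` outer_spectrum W) = {}"
    "outer_spectrum W \<inter> \<iota> ` outer_spectrum W = {}"
    unfolding unit_spectrum_def outer_spectrum_def by force+
  show "inj_on \<iota> (outer_spectrum W)" by (auto simp: \<iota>_def inj_on_def)
qed

lemma sum_spectrum_split:
  fixes g :: "complex \<Rightarrow> nat"
  assumes "W \<in> Sp"
  shows "(\<Sum>l\<in>spectrum (cplx W). g l) = (\<Sum>l\<in>unit_spectrum W. g l) + (\<Sum>l\<in>outer_spectrum W. g l + g (1 / cnj l))"
  using spectrum_split[OF assms] finite_unit_spectrum[of W] finite_outer_spectrum[of W]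
  by (simp add: sum.union_disjoint sum.reindex sum.distrib)

lemma prod_spectrum_split:
  fixes g :: "complex \<Rightarrow> complex"
  assumes "W \<in> Sp"
  shows "(\<Prod>l\<in>spectrum (cplx W). g l) = (\<Prod>l\<in>unit_spectrum W. g l) * (\<Prod>l\<in>outer_spectrum W. g l * g (1 / cnj l))"
  using spectrum_split[OF assms] finite_unit_spectrum[of W] finite_outer_spectrum[of W]
  by (simp add: prod.union_disjoint prod.reindex prod.distrib)

text \<open>The index bound is saturated by the invariant graph, whose dimension is \<open>n\<close>.\<close>
lemma invariant_graph_dims_eq:
  fixes W :: "'n::finite sqm"
  assumes W: "W \<in> Sp" and K: "invariant_graph W K"
  defines "f \<equiv> \<lambda>l. vec.dim (gen_eigenspace (graph_pos W K) l)"
  shows "l \<in> unit_spectrum W \<Longrightarrow> f l = krein_p W l"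
    and "l \<in> outer_spectrum W \<Longrightarrow> f l + f (1 / cnj l) = vec.dim (gen_eigenspace (cplx W) l)"
proof -
  note dims = invariant_graph_dims[OF W K]
  have unit_le: "f l \<le> krein_p W l" if "l \<in> unit_spectrum W" for l
    using dims(1)[of l] that by (simp add: unit_spectrum_def f_def)
  have outer_le: "f l + f (1 / cnj l) \<le> vec.dim (gen_eigenspace (cplx W) l)" if "l \<in> outer_spectrum W" for l
    using dims(2)[of l] that by (simp add: outer_spectrum_def f_def)
  have "(\<Sum>l\<in>spectrum (cplx W). f l) = CARD('n)"
    unfolding sum_dim_gen_eigenspace[of "graph_pos W K", symmetric] f_def
    by (rule sum.mono_neutral_right[OF finite_spectrum dims(3)]) (metis DiffD2 spectrum_iff_dim)
  then have "(\<Sum>l\<in>unit_spectrum W. krein_p W l) + (\<Sum>l\<in>outer_spectrum W. vec.dim (gen_eigenspace (cplx W) l))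
     \<le> (\<Sum>l\<in>unit_spectrum W. f l) + (\<Sum>l\<in>outer_spectrum W. f l + f (1 / cnj l))"
    using krein_index_bound[OF W] sum_spectrum_split[OF W, of f] by simp
  moreover have "(\<Sum>l\<in>unit_spectrum W. f l) \<le> (\<Sum>l\<in>unit_spectrum W. krein_p W l)"
    "(\<Sum>l\<in>outer_spectrum W. f l + f (1 / cnj l)) \<le> (\<Sum>l\<in>outer_spectrum W. vec.dim (gen_eigenspace (cplx W) l))"
    using unit_le outer_le by (auto intro: sum_mono)
  ultimately have sum_eq: "(\<Sum>l\<in>unit_spectrum W. f l) = (\<Sum>l\<in>unit_spectrum W. krein_p W l)"
    "(\<Sum>l\<in>outer_spectrum W. f l + f (1 / cnj l)) = (\<Sum>l\<in>outer_spectrum W. vec.dim (gen_eigenspace (cplx W) l))"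
    by linarith+
  show "l \<in> unit_spectrum W \<Longrightarrow> f l = krein_p W l"
    by (rule sum_mono_inv[OF sum_eq(1) unit_le _ finite_unit_spectrum])
  show "l \<in> outer_spectrum W \<Longrightarrow> f l + f (1 / cnj l) = vec.dim (gen_eigenspace (cplx W) l)"
    by (rule sum_mono_inv[OF sum_eq(2) outer_le _ finite_outer_spectrum])
qed

lemma sgn_inverse_cnj: "sgn (1 / cnj l) = sgn l"
proof (cases "l = 0")
  case False
  have "l * cnj l = complex_of_real (cmod l) * complex_of_real (cmod l)"
    by (simp add: mult_cnj_norm power2_eq_square)
  then have "l / complex_of_real (cmod l) = complex_of_real (cmod l) / cnj l"
    using False by (simp add: frac_eq_eq)
  then show ?thesis by (simp add: sgn_eq norm_divide)
qed simp

lemma sgn_det_graph_pos: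
  fixes W :: "'n::finite sqm"
  assumes W: "W \<in> Sp" and K: "invariant_graph W K"
  shows "sgn (det (graph_pos W K)) = (\<Prod>l\<in>unit_spectrum W. l ^ krein_p W l)
    * (\<Prod>l\<in>outer_spectrum W. sgn l ^ vec.dim (gen_eigenspace (cplx W) l))"
proof -
  define f where "f l = vec.dim (gen_eigenspace (graph_pos W K) l)" for l
  have "0 \<notin> spectrum (graph_pos W K)"
    using graph_pos_invertible[OF W] K
    unfolding spectrum_iff_eigenvector invertible_iff_kernel invariant_graph_def by auto
  then have "det (graph_pos W K) = (\<Prod>l\<in>spectrum (graph_pos W K). l ^ f l)"
    unfolding f_def by (rule det_eq_prod_gen_eigenspace)
  also have "\<dots> = (\<Prod>l\<in>spectrum (cplx W). l ^ f l)"
    by (rule prod.mono_neutral_left[OF finite_spectrum invariant_graph_dims(3)[OF W K]])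
      (metis DiffD2 f_def power_0 spectrum_iff_dim)
  finally have "sgn (det (graph_pos W K)) = (\<Prod>l\<in>spectrum (cplx W). sgn l ^ f l)"
    by (simp add: sgn_prod_complex sgn_power_complex)
  also have "\<dots> = (\<Prod>l\<in>unit_spectrum W. sgn l ^ f l) * (\<Prod>l\<in>outer_spectrum W. sgn l ^ (f l + f (1 / cnj l)))"
    unfolding prod_spectrum_split[OF W] sgn_inverse_cnj by (simp add: power_add)
  also have "(\<Prod>l\<in>unit_spectrum W. sgn l ^ f l) = (\<Prod>l\<in>unit_spectrum W. l ^ krein_p W l)"
    using invariant_graph_dims_eq(1)[OF W K, folded f_def]
    by (intro prod.cong) (auto simp: unit_spectrum_def sgn_div_norm)
  also have "(\<Prod>l\<in>outer_spectrum W. sgn l ^ (f l + f (1 / cnj l)))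
      = (\<Prod>l\<in>outer_spectrum W. sgn l ^ vec.dim (gen_eigenspace (cplx W) l))"
    by (intro prod.cong refl) (simp add: invariant_graph_dims_eq(2)[OF W K, folded f_def])
  finally show ?thesis .
qed

lemma prod_unit_spectrum:
  assumes W: "W \<in> Sp"
  shows "(\<Prod>l\<in>unit_spectrum W. l ^ krein_p W l)
    = (\<Prod>l\<in>{l\<in>spectrum (cplx W). cmod l = 1 \<and> l \<noteq> 1 \<and> l \<noteq> -1}. l ^ krein_p W l) * (-1) ^ krein_p W (-1)"
proof -
  let ?U = "{l\<in>spectrum (cplx W). cmod l = 1 \<and> l \<noteq> 1 \<and> l \<noteq> -1}"
  have "(\<Prod>l\<in>unit_spectrum W. l ^ krein_p W l) = (\<Prod>l\<in>?U \<union> {1, -1}. l ^ krein_p W l)"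
  proof (rule prod.mono_neutral_left)
    show "\<forall>i\<in>?U \<union> {1, - 1} - unit_spectrum W. i ^ krein_p W i = 1"
      using dim_gen_eigenspace_minus_one[OF W]
      by (cases "krein_p W (-1) = 0") (auto simp: unit_spectrum_def spectrum_iff_dim simp del: vec.dim_eq_0)
  qed (use finite_spectrum[of "cplx W"] in \<open>auto simp: unit_spectrum_def\<close>)
  also have "\<dots> = (\<Prod>l\<in>?U. l ^ krein_p W l) * (\<Prod>l\<in>{1, -1}. l ^ krein_p W l)"
    by (rule prod.union_disjoint) (use finite_spectrum[of "cplx W"] in auto)
  finally show ?thesis by simp
qed

lemma prod_outer_spectrum_sgn:
  fixes W :: "'n::finite sqm"
  defines "d \<equiv> \<lambda>l. vec.dim (gen_eigenspace (cplx W) l)"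
  shows "(\<Prod>l\<in>outer_spectrum W. sgn l ^ d l) = (-1) ^ (\<Sum>l\<in>{l\<in>outer_spectrum W. l \<in> \<real> \<and> Re l < 0}. d l)"
proof -
  let ?L = "outer_spectrum W"
  let ?upper = "{l\<in>?L. Im l > 0}" and ?lower = "{l\<in>?L. Im l < 0}" and ?real = "{l\<in>?L. Im l = 0}"
  have finite: "finite ?L" by (rule finite_outer_spectrum)
  have d_cnj: "d (cnj l) = d l" for l by (simp add: d_def dim_gen_eigenspace_cnj)
  have "cnj l \<in> ?L \<longleftrightarrow> l \<in> ?L" for l
    unfolding outer_spectrum_def mem_Collect_eq spectrum_iff_dim complex_mod_cnj dim_gen_eigenspace_cnj ..
  then have conj: "bij_betw cnj ?upper ?lower" by (intro bij_betw_byWitness[where f' = cnj]) auto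
  have "?L = ?real \<union> (?upper \<union> ?lower)" by auto
  then have "(\<Prod>l\<in>?L. sgn l ^ d l) = (\<Prod>l\<in>?real \<union> (?upper \<union> ?lower). sgn l ^ d l)" by simp
  also have "\<dots> = (\<Prod>l\<in>?real. sgn l ^ d l) * ((\<Prod>l\<in>?upper. sgn l ^ d l) * (\<Prod>l\<in>?lower. sgn l ^ d l))"
  proof -
    have "?real \<inter> (?upper \<union> ?lower) = {}" "?upper \<inter> ?lower = {}" by auto
    then show ?thesis using finite by (simp add: prod.union_disjoint)
  qed
  also have "(\<Prod>l\<in>?lower. sgn l ^ d l) = (\<Prod>l\<in>?upper. sgn (cnj l) ^ d l)"
    by (subst prod.reindex_bij_betw[OF conj, symmetric]) (simp add: d_cnj)
  also have "(\<Prod>l\<in>?upper. sgn l ^ d l) * (\<Prod>l\<in>?upper. sgn (cnj l) ^ d l) = 1"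
    unfolding prod.distrib[symmetric] power_mult_distrib[symmetric]
  proof (rule prod.neutral, rule ballI)
    fix l assume "l \<in> ?upper"
    then have "l \<noteq> 0" by auto
    have "sgn l * sgn (cnj l) = sgn (complex_of_real ((cmod l)\<^sup>2))" by (simp only: mult_cnj_norm flip: sgn_mult)
    then show "(sgn l * sgn (cnj l)) ^ d l = 1" using \<open>l \<noteq> 0\<close> by (simp add: sgn_of_real del: of_real_power)
  qed
  also have "(\<Prod>l\<in>?real. sgn l ^ d l) = (\<Prod>l\<in>{l\<in>?L. l \<in> \<real> \<and> Re l < 0}. (-1) ^ d l)"
  proof (rule prod.mono_neutral_cong_right)
    have "sgn l = (if Re l < 0 then -1 else 1)" if "l \<in> ?L" "Im l = 0" for l
    proof -
      have "Re l \<noteq> 0" using that by (auto simp: outer_spectrum_def cmod_def)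
      then show ?thesis
        using that sgn_of_real[of "Re l", where 'a = complex] by (simp add: complex_is_Real_iff[symmetric] sgn_real_def)
    qed
    then show "\<forall>l\<in>?real - {l\<in>?L. l \<in> \<real> \<and> Re l < 0}. sgn l ^ d l = 1"
      "\<And>l. l \<in> {l\<in>?L. l \<in> \<real> \<and> Re l < 0} \<Longrightarrow> sgn l ^ d l = (-1) ^ d l"
      by (auto simp: complex_is_Real_iff)
  qed (use finite in \<open>auto simp: complex_is_Real_iff\<close>)
  finally show ?thesis by (simp add: power_sum)
qed

lemma half_neg_mult:
  assumes W: "W \<in> Sp"
  shows "neg_mult W div 2 = krein_p W (-1)
    + (\<Sum>l\<in>{l\<in>outer_spectrum W. l \<in> \<real> \<and> Re l < 0}. vec.dim (gen_eigenspace (cplx W) l))"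
proof -
  let ?d = "\<lambda>l. vec.dim (gen_eigenspace (cplx W) l)" and ?N = "{l. l \<in> \<real> \<and> Re l < 0}"
  let ?g = "\<lambda>l. if l \<in> ?N then ?d l else 0"
  have "neg_mult W = (\<Sum>l\<in>spectrum (cplx W). ?g l)"
    by (simp add: neg_mult_def eigenvalues_eq_spectrum geneig_eq_gen_eigenspace sum.If_cases finite_spectrum Int_def)
  also have "\<dots> = (\<Sum>l\<in>unit_spectrum W. ?g l) + (\<Sum>l\<in>outer_spectrum W. ?g l + ?g (1 / cnj l))"
    by (rule sum_spectrum_split[OF W])
  also have "(\<Sum>l\<in>unit_spectrum W. ?g l) = (\<Sum>l\<in>{-1}. ?d l)"
  proof (rule sum.mono_neutral_cong)
    show "?d l = 0" if "l \<in> {- 1} - unit_spectrum W" for l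
      using that by (auto simp: unit_spectrum_def spectrum_iff_dim)
    show "?g l = 0" if "l \<in> unit_spectrum W - {-1}" for l
      using that by (auto simp: unit_spectrum_def elim!: Reals_cases)
  qed (use finite_unit_spectrum in auto)
  also have "(\<Sum>l\<in>outer_spectrum W. ?g l + ?g (1 / cnj l)) = (\<Sum>l\<in>outer_spectrum W. 2 * ?g l)"
  proof (rule sum.cong[OF refl])
    fix l assume "l \<in> outer_spectrum W"
    then have "l \<noteq> 0" by (auto simp: outer_spectrum_def)
    then have "1 / cnj l \<in> ?N \<longleftrightarrow> l \<in> ?N"
      by (auto simp: complex_is_Real_iff Re_divide Im_divide divide_less_0_iff sum_power2_eq_zero_iff complex_eq_iff)
    then show "?g l + ?g (1 / cnj l) = 2 * ?g l"
      using spectrum_inverse_cnj(1)[OF W \<open>l \<noteq> 0\<close>] by simp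
  qed
  also have "\<dots> = 2 * (\<Sum>l\<in>{l\<in>outer_spectrum W. l \<in> \<real> \<and> Re l < 0}. ?d l)"
    using finite_outer_spectrum[of W] by (simp add: sum.If_cases Int_def flip: sum_distrib_left)
  finally show ?thesis by (simp add: dim_gen_eigenspace_minus_one[OF W])
qed

theorem upsilon_eq_sgn_det: "W \<in> Sp \<Longrightarrow> invariant_graph W K \<Longrightarrow> upsilon W = sgn (det (graph_pos W K))"
  unfolding upsilon_def eigenvalues_eq_spectrum
  by (simp add: sgn_det_graph_pos prod_unit_spectrum prod_outer_spectrum_sgn half_neg_mult power_add mult_ac)

lemma continuous_on_closed_graph:
  fixes f :: "'a::metric_space \<Rightarrow> 'b::metric_space"
  assumes T: "compact T" "f ` S \<subseteq> T"
    and graph: "\<And>X x y. (\<And>k::nat. X k \<in> S) \<Longrightarrow> X \<longlonglongrightarrow> x \<Longrightarrow> x \<in> S \<Longrightarrow> (\<lambda>k. f (X k)) \<longlonglongrightarrow> y \<Longrightarrow> y = f x"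
  shows "continuous_on S f"
  unfolding continuous_on_sequentially
proof (intro allI ballI impI, elim conjE)
  fix X x assume x: "x \<in> S" and X: "\<forall>n. X n \<in> S" "X \<longlonglongrightarrow> x"
  show "(f \<circ> X) \<longlonglongrightarrow> f x"
  proof (rule ccontr)
    assume "\<not> ?thesis"
    then obtain e where e: "e > 0" "\<forall>N. \<exists>n\<ge>N. dist (f (X n)) (f x) \<ge> e"
      by (auto simp: lim_sequentially not_less)
    then have "infinite {n. dist (f (X n)) (f x) \<ge> e}"
      unfolding infinite_nat_iff_unbounded_le by auto
    then obtain r :: "nat \<Rightarrow> nat" where r: "strict_mono r" "\<And>n. dist (f (X (r n))) (f x) \<ge> e"
      using infinite_enumerate by blast
    have "\<forall>n. (f \<circ> X \<circ> r) n \<in> T" using T(2) X(1) by auto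
    then obtain l r' where l: "strict_mono r'" "((f \<circ> X \<circ> r) \<circ> r') \<longlonglongrightarrow> l"
      using T(1) unfolding compact_def by blast
    have "(\<lambda>k. X (r (r' k))) \<longlonglongrightarrow> x"
      using LIMSEQ_subseq_LIMSEQ[OF X(2), of "r \<circ> r'"] strict_mono_o[OF r(1) l(1)] by (simp add: o_def)
    then have "l = f x" using graph[of "\<lambda>k. X (r (r' k))" x l] X(1) x l(2) by (simp add: o_def)
    then have "(\<lambda>k. dist (f (X (r (r' k)))) (f x)) \<longlonglongrightarrow> 0"
      using l(2) by (simp add: o_def tendsto_dist_iff[symmetric])
    then have "e \<le> 0" by (rule LIMSEQ_le_const) (use r(2) in auto)
    then show False using e(1) by simp
  qed
qed

lemma norm_upsilon:
  assumes "W \<in> Sp" shows "cmod (upsilon W) = 1"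
proof -
  obtain K where K: "invariant_graph W K" by (rule invariant_graph_exists[OF assms])
  then have "det (graph_pos W K) \<noteq> 0"
    using graph_pos_invertible[OF assms] invertible_det_nz by (auto simp: invariant_graph_def)
  then show ?thesis using upsilon_eq_sgn_det[OF assms K] by (simp add: norm_sgn)
qed

lemma continuous_on_upsilon: "continuous_on Sp (upsilon :: 'n::finite sqm \<Rightarrow> complex)"
proof (rule continuous_on_closed_graph)
  show "compact (sphere (0::complex) 1)" by simp
  show "upsilon ` Sp \<subseteq> sphere (0::complex) 1" using norm_upsilon by auto
  fix X :: "nat \<Rightarrow> 'n sqm" and x y
  assume X: "\<And>k. X k \<in> Sp" "X \<longlonglongrightarrow> x" and x: "x \<in> Sp" and y: "(\<lambda>k. upsilon (X k)) \<longlonglongrightarrow> y"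
  have "\<forall>k. \<exists>K. invariant_graph (X k) K" using invariant_graph_exists[OF X(1)] by metis
  then obtain K where K: "\<And>k. invariant_graph (X k) (K k)" by metis
  then have "\<forall>k. K k \<in> contractions" by (simp add: invariant_graph_def)
  then obtain K' r where r: "K' \<in> contractions" "strict_mono r" "(K \<circ> r) \<longlonglongrightarrow> K'"
    using contractions_compact unfolding compact_def by metis
  have X_lim: "(\<lambda>k. X (r k)) \<longlonglongrightarrow> x" using LIMSEQ_subseq_LIMSEQ[OF X(2) r(2)] by (simp add: o_def)
  have pair_lim: "(\<lambda>k. (X (r k), K (r k))) \<longlonglongrightarrow> (x, K')" using r(3) X_lim by (intro tendsto_Pair) (simp_all add: o_def)
  have pos_lim: "(\<lambda>k. graph_pos (X (r k)) (K (r k))) \<longlonglongrightarrow> graph_pos x K'"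
    using continuous_on_tendsto_compose[OF graph_pos_continuous pair_lim] by simp
  have neg_lim: "(\<lambda>k. graph_neg (X (r k)) (K (r k))) \<longlonglongrightarrow> graph_neg x K'"
    using continuous_on_tendsto_compose[OF graph_neg_continuous pair_lim] by simp
  have "(\<lambda>k. K (r k) ** graph_pos (X (r k)) (K (r k))) \<longlonglongrightarrow> K' ** graph_pos x K'"
    using r(3) pos_lim by (intro matrix_mult.tendsto) (simp_all add: o_def)
  moreover have "graph_neg (X k) (K k) = K k ** graph_pos (X k) (K k)" for k
    using K by (simp add: invariant_graph_def)
  ultimately have K': "invariant_graph x K'"
    using neg_lim r(1) LIMSEQ_unique unfolding invariant_graph_def by auto
  have "det (graph_pos x K') \<noteq> 0" using graph_pos_invertible[OF x r(1)] invertible_det_nz by blast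
  then have "(\<lambda>k. sgn (det (graph_pos (X (r k)) (K (r k))))) \<longlonglongrightarrow> sgn (det (graph_pos x K'))"
    by (intro tendsto_sgn tendsto_det pos_lim)
  then have "(\<lambda>k. upsilon (X (r k))) \<longlonglongrightarrow> upsilon x"
    using upsilon_eq_sgn_det[OF X(1) K] upsilon_eq_sgn_det[OF x K'] by simp
  moreover have "(\<lambda>k. upsilon (X (r k))) \<longlonglongrightarrow> y"
    using LIMSEQ_subseq_LIMSEQ[OF y r(2)] by (simp add: o_def)
  ultimately show "y = upsilon x" by (rule LIMSEQ_unique[THEN sym])
qed

section \<open>The universal cover and lifts\<close>

lemma sp_pathD:
  assumes "sp_path g"
  shows "path g" "path_image g \<subseteq> Sp" "pathstart g = mat 1" "g 0 = mat 1" "\<And>t. t \<in> {0..1} \<Longrightarrow> g t \<in> Sp"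
    "continuous_on {0..1} g"
  using assms by (auto simp: sp_path_def path_image_def pathstart_def path_def)

lemma cls_self: "sp_path g \<Longrightarrow> g \<in> cls g"
  by (simp add: cls_def sp_path_def)

lemma sp_path_homotopic: "sp_path g \<Longrightarrow> homotopic_paths Sp g h \<Longrightarrow> sp_path h"
  by (metis homotopic_paths_imp_path homotopic_paths_imp_pathstart homotopic_paths_imp_subset sp_path_def)

lemma cls_eqI:
  assumes "homotopic_paths Sp g h"
  shows "cls g = cls h"
  using assms homotopic_paths_sym homotopic_paths_trans unfolding cls_def by blast

lemma SpT_mem:
  assumes "w \<in> SpT" "g \<in> w"
  shows "w = cls g" "sp_path g"
proof -
  obtain h where h: "w = cls h" "sp_path h" using assms(1) by (auto simp: SpT_def)
  then have "homotopic_paths Sp h g" "sp_path g" using assms(2) by (auto simp: cls_def)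
  then show "w = cls g" "sp_path g" using h cls_eqI by blast+
qed

lemma cls_in_SpT: "sp_path g \<Longrightarrow> cls g \<in> SpT"
  by (auto simp: SpT_def)

lemma SpT_nonempty: "w \<in> SpT \<Longrightarrow> \<exists>g. g \<in> w"
  using cls_self by (auto simp: SpT_def)

lemma proj_eq:
  assumes "w \<in> SpT" "g \<in> w"
  shows "proj w = pathfinish g"
proof -
  have "(SOME g. g \<in> w) \<in> w" using assms(2) by (rule someI[of "\<lambda>g. g \<in> w"])
  then have "homotopic_paths Sp g (SOME g. g \<in> w)" using SpT_mem[OF assms] by (auto simp: cls_def)
  then show ?thesis by (simp add: proj_def homotopic_paths_imp_pathfinish)
qed

lemma proj_cls: "sp_path g \<Longrightarrow> proj (cls g) = g 1"
  using proj_eq[OF cls_in_SpT cls_self] by (simp add: pathfinish_def)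

lemma proj_in_Sp: "w \<in> SpT \<Longrightarrow> proj w \<in> Sp"
  using SpT_nonempty[of w] proj_eq[of w] SpT_mem(2)[of w] sp_pathD(5) by (fastforce simp: pathfinish_def)

lemma sp_path_join:
  assumes "sp_path g" "path d" "path_image d \<subseteq> Sp" "pathstart d = pathfinish g"
  shows "sp_path (g +++ d)"
  using assms by (auto simp: sp_path_def path_image_join)

lemma sp_path_const: "sp_path (\<lambda>t. mat 1)"
  by (auto simp: sp_path_def path_def path_image_def pathstart_def)

lemma idT_in_SpT: "idT \<in> SpT"
  unfolding idT_def by (rule cls_in_SpT[OF sp_path_const])

lemma nbhd_mono: "V \<subseteq> V' \<Longrightarrow> nbhd w V \<subseteq> nbhd w V'"
  unfolding nbhd_def by blast

lemma nbhd_subset: "w \<in> SpT \<Longrightarrow> nbhd w V \<subseteq> SpT"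
  unfolding nbhd_def using SpT_mem(2) by (auto intro!: cls_in_SpT sp_path_join)

lemma openin_SpT_top:
  fixes U :: "(real \<Rightarrow> 'n::finite sqm) set set"
  shows "openin SpT_top U \<longleftrightarrow> U \<subseteq> SpT \<and> (\<forall>w\<in>U. \<exists>V. open V \<and> proj w \<in> V \<and> nbhd w V \<subseteq> U)"
proof -
  let ?P = "\<lambda>U :: (real \<Rightarrow> 'n sqm) set set. U \<subseteq> SpT \<and> (\<forall>w\<in>U. \<exists>V. open V \<and> proj w \<in> V \<and> nbhd w V \<subseteq> U)"
  have "istopology ?P"
    unfolding istopology_def
  proof (intro conjI allI impI)
    fix S T
    assume S: "?P S" and T: "?P T"
    show "S \<inter> T \<subseteq> SpT" using S by blast
    show "\<forall>w\<in>S \<inter> T. \<exists>V. open V \<and> proj w \<in> V \<and> nbhd w V \<subseteq> S \<inter> T"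
    proof
      fix w assume "w \<in> S \<inter> T"
      then obtain V V' where "open V" "proj w \<in> V" "nbhd w V \<subseteq> S" "open V'" "proj w \<in> V'" "nbhd w V' \<subseteq> T"
        using S T by blast
      then show "\<exists>V. open V \<and> proj w \<in> V \<and> nbhd w V \<subseteq> S \<inter> T"
        using nbhd_mono[of "V \<inter> V'" V w] nbhd_mono[of "V \<inter> V'" V' w]
        by (intro exI[of _ "V \<inter> V'"]) auto
    qed
  next
    fix K
    assume K: "\<forall>S\<in>K. ?P S"
    show "\<Union> K \<subseteq> SpT" using K by blast
    show "\<forall>w\<in>\<Union> K. \<exists>V. open V \<and> proj w \<in> V \<and> nbhd w V \<subseteq> \<Union> K" using K by (meson Union_iff Union_upper subset_trans)
  qed
  then show ?thesis unfolding SpT_top_def by (simp add: topology_inverse')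
qed

lemma topspace_SpT_top [simp]: "topspace (SpT_top :: (real \<Rightarrow> 'n::finite sqm) set topology) = SpT"
proof -
  have "\<forall>w\<in>(SpT :: (real \<Rightarrow> 'n sqm) set set). \<exists>V. open V \<and> proj w \<in> V \<and> nbhd w V \<subseteq> SpT"
    by (intro ballI exI[of _ UNIV]) (simp add: nbhd_subset)
  then have "openin SpT_top (SpT :: (real \<Rightarrow> 'n sqm) set set)" unfolding openin_SpT_top by simp
  then have "(SpT :: (real \<Rightarrow> 'n sqm) set set) \<subseteq> topspace SpT_top" by (rule openin_subset)
  moreover have "topspace SpT_top \<subseteq> (SpT :: (real \<Rightarrow> 'n sqm) set set)"
    using openin_topspace[of "SpT_top :: (real \<Rightarrow> 'n sqm) set topology"] unfolding openin_SpT_top by simp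
  ultimately show ?thesis by simp
qed

lemma continuous_map_SpT_top:
  assumes "\<And>w Q. w \<in> SpT \<Longrightarrow> open Q \<Longrightarrow> f w \<in> Q \<Longrightarrow> \<exists>V. open V \<and> proj w \<in> V \<and> (\<forall>v\<in>nbhd w V. f v \<in> Q)"
  shows "continuous_map SpT_top euclidean f"
  unfolding continuous_map_def
proof (intro conjI allI impI)
  fix U :: "'b set" assume U: "openin euclidean U"
  show "openin SpT_top {x \<in> topspace SpT_top. f x \<in> U}"
    unfolding openin_SpT_top topspace_SpT_top
  proof (intro conjI ballI)
    fix w assume w: "w \<in> {x \<in> SpT. f x \<in> U}"
    then obtain V where "open V" "proj w \<in> V" "\<forall>v\<in>nbhd w V. f v \<in> U" using assms[of w U] U by auto
    then show "\<exists>V. open V \<and> proj w \<in> V \<and> nbhd w V \<subseteq> {x \<in> SpT. f x \<in> U}"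
      using nbhd_subset[of w V] w by blast
  qed auto
qed simp

lemma nbhdE:
  assumes "w \<in> SpT" "v \<in> nbhd w V"
  obtains g d where "g \<in> w" "sp_path g" "path d" "path_image d \<subseteq> V \<inter> Sp" "pathstart d = pathfinish g"
    "v = cls (g +++ d)" "sp_path (g +++ d)" "v \<in> SpT"
proof -
  obtain g d where *: "g \<in> w" "path d" "path_image d \<subseteq> V \<inter> Sp" "pathstart d = pathfinish g" "v = cls (g +++ d)"
    using assms(2) unfolding nbhd_def by blast
  moreover have "sp_path g" using SpT_mem(2)[OF assms(1) *(1)] .
  moreover have "sp_path (g +++ d)" using sp_path_join[OF \<open>sp_path g\<close>] * by blast
  ultimately show ?thesis using that cls_in_SpT by blast
qed

lemma continuous_map_proj: "continuous_map SpT_top euclidean proj"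
proof (rule continuous_map_SpT_top)
  fix w :: "(real \<Rightarrow> 'a sqm) set" and Q assume w: "w \<in> SpT" "open Q" "proj w \<in> Q"
  have "proj v \<in> Q" if v: "v \<in> nbhd w Q" for v
  proof -
    obtain g d where "path_image d \<subseteq> Q \<inter> Sp" "v = cls (g +++ d)" "sp_path (g +++ d)"
      using nbhdE[OF w(1) v] by metis
    then show ?thesis by (auto simp: proj_cls joinpaths_def path_image_def)
  qed
  then show "\<exists>V. open V \<and> proj w \<in> V \<and> (\<forall>v\<in>nbhd w V. proj v \<in> Q)" using w by blast
qed

lemma exp_eq_1_norm:
  fixes a b :: complex
  assumes "exp a = 1" "exp b = 1" "a \<noteq> b"
  shows "2 * pi \<le> norm (a - b)"
proof -
  obtain m n :: int where "Re a = 0" "Im a = of_int (2 * m) * pi" "Re b = 0" "Im b = of_int (2 * n) * pi"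
    using assms(1,2) by (auto simp: exp_eq_1)
  then have parts: "Re (a - b) = 0" "Im (a - b) = 2 * pi * of_int (m - n)" by (auto simp: algebra_simps)
  have "m \<noteq> n" using assms(3) \<open>Re a = 0\<close> \<open>Re b = 0\<close> \<open>Im a = _\<close> \<open>Im b = _\<close> by (auto simp: complex_eq_iff)
  then have "\<bar>real_of_int (m - n)\<bar> \<ge> 1" by linarith
  then have "2 * pi * 1 \<le> 2 * pi * \<bar>real_of_int (m - n)\<bar>" by (intro mult_left_mono) auto
  also have "\<dots> = \<bar>Im (a - b)\<bar>" unfolding parts(2) by (simp add: abs_mult)
  also have "\<dots> \<le> norm (a - b)" by (rule abs_Im_le_cmod)
  finally show ?thesis by simp
qed

lemma exp_eq_1_const:
  fixes f :: "'a::topological_space \<Rightarrow> complex"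
  assumes "connected S" "continuous_on S f" "\<And>x. x \<in> S \<Longrightarrow> exp (f x) = 1" "x \<in> S" "y \<in> S"
  shows "f x = f y"
proof -
  have "f constant_on S"
    by (rule continuous_discrete_range_constant[OF assms(1,2)])
      (use exp_eq_1_norm assms(3) in \<open>metis pi_gt_zero mult_pos_pos zero_less_numeral\<close>)
  then show ?thesis using assms(4,5) by (auto simp: constant_on_def)
qed

lemma log_diff_constant_scaled:
  fixes f g :: "'a::topological_space \<Rightarrow> complex"
  assumes "connected S" "continuous_on S f" "continuous_on S g" "\<And>x. x \<in> S \<Longrightarrow> exp (f x) = c * exp (g x)"
    "c \<noteq> 0" "x \<in> S" "y \<in> S"
  shows "f x - g x = f y - g y"
proof -
  have "f x - g x - Ln c = f y - g y - Ln c"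
    by (rule exp_eq_1_const[OF assms(1), where f = "\<lambda>x. f x - g x - Ln c"])
      (use assms in \<open>auto intro!: continuous_intros simp: exp_diff\<close>)
  then show ?thesis by simp
qed

lemma log_diff_constant:
  fixes f g :: "'a::topological_space \<Rightarrow> complex"
  assumes "connected S" "continuous_on S f" "continuous_on S g" "\<And>x. x \<in> S \<Longrightarrow> exp (f x) = exp (g x)"
    "x \<in> S" "y \<in> S"
  shows "f x - g x = f y - g y"
  by (rule exp_eq_1_const[OF assms(1), where f = "\<lambda>x. f x - g x"])
    (use assms in \<open>auto intro!: continuous_intros simp: exp_diff\<close>)

lemma continuous_log_on_rectangle:
  fixes F :: "real \<times> real \<Rightarrow> complex"
  assumes F: "continuous_on ({a..b} \<times> {c..d}) F" "\<And>p. p \<in> {a..b} \<times> {c..d} \<Longrightarrow> F p \<noteq> 0"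
  obtains L where "\<And>s t. s \<in> {a..b} \<Longrightarrow> t \<in> {c..d} \<Longrightarrow> exp (L s t) = F (s, t)"
    "\<And>t. t \<in> {c..d} \<Longrightarrow> continuous_on {a..b} (\<lambda>s. L s t)" "\<And>s. s \<in> {a..b} \<Longrightarrow> continuous_on {c..d} (L s)"
proof -
  obtain L where L: "continuous_on ({a..b} \<times> {c..d}) L" "\<And>p. p \<in> {a..b} \<times> {c..d} \<Longrightarrow> F p = exp (L p)"
    by (rule continuous_logarithm_on_contractible[OF F(1) convex_imp_contractible F(2)]) (auto intro: convex_Times)
  show ?thesis
  proof (rule that[of "\<lambda>s t. L (s, t)"])
    show "continuous_on {a..b} (\<lambda>s. L (s, t))" if "t \<in> {c..d}" for t
      by (rule continuous_on_compose2[OF L(1)]) (use that in \<open>auto intro!: continuous_intros\<close>)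
    show "continuous_on {c..d} (\<lambda>t. L (s, t))" if "s \<in> {a..b}" for s
      by (rule continuous_on_compose2[OF L(1)]) (use that in \<open>auto intro!: continuous_intros\<close>)
  qed (simp add: L(2))
qed

definition log_along :: "('n::finite sqm \<Rightarrow> complex) \<Rightarrow> (real \<Rightarrow> 'n sqm) \<Rightarrow> (real \<Rightarrow> complex) \<Rightarrow> bool" where
  "log_along F g l \<longleftrightarrow> continuous_on {0..1} l \<and> (\<forall>t\<in>{0..1}. exp (l t) = F (g t)) \<and> l 0 = 0"

definition log_lift :: "('n::finite sqm \<Rightarrow> complex) \<Rightarrow> (real \<Rightarrow> 'n sqm) set \<Rightarrow> complex" where
  "log_lift F w = (SOME z. \<exists>g\<in>w. \<exists>l. log_along F g l \<and> z = l 1)"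

lemma joinpaths_second_half:
  assumes "pathstart p = pathfinish g" "s \<in> {0..1}"
  shows "(g +++ p) ((1 + s) / 2) = p s"
proof (cases "s = 0")
  case True
  then show ?thesis using assms(1) by (simp add: joinpaths_def pathstart_def pathfinish_def)
next
  case False
  then have "\<not> (1 + s) / 2 \<le> 1 / 2" using assms(2) by simp
  moreover have "2 * ((1 + s) / 2) - 1 = s" by (simp add: field_simps)
  ultimately show ?thesis unfolding joinpaths_def by presburger
qed

locale nonvanishing_on_Sp =
  fixes F :: "'n::finite sqm \<Rightarrow> complex"
  assumes cont: "continuous_on Sp F" and nz: "\<And>W. W \<in> Sp \<Longrightarrow> F W \<noteq> 0" and one: "F (mat 1) = 1"
begin

lemma log_exists:
  assumes "sp_path g" obtains l where "log_along F g l"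
proof -
  note g = sp_pathD[OF assms]
  have "continuous_on {0..1} (\<lambda>t. F (g t))"
    by (rule continuous_on_compose2[OF cont g(6)]) (use g(5) in auto)
  then obtain l where l: "continuous_on {0..1} l" "\<And>t. t \<in> {0..1} \<Longrightarrow> F (g t) = exp (l t)"
    using continuous_logarithm_on_contractible[of "{0..1::real}" "\<lambda>t. F (g t)"] nz g(5)
    by (metis convex_imp_contractible convex_real_interval(5))
  have "exp (l 0) = 1" using l(2)[of 0] g(4) one by simp
  then have "log_along F g (\<lambda>t. l t - l 0)"
    unfolding log_along_def using l by (auto intro!: continuous_intros simp: exp_diff)
  then show ?thesis by (rule that)
qed

lemma log_homotopy:
  assumes hom: "homotopic_paths Sp g h" and g: "log_along F g lg" and h: "log_along F h lh"
  shows "lg 1 = lh 1"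
proof -
  obtain H where H: "continuous_on ({0..1} \<times> {0..1}) H" "H ` ({0..1} \<times> {0..1}) \<subseteq> Sp"
      "\<forall>x\<in>{0..1}. H (0, x) = g x" "\<forall>x\<in>{0..1}. H (1, x) = h x"
      "\<forall>t\<in>{0..1::real}. pathstart (H \<circ> Pair t) = pathstart g \<and> pathfinish (H \<circ> Pair t) = pathfinish g"
    using hom unfolding homotopic_paths by (auto simp: image_subset_iff_funcset)
  have "F (H p) \<noteq> 0" if "p \<in> {0..1} \<times> {0..1}" for p using H(2) nz that by blast
  then obtain L where L: "\<And>s t. s \<in> {0..1} \<Longrightarrow> t \<in> {0..1} \<Longrightarrow> exp (L s t) = F (H (s, t))"
    "\<And>t. t \<in> {0..1} \<Longrightarrow> continuous_on {0..1} (\<lambda>s. L s t)" "\<And>s. s \<in> {0..1} \<Longrightarrow> continuous_on {0..1} (L s)"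
    using continuous_log_on_rectangle[OF continuous_on_compose2[OF cont H(1,2)]] by blast
  have H_ends: "H (s, 0) = g 0" "H (s, 1) = g 1" if "s \<in> {0..1}" for s
    using H(5) that by (auto simp: pathstart_def pathfinish_def)
  have "L 0 x - L 0 x = L 1 x - L 0 x" if "x = 0 \<or> x = 1" for x
    by (rule log_diff_constant[of "{0..1::real}" "\<lambda>s. L s x" "\<lambda>s. L 0 x"])
      (use that L(1,2) H_ends in \<open>auto intro!: continuous_intros\<close>)
  then have "L 0 0 = L 1 0" "L 0 1 = L 1 1" by simp_all
  moreover have "L 0 0 - lg 0 = L 0 1 - lg 1"
    by (rule log_diff_constant[of "{0..1::real}"]) (use L g H(3) in \<open>auto simp: log_along_def\<close>)
  moreover have "L 1 0 - lh 0 = L 1 1 - lh 1"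
    by (rule log_diff_constant[of "{0..1::real}"]) (use L h H(4) in \<open>auto simp: log_along_def\<close>)
  ultimately show ?thesis using g h by (simp add: log_along_def)
qed

lemma log_lift_eq:
  assumes w: "w \<in> SpT" "g \<in> w" and l: "log_along F g l"
  shows "log_lift F w = l 1"
proof -
  have "\<exists>z. \<exists>g\<in>w. \<exists>l. log_along F g l \<and> z = l 1" using w l by blast
  from someI_ex[OF this] obtain h l' where h: "h \<in> w" "log_along F h l'" "log_lift F w = l' 1"
    unfolding log_lift_def by blast
  have "homotopic_paths Sp g h" using SpT_mem[OF w] h(1) by (auto simp: cls_def)
  then show ?thesis using log_homotopy[OF _ l h(2)] h(3) by simp
qed

lemma exp_log_lift: "w \<in> SpT \<Longrightarrow> exp (log_lift F w) = F (proj w)"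
proof -
  assume w: "w \<in> SpT"
  then obtain g where g: "g \<in> w" using SpT_nonempty by blast
  have path: "sp_path g" by (rule SpT_mem(2)[OF w g])
  obtain l where l: "log_along F g l" using log_exists[OF path] .
  show ?thesis using log_lift_eq[OF w g l] proj_eq[OF w g] l by (simp add: log_along_def pathfinish_def)
qed

lemma log_lift_idT: "log_lift F idT = 0"
proof -
  have "log_along F (\<lambda>t. mat 1) (\<lambda>t. 0)" by (simp add: log_along_def one)
  then show ?thesis using log_lift_eq[OF idT_in_SpT _] cls_self[OF sp_path_const] by (simp add: idT_def)
qed

lemma log_lift_join:
  assumes w: "w \<in> SpT" "g \<in> w" and p: "path p" "path_image p \<subseteq> Sp" "pathstart p = pathfinish g"
    and principal: "\<And>s. s \<in> {0..1} \<Longrightarrow> F (p s) / F (p 0) \<notin> \<real>\<^sub>\<le>\<^sub>0"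
  shows "log_lift F (cls (g +++ p)) = log_lift F w + Ln (F (p 1) / F (p 0))"
proof -
  have path: "sp_path (g +++ p)" using sp_path_join SpT_mem[OF w] p by blast
  obtain l where l: "log_along F (g +++ p) l" using log_exists[OF path] .
  then have l_cont: "continuous_on {0..1} l" and l_exp: "\<And>t. t \<in> {0..1} \<Longrightarrow> exp (l t) = F ((g +++ p) t)"
    by (auto simp: log_along_def)
  have p_Sp: "p s \<in> Sp" if "s \<in> {0..1}" for s using p(2) that by (auto simp: path_image_def)
  have nonzero: "F (p 0) \<noteq> 0" using nz[OF p_Sp[of 0]] by simp
  have "log_along F g (\<lambda>t. l (t / 2))"
    unfolding log_along_def
  proof (intro conjI ballI)
    show "continuous_on {0..1} (\<lambda>t. l (t / 2))"
      by (rule continuous_on_compose2[OF l_cont]) (auto intro!: continuous_intros)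
    show "exp (l (t / 2)) = F (g t)" if "t \<in> {0..1}" for t
      using l_exp[of "t / 2"] that by (auto simp: joinpaths_def)
  qed (use l in \<open>simp add: log_along_def\<close>)
  then have "log_lift F w = l (1 / 2)" using log_lift_eq[OF w] by simp
  moreover have "log_lift F (cls (g +++ p)) = l 1"
    using log_lift_eq[OF cls_in_SpT[OF path] cls_self[OF path] l] .
  moreover have "l ((1 + 0) / 2) - Ln (F (p 0) / F (p 0)) = l ((1 + 1) / 2) - Ln (F (p 1) / F (p 0))"
  proof (rule log_diff_constant_scaled[of "{0..1::real}" "\<lambda>s. l ((1 + s) / 2)" "\<lambda>s. Ln (F (p s) / F (p 0))" "F (p 0)"])
    show "continuous_on {0..1} (\<lambda>s. l ((1 + s) / 2))"
      by (rule continuous_on_compose2[OF l_cont]) (auto intro!: continuous_intros)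
    have "continuous_on {0..1} (\<lambda>s. F (p s))"
      by (rule continuous_on_compose2[OF cont]) (use p(1) p_Sp in \<open>auto simp: path_def\<close>)
    then show "continuous_on {0..1} (\<lambda>s. Ln (F (p s) / F (p 0)))"
      using principal nonzero by (intro continuous_intros) auto
    fix s :: real assume s: "s \<in> {0..1}"
    have "exp (l ((1 + s) / 2)) = F (p s)" using l_exp[of "(1 + s) / 2"] joinpaths_second_half[OF p(3) s] s by simp
    then show "exp (l ((1 + s) / 2)) = F (p 0) * exp (Ln (F (p s) / F (p 0)))"
      using nonzero nz[OF p_Sp[OF s]] by simp
  qed (use nonzero in auto)
  ultimately show ?thesis using nonzero by simp
qed

lemma continuous_log_lift: "continuous_map SpT_top euclidean (log_lift F)"
proof (rule continuous_map_SpT_top)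
  fix w Q assume w: "w \<in> SpT" and Q: "open Q" "log_lift F w \<in> Q"
  obtain e where e: "e > 0" "ball (log_lift F w) e \<subseteq> Q" by (rule openE[OF Q])
  have "isCont Ln (1::complex)" by (rule continuous_at_Ln) simp
  then obtain d where "d > 0" "\<forall>z. dist z 1 < d \<longrightarrow> dist (Ln z) (Ln 1) < e"
    unfolding continuous_at_eps_delta using e(1) by blast
  then have d: "d > 0" "\<And>z. dist z 1 < d \<Longrightarrow> cmod (Ln z) < e" by simp_all
  let ?x = "proj w"
  have x: "?x \<in> Sp" "F ?x \<noteq> 0" using proj_in_Sp[OF w] nz by auto
  have "continuous_on Sp (\<lambda>x. F x / F ?x)" using cont x by (intro continuous_intros) auto
  moreover have "min d 1 > 0" using d(1) by simp
  ultimately obtain r where r: "r > 0" "\<forall>x\<in>Sp. dist x ?x < r \<longrightarrow> dist (F x / F ?x) (F ?x / F ?x) < min d 1"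
    using x(1) unfolding continuous_on_iff by blast
  have "log_lift F v \<in> Q" if v: "v \<in> nbhd w (ball ?x r)" for v
  proof -
    obtain g p where gp: "g \<in> w" "path p" "path_image p \<subseteq> ball ?x r \<inter> Sp" "pathstart p = pathfinish g"
      "v = cls (g +++ p)" by (rule nbhdE[OF w v])
    have start: "p 0 = ?x" using gp(4) proj_eq[OF w gp(1)] by (simp add: pathstart_def)
    have near: "dist (F (p s) / F (p 0)) 1 < min d 1" if "s \<in> {0..1}" for s
    proof -
      have "p s \<in> ball ?x r \<inter> Sp" using gp(3) that by (auto simp: path_image_def simp del: mem_ball)
      then show ?thesis using r(2) x(2) by (simp add: start dist_commute)
    qed
    have "F (p s) / F (p 0) \<notin> \<real>\<^sub>\<le>\<^sub>0" if "s \<in> {0..1}" for s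
    proof
      assume "F (p s) / F (p 0) \<in> \<real>\<^sub>\<le>\<^sub>0"
      then have "Re (F (p s) / F (p 0)) \<le> 0" by (simp add: complex_nonpos_Reals_iff)
      then show False using near[OF that] abs_Re_le_cmod[of "F (p s) / F (p 0) - 1"] by (simp add: dist_norm)
    qed
    then have "log_lift F v = log_lift F w + Ln (F (p 1) / F (p 0))"
      unfolding gp(5) using gp(3) by (intro log_lift_join[OF w gp(1,2) _ gp(4)]) auto
    then have "log_lift F v \<in> ball (log_lift F w) e" using d(2) near[of 1] by (simp add: dist_norm)
    then show ?thesis using e(2) by blast
  qed
  then show "\<exists>V. open V \<and> ?x \<in> V \<and> (\<forall>v\<in>nbhd w V. log_lift F v \<in> Q)"
    using r(1) by (intro exI[of _ "ball ?x r"]) auto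
qed

end

lemma sp_path_subpath:
  assumes g: "sp_path g" and t: "t \<in> {0..1}"
  shows "sp_path (subpath 0 t g)"
proof -
  have "path_image (subpath 0 t g) \<subseteq> path_image g" using t by (intro path_image_subpath_subset) auto
  moreover have "path (subpath 0 t g)" using sp_pathD(1)[OF g] t by (intro path_subpath) auto
  moreover have "pathstart (subpath 0 t g) = mat 1" using sp_pathD(4)[OF g] by (simp add: pathstart_def subpath_def)
  ultimately show ?thesis using sp_pathD(2)[OF g] unfolding sp_path_def by blast
qed

lemma cls_subpath_near:
  assumes g: "sp_path g" and t: "t \<in> {0..1}" and V: "open V" "g t \<in> V"
  obtains d where "d > 0" "\<And>s. s \<in> {0..1} \<Longrightarrow> dist s t < d \<Longrightarrow> cls (subpath 0 s g) \<in> nbhd (cls (subpath 0 t g)) V"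
proof -
  obtain e where e: "e > 0" "ball (g t) e \<subseteq> V" by (rule openE[OF V])
  then obtain d where d: "d > 0" "\<And>s. s \<in> {0..1} \<Longrightarrow> dist s t < d \<Longrightarrow> dist (g s) (g t) < e"
    using sp_pathD(6)[OF g] t unfolding continuous_on_iff by metis
  show ?thesis
  proof (rule that[OF d(1)])
    fix s :: real assume s: "s \<in> {0..1}" "dist s t < d"
    let ?p = "subpath t s g"
    have "path_image ?p \<subseteq> V \<inter> Sp"
    proof
      fix x assume "x \<in> path_image ?p"
      then obtain r where r: "r \<in> closed_segment t s" "x = g r" by (auto simp: path_image_subpath_gen)
      then have "r \<in> {0..1}" "dist r t < d"
        using s t by (auto simp: dist_real_def closed_segment_eq_real_ivl split: if_splits)
      then show "x \<in> V \<inter> Sp" using d(2)[of r] e(2) r(2) sp_pathD(5)[OF g] by (auto simp: dist_commute)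
    qed
    moreover have "path ?p" using s(1) t sp_pathD[OF g] by (auto intro: path_subpath)
    moreover have "subpath 0 t g \<in> cls (subpath 0 t g)" by (rule cls_self[OF sp_path_subpath[OF g t]])
    ultimately have "cls (subpath 0 t g +++ ?p) \<in> nbhd (cls (subpath 0 t g)) V"
      unfolding nbhd_def by (intro CollectI exI[of _ "subpath 0 t g"] exI[of _ ?p] conjI refl) auto
    moreover have "cls (subpath 0 t g +++ ?p) = cls (subpath 0 s g)"
      by (rule cls_eqI, rule homotopic_join_subpaths) (use sp_pathD[OF g] s t in auto)
    ultimately show "cls (subpath 0 s g) \<in> nbhd (cls (subpath 0 t g)) V" by simp
  qed
qed

lemma proj_cls_subpath: "sp_path g \<Longrightarrow> t \<in> {0..1} \<Longrightarrow> proj (cls (subpath 0 t g)) = g t"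
  using proj_cls[OF sp_path_subpath] by (simp add: subpath_def)

lemma continuous_along_path:
  fixes f :: "(real \<Rightarrow> 'n::finite sqm) set \<Rightarrow> 'b::topological_space"
  assumes f: "continuous_map SpT_top euclidean f" and g: "sp_path g"
  shows "continuous_on {0..1} (\<lambda>t. f (cls (subpath 0 t g)))"
  unfolding continuous_on_topological
proof (intro ballI allI impI)
  fix t B assume t: "t \<in> {0..1::real}" and B: "open B" "f (cls (subpath 0 t g)) \<in> B"
  have "openin SpT_top {x \<in> SpT. f x \<in> B}" using f B(1) by (auto simp: continuous_map_def)
  then obtain V where V: "open V" "g t \<in> V" "nbhd (cls (subpath 0 t g)) V \<subseteq> {x \<in> SpT. f x \<in> B}"
    using cls_in_SpT[OF sp_path_subpath[OF g t]] B(2) proj_cls_subpath[OF g t] unfolding openin_SpT_top by auto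
  obtain d where d: "d > 0" "\<And>s. s \<in> {0..1} \<Longrightarrow> dist s t < d \<Longrightarrow> cls (subpath 0 s g) \<in> nbhd (cls (subpath 0 t g)) V"
    by (rule cls_subpath_near[OF g t V(1,2)]) (rule that)
  then have "f (cls (subpath 0 s g)) \<in> B" if "s \<in> {0..1}" "dist s t < d" for s
    using V(3) that by blast
  then show "\<exists>A. open A \<and> t \<in> A \<and> (\<forall>y\<in>{0..1}. y \<in> A \<longrightarrow> f (cls (subpath 0 y g)) \<in> B)"
    using d(1) by (intro exI[of _ "ball t d"]) (auto simp: dist_commute)
qed

lemma cls_subpath_0: "sp_path g \<Longrightarrow> cls (subpath 0 0 g) = idT"
  using sp_pathD(4)[of g] by (simp add: subpath_def idT_def)

lemma upsilon_one: "upsilon (mat 1 :: 'a::finite sqm) = 1"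
proof -
  have spectrum: "spectrum (cplx (mat 1 :: 'a sqm)) \<subseteq> {1}"
  proof
    fix l :: complex assume "l \<in> spectrum (cplx (mat 1 :: 'a sqm))"
    then obtain x :: "'a cvec" where x: "x \<noteq> 0" "x = l *s x" unfolding spectrum_iff_eigenvector cplx_one by auto
    then have "1 *s x = l *s x" by simp
    then show "l \<in> {1}" using x(1) vec.scale_cancel_right[of 1 x l] by simp
  qed
  then have no_negative: "{l \<in> eigenvalues (mat 1 :: 'a sqm). l \<in> \<real> \<and> Re l < 0} = {}"
    and no_unit: "{l \<in> eigenvalues (mat 1 :: 'a sqm). cmod l = 1 \<and> l \<noteq> 1 \<and> l \<noteq> -1} = {}"
    unfolding eigenvalues_eq_spectrum by auto
  show ?thesis unfolding upsilon_def neg_mult_def no_negative no_unit by simp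
qed

interpretation upsilon_lift: nonvanishing_on_Sp "upsilon :: 'n::finite sqm \<Rightarrow> complex"
proof
  show "upsilon W \<noteq> 0" if "W \<in> Sp" for W :: "'n sqm" using norm_upsilon[OF that] by auto
qed (simp_all add: continuous_on_upsilon upsilon_one)

lemma log_on_SpT_unique:
  fixes f h :: "(real \<Rightarrow> 'n::finite sqm) set \<Rightarrow> complex"
  assumes f: "continuous_map SpT_top euclidean f" and h: "continuous_map SpT_top euclidean h"
    and eq: "\<And>w. w \<in> SpT \<Longrightarrow> exp (f w) = exp (h w)" "f idT = h idT" and w: "w \<in> SpT"
  shows "f w = h w"
proof -
  obtain g where g: "g \<in> w" using SpT_nonempty[OF w] by blast
  have path: "sp_path g" "w = cls g" using SpT_mem[OF w g] by auto
  have "f (cls (subpath 0 1 g)) - h (cls (subpath 0 1 g)) = f (cls (subpath 0 0 g)) - h (cls (subpath 0 0 g))"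
    by (rule log_diff_constant[of "{0..1::real}"])
      (use eq(1) cls_in_SpT[OF sp_path_subpath[OF path(1)]] continuous_along_path[OF _ path(1)] f h in auto)
  then show ?thesis by (simp add: cls_subpath_0[OF path(1)] path(2) eq(2))
qed

lemma continuous_map_SpT_compose:
  assumes "continuous_map SpT_top euclidean f" "continuous_on UNIV h"
  shows "continuous_map SpT_top euclidean (\<lambda>w. h (f w))"
  using continuous_map_compose[OF assms(1), of euclidean h] assms(2)
  by (simp add: o_def continuous_map_iff_continuous2)

lemma maslov_ex1:
  "\<exists>!f. continuous_map SpT_top euclideanreal f
      \<and> (\<forall>w\<in>(SpT :: (real \<Rightarrow> 'n::finite sqm) set set). exp (2 * pi * \<i> * complex_of_real (f w)) = upsilon (proj w))
      \<and> f idT = 0 \<and> (\<forall>w. w \<notin> SpT \<longrightarrow> f w = 0)" (is "\<exists>!f. ?P f")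
proof (rule ex1I)
  let ?f = "\<lambda>w. if w \<in> (SpT :: (real \<Rightarrow> 'n sqm) set set) then Im (log_lift upsilon w) / (2 * pi) else 0"
  have "continuous_map SpT_top euclideanreal (\<lambda>w. Im (log_lift upsilon w) / (2 * pi))"
    by (rule continuous_map_SpT_compose[OF upsilon_lift.continuous_log_lift, where h = "\<lambda>z. Im z / (2 * pi)"])
      (intro continuous_intros, simp)
  then have "continuous_map SpT_top euclideanreal ?f"
    by (rule continuous_map_eq) simp
  moreover have "exp (2 * pi * \<i> * complex_of_real (?f w)) = upsilon (proj w)" if w: "w \<in> SpT" for w
  proof -
    have "cmod (exp (log_lift upsilon w)) = 1" unfolding upsilon_lift.exp_log_lift[OF w] by (rule norm_upsilon[OF proj_in_Sp[OF w]])
    then have "Re (log_lift upsilon w) = 0" by (simp add: norm_exp_eq_Re)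
    then have "log_lift upsilon w = 2 * pi * \<i> * complex_of_real (?f w)" using w by (simp add: complex_eq_iff)
    then show ?thesis using upsilon_lift.exp_log_lift[OF w] by simp
  qed
  ultimately show f: "?P ?f" by (simp add: upsilon_lift.log_lift_idT)
  fix h assume h: "?P h"
  have scaled: "continuous_map SpT_top euclidean (\<lambda>w. 2 * pi * \<i> * complex_of_real (k w))" if "?P k" for k
    by (rule continuous_map_SpT_compose[where h = "\<lambda>x. 2 * pi * \<i> * complex_of_real x"])
      (use that in \<open>auto intro!: continuous_intros\<close>)
  have "2 * pi * \<i> * complex_of_real (h w) = 2 * pi * \<i> * complex_of_real (?f w)" if "w \<in> SpT" for w
    by (rule log_on_SpT_unique[OF scaled[OF h] scaled[OF f] _ _ that]) (use h f in auto)
  then have "w \<in> SpT \<Longrightarrow> h w = ?f w" for w by (simp only: mult_cancel_left of_real_eq_iff) simp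
  then have "h w = ?f w" for w using h by (cases "w \<in> SpT") simp_all
  then show "h = ?f" by blast
qed

lemma maslov_characterization:
  fixes w :: "(real \<Rightarrow> 'n::finite sqm) set"
  shows "continuous_map SpT_top euclideanreal (maslov :: (real \<Rightarrow> 'n sqm) set \<Rightarrow> real)"
  "w \<in> SpT \<Longrightarrow> exp (2 * pi * \<i> * complex_of_real (maslov w)) = upsilon (proj w)"
  "maslov (idT :: (real \<Rightarrow> 'n sqm) set) = 0"
  using theI'[OF maslov_ex1[where 'n = 'n]] unfolding maslov_def by blast+

lemma curve_from_idT_iff:
  assumes w: "w \<in> SpT" and c: "path c" "path_image c \<subseteq> Sp"
  shows "curve_from_to c idT w \<longleftrightarrow> c \<in> w"
proof
  assume "curve_from_to c idT w"
  then obtain g where g: "g \<in> idT" "c 0 = pathfinish g" "g +++ c \<in> w" by (auto simp: curve_from_to_def)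
  have null_homotopic: "homotopic_paths Sp (\<lambda>t. mat 1) g" "sp_path g" using g(1) by (auto simp: idT_def cls_def)
  have start: "c 0 = mat 1" using g(2) homotopic_paths_imp_pathfinish[OF null_homotopic(1)] by (simp add: pathfinish_def)
  have path: "sp_path c" using c start by (simp add: sp_path_def pathstart_def)
  have "homotopic_paths Sp (g +++ c) ((\<lambda>t. mat 1) +++ c)"
    by (intro homotopic_paths_join) (use null_homotopic c g(2) in \<open>auto simp: homotopic_paths_sym pathstart_def\<close>)
  moreover have "homotopic_paths Sp ((\<lambda>t. mat 1) +++ c) c"
    using homotopic_paths_lid[OF c] by (simp add: pathstart_def start linepath_refl)
  ultimately have "homotopic_paths Sp (g +++ c) c" by (rule homotopic_paths_trans)
  then show "c \<in> w" using SpT_mem[OF w g(3)] path by (auto simp: cls_def)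
next
  assume cw: "c \<in> w"
  have path: "sp_path c" "w = cls c" using SpT_mem[OF w cw] by auto
  have start: "c 0 = mat 1" using sp_pathD[OF path(1)] by simp
  have h: "homotopic_paths Sp ((\<lambda>t. mat 1) +++ c) c"
    using homotopic_paths_lid[OF c] by (simp add: pathstart_def start linepath_refl)
  have "(\<lambda>t. mat 1) +++ c \<in> w"
    unfolding path(2) cls_def using h sp_path_homotopic[OF path(1)] homotopic_paths_sym by blast
  then show "curve_from_to c idT w"
    unfolding curve_from_to_def using cls_self[OF sp_path_const] start
    by (intro bexI[of _ "\<lambda>t. mat 1"]) (auto simp: idT_def pathfinish_def)
qed

section \<open>Normal form of positive elliptic matrices\<close>

definition Sp_pos :: "'n::finite sqm set" where
  "Sp_pos = {W \<in> Sp. \<forall>v. v \<noteq> 0 \<longrightarrow> omega0 v (W *v v) > 0}"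

definition Sp_nonneg :: "'n::finite sqm set" where
  "Sp_nonneg = {W \<in> Sp. \<forall>v. omega0 v (W *v v) \<ge> 0}"

lemma Sp_pos_subset_Sp_nonneg: "Sp_pos \<subseteq> Sp_nonneg"
proof
  fix W :: "'n::finite sqm" assume W: "W \<in> Sp_pos"
  have "omega0 v (W *v v) \<ge> 0" for v
    using W by (cases "v = 0") (auto simp: Sp_pos_def omega.zero_left less_imp_le)
  then show "W \<in> Sp_nonneg" using W by (simp add: Sp_pos_def Sp_nonneg_def)
qed

definition krein_elliptic :: "'n::finite sqm \<Rightarrow> bool" where
  "krein_elliptic W \<longleftrightarrow> W \<in> Sp \<and> (\<forall>x l. x \<noteq> 0 \<longrightarrow> cplx W *v x = l *s x \<longrightarrow> Im l * krein_sq x > 0)"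

lemma Sp_pos_krein_elliptic:
  assumes "W \<in> Sp_pos" shows "krein_elliptic W"
  unfolding krein_elliptic_def
proof (intro conjI allI impI)
  show "W \<in> Sp" using assms by (simp add: Sp_pos_def)
  fix x l assume x: "x \<noteq> 0" "cplx W *v x = l *s x"
  have "krein x (cplx W *v x) = cnj l * complex_of_real (krein_sq x)"
    by (simp add: x(2) krein_scale_right krein_self)
  then have "Im (krein x (cplx W *v x)) = - (Im l * krein_sq x)" by simp
  moreover have "Im (krein x (cplx W *v x)) = - (omega0 (Re_vec x) (W *v Re_vec x) + omega0 (Im_vec x) (W *v Im_vec x))"
    by (simp add: krein_Re_Im Re_vec_cplx Im_vec_cplx)
  ultimately have form: "Im l * krein_sq x = omega0 (Re_vec x) (W *v Re_vec x) + omega0 (Im_vec x) (W *v Im_vec x)" by simp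
  have form_pos: "omega0 v (W *v v) \<ge> 0" "v \<noteq> 0 \<Longrightarrow> omega0 v (W *v v) > 0" for v
    using assms Sp_pos_subset_Sp_nonneg by (auto simp: Sp_pos_def Sp_nonneg_def)
  show "Im l * krein_sq x > 0"
  proof (cases "Re_vec x = 0")
    case True
    then have "Im_vec x \<noteq> 0" using Re_Im_vec_eq_0 x(1) by blast
    then show ?thesis unfolding form using form_pos by (intro add_nonneg_pos) auto
  next
    case False
    then show ?thesis unfolding form using form_pos by (intro add_pos_nonneg) auto
  qed
qed

lemma Sp_ell_plus_krein_elliptic:
  assumes "W \<in> Sp_ell_plus" shows "krein_elliptic W"
  unfolding krein_elliptic_def
proof (intro conjI allI impI)
  show "W \<in> Sp" using assms by (simp add: Sp_ell_plus_def)
  have elliptic: "cmod l = 1 \<and> l \<noteq> 1 \<and> l \<noteq> -1 \<and> (Im l > 0 \<longrightarrow> krein_positive W l)" if "l \<in> spectrum (cplx W)" for l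
    using assms that unfolding Sp_ell_plus_def eigenvalues_eq_spectrum by blast
  have upper: "krein_sq x > 0" if x: "x \<noteq> 0" "cplx W *v x = l *s x" and l: "Im l > 0" for x l
  proof -
    have "l \<in> spectrum (cplx W)" using x spectrum_iff_eigenvector by blast
    then have "krein_posdef_on (gen_eigenspace (cplx W) l)" using elliptic l by (auto simp: krein_positive_def geneig_eq_gen_eigenspace)
    then show ?thesis using x eigenvector_gen_eigenspace by (auto simp: krein_posdef_on_iff)
  qed
  fix x l assume x: "x \<noteq> 0" "cplx W *v x = l *s x"
  have l: "l \<in> spectrum (cplx W)" using x spectrum_iff_eigenvector by blast
  have "Im l \<noteq> 0"
  proof
    assume i: "Im l = 0"
    then have "\<bar>Re l\<bar> = 1" using elliptic[OF l] by (simp add: cmod_def)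
    then show False using elliptic[OF l] i by (auto simp: complex_eq_iff abs_if split: if_splits)
  qed
  then consider "Im l > 0" | "Im l < 0" by linarith
  then show "Im l * krein_sq x > 0"
  proof cases
    case 1 then show ?thesis using upper[OF x] by simp
  next
    case 2
    have "cplx W *v cnj_vec x = cnj l *s cnj_vec x" using x(2) by (simp add: cplx_cnj_vec cnj_vec_scale)
    then have "krein_sq (cnj_vec x) > 0" using upper[of "cnj_vec x" "cnj l"] x(1) 2 by simp
    then show ?thesis using 2 by (simp add: krein_sq_cnj_vec mult_neg_neg)
  qed
qed

lemma krein_elliptic_eigenvalue:
  assumes W: "krein_elliptic W" and x: "x \<noteq> 0" "cplx W *v x = l *s x"
  shows "cmod l = 1" "Im l * krein_sq x > 0" "krein_sq x \<noteq> 0"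
proof -
  show i: "Im l * krein_sq x > 0" using assms unfolding krein_elliptic_def by blast
  then show k: "krein_sq x \<noteq> 0" by auto
  have "krein_sq (l *s x) = krein_sq x" using krein_sq_Sp[of W x] W x(2) by (simp add: krein_elliptic_def)
  then have "(cmod l)\<^sup>2 = 1" using k by (simp add: krein_sq_scale)
  then show "cmod l = 1" using power2_eq_imp_eq[of "cmod l" 1] by simp
qed

definition krein_orthogonal :: "'n::finite cvec set \<Rightarrow> bool" where
  "krein_orthogonal B \<longleftrightarrow> (\<forall>b\<in>B. \<forall>c\<in>B. b \<noteq> c \<longrightarrow> krein b c = 0)"

lemma krein_orthogonal_complement_invariant:
  assumes "W \<in> Sp" "cplx W *v x = l *s x" "l \<noteq> 0" "krein y x = 0"
  shows "krein (cplx W *v y) x = 0"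
proof -
  have "cnj l * krein (cplx W *v y) x = krein (cplx W *v y) (cplx W *v x)"
    by (simp add: assms(2) krein_scale_right)
  then show ?thesis using assms(3,4) by (simp add: krein_Sp[OF assms(1)])
qed

lemma span_insert_krein_complement:
  assumes V: "vec.subspace V" "x \<in> V" "krein x x \<noteq> 0" and B: "{y \<in> V. krein y x = 0} \<subseteq> vec.span B"
  shows "V \<subseteq> vec.span (insert x B)"
proof
  fix y assume y: "y \<in> V"
  define c where "c = krein y x / krein x x"
  have "y - c *s x \<in> vec.span B"
    using V y by (intro subsetD[OF B]) (simp add: vec.subspace_diff vec.subspace_scale krein_diff_left krein_scale_left c_def)
  then have "y - c *s x \<in> vec.span (insert x B)" using vec.span_mono[of B "insert x B"] by blast
  then have "(y - c *s x) + c *s x \<in> vec.span (insert x B)"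
    by (intro vec.span_add vec.span_scale) (auto intro: vec.span_base)
  then show "y \<in> vec.span (insert x B)" by simp
qed

lemma krein_orthogonal_eigenbasis:
  fixes W :: "'n::finite sqm"
  assumes W: "krein_elliptic W"
  shows "vec.subspace V \<Longrightarrow> (\<And>x. x \<in> V \<Longrightarrow> cplx W *v x \<in> V) \<Longrightarrow>
    \<exists>B. finite B \<and> B \<subseteq> V \<and> V \<subseteq> vec.span B \<and> krein_orthogonal B \<and> (\<forall>b\<in>B. b \<noteq> 0 \<and> (\<exists>l. cplx W *v b = l *s b))"
proof (induction "vec.dim V" arbitrary: V rule: less_induct)
  case less
  show ?case
  proof (cases "V = {0}")
    case True
    then show ?thesis by (intro exI[of _ "{}"]) (auto simp: krein_orthogonal_def)
  next
    case False
    obtain x l where x: "x \<in> V" "x \<noteq> 0" "cplx W *v x = l *s x"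
      by (rule eigenvector_in_invariant_subspace[OF less.prems(1) False less.prems(2)]) (assumption, rule that)
    have W_Sp: "W \<in> Sp" using W by (simp add: krein_elliptic_def)
    have nondegenerate: "krein x x \<noteq> 0" using krein_elliptic_eigenvalue(3)[OF W x(2,3)] by (simp add: krein_self)
    have "l \<noteq> 0" using krein_elliptic_eigenvalue(1)[OF W x(2,3)] by auto
    define V' where "V' = {y \<in> V. krein y x = 0}"
    have V': "vec.subspace V'"
      using less.prems(1) unfolding V'_def vec.subspace_def by (simp add: krein_add_left krein_scale_left)
    have V'_invariant: "cplx W *v y \<in> V'" if "y \<in> V'" for y
      using that less.prems(2) krein_orthogonal_complement_invariant[OF W_Sp x(3) \<open>l \<noteq> 0\<close>] by (simp add: V'_def)
    have "V' \<subset> V" using x(1) nondegenerate unfolding V'_def by blast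
    then have "vec.dim V' < vec.dim V"
      by (intro vec.dim_psubset) (simp add: vec.span_eq_iff[THEN iffD2] V' less.prems(1))
    from less.hyps[OF this V' V'_invariant] obtain B where B: "finite B" "B \<subseteq> V'" "V' \<subseteq> vec.span B"
      "krein_orthogonal B" "\<forall>b\<in>B. b \<noteq> 0 \<and> (\<exists>l. cplx W *v b = l *s b)" by blast
    have "krein b x = 0" "krein x b = 0" if "b \<in> B" for b
      using B(2) that krein_sym[of x b] by (auto simp: V'_def)
    then have "krein_orthogonal (insert x B)" using B(4) by (auto simp: krein_orthogonal_def)
    moreover have "V \<subseteq> vec.span (insert x B)"
      using span_insert_krein_complement[OF less.prems(1) x(1) nondegenerate] B(3) by (simp add: V'_def)
    ultimately show ?thesis using B x by (intro exI[of _ "insert x B"]) (auto simp: V'_def)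
  qed
qed

lemma krein_orthogonal_sum:
  assumes "finite B" "krein_orthogonal B"
  shows "krein (\<Sum>b\<in>B. u b *s b) (\<Sum>b\<in>B. v b *s b) = (\<Sum>b\<in>B. u b * cnj (v b) * complex_of_real (krein_sq b))"
proof -
  have "krein (\<Sum>b\<in>B. u b *s b) (\<Sum>b\<in>B. v b *s b) = (\<Sum>b\<in>B. \<Sum>c\<in>B. krein (u b *s b) (v c *s c))"
    unfolding krein_sum_left krein_sum_right by (rule sum.swap)
  also have "\<dots> = (\<Sum>b\<in>B. \<Sum>c\<in>B. u b * cnj (v c) * krein b c)"
    by (simp add: krein_scale_left krein_scale_right mult_ac)
  also have "\<dots> = (\<Sum>b\<in>B. \<Sum>c\<in>B. if c = b then u b * cnj (v b) * complex_of_real (krein_sq b) else 0)"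
    by (intro sum.cong) (use assms(2) in \<open>auto simp: krein_orthogonal_def krein_self\<close>)
  also have "\<dots> = (\<Sum>b\<in>B. u b * cnj (v b) * complex_of_real (krein_sq b))"
    by (simp add: sum.delta assms(1))
  finally show ?thesis .
qed

lemma krein_orthogonal_independent:
  assumes B: "finite B" "krein_orthogonal B" and nonzero: "\<And>b. b \<in> B \<Longrightarrow> krein_sq b \<noteq> 0"
  shows "vec.independent B"
proof (rule vec.independent_if_scalars_zero[OF B(1)])
  fix f x assume f: "(\<Sum>x\<in>B. f x *s x) = 0" and x: "x \<in> B"
  have "krein (\<Sum>b\<in>B. f b *s b) (\<Sum>b\<in>B. (if b = x then 1 else 0) *s b)
      = (\<Sum>b\<in>B. if b = x then f x * complex_of_real (krein_sq x) else 0)"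
    unfolding krein_orthogonal_sum[OF B] by (rule sum.cong) auto
  then show "f x = 0" using x B(1) nonzero[OF x] by (simp add: f)
qed

lemma card_krein_orthogonal_positive_le:
  fixes C :: "'n::finite cvec set"
  assumes C: "finite C" "krein_orthogonal C" and pos: "\<And>b. b \<in> C \<Longrightarrow> krein_sq b > 0"
  shows "card C \<le> CARD('n)"
proof -
  have "vec.independent C" by (rule krein_orthogonal_independent[OF C]) (use pos in force)
  then have "card C = vec.dim (vec.span C)" by (rule vec.dim_span_eq_card_independent[symmetric])
  also have "\<dots> \<le> CARD('n)"
  proof (rule dim_krein_nonneg_le[OF vec.subspace_span])
    fix x assume "x \<in> vec.span C"
    then obtain u where u: "x = (\<Sum>b\<in>C. u b *s b)" unfolding vec.span_finite[OF C(1)] by auto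
    have "krein x x = (\<Sum>b\<in>C. u b * cnj (u b) * complex_of_real (krein_sq b))"
      unfolding u by (rule krein_orthogonal_sum[OF C])
    then have "krein_sq x = (\<Sum>b\<in>C. (cmod (u b))\<^sup>2 * krein_sq b)"
      by (simp add: krein_sq_def[of x] mult_cnj_norm)
    also have "\<dots> \<ge> 0" by (intro sum_nonneg mult_nonneg_nonneg) (use pos in \<open>auto simp: less_imp_le\<close>)
    finally show "krein_sq x \<ge> 0" .
  qed
  finally show ?thesis .
qed

lemma krein_elliptic_eigenbasis:
  assumes W: "krein_elliptic W"
  obtains B m where "finite B" "UNIV \<subseteq> vec.span B" "krein_orthogonal B" "\<And>b. b \<in> B \<Longrightarrow> cplx W *v b = m b *s b"
    "\<And>b. b \<in> B \<Longrightarrow> cmod (m b) = 1 \<and> Im (m b) * krein_sq b > 0"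
proof -
  obtain B where B: "finite B" "UNIV \<subseteq> vec.span B" "krein_orthogonal B" "\<forall>b\<in>B. b \<noteq> 0 \<and> (\<exists>l. cplx W *v b = l *s b)"
    using krein_orthogonal_eigenbasis[OF W vec.subspace_UNIV] by auto
  obtain m where m: "\<And>b. b \<in> B \<Longrightarrow> cplx W *v b = m b *s b" using B(4) by metis
  have "cmod (m b) = 1 \<and> Im (m b) * krein_sq b > 0" if "b \<in> B" for b
    using krein_elliptic_eigenvalue[OF W _ m[OF that]] B(4) that by auto
  with B m show ?thesis by (intro that)
qed

lemma krein_elliptic_imp_Sp_pos:
  fixes W :: "'n::finite sqm"
  assumes W: "krein_elliptic W"
  shows "W \<in> Sp_pos"
  unfolding Sp_pos_def
proof (intro CollectI conjI allI impI)
  show "W \<in> Sp" using W by (simp add: krein_elliptic_def)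
  fix v :: "real^('n + 'n)" assume v: "v \<noteq> 0"
  obtain B m where B: "finite B" "UNIV \<subseteq> vec.span B" "krein_orthogonal B" and m: "\<And>b. b \<in> B \<Longrightarrow> cplx W *v b = m b *s b"
    and pos: "\<And>b. b \<in> B \<Longrightarrow> cmod (m b) = 1 \<and> Im (m b) * krein_sq b > 0"
    by (rule krein_elliptic_eigenbasis[OF W]) (rule that)
  obtain u where u: "of_real_vec v = (\<Sum>b\<in>B. u b *s b)" using B(2) unfolding vec.span_finite[OF B(1)] by blast
  have "cplx W *v of_real_vec v = (\<Sum>b\<in>B. (u b * m b) *s b)"
    unfolding u vec.sum by (rule sum.cong) (simp_all add: vec.scale m)
  then have "krein (of_real_vec v) (cplx W *v of_real_vec v)
      = (\<Sum>b\<in>B. (u b * cnj (u b)) * cnj (m b) * complex_of_real (krein_sq b))"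
    unfolding u by (simp add: krein_orthogonal_sum[OF B(1,3)] mult_ac)
  then have "Im (krein (of_real_vec v) (cplx W *v of_real_vec v)) = - (\<Sum>b\<in>B. (cmod (u b))\<^sup>2 * (Im (m b) * krein_sq b))"
    unfolding mult_cnj_norm by (simp add: sum_negf mult_ac)
  then have form: "omega0 v (W *v v) = (\<Sum>b\<in>B. (cmod (u b))\<^sup>2 * (Im (m b) * krein_sq b))"
    by (simp add: cplx_of_real_vec krein_of_real_vec)
  have "\<exists>b\<in>B. u b \<noteq> 0"
  proof (rule ccontr)
    assume "\<not> (\<exists>b\<in>B. u b \<noteq> 0)"
    then have "of_real_vec v = 0" by (simp add: u)
    then show False using v by (simp add: of_real_vec_eq_0)
  qed
  then obtain b where "b \<in> B" "u b \<noteq> 0" by blast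
  then show "omega0 v (W *v v) > 0"
    unfolding form using pos
    by (intro sum_pos2[OF B(1), of b]) (simp_all only: less_imp_le zero_le_power2 mult_nonneg_nonneg, simp)
qed

definition krein_frame :: "'n::finite sqm \<Rightarrow> ('n \<Rightarrow> 'n cvec) \<Rightarrow> ('n \<Rightarrow> complex) \<Rightarrow> bool" where
  "krein_frame W x l \<longleftrightarrow> (\<forall>j. cplx W *v x j = l j *s x j) \<and> (\<forall>j. cmod (l j) = 1)
     \<and> (\<forall>i j. krein (x i) (x j) = (if i = j then 2 else 0))"

lemma krein_frame_exists:
  fixes W :: "'n::finite sqm"
  assumes W: "krein_elliptic W"
  obtains x l where "krein_frame W x l" "\<And>j. Im (l j) > 0"
proof -
  obtain B m where B: "finite B" "UNIV \<subseteq> vec.span B" "krein_orthogonal B" and m: "\<And>b. b \<in> B \<Longrightarrow> cplx W *v b = m b *s b"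
    and m_unit: "\<And>b. b \<in> B \<Longrightarrow> cmod (m b) = 1 \<and> Im (m b) * krein_sq b > 0"
    by (rule krein_elliptic_eigenbasis[OF W]) (rule that)
  define P where "P = {b \<in> B. krein_sq b > 0}"
  define N where "N = {b \<in> B. krein_sq b < 0}"
  have partition: "B = P \<union> N" "P \<inter> N = {}" using m_unit by (force simp: P_def N_def zero_less_mult_iff)+
  have finite: "finite P" "finite N" using B(1) by (auto simp: P_def N_def)
  have card_P: "card P \<le> CARD('n)"
    by (rule card_krein_orthogonal_positive_le) (use finite B(3) in \<open>auto simp: P_def krein_orthogonal_def\<close>)
  have "card (cnj_vec ` N) \<le> CARD('n)"
    by (rule card_krein_orthogonal_positive_le)
      (use finite B(3) in \<open>auto simp: N_def krein_orthogonal_def krein_cnj_vec krein_sq_cnj_vec\<close>)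
  moreover have "card (cnj_vec ` N) = card N" by (rule card_image) (metis cnj_vec_cnj_vec inj_on_inverseI)
  moreover have "CARD('n) + CARD('n) \<le> card P + card N"
    using vec.dim_le_card[OF B(2,1)] card_Un_disjoint[OF finite partition(2)] by (simp add: partition(1)[symmetric] card_cart_basis)
  ultimately have "card P = CARD('n)" using card_P by linarith
  then obtain e where e: "bij_betw e (UNIV::'n set) P"
    using finite finite_same_card_bij[of "UNIV::'n set" P] by auto
  then have eP: "e j \<in> P" and inj: "e i = e j \<longleftrightarrow> i = j" for i j by (auto simp: bij_betw_def dest: injD)
  then have eB: "e j \<in> B" "krein_sq (e j) > 0" for j by (auto simp: P_def)
  define s where "s j = sqrt (2 / krein_sq (e j))" for j
  define x where "x j = complex_of_real (s j) *s e j" for j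
  show ?thesis
  proof (rule that[of x "\<lambda>j. m (e j)"])
    have "krein (x i) (x j) = (if i = j then 2 else 0)" for i j
    proof (cases "i = j")
      case True
      have "krein_sq (x j) = 2" using eB(2)[of j] by (simp add: x_def krein_sq_scale s_def)
      then show ?thesis using True by (simp add: krein_self)
    next
      case False
      then have "krein (e i) (e j) = 0" using B(3) eB(1) inj by (auto simp: krein_orthogonal_def)
      then show ?thesis using False by (simp add: x_def krein_scale_left krein_scale_right)
    qed
    then show "krein_frame W x (\<lambda>j. m (e j))"
      using m_unit[OF eB(1)] by (simp add: krein_frame_def x_def vec.scale m[OF eB(1)] mult.commute)
    show "Im (m (e j)) > 0" for j using m_unit[OF eB(1), of j] eB(2)[of j] by (simp add: zero_less_mult_iff)
  qed
qed

lemma krein_elliptic_semisimple: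
  assumes W: "krein_elliptic W" and l: "l \<in> spectrum (cplx W)" and y: "y \<in> gen_eigenspace (cplx W) l"
  shows "cplx W *v y = l *s y"
proof -
  have W_Sp: "W \<in> Sp" using W by (simp add: krein_elliptic_def)
  have "cmod l = 1" using l krein_elliptic_eigenvalue(1)[OF W] by (auto simp: spectrum_iff_eigenvector)
  then have unit: "cnj l * l = 1" by (simp add: mult_cnj_eq_1_iff mult.commute)
  have nilpotent: "(shift (cplx W) l ^^ k) y = 0 \<Longrightarrow> y = 0 \<or> shift (cplx W) l y = 0" for k y
  proof (induction k arbitrary: y)
    case (Suc k)
    define z where "z = shift (cplx W) l y"
    have "(shift (cplx W) l ^^ k) z = 0" using Suc.prems by (simp add: shift_pow_comm z_def)
    from Suc.IH[OF this] have Wz: "cplx W *v z = l *s z" by (auto simp: shift_def)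
    have Wy: "cplx W *v y = l *s y + z" by (simp add: z_def shift_def)
    have "krein y z = krein (l *s y + z) (l *s z)" using krein_Sp[OF W_Sp, of y z] by (simp add: Wy Wz)
    also have "\<dots> = (cnj l * l) * krein y z + cnj l * krein z z"
      by (simp add: krein_add_left krein_scale_left krein_scale_right algebra_simps)
    finally have "krein_sq z = 0" using unit by (auto simp: krein_self)
    then show ?case using krein_elliptic_eigenvalue(3)[OF W _ Wz] by (auto simp: z_def)
  qed simp
  have "shift (cplx W) l y = 0" using nilpotent[OF y[unfolded gen_eigenspace_def mem_Collect_eq]] by auto
  then show ?thesis by (simp add: shift_def)
qed

lemma Sp_pos_eq_Sp_ell_plus: "Sp_pos = (Sp_ell_plus :: 'n::finite sqm set)"
proof
  show "(Sp_ell_plus :: 'n sqm set) \<subseteq> Sp_pos"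
    using Sp_ell_plus_krein_elliptic krein_elliptic_imp_Sp_pos by blast
  show "Sp_pos \<subseteq> (Sp_ell_plus :: 'n sqm set)"
  proof
    fix W :: "'n sqm" assume W_pos: "W \<in> Sp_pos"
    then have W: "krein_elliptic W" by (rule Sp_pos_krein_elliptic)
    have "cmod l = 1 \<and> l \<noteq> 1 \<and> l \<noteq> -1 \<and> (Im l > 0 \<longrightarrow> krein_positive W l)" if l: "l \<in> spectrum (cplx W)" for l
    proof -
      obtain x where "x \<noteq> 0" "cplx W *v x = l *s x" using l spectrum_iff_eigenvector by blast
      then have "cmod l = 1" "Im l \<noteq> 0" using krein_elliptic_eigenvalue(1,2)[OF W] by fastforce+
      moreover have "krein_sq y > 0" if "Im l > 0" "y \<in> gen_eigenspace (cplx W) l" "y \<noteq> 0" for y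
        using krein_elliptic_eigenvalue(2)[OF W that(3) krein_elliptic_semisimple[OF W l that(2)]] that(1)
        by (simp add: zero_less_mult_iff)
      ultimately show ?thesis by (auto simp: krein_positive_def krein_posdef_on_iff geneig_eq_gen_eigenspace)
    qed
    then show "W \<in> Sp_ell_plus" using W_pos by (simp add: Sp_ell_plus_def eigenvalues_eq_spectrum Sp_pos_def)
  qed
qed

definition block_rot :: "('n::finite \<Rightarrow> real) \<Rightarrow> 'n sqm" where
  "block_rot \<theta> = (\<chi> i k. case i of
      Inl j \<Rightarrow> (if k = Inl j then cos (\<theta> j) else if k = Inr j then - sin (\<theta> j) else 0)
    | Inr j \<Rightarrow> (if k = Inl j then sin (\<theta> j) else if k = Inr j then cos (\<theta> j) else 0))"

lemma block_rot_vec: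
  "(block_rot \<theta> *v u) $ Inl j = cos (\<theta> j) * u $ Inl j - sin (\<theta> j) * u $ Inr j"
  "(block_rot \<theta> *v u) $ Inr j = sin (\<theta> j) * u $ Inl j + cos (\<theta> j) * u $ Inr j"
  by (simp_all add: block_rot_def matrix_vector_mult_def sum_UNIV_Plus if_distrib if_distribR cong: if_cong)

lemma cplx_block_rot_vec:
  "(cplx (block_rot \<theta>) *v u) $ Inl j = complex_of_real (cos (\<theta> j)) * u $ Inl j - complex_of_real (sin (\<theta> j)) * u $ Inr j"
  "(cplx (block_rot \<theta>) *v u) $ Inr j = complex_of_real (sin (\<theta> j)) * u $ Inl j + complex_of_real (cos (\<theta> j)) * u $ Inr j"
  by (simp_all add: cplx_def block_rot_def matrix_vector_mult_def sum_UNIV_Plus if_distrib if_distribR cong: if_cong)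

lemma det_shift_similar:
  fixes A D F :: "complex^'m^'m"
  assumes F: "invertible F" and eq: "A ** F = F ** D"
  shows "det (mat z - A) = det (mat z - D)"
proof -
  have "mat z ** F = F ** mat z"
    by (simp add: vec_eq_iff matrix_matrix_mult_def mat_def if_distrib if_distribR mult.commute cong: if_cong)
  then have "(mat z - A) ** F = F ** (mat z - D)"
    by (simp add: matrix_mult.diff_left matrix_mult.diff_right eq)
  then have "det (mat z - A) * det F = det F * det (mat z - D)" by (metis det_mul)
  moreover have "det F \<noteq> 0" using F invertible_det_nz by blast
  ultimately show ?thesis by simp
qed

lemma cplx_invertible: "invertible M \<Longrightarrow> invertible (cplx M)"
  by (metis cplx_mult cplx_one invertible_right_inverse)

lemma charpoly_block_rot: "charpoly (block_rot \<theta>) z = (\<Prod>j\<in>UNIV. (z - cis (\<theta> j)) * (z - cis (- \<theta> j)))"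
  for \<theta> :: "'n::finite \<Rightarrow> real"
proof -
  let ?d = "case_sum (\<lambda>j. cis (\<theta> j)) (\<lambda>j. cis (- \<theta> j))"
  define F :: "complex^('n + 'n)^('n + 'n)"
    where "F = (\<chi> r k. case k of Inl j \<Rightarrow> of_parts (axis j 1) 0 $ r | Inr j \<Rightarrow> of_parts 0 (axis j 1) $ r)"
  have F: "(F *v u) $ Inl j = u $ Inl j + u $ Inr j" "(F *v u) $ Inr j = - \<i> * (u $ Inl j - u $ Inr j)" for u j
    by (simp_all add: F_def of_parts_def matrix_vector_mult_def sum_UNIV_Plus axis_def if_distrib if_distribR algebra_simps cong: if_cong)
  have "invertible F"
    unfolding invertible_iff_kernel
  proof (intro allI impI)
    fix u assume "F *v u = 0"
    then have "u $ Inl j + u $ Inr j = 0" "u $ Inl j - u $ Inr j = 0" for j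
      using F[of u j] by simp_all
    then show "u = 0" by (simp add: vec_sum_eq_iff complex_eq_iff)
  qed
  moreover have "cplx (block_rot \<theta>) ** F = F ** diag_matrix ?d"
    unfolding matrix_eq vec_sum_eq_iff
    by (simp add: cplx_block_rot_vec F diag_matrix_vec complex_eq_iff algebra_simps flip: matrix_vector_mul_assoc)
  ultimately have "charpoly (block_rot \<theta>) z = det (mat z - diag_matrix ?d)"
    unfolding charpoly_mat by (rule det_shift_similar)
  also have "mat z - diag_matrix ?d = diag_matrix (\<lambda>k. z - ?d k)"
    by (simp add: vec_eq_iff mat_def diag_matrix_def)
  finally show ?thesis by (simp add: det_diag_matrix prod_UNIV_Plus prod.distrib)
qed

lemma charpoly_normal_form:
  assumes "M \<in> Sp" "W ** M = M ** block_rot \<theta>"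
  shows "charpoly W z = (\<Prod>j\<in>UNIV. (z - cis (\<theta> j)) * (z - cis (- \<theta> j)))"
proof -
  have "cplx W ** cplx M = cplx M ** cplx (block_rot \<theta>)" using assms(2) by (simp flip: cplx_mult)
  then have "charpoly W z = charpoly (block_rot \<theta>) z"
    unfolding charpoly_mat by (rule det_shift_similar[OF cplx_invertible[OF Sp_invertible[OF assms(1)]]])
  then show ?thesis by (simp only: charpoly_block_rot)
qed

definition frame_sum :: "('n::finite \<Rightarrow> 'n cvec) \<Rightarrow> complex^'n \<Rightarrow> 'n cvec" where
  "frame_sum x c = (\<Sum>j\<in>UNIV. c $ j *s x j)"

lemma krein_sq_frame_sum:
  assumes "krein_frame W x l"
  shows "krein_sq (frame_sum x c) = 2 * (norm c)\<^sup>2"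
proof -
  have "krein (frame_sum x c) (frame_sum x c) = (\<Sum>i\<in>UNIV. \<Sum>j\<in>UNIV. krein (c $ i *s x i) (c $ j *s x j))"
    unfolding frame_sum_def krein_sum_left krein_sum_right by (rule sum.swap)
  also have "\<dots> = (\<Sum>i\<in>UNIV. \<Sum>j\<in>UNIV. if j = i then 2 * (c $ i * cnj (c $ i)) else 0)"
    using assms by (intro sum.cong refl) (simp add: krein_scale_left krein_scale_right krein_frame_def)
  finally show ?thesis by (simp add: krein_sq_def norm_cvec_sq mult_cnj_norm sum_distrib_left)
qed

lemma krein_frame_invariant_graph:
  fixes W :: "'n::finite sqm"
  assumes x: "krein_frame W x l"
  obtains K P where "invariant_graph W K" "invertible P" "graph_pos W K ** P = P ** diag_matrix l"
proof -
  define P where "P = (\<chi> r j. pos_part (x j) $ r)"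
  define Q where "Q = (\<chi> r j. neg_part (x j) $ r)"
  have P: "P *v c = pos_part (frame_sum x c)" and Q: "Q *v c = neg_part (frame_sum x c)" for c
    by (simp_all add: frame_sum_def pos_part_sum neg_part_sum pos_part_scale neg_part_scale P_def Q_def
        vec_eq_iff matrix_vector_mult_def mult.commute)
  have norms: "(norm (P *v c))\<^sup>2 = (norm (Q *v c))\<^sup>2 + (norm c)\<^sup>2" for c
    using krein_sq_frame_sum[OF x, of c] by (simp add: krein_sq_eq P Q)
  then have P_inv: "invertible P"
    unfolding invertible_iff_kernel by (metis norm_eq_zero sum_power2_eq_zero_iff zero_eq_power2)
  define K where "K = Q ** matrix_inv P"
  have KP: "K *v (P *v c) = Q *v c" for c
    by (simp add: K_def matrix_inv_cancel[OF P_inv] flip: matrix_vector_mul_assoc)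
  have surj: "\<exists>c. a = P *v c" for a using matrix_inv_cancel(1)[OF P_inv, of a] by metis
  have "norm (K *v a) \<le> norm a" for a
  proof -
    obtain c where "a = P *v c" using surj by blast
    then show ?thesis using norms[of c] by (simp add: KP power2_le_imp_le)
  qed
  then have K: "K \<in> contractions" by (simp add: contractions_def)
  have graph: "graph_vec K (P *v c) = frame_sum x c" for c
    unfolding graph_vec_def KP unfolding P Q by (rule of_parts_collapse)
  have "cplx W *v frame_sum x c = frame_sum x (diag_matrix l *v c)" for c
    unfolding frame_sum_def vec.sum
    by (rule sum.cong) (use x in \<open>simp_all add: krein_frame_def vec.scale diag_matrix_vec mult.commute\<close>)
  then have pos: "graph_pos W K *v (P *v c) = P *v (diag_matrix l *v c)"
    and neg: "graph_neg W K *v (P *v c) = Q *v (diag_matrix l *v c)" for c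
    unfolding graph_pos_vec graph_neg_vec graph by (simp_all only: P Q)
  have "graph_neg W K = K ** graph_pos W K"
    unfolding matrix_eq
  proof
    fix a
    obtain c where "a = P *v c" using surj by blast
    then show "graph_neg W K *v a = (K ** graph_pos W K) *v a"
      by (simp add: pos neg KP flip: matrix_vector_mul_assoc)
  qed
  moreover have "graph_pos W K ** P = P ** diag_matrix l"
    unfolding matrix_eq by (simp add: pos flip: matrix_vector_mul_assoc)
  ultimately show ?thesis using that K P_inv by (simp add: invariant_graph_def)
qed

lemma upsilon_krein_frame:
  assumes W: "W \<in> Sp" and x: "krein_frame W x l"
  shows "upsilon W = (\<Prod>j\<in>UNIV. l j)"
proof -
  obtain K P where K: "invariant_graph W K" and P: "invertible P" "graph_pos W K ** P = P ** diag_matrix l"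
    by (rule krein_frame_invariant_graph[OF x])
  have "det (graph_pos W K) * det P = det P * det (diag_matrix l)" by (metis P(2) det_mul)
  then have "det (graph_pos W K) = (\<Prod>j\<in>UNIV. l j)" using P(1) by (simp add: det_diag_matrix invertible_det_nz)
  moreover have "sgn (l j) = l j" for j using x by (simp add: krein_frame_def sgn_eq)
  ultimately show ?thesis by (simp add: upsilon_eq_sgn_det[OF W K] sgn_prod_complex)
qed

lemma krein_frame_cnj_orthogonal:
  assumes W: "W \<in> Sp" and x: "krein_frame W x l" and upper: "\<And>j. Im (l j) > 0"
  shows "krein (x i) (cnj_vec (x j)) = 0"
proof -
  have eigen: "cplx W *v x j = l j *s x j" and unit: "l j * cnj (l j) = 1" for j
    using x by (simp_all add: krein_frame_def mult_cnj_eq_1_iff)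
  have "krein (x i) (cnj_vec (x j)) = krein (cplx W *v x i) (cplx W *v cnj_vec (x j))" by (simp add: krein_Sp[OF W])
  also have "\<dots> = l i * l j * krein (x i) (cnj_vec (x j))"
    by (simp add: cplx_cnj_vec eigen cnj_vec_scale krein_scale_left krein_scale_right mult.assoc)
  finally have "(1 - l i * l j) * krein (x i) (cnj_vec (x j)) = 0" by (simp add: algebra_simps)
  moreover have "l i * l j \<noteq> 1"
  proof
    assume "l i * l j = 1"
    then have "l j = cnj (l i)" using unit[of i] by (metis mult_left_cancel mult_zero_left zero_neq_one)
    then show False using upper[of i] upper[of j] by simp
  qed
  ultimately show ?thesis by simp
qed

lemma krein_frame_symplectic_basis:
  assumes x: "krein_frame W x l" and cnj: "\<And>i j. krein (x i) (cnj_vec (x j)) = 0"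
  shows "omega0 (Im_vec (x i)) (Re_vec (x j)) = (if i = j then 1 else 0)"
    "omega0 (Re_vec (x i)) (Im_vec (x j)) = (if i = j then -1 else 0)"
    "omega0 (Re_vec (x i)) (Re_vec (x j)) = 0" "omega0 (Im_vec (x i)) (Im_vec (x j)) = 0"
proof -
  have "krein (x i) (x j) = (if i = j then 2 else 0)" using x by (simp add: krein_frame_def)
  then show "omega0 (Im_vec (x i)) (Re_vec (x j)) = (if i = j then 1 else 0)"
    "omega0 (Re_vec (x i)) (Im_vec (x j)) = (if i = j then -1 else 0)"
    "omega0 (Re_vec (x i)) (Re_vec (x j)) = 0" "omega0 (Im_vec (x i)) (Im_vec (x j)) = 0"
    using cnj[of i j] by (auto simp: krein_Re_Im complex_eq_iff omega.minus_right split: if_splits)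
qed

lemma krein_frame_normal_form:
  fixes W :: "'n::finite sqm"
  assumes W: "W \<in> Sp" and x: "krein_frame W x (\<lambda>j. cis (\<theta> j))" and upper: "\<And>j. sin (\<theta> j) > 0"
  obtains M where "M \<in> Sp" "W ** M = M ** block_rot \<theta>"
proof -
  define a b where "a j = Re_vec (x j)" and "b j = Im_vec (x j)" for j
  have "krein (x i) (cnj_vec (x j)) = 0" for i j
    by (rule krein_frame_cnj_orthogonal[OF W x]) (simp add: upper)
  note basis = krein_frame_symplectic_basis[OF x this, folded a_def b_def]
  define M where "M = (\<chi> r k. case k of Inl j \<Rightarrow> b j $ r | Inr j \<Rightarrow> a j $ r)"
  have M: "M *v u = (\<Sum>j\<in>UNIV. u $ Inl j *\<^sub>R b j + u $ Inr j *\<^sub>R a j)" for u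
    by (simp add: M_def vec_eq_iff matrix_vector_mult_def sum_UNIV_Plus sum.distrib mult.commute)
  have "M \<in> Sp"
    unfolding Sp_def
  proof (intro CollectI allI)
    fix u v
    have "omega0 (M *v u) (M *v v) = (\<Sum>i\<in>UNIV. \<Sum>j\<in>UNIV.
        omega0 (u $ Inl i *\<^sub>R b i + u $ Inr i *\<^sub>R a i) (v $ Inl j *\<^sub>R b j + v $ Inr j *\<^sub>R a j))"
      unfolding M omega.sum_left omega.sum_right by (rule sum.swap)
    also have "\<dots> = (\<Sum>i\<in>UNIV. \<Sum>j\<in>UNIV. if j = i then u $ Inl i * v $ Inr i - u $ Inr i * v $ Inl i else 0)"
      by (intro sum.cong refl) (simp add: omega_linear basis)
    also have "\<dots> = omega0 u v" by (simp add: omega0_def)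
    finally show "omega0 (M *v u) (M *v v) = omega0 u v" .
  qed
  moreover have action: "W *v a j = cos (\<theta> j) *\<^sub>R a j - sin (\<theta> j) *\<^sub>R b j"
    "W *v b j = sin (\<theta> j) *\<^sub>R a j + cos (\<theta> j) *\<^sub>R b j" for j
  proof -
    have "cplx W *v x j = cis (\<theta> j) *s x j" using x by (simp add: krein_frame_def)
    then have "Re_vec (cplx W *v x j) = cos (\<theta> j) *\<^sub>R a j - sin (\<theta> j) *\<^sub>R b j"
      "Im_vec (cplx W *v x j) = sin (\<theta> j) *\<^sub>R a j + cos (\<theta> j) *\<^sub>R b j"
      by (simp_all add: a_def b_def Re_vec_def Im_vec_def vec_eq_iff)
    then show "W *v a j = cos (\<theta> j) *\<^sub>R a j - sin (\<theta> j) *\<^sub>R b j" "W *v b j = sin (\<theta> j) *\<^sub>R a j + cos (\<theta> j) *\<^sub>R b j"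
      by (simp_all add: Re_vec_cplx Im_vec_cplx a_def b_def)
  qed
  have "W *v (M *v u) = M *v (block_rot \<theta> *v u)" for u
    unfolding M matrix_vec_mult.sum_right
    by (intro sum.cong refl) (simp add: matrix_vec_linear action block_rot_vec algebra_simps)
  then have "W ** M = M ** block_rot \<theta>" unfolding matrix_eq by (simp flip: matrix_vector_mul_assoc)
  ultimately show ?thesis by (rule that)
qed

lemma normal_form:
  fixes W :: "'n::finite sqm"
  assumes "W \<in> Sp_pos"
  obtains M \<theta> where "M \<in> Sp" "\<And>j::'n. 0 < \<theta> j \<and> \<theta> j < pi" "W ** M = M ** block_rot \<theta>"
    "upsilon W = cis (\<Sum>j\<in>UNIV. \<theta> j)"
proof -
  have W: "W \<in> Sp" using assms by (simp add: Sp_pos_def)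
  obtain x l where x: "krein_frame W x l" and upper: "\<And>j. Im (l j) > 0"
    by (rule krein_frame_exists[OF Sp_pos_krein_elliptic[OF assms]]) (rule that)
  define \<theta> where "\<theta> j = Arg (l j)" for j
  have "l j \<noteq> 0" "cmod (l j) = 1" for j using upper[of j] x by (auto simp: krein_frame_def)
  then have "l j = cis (\<theta> j)" for j by (simp add: \<theta>_def cis_Arg sgn_eq)
  then have l: "l = (\<lambda>j. cis (\<theta> j))" by blast
  have \<theta>: "0 < \<theta> j \<and> \<theta> j < pi" for j using upper[of j] Arg_lt_pi[of "l j"] by (simp add: \<theta>_def)
  obtain M where M: "M \<in> Sp" "W ** M = M ** block_rot \<theta>"
    by (rule krein_frame_normal_form[OF W x[unfolded l]]) (use \<theta> in \<open>auto intro: sin_gt_zero\<close>)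
  have "upsilon W = cis (\<Sum>j\<in>UNIV. \<theta> j)"
    unfolding upsilon_krein_frame[OF W x] l by (simp add: cis_conv_exp exp_sum sum_distrib_left)
  then show ?thesis by (rule that[OF M(1) \<theta> M(2)])
qed

section \<open>The Maslov quasimorphism on the closure\<close>

definition spectral_angles :: "'n::finite sqm \<Rightarrow> (real^'n) \<Rightarrow> bool" where
  "spectral_angles W \<theta> \<longleftrightarrow> (\<forall>j. 0 \<le> \<theta> $ j \<and> \<theta> $ j \<le> pi) \<and>
     (\<forall>z. charpoly W z = (\<Prod>j\<in>UNIV. (z - cis (\<theta> $ j)) * (z - cis (- \<theta> $ j))))"

lemma spectral_angles_sum_bounds:
  fixes \<theta> :: "real^'n::finite"
  assumes "spectral_angles W \<theta>"
  shows "0 \<le> (\<Sum>j\<in>UNIV. \<theta> $ j)" "(\<Sum>j\<in>UNIV. \<theta> $ j) \<le> real CARD('n) * pi"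
proof -
  show "0 \<le> (\<Sum>j\<in>UNIV. \<theta> $ j)" using assms by (simp add: spectral_angles_def sum_nonneg)
  have "(\<Sum>j\<in>UNIV. \<theta> $ j) \<le> (\<Sum>j\<in>(UNIV::'n set). pi)"
    by (rule sum_mono) (use assms in \<open>simp add: spectral_angles_def\<close>)
  then show "(\<Sum>j\<in>UNIV. \<theta> $ j) \<le> real CARD('n) * pi" by simp
qed

lemma cis_quadratic_factor: "(z - cis t) * (z - cis (- t)) = z\<^sup>2 - 2 * complex_of_real (cos t) * z + 1"
proof -
  have "cis t + cis (- t) = 2 * complex_of_real (cos t)" by (simp add: complex_eq_iff)
  moreover have "(z - cis t) * (z - cis (- t)) = z\<^sup>2 - (cis t + cis (- t)) * z + cis t * cis (- t)"
    by (simp add: algebra_simps power2_eq_square)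
  ultimately show ?thesis by (simp add: cis_mult)
qed

text \<open>The substitution \<open>z + 1/z = 2 y\<close> turns each quadratic factor into a linear one.\<close>
lemma prod_quadratic_eq_imp_prod_linear_eq:
  fixes a b :: "'n::finite \<Rightarrow> real"
  assumes "\<And>z. (\<Prod>j\<in>UNIV. z\<^sup>2 - 2 * complex_of_real (a j) * z + 1) = (\<Prod>j\<in>UNIV. z\<^sup>2 - 2 * complex_of_real (b j) * z + 1)"
  shows "(\<Prod>j\<in>UNIV. y - a j) = (\<Prod>j\<in>UNIV. y - b j)"
proof -
  define z where "z = complex_of_real y + csqrt ((complex_of_real y)\<^sup>2 - 1)"
  have z: "z\<^sup>2 + 1 = 2 * complex_of_real y * z"
    by (simp add: z_def power2_sum) (simp add: algebra_simps power2_eq_square)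
  then have "z \<noteq> 0" by auto
  have factor: "z\<^sup>2 - 2 * complex_of_real c * z + 1 = (2 * z) * complex_of_real (y - c)" for c
  proof -
    have "z\<^sup>2 - 2 * complex_of_real c * z + 1 = (z\<^sup>2 + 1) - 2 * complex_of_real c * z" by simp
    also have "\<dots> = (2 * z) * complex_of_real (y - c)" unfolding z by (simp add: algebra_simps)
    finally show ?thesis .
  qed
  have "(2 * z) ^ CARD('n) * complex_of_real (\<Prod>j\<in>UNIV. y - a j) = (2 * z) ^ CARD('n) * complex_of_real (\<Prod>j\<in>UNIV. y - b j)"
    using assms[of z] unfolding factor prod.distrib by (simp del: of_real_diff)
  then show ?thesis using \<open>z \<noteq> 0\<close> by (simp only: mult_cancel_left power_eq_0_iff of_real_eq_iff) simp
qed

lemma prod_linear_eq_imp_mset_eq: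
  fixes a b :: "'n::finite \<Rightarrow> real"
  assumes "\<And>y. (\<Prod>j\<in>UNIV. y - a j) = (\<Prod>j\<in>UNIV. y - b j)"
  shows "(\<Sum>j\<in>UNIV. {#a j#}) = (\<Sum>j\<in>UNIV. {#b j#})"
proof -
  define P where "P c = (\<Prod>j\<in>UNIV. [:- c j, 1:])" for c :: "'n \<Rightarrow> real"
  have "poly (P a) y = poly (P b) y" for y using assms[of y] by (simp add: P_def poly_prod algebra_simps)
  then have "P a = P b" by (simp add: poly_eq_poly_eq_iff[symmetric] fun_eq_iff)
  moreover have "proots (P c) = (\<Sum>j\<in>UNIV. {#c j#})" for c
    unfolding P_def by (subst proots_prod) auto
  ultimately show ?thesis by metis
qed

lemma spectral_angles_sum_unique:
  fixes \<theta> \<phi> :: "real^'n::finite"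
  assumes "spectral_angles W \<theta>" "spectral_angles W \<phi>"
  shows "(\<Sum>j\<in>UNIV. \<theta> $ j) = (\<Sum>j\<in>UNIV. \<phi> $ j)"
proof -
  have "(\<Prod>j\<in>UNIV. z\<^sup>2 - 2 * complex_of_real (cos (\<theta> $ j)) * z + 1) = (\<Prod>j\<in>UNIV. z\<^sup>2 - 2 * complex_of_real (cos (\<phi> $ j)) * z + 1)" for z
    using assms unfolding spectral_angles_def cis_quadratic_factor by metis
  then have mset: "(\<Sum>j\<in>UNIV. {#cos (\<theta> $ j)#}) = (\<Sum>j\<in>UNIV. {#cos (\<phi> $ j)#})"
    by (intro prod_linear_eq_imp_mset_eq prod_quadratic_eq_imp_prod_linear_eq)
  have arccos_sum: "sum_mset (image_mset arccos (\<Sum>j\<in>A. {#cos (\<psi> $ j)#})) = (\<Sum>j\<in>A. arccos (cos (\<psi> $ j)))" for A :: "'n set" and \<psi> :: "real^'n"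
    by (induction A rule: infinite_finite_induct) simp_all
  have "arccos (cos (\<theta> $ j)) = \<theta> $ j" "arccos (cos (\<phi> $ j)) = \<phi> $ j" for j
    using assms by (simp_all add: spectral_angles_def arccos_cos)
  then show ?thesis using arccos_sum[of \<theta> UNIV] arccos_sum[of \<phi> UNIV] mset by simp
qed

lemma charpoly_tendsto:
  assumes "X \<longlonglongrightarrow> W"
  shows "(\<lambda>k. charpoly (X k) z) \<longlonglongrightarrow> charpoly W z"
proof -
  have "(\<lambda>k. cplx (X k)) \<longlonglongrightarrow> cplx W"
    unfolding cplx_def by (intro tendsto_intros assms)
  then show ?thesis unfolding charpoly_mat by (intro tendsto_det tendsto_intros)
qed

lemma spectral_angles_limit:
  fixes T :: "nat \<Rightarrow> real^'n::finite"
  assumes X: "X \<longlonglongrightarrow> W" and T: "\<And>k. spectral_angles (X k) (T k)" and m: "(\<lambda>k. \<Sum>j\<in>UNIV. T k $ j) \<longlonglongrightarrow> m"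
  obtains \<theta> where "spectral_angles W \<theta>" "(\<Sum>j\<in>UNIV. \<theta> $ j) = m"
proof -
  have "compact (cbox (0 :: real^'n) (\<chi> j. pi))" by (rule compact_cbox)
  moreover have "T k \<in> cbox 0 (\<chi> j. pi)" for k using T[of k] by (simp add: spectral_angles_def mem_box_cart)
  ultimately obtain \<theta> r where r: "\<theta> \<in> cbox 0 (\<chi> j. pi)" "strict_mono r" "(T \<circ> r) \<longlonglongrightarrow> \<theta>"
    unfolding compact_def by metis
  have T_lim: "(\<lambda>k. T (r k) $ j) \<longlonglongrightarrow> \<theta> $ j" for j using tendsto_vec_nth[OF r(3)] by (simp add: o_def)
  have X_lim: "(\<lambda>k. X (r k)) \<longlonglongrightarrow> W" using LIMSEQ_subseq_LIMSEQ[OF X r(2)] by (simp add: o_def)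
  have "charpoly W z = (\<Prod>j\<in>UNIV. (z - cis (\<theta> $ j)) * (z - cis (- \<theta> $ j)))" for z
  proof (rule LIMSEQ_unique[OF charpoly_tendsto[OF X_lim]])
    have "(\<lambda>k. \<Prod>j\<in>UNIV. (z - cis (T (r k) $ j)) * (z - cis (- T (r k) $ j)))
      \<longlonglongrightarrow> (\<Prod>j\<in>UNIV. (z - cis (\<theta> $ j)) * (z - cis (- \<theta> $ j)))"
      by (intro tendsto_intros T_lim)
    then show "(\<lambda>k. charpoly (X (r k)) z) \<longlonglongrightarrow> (\<Prod>j\<in>UNIV. (z - cis (\<theta> $ j)) * (z - cis (- \<theta> $ j)))"
      using T unfolding spectral_angles_def by simp
  qed
  then have "spectral_angles W \<theta>" using r(1) by (simp add: spectral_angles_def mem_box_cart)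
  moreover have "(\<Sum>j\<in>UNIV. \<theta> $ j) = m"
  proof (rule LIMSEQ_unique)
    show "(\<lambda>k. \<Sum>j\<in>UNIV. T (r k) $ j) \<longlonglongrightarrow> (\<Sum>j\<in>UNIV. \<theta> $ j)" by (intro tendsto_sum T_lim)
    show "(\<lambda>k. \<Sum>j\<in>UNIV. T (r k) $ j) \<longlonglongrightarrow> m" using LIMSEQ_subseq_LIMSEQ[OF m r(2)] by (simp add: o_def)
  qed
  ultimately show ?thesis by (rule that)
qed

lemma continuous_on_spectral_angles_sum:
  fixes T :: "'a::metric_space \<Rightarrow> real^'n::finite"
  assumes g: "continuous_on S g" and T: "\<And>t. t \<in> S \<Longrightarrow> spectral_angles (g t) (T t)"
  shows "continuous_on S (\<lambda>t. \<Sum>j\<in>UNIV. T t $ j)"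
proof (rule continuous_on_closed_graph)
  show "compact {0..real CARD('n) * pi}" by simp
  show "(\<lambda>t. \<Sum>j\<in>UNIV. T t $ j) ` S \<subseteq> {0..real CARD('n) * pi}" using spectral_angles_sum_bounds[OF T] by auto
  fix X x y assume X: "\<And>k::nat. X k \<in> S" "X \<longlonglongrightarrow> x" and x: "x \<in> S" and y: "(\<lambda>k. \<Sum>j\<in>UNIV. T (X k) $ j) \<longlonglongrightarrow> y"
  have "(\<lambda>k. g (X k)) \<longlonglongrightarrow> g x" using continuous_on_tendsto_compose[OF g X(2) x] X(1) by simp
  from spectral_angles_limit[OF this T[OF X(1)] y] obtain \<theta> where "spectral_angles (g x) \<theta>" "(\<Sum>j\<in>UNIV. \<theta> $ j) = y" .
  then show "y = (\<Sum>j\<in>UNIV. T x $ j)" using spectral_angles_sum_unique[OF _ T[OF x]] by simp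
qed

lemma spectral_angles_Sp_pos:
  fixes W :: "'n::finite sqm"
  assumes "W \<in> Sp_pos"
  obtains \<theta> where "spectral_angles W \<theta>" "upsilon W = cis (\<Sum>j\<in>UNIV. \<theta> $ j)"
proof -
  obtain M \<theta> where M: "M \<in> Sp" "\<And>j::'n. 0 < \<theta> j \<and> \<theta> j < pi" "W ** M = M ** block_rot \<theta>"
    "upsilon W = cis (\<Sum>j\<in>UNIV. \<theta> j)" by (rule normal_form[OF assms]) (rule that)
  have "spectral_angles W (\<chi> j. \<theta> j)"
    unfolding spectral_angles_def using M(2) charpoly_normal_form[OF M(1,3)] by (auto simp: less_imp_le)
  then show ?thesis using that[of "\<chi> j. \<theta> j"] M(4) by simp
qed

lemma spectral_angles_one: "spectral_angles (mat 1 :: 'n::finite sqm) 0"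
proof -
  have "block_rot (\<lambda>j::'n. 0) = mat 1"
    unfolding matrix_eq vec_sum_eq_iff by (simp add: block_rot_vec)
  then show ?thesis using charpoly_block_rot[of "\<lambda>j::'n. 0"] by (simp add: spectral_angles_def)
qed

lemma maslov_SpT_ell_plus:
  fixes w :: "(real \<Rightarrow> 'n::finite sqm) set"
  assumes "w \<in> SpT_ell_plus"
  obtains \<theta> where "spectral_angles (proj w) \<theta>" "2 * pi * maslov w = (\<Sum>j\<in>UNIV. \<theta> $ j)"
proof -
  obtain g where w: "w \<in> SpT" "g \<in> w" and g_pos: "\<And>t. t \<in> {0<..1} \<Longrightarrow> g t \<in> Sp_pos"
    using assms unfolding SpT_ell_plus_def Sp_pos_eq_Sp_ell_plus by blast
  have g: "sp_path g" "w = cls g" using SpT_mem[OF w] by auto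
  have "\<exists>\<theta>. spectral_angles (g t) \<theta> \<and> upsilon (g t) = cis (\<Sum>j\<in>UNIV. \<theta> $ j)" if "t \<in> {0..1}" for t
  proof (cases "t = 0")
    case True
    then show ?thesis using spectral_angles_one upsilon_one sp_pathD(4)[OF g(1)] by (intro exI[of _ 0]) simp
  next
    case False
    then have "g t \<in> Sp_pos" using g_pos that by simp
    then show ?thesis by (rule spectral_angles_Sp_pos) blast
  qed
  then obtain T where T: "\<And>t. t \<in> {0..1} \<Longrightarrow> spectral_angles (g t) (T t)"
     "\<And>t. t \<in> {0..1} \<Longrightarrow> upsilon (g t) = cis (\<Sum>j\<in>UNIV. T t $ j)" by metis
  define S where "S t = (\<Sum>j\<in>UNIV. T t $ j)" for t
  have "2 * pi * \<i> * complex_of_real (maslov (cls (subpath 0 1 g))) - \<i> * complex_of_real (S 1)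
     = 2 * pi * \<i> * complex_of_real (maslov (cls (subpath 0 0 g))) - \<i> * complex_of_real (S 0)"
  proof (rule log_diff_constant[of "{0..1::real}"])
    have "continuous_on {0..1} (\<lambda>t. maslov (cls (subpath 0 t g)))" by (rule continuous_along_path[OF maslov_characterization(1) g(1)])
    then show "continuous_on {0..1} (\<lambda>t. 2 * pi * \<i> * complex_of_real (maslov (cls (subpath 0 t g))))"
      by (intro continuous_intros)
    have "continuous_on {0..1} S" unfolding S_def by (rule continuous_on_spectral_angles_sum[OF sp_pathD(6)[OF g(1)] T(1)])
    then show "continuous_on {0..1} (\<lambda>t. \<i> * complex_of_real (S t))" by (intro continuous_intros)
    fix t :: real assume t: "t \<in> {0..1}"
    show "exp (2 * pi * \<i> * complex_of_real (maslov (cls (subpath 0 t g)))) = exp (\<i> * complex_of_real (S t))"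
      using maslov_characterization(2)[OF cls_in_SpT[OF sp_path_subpath[OF g(1) t]]] T(2)[OF t]
      by (simp add: S_def proj_cls_subpath[OF g(1) t] cis_conv_exp)
  qed auto
  moreover have "S 0 = 0"
    using spectral_angles_sum_unique[OF T(1)[of 0], of 0] spectral_angles_one sp_pathD(4)[OF g(1)] by (simp add: S_def)
  moreover have "maslov (cls (subpath 0 0 g)) = 0" by (simp add: cls_subpath_0[OF g(1)] maslov_characterization(3))
  ultimately have "\<i> * complex_of_real (2 * pi * maslov w) = \<i> * complex_of_real (S 1)"
    by (simp add: g(2) mult_ac)
  then have "2 * pi * maslov w = S 1" by (simp only: mult_cancel_left of_real_eq_iff) simp
  moreover have "proj w = g 1" using proj_cls[OF g(1)] g(2) by simp
  ultimately show ?thesis using that[of "T 1"] T(1)[of 1] by (simp add: S_def)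
qed

lemma continuous_map_closure_of_mem_closure:
  assumes "w \<in> X closure_of A" "continuous_map X euclidean f"
  shows "f w \<in> closure (f ` A)"
  using continuous_map_image_closure_subset[OF assms(2), of A] assms(1) by auto

theorem maslov_closure:
  fixes w :: "(real \<Rightarrow> 'n::finite sqm) set"
  assumes w: "w \<in> SpT_top closure_of SpT_ell_plus"
  obtains \<theta> where "spectral_angles (proj w) \<theta>" "2 * pi * maslov w = (\<Sum>j\<in>UNIV. \<theta> $ j)"
proof -
  let ?f = "\<lambda>v :: (real \<Rightarrow> 'n sqm) set. (proj v, maslov v)"
  have "continuous_map SpT_top (prod_topology euclidean euclidean) ?f"
    by (intro continuous_map_pairedI continuous_map_proj maslov_characterization(1))
  then have "?f w \<in> closure (?f ` SpT_ell_plus)" by (intro continuous_map_closure_of_mem_closure[OF w]) simp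
  then obtain X where X: "\<forall>k. X k \<in> ?f ` SpT_ell_plus" "X \<longlonglongrightarrow> ?f w" unfolding closure_sequential by blast
  have "\<exists>\<theta>. spectral_angles (fst (X k)) \<theta> \<and> 2 * pi * snd (X k) = (\<Sum>j\<in>UNIV. \<theta> $ j)" for k
  proof -
    obtain v where "v \<in> SpT_ell_plus" "X k = ?f v" using X(1) by blast
    then show ?thesis using maslov_SpT_ell_plus[of v] by auto
  qed
  then obtain T where T: "\<And>k. spectral_angles (fst (X k)) (T k)" "\<And>k. 2 * pi * snd (X k) = (\<Sum>j\<in>UNIV. T k $ j)" by metis
  have "(\<lambda>k. \<Sum>j\<in>UNIV. T k $ j) \<longlonglongrightarrow> 2 * pi * maslov w"
    unfolding T(2)[symmetric] using tendsto_snd[OF X(2)] by (intro tendsto_intros) simp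
  from spectral_angles_limit[OF _ T(1) this] obtain \<theta> where "spectral_angles (proj w) \<theta>" "(\<Sum>j\<in>UNIV. \<theta> $ j) = 2 * pi * maslov w"
    using tendsto_fst[OF X(2)] by auto
  then show ?thesis by (intro that) (assumption, rule sym)
qed

lemma closed_Sp_nonneg: "closed (Sp_nonneg :: 'n::finite sqm set)"
proof -
  have "(Sp_nonneg :: 'n sqm set) = Sp \<inter> (\<Inter>v. {W. 0 \<le> omega0 v (W *v v)})" by (auto simp: Sp_nonneg_def)
  also have "closed \<dots>"
    by (intro closed_Int closed_Sp closed_INT ballI closed_Collect_le continuous_on_const omega.continuous_on
        matrix_vec_mult.continuous_on continuous_on_id)
  finally show ?thesis .
qed

lemma Sp_nonneg_one: "mat 1 \<in> Sp_nonneg"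
  by (simp add: Sp_nonneg_def Sp_one omega0_self)

lemma SpT_ell_plus_path:
  assumes "v \<in> SpT_ell_plus"
  obtains g where "v \<in> SpT" "g \<in> v" "\<And>s. s \<in> {0..1} \<Longrightarrow> g s \<in> Sp_nonneg" "\<And>s. s \<in> {0<..1} \<Longrightarrow> g s \<in> Sp_pos"
proof -
  obtain g where g: "v \<in> SpT" "g \<in> v" "\<And>s. s \<in> {0<..1} \<Longrightarrow> g s \<in> Sp_pos"
    using assms unfolding SpT_ell_plus_def Sp_pos_eq_Sp_ell_plus by blast
  have "g s \<in> Sp_nonneg" if "s \<in> {0..1}" for s
  proof (cases "s = 0")
    case True
    then show ?thesis using sp_pathD(4)[of g] SpT_mem[OF g(1,2)] Sp_nonneg_one by simp
  next
    case False
    then show ?thesis using g(3)[of s] that Sp_pos_subset_Sp_nonneg by auto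
  qed
  with g show ?thesis using that by blast
qed

lemma SpT_ell_plus_proj: "v \<in> SpT_ell_plus \<Longrightarrow> proj v \<in> Sp_nonneg"
  by (elim SpT_ell_plus_path) (simp add: proj_eq pathfinish_def)

lemma closure_proj_Sp_nonneg:
  assumes "w \<in> SpT_top closure_of SpT_ell_plus"
  shows "proj w \<in> Sp_nonneg"
  using continuous_map_closure_of_mem_closure[OF assms continuous_map_proj] closure_minimal[OF _ closed_Sp_nonneg] SpT_ell_plus_proj
  by blast

section \<open>Complex rotations and monotonicity\<close>

definition crot :: "complex \<Rightarrow> complex^('n::finite + 'n)^('n + 'n)" where
  "crot a = mat (cos a) + mat (sin a) ** cplx J0"

definition rot_det :: "complex \<Rightarrow> 'n::finite sqm \<Rightarrow> complex" where
  "rot_det a W = det (cplx W - crot a)"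

lemma bounded_linear_mat: "bounded_linear (mat :: complex \<Rightarrow> complex^'m^'m)"
  unfolding linear_conv_bounded_linear[symmetric] by (rule linearI) (simp_all add: mat_def vec_eq_iff)

lemma bounded_linear_cplx: "bounded_linear (cplx :: 'n::finite sqm \<Rightarrow> _)"
  unfolding linear_conv_bounded_linear[symmetric] by (rule linearI) (simp_all add: cplx_def vec_eq_iff scaleR_conv_of_real[where 'a = complex])

lemma cplx_diff: "cplx (A - B) = cplx A - cplx B"
  by (simp add: cplx_def vec_eq_iff)

lemma det_cplx: "det (cplx A) = complex_of_real (det A)"
  by (simp add: det_def cplx_def)

lemma crot_vec: "crot a *v x = of_parts (exp (\<i> * a) *s pos_part x) (exp (- (\<i> * a)) *s neg_part x)"
proof -
  have crot: "crot a *v x = cos a *s x + sin a *s (cplx J0 *v x)"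
    by (simp add: crot_def matrix_vec_mult.add_left mat_vec flip: matrix_vector_mul_assoc)
  show ?thesis
    by (simp add: crot vec_sum_eq_iff cplx_J0_vec of_parts_def pos_part_def neg_part_def cos_exp_eq sin_exp_eq field_simps)
qed

lemma norm_parts: "(norm x)\<^sup>2 = 2 * ((norm (pos_part x))\<^sup>2 + (norm (neg_part x))\<^sup>2)"
proof -
  have parallelogram: "(cmod (p + m))\<^sup>2 + (cmod (\<i> * (p - m)))\<^sup>2 = 2 * (cmod p)\<^sup>2 + 2 * (cmod m)\<^sup>2" for p m
    unfolding cmod_power2 by (simp add: power2_eq_square algebra_simps)
  have "(norm (of_parts p m))\<^sup>2 = 2 * ((norm p)\<^sup>2 + (norm m)\<^sup>2)" for p m
    unfolding norm_cvec_sq sum_UNIV_Plus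
    by (simp add: of_parts_def parallelogram sum_distrib_left flip: sum.distrib)
  from this[of "pos_part x" "neg_part x"] show ?thesis by (simp add: of_parts_collapse)
qed

lemma norm_scale_cvec: "norm (k *s (x::complex^'m)) = cmod k * norm x"
proof -
  have "(norm (k *s x))\<^sup>2 = (cmod k * norm x)\<^sup>2"
    by (simp add: norm_cvec_sq norm_mult power_mult_distrib sum_distrib_left)
  then show ?thesis by simp
qed

lemma krein_sq_crot:
  assumes "Im a \<ge> 0"
  shows "(1 - exp (- (2 * Im a))) * (norm x)\<^sup>2 \<le> krein_sq x - krein_sq (crot a *v x)"
proof -
  define e where "e = exp (2 * Im a)"
  have e: "e \<ge> 1" "exp (- (2 * Im a)) = 1 / e" using assms by (simp_all add: e_def exp_minus field_simps)
  have norms: "(cmod (exp (\<i> * a)))\<^sup>2 = 1 / e" "(cmod (exp (- (\<i> * a))))\<^sup>2 = e"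
    unfolding e(2)[symmetric] by (simp_all add: e_def flip: exp_of_nat_mult)
  have "krein_sq x - krein_sq (crot a *v x) = 2 * ((1 - 1 / e) * (norm (pos_part x))\<^sup>2 + (e - 1) * (norm (neg_part x))\<^sup>2)"
    by (simp only: krein_sq_eq crot_vec pos_part_of_parts neg_part_of_parts norm_scale_cvec power_mult_distrib norms) (simp add: algebra_simps)
  moreover have "1 - 1 / e \<le> e - 1"
  proof -
    have "0 \<le> (e - 1)\<^sup>2 / e" using e(1) by simp
    also have "\<dots> = (e - 1) - (1 - 1 / e)" using e(1) by (simp add: field_simps power2_eq_square)
    finally show ?thesis by simp
  qed
  then have "(1 - 1 / e) * (norm (neg_part x))\<^sup>2 \<le> (e - 1) * (norm (neg_part x))\<^sup>2" by (rule mult_right_mono) simp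
  ultimately show ?thesis unfolding norm_parts[of x] e(2) by (simp add: algebra_simps)
qed

lemma rot_det_nonzero:
  assumes W: "W \<in> Sp" and a: "Im a > 0"
  shows "invertible (cplx W - crot a)" "rot_det a W \<noteq> 0"
proof -
  show i: "invertible (cplx W - crot a)"
    unfolding invertible_iff_kernel
  proof (intro allI impI)
    fix x assume "(cplx W - crot a) *v x = 0"
    then have "cplx W *v x = crot a *v x" by (simp add: matrix_vec_mult.diff_left)
    then have "krein_sq x = krein_sq (crot a *v x)" using krein_sq_Sp[OF W, of x] by simp
    then have "(1 - exp (- (2 * Im a))) * (norm x)\<^sup>2 \<le> 0" using krein_sq_crot[of a x] a by simp
    moreover have "1 - exp (- (2 * Im a)) > 0" using a by simp
    ultimately show "x = 0" by (simp add: mult_le_0_iff)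
  qed
  show "rot_det a W \<noteq> 0" using i by (simp add: rot_det_def invertible_det_nz)
qed

text \<open>With \<open>y = (W - R)\<^sup>-\<^sup>1 J p\<close> one has \<open>W y = J p + R y\<close>, and \<open>W\<close> preserves the Krein form.\<close>
lemma Im_rot_resolvent:
  fixes W :: "'n::finite sqm"
  assumes W: "W \<in> Sp" and a: "Im a > 0"
  defines "Mi \<equiv> matrix_inv (cplx W - crot a)"
  shows "(1 - exp (- (2 * Im a))) / 2 * (norm (Mi *v (cplx J0 *v of_real_vec p)))\<^sup>2
     \<le> Im (\<Sum>k\<in>UNIV. complex_of_real (p $ k) * ((cplx W ** Mi ** cplx J0) *v of_real_vec p) $ k)"
proof -
  define y where "y = Mi *v (cplx J0 *v of_real_vec p)"
  define z where "z = cplx W *v y"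
  have "(cplx W - crot a) *v y = cplx J0 *v of_real_vec p"
    unfolding y_def Mi_def by (rule matrix_inv_cancel(1)[OF rot_det_nonzero(1)[OF W a]])
  then have z_split: "z = crot a *v y + of_real_vec (J0 *v p)" by (simp add: z_def matrix_vec_mult.diff_left cplx_of_real_vec algebra_simps)
  have isotropic: "krein (of_real_vec (J0 *v p)) (of_real_vec (J0 *v p)) = 0" by (simp add: krein_of_real_vec omega0_self)
  have "krein_sq y = krein_sq z" using krein_sq_Sp[OF W] by (simp add: z_def)
  also have "\<dots> = krein_sq (crot a *v y) + 2 * Re (krein (crot a *v y) (of_real_vec (J0 *v p)))"
    unfolding z_split krein_sq_add by (simp add: krein_sq_def isotropic)
  also have "krein (crot a *v y) (of_real_vec (J0 *v p)) = krein z (of_real_vec (J0 *v p))"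
    unfolding z_split krein_add_left isotropic by simp
  also have "krein z (of_real_vec (J0 *v p)) = - \<i> * (\<Sum>k\<in>UNIV. complex_of_real (p $ k) * z $ k)"
    unfolding krein_expand sum_UNIV_Plus sum.distrib[symmetric] sum_distrib_left
    by (rule sum.cong) (simp_all add: of_real_vec_def J0_mult_vec algebra_simps)
  finally have "Im (\<Sum>k\<in>UNIV. complex_of_real (p $ k) * z $ k) = (krein_sq y - krein_sq (crot a *v y)) / 2" by simp
  moreover have "z = (cplx W ** Mi ** cplx J0) *v of_real_vec p" by (simp add: z_def y_def matrix_vector_mul_assoc matrix_mul_assoc)
  ultimately show ?thesis using krein_sq_crot[of a y] a by (simp add: y_def)
qed

definition Im_matrix :: "complex^'m^'m \<Rightarrow> real^'m^'m" where "Im_matrix B = (\<chi> i k. Im (B $ i $ k))"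

lemma Im_matrix_inner: "p \<bullet> (Im_matrix B *v p) = Im (\<Sum>k\<in>UNIV. complex_of_real (p $ k) * (B *v of_real_vec p) $ k)"
  by (simp add: Im_matrix_def inner_vec_def matrix_vector_mult_def of_real_vec_def sum_distrib_left Im_sum)

lemma Im_trace_cplx: "Im (trace (B ** cplx S)) = trace (Im_matrix B ** S)"
  by (simp add: Im_matrix_def trace_def matrix_matrix_mult_def cplx_def Im_sum)

lemma Im_trace_rot_nonneg:
  fixes W S :: "'n::finite sqm"
  assumes W: "W \<in> Sp" and a: "Im a > 0" and S: "psd_matrix S"
  shows "0 \<le> Im (trace (matrix_inv (cplx W - crot a) ** cplx (J0 ** S ** W)))"
proof -
  let ?Mi = "matrix_inv (cplx W - crot a)"
  have "trace (?Mi ** cplx (J0 ** S ** W)) = trace ((cplx J0 ** cplx S) ** (cplx W ** ?Mi))"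
    using trace_mul_sym[of ?Mi "cplx (J0 ** S ** W)"] by (simp add: cplx_mult matrix_mul_assoc)
  also have "\<dots> = trace ((cplx W ** ?Mi) ** cplx J0 ** cplx S)"
    using trace_mul_sym[of "cplx J0 ** cplx S" "cplx W ** ?Mi"] by (simp add: matrix_mul_assoc)
  finally have "Im (trace (?Mi ** cplx (J0 ** S ** W))) = trace (Im_matrix (cplx W ** ?Mi ** cplx J0) ** S)"
    by (simp add: Im_trace_cplx)
  moreover have "0 \<le> p \<bullet> (Im_matrix (cplx W ** ?Mi ** cplx J0) *v p)" for p
  proof -
    have "0 \<le> (1 - exp (- (2 * Im a))) / 2 * (norm (?Mi *v (cplx J0 *v of_real_vec p)))\<^sup>2" using a by simp
    also note Im_rot_resolvent[OF W a, of p]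
    finally show ?thesis by (simp only: Im_matrix_inner)
  qed
  ultimately show ?thesis using trace_psd_mult_nonneg[OF S] by simp
qed

lemma log_has_vector_derivative:
  assumes l: "continuous_on S l" and t: "t \<in> S"
    and d: "((\<lambda>s. exp (l s)) has_vector_derivative exp (l t) * \<tau>) (at t within S)"
  shows "(l has_vector_derivative (\<tau>::complex)) (at t within (S::real set))"
proof -
  let ?q = "\<lambda>s. exp (l s) * exp (- l t)"
  have "(l \<longlongrightarrow> l t) (at t within S)" using l t by (simp add: continuous_on_def)
  then obtain r where r: "r > 0" "\<And>s. s \<in> S \<Longrightarrow> s \<noteq> t \<Longrightarrow> dist s t < r \<Longrightarrow> dist (l s) (l t) < pi"
    unfolding Lim_within using pi_gt_zero by (metis zero_less_dist_iff)
  have local_log: "l t + Ln (?q s) = l s" if "s \<in> S" "dist s t < r" for s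
  proof -
    have "norm (l s - l t) < pi" using r(2)[OF that(1) _ that(2)] by (cases "s = t") (simp_all add: dist_norm)
    then have "\<bar>Im (l s - l t)\<bar> < pi" using abs_Im_le_cmod[of "l s - l t"] by linarith
    then have "Ln (exp (l s - l t)) = l s - l t" by (intro Ln_exp) auto
    then show ?thesis by (simp add: exp_diff exp_minus field_simps)
  qed
  have "(?q has_vector_derivative exp (l t) * \<tau> * exp (- l t)) (at t within S)"
    by (intro derivative_intros d)
  then have q: "(?q has_vector_derivative \<tau>) (at t within S)" by (simp add: exp_minus mult_ac)
  have "(Ln has_field_derivative 1) (at (?q t) within ?q ` S)"
    using has_field_derivative_at_within[OF has_field_derivative_Ln[of 1, simplified]] by (simp add: exp_minus)
  from field_vector_diff_chain_within[OF q this]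
  have "((\<lambda>s. l t + Ln (?q s)) has_vector_derivative \<tau>) (at t within S)"
    using has_vector_derivative_add[OF has_vector_derivative_const] by (fastforce simp: o_def)
  then show ?thesis by (rule has_vector_derivative_transform_within[OF _ r(1) t]) (use local_log in auto)
qed

lemma Im_log_det_mean_value:
  assumes l: "continuous_on {x..y} l" and xy: "x \<le> y"
    and M: "\<And>t. t \<in> {x..y} \<Longrightarrow> (M has_vector_derivative M' t) (at t within {x..y})" "\<And>t. t \<in> {x..y} \<Longrightarrow> invertible (M t)"
    and e: "\<And>t. t \<in> {x..y} \<Longrightarrow> exp (l t) = det (M t :: complex^'m^'m)"
  obtains t where "t \<in> {x..y}" "Im (l y) - Im (l x) = (y - x) * Im (trace (matrix_inv (M t) ** M' t))"
proof -
  let ?\<tau> = "\<lambda>t. trace (matrix_inv (M t) ** M' t)"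
  have "((\<lambda>s. Im (l s)) has_vector_derivative Im (?\<tau> t)) (at t within {x..y})" if t: "t \<in> {x..y}" for t
  proof -
    have "((\<lambda>s. exp (l s)) has_vector_derivative det (M t) * ?\<tau> t) (at t within {x..y})"
      by (rule has_vector_derivative_transform[OF t e has_vector_derivative_det[OF M(1)[OF t] M(2)[OF t]]])
    then have "(l has_vector_derivative ?\<tau> t) (at t within {x..y})"
      by (intro log_has_vector_derivative[OF l t]) (simp add: e[OF t])
    then show ?thesis by (rule bounded_linear.has_vector_derivative[OF bounded_linear_Im])
  qed
  then show thesis
    using mvt_very_simple[OF xy, of "\<lambda>s. Im (l s)" "\<lambda>t h. h * Im (?\<tau> t)"] that
    by (auto simp: has_vector_derivative_def)
qed

lemma rot_det_mono:
  assumes c: "weakly_causal c D" and a: "Im a > 0" and l: "continuous_on {0..1} l"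
    and e: "\<And>t. t \<in> {0..1} \<Longrightarrow> exp (l t) = rot_det a (c t)" and st: "0 \<le> s" "s \<le> t" "t \<le> 1"
  shows "Im (l s) \<le> Im (l t)"
proof -
  have curve: "Sp_curve c D" using c by (simp add: weakly_causal_def)
  have st_sub: "{s..t} \<subseteq> {0..1}" using st by simp
  obtain r where r: "r \<in> {s..t}" "Im (l t) - Im (l s) = (t - s) * Im (trace (matrix_inv (cplx (c r) - crot a) ** cplx (D r)))"
  proof (rule Im_log_det_mean_value[OF _ st(2)])
    show "continuous_on {s..t} l" by (rule continuous_on_subset[OF l st_sub])
    fix r assume "r \<in> {s..t}"
    then have r: "r \<in> {0..1}" using st by auto
    have "(c has_vector_derivative D r) (at r within {s..t})"
      by (rule has_vector_derivative_within_subset[OF Sp_curveD(6)[OF curve r] st_sub])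
    from has_vector_derivative_diff[OF bounded_linear.has_vector_derivative[OF bounded_linear_cplx this] has_vector_derivative_const, of "crot a"]
    show "((\<lambda>s. cplx (c s) - crot a) has_vector_derivative cplx (D r)) (at r within {s..t})" by (simp only: diff_zero)
    show "invertible (cplx (c r) - crot a)" by (rule rot_det_nonzero(1)[OF Sp_curveD(2)[OF curve r] a])
    show "exp (l r) = det (cplx (c r) - crot a)" using e[OF r] by (simp add: rot_det_def)
  qed
  have W: "c r \<in> Sp" and r01: "r \<in> {0..1}" using Sp_curveD(2)[OF curve] r(1) st by auto
  let ?X = "logder c r"
  have X: "psd_matrix (form_matrix ?X)"
    using weakly_causal_logder[OF curve] c r01 by (simp add: psd_form_matrix)
  have "J0 ** form_matrix ?X = ?X"
    by (simp add: form_matrix_def matrix_mult.minus_right matrix_mul_assoc J0_mult_J0 matrix_mult.minus_left)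
  moreover have "?X ** c r = D r"
    using Sp_curveD(3)[OF curve r01] matrix_inv_left[OF Sp_invertible[OF W]] by (simp flip: matrix_mul_assoc)
  ultimately have "0 \<le> Im (trace (matrix_inv (cplx (c r) - crot a) ** cplx (D r)))"
    using Im_trace_rot_nonneg[OF W a X] by simp
  then show ?thesis using r(2) st(2) by (metis diff_ge_0_iff_ge mult_nonneg_nonneg)
qed

lemma norm_exp_minus_one:
  assumes "\<bar>Re z\<bar> \<le> 1 / 4" shows "cmod (exp z - 1) \<le> 2 * cmod z"
proof -
  have "cmod (exp z - 1) \<le> exp \<bar>Re z\<bar> * cmod z" using Taylor_exp[of z 0] by simp
  also have "exp \<bar>Re z\<bar> \<le> 2" using real_exp_bound_lemma[of "\<bar>Re z\<bar>"] assms by linarith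
  finally show ?thesis by (simp add: mult_right_mono)
qed

lemma norm_crot_diff:
  fixes x :: "'n::finite cvec"
  assumes "\<bar>\<beta> - b\<bar> \<le> e" "0 < e" "e \<le> 1 / 4"
  shows "norm (crot (complex_of_real b) *v x - crot (Complex \<beta> e) *v x) \<le> 4 * e * norm x"
proof -
  let ?a = "Complex \<beta> e" and ?b = "complex_of_real b"
  have phase_diff: "cmod (exp (s * (\<i> * ?b)) - exp (s * (\<i> * ?a))) \<le> 4 * e" if s: "s = 1 \<or> s = -1" for s
  proof -
    define z where "z = s * (\<i> * (?a - ?b))"
    have "cmod z \<le> \<bar>\<beta> - b\<bar> + e" using s cmod_le[of "?a - ?b"] assms(2) by (auto simp: z_def norm_mult)
    then have z: "cmod z \<le> 2 * e" using assms(1) by linarith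
    have "\<bar>Re z\<bar> = e" using s assms(2) by (auto simp: z_def)
    then have "cmod (exp z - 1) \<le> 4 * e" using norm_exp_minus_one[of z] z assms(3) by linarith
    moreover have "exp (s * (\<i> * ?b)) - exp (s * (\<i> * ?a)) = - exp (s * (\<i> * ?b)) * (exp z - 1)"
      by (simp add: z_def ring_distribs exp_add exp_diff)
    moreover have "cmod (exp (s * (\<i> * ?b))) = 1" using s by auto
    ultimately show ?thesis by (simp add: norm_mult del: norm_exp_eq_Re)
  qed
  have "crot ?b *v x - crot ?a *v x = of_parts ((exp (\<i> * ?b) - exp (\<i> * ?a)) *s pos_part x) ((exp (- (\<i> * ?b)) - exp (- (\<i> * ?a))) *s neg_part x)"
    unfolding crot_vec by (simp add: of_parts_def vec_eq_iff algebra_simps split: sum.split)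
  then have "(norm (crot ?b *v x - crot ?a *v x))\<^sup>2
     = 2 * ((cmod (exp (\<i> * ?b) - exp (\<i> * ?a)) * norm (pos_part x))\<^sup>2 + (cmod (exp (- (\<i> * ?b)) - exp (- (\<i> * ?a))) * norm (neg_part x))\<^sup>2)"
    by (simp only: norm_parts[of "of_parts _ _"] pos_part_of_parts neg_part_of_parts norm_scale_cvec)
  also have "\<dots> \<le> 2 * ((4 * e * norm (pos_part x))\<^sup>2 + (4 * e * norm (neg_part x))\<^sup>2)"
    using phase_diff[of 1] phase_diff[of "-1"] by (intro mult_left_mono add_mono power_mono mult_right_mono) simp_all
  also have "\<dots> = (4 * e * norm x)\<^sup>2" by (simp only: power_mult_distrib norm_parts[of x]) (simp add: algebra_simps)
  finally show ?thesis by (rule power2_le_imp_le) (use assms in simp)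
qed

lemma norm_matrix_vec_columns:
  fixes A :: "complex^'m^'k"
  shows "(norm (A *v z))\<^sup>2 \<le> (\<Sum>k\<in>UNIV. (norm (A *v axis k 1))\<^sup>2) * (norm z)\<^sup>2"
proof -
  have "norm (A *v z) = norm (\<Sum>k\<in>UNIV. z $ k *s (A *v axis k 1))"
    by (rule arg_cong[where f = norm]) (simp add: vec_eq_iff matrix_vector_mult_axis matrix_vector_mult_def[of A z] mult.commute)
  also have "\<dots> \<le> (\<Sum>k\<in>UNIV. norm (A *v axis k 1) * cmod (z $ k))"
    by (rule order_trans[OF norm_sum]) (simp add: norm_scale_cvec mult.commute)
  finally have "(norm (A *v z))\<^sup>2 \<le> (\<Sum>k\<in>UNIV. norm (A *v axis k 1) * cmod (z $ k))\<^sup>2" by (rule power_mono) simp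
  also have "\<dots> \<le> (\<Sum>k\<in>UNIV. (norm (A *v axis k 1))\<^sup>2) * (\<Sum>k\<in>UNIV. (cmod (z $ k))\<^sup>2)" by (rule Cauchy_Schwarz_ineq_sum)
  finally show ?thesis by (simp only: norm_cvec_sq[of z])
qed

lemma cplx_J0_cplx_J0: "cplx J0 *v (cplx J0 *v v) = - v" and norm_cplx_J0: "norm (cplx J0 *v v) = norm v"
  for v :: "'n::finite cvec"
proof -
  show "cplx J0 *v (cplx J0 *v v) = - v" by (simp add: vec_sum_eq_iff cplx_J0_vec)
  show "norm (cplx J0 *v v) = norm v"
    by (rule power2_eq_imp_eq) (simp_all add: norm_cvec_sq sum_UNIV_Plus cplx_J0_vec add.commute)
qed

lemma rot_resolvent_columns_lower_bound:
  fixes W :: "'n::finite sqm"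
  assumes W: "W \<in> Sp" and x: "cplx W *v x = crot (complex_of_real b) *v x" "x \<noteq> 0"
    and e: "\<bar>\<beta> - b\<bar> \<le> e" "0 < e" "e \<le> 1 / 4"
  shows "1 \<le> (\<Sum>k\<in>UNIV. (norm ((matrix_inv (cplx W - crot (Complex \<beta> e)) ** cplx J0) *v axis k 1))\<^sup>2) * (16 * e\<^sup>2)"
proof -
  let ?M = "cplx W - crot (Complex \<beta> e)"
  define T where "T = (\<Sum>k\<in>UNIV. (norm ((matrix_inv ?M ** cplx J0) *v axis k 1))\<^sup>2)"
  define z where "z = - (cplx J0 *v (?M *v x))"
  have "(matrix_inv ?M ** cplx J0) *v z = x"
    using matrix_inv_cancel(2)[OF rot_det_nonzero(1)[OF W], of "Complex \<beta> e" x] e(2)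
    by (simp add: z_def matrix_vec_mult.minus_right cplx_J0_cplx_J0 flip: matrix_vector_mul_assoc)
  then have "(norm x)\<^sup>2 \<le> T * (norm z)\<^sup>2" using norm_matrix_vec_columns[of "matrix_inv ?M ** cplx J0" z] by (simp add: T_def)
  also have "norm z = norm (crot (complex_of_real b) *v x - crot (Complex \<beta> e) *v x)"
    by (simp add: z_def norm_cplx_J0 matrix_vec_mult.diff_left x)
  also have "T * (norm (crot (complex_of_real b) *v x - crot (Complex \<beta> e) *v x))\<^sup>2 \<le> T * (4 * e * norm x)\<^sup>2"
    using norm_crot_diff[OF e, of x] by (intro mult_left_mono power_mono) (simp_all add: T_def sum_nonneg)
  finally have "1 * (norm x)\<^sup>2 \<le> (T * (16 * e\<^sup>2)) * (norm x)\<^sup>2" by (simp add: power_mult_distrib mult_ac)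
  then show ?thesis unfolding T_def by (rule mult_right_le_imp_le) (use x in simp)
qed

lemma one_minus_exp_ge:
  assumes "0 < e" "e \<le> 1 / 4"
  shows "e \<le> 1 - exp (- (2 * e :: real))"
proof -
  have "1 + 2 * e \<le> exp (2 * e)" by (rule exp_ge_add_one_self)
  then have "exp (- (2 * e)) \<le> 1 / (1 + 2 * e)" using assms by (simp add: exp_minus field_simps)
  also have "\<dots> \<le> 1 - e"
  proof -
    have "1 \<le> (1 - e) * (1 + 2 * e)" using assms mult_right_mono[of e "1/2" e] by (simp add: algebra_simps)
    then show ?thesis using assms by (simp add: pos_divide_le_eq)
  qed
  finally show ?thesis by simp
qed

lemma Im_trace_rot_lower_bound:
  fixes W :: "'n::finite sqm"
  assumes W: "W \<in> Sp" and x: "cplx W *v x = crot (complex_of_real b) *v x" "x \<noteq> 0"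
    and e: "\<bar>\<beta> - b\<bar> \<le> e" "0 < e" "e \<le> 1 / 4"
  defines "Mi \<equiv> matrix_inv (cplx W - crot (Complex \<beta> e))"
  shows "1 / (32 * e) \<le> Im (trace (cplx W ** Mi ** cplx J0))"
proof -
  define T where "T = (\<Sum>k\<in>UNIV. (norm ((Mi ** cplx J0) *v axis k 1))\<^sup>2)"
  have "1 \<le> T * (16 * e\<^sup>2)" unfolding T_def Mi_def by (rule rot_resolvent_columns_lower_bound[OF W x e])
  then have "1 / (32 * e) \<le> e * T / 2" using e by (simp add: field_simps power2_eq_square)
  also have "e * T \<le> (1 - exp (- (2 * e))) * T"
    by (rule mult_right_mono[OF one_minus_exp_ge[OF e(2,3)]]) (simp add: T_def sum_nonneg)
  also have "(1 - exp (- (2 * e))) * T / 2 = (1 - exp (- (2 * e))) / 2 * T" by simp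
  also have "\<dots> \<le> Im (trace (cplx W ** Mi ** cplx J0))"
  proof -
    have axis: "of_real_vec (axis k 1) = axis k 1" for k :: "'n + 'n" by (simp add: of_real_vec_def axis_def vec_eq_iff)
    have diagonal: "(\<Sum>j\<in>UNIV. complex_of_real (axis k 1 $ j) * (B *v axis k 1) $ j) = B $ k $ k" for k and B :: "complex^('n + 'n)^('n + 'n)"
      unfolding matrix_vector_mult_axis by (simp add: axis_def if_distrib if_distribR cong: if_cong)
    have "(1 - exp (- (2 * e))) / 2 * (norm ((Mi ** cplx J0) *v axis k 1))\<^sup>2 \<le> Im ((cplx W ** Mi ** cplx J0) $ k $ k)" for k
      using Im_rot_resolvent[OF W, of "Complex \<beta> e" "axis k 1"] e(2) unfolding Mi_def[symmetric] axis diagonal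
      by (simp add: matrix_vector_mul_assoc)
    then show ?thesis unfolding T_def sum_distrib_left trace_def Im_sum by (rule sum_mono)
  qed
  finally show ?thesis by simp
qed

lemma has_vector_derivative_crot:
  "((\<lambda>\<beta>. crot (Complex \<beta> e)) has_vector_derivative cplx (J0 :: 'n::finite sqm) ** crot (Complex \<beta> e)) (at \<beta> within S)"
proof -
  have "((\<lambda>\<beta>. complex_of_real \<beta> + \<i> * complex_of_real e) has_vector_derivative 1) (at \<beta> within S)"
    by (auto intro!: derivative_eq_intros)
  then have C: "((\<lambda>\<beta>. Complex \<beta> e) has_vector_derivative 1) (at \<beta> within S)" by (simp add: Complex_eq)
  have "((\<lambda>\<beta>. cos (Complex \<beta> e)) has_vector_derivative - sin (Complex \<beta> e)) (at \<beta> within S)"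
    using field_vector_diff_chain_within[OF C, of cos "- sin (Complex \<beta> e)"] by (simp add: o_def DERIV_cos has_field_derivative_at_within)
  moreover have "((\<lambda>\<beta>. sin (Complex \<beta> e)) has_vector_derivative cos (Complex \<beta> e)) (at \<beta> within S)"
    using field_vector_diff_chain_within[OF C, of sin "cos (Complex \<beta> e)"] by (simp add: o_def DERIV_sin has_field_derivative_at_within)
  ultimately have "((\<lambda>\<beta>. crot (Complex \<beta> e)) has_vector_derivative mat (- sin (Complex \<beta> e)) + mat (cos (Complex \<beta> e)) ** cplx (J0 :: 'n sqm)) (at \<beta> within S)"
    unfolding crot_def
    by (intro has_vector_derivative_add bounded_linear.has_vector_derivative[OF bounded_linear_mat]
        bounded_linear.has_vector_derivative[OF matrix_mult.bounded_linear_left])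
  moreover have "mat (- sin a) + mat (cos a) ** cplx (J0 :: 'n sqm) = cplx J0 ** crot a" for a
    unfolding matrix_eq vec_sum_eq_iff
    by (simp add: crot_def matrix_vec_mult.add_left mat_vec cplx_J0_vec flip: matrix_vector_mul_assoc)
  ultimately show ?thesis by (simp only:)
qed

lemma rot_det_drop:
  fixes W :: "'n::finite sqm"
  assumes W: "W \<in> Sp" and x: "cplx W *v x = crot (complex_of_real b) *v x" "x \<noteq> 0" and e: "0 < e" "e \<le> 1 / 4"
    and l: "continuous_on {b - e..b + e} l" and el: "\<And>\<beta>. \<beta> \<in> {b - e..b + e} \<Longrightarrow> exp (l \<beta>) = rot_det (Complex \<beta> e) W"
  shows "Im (l (b + e)) + 1 / 16 \<le> Im (l (b - e))"
proof -
  define M where "M \<beta> = cplx W - crot (Complex \<beta> e)" for \<beta>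
  have inv: "invertible (M \<beta>)" for \<beta> unfolding M_def using rot_det_nonzero(1)[OF W] e by simp
  obtain \<beta> where \<beta>: "\<beta> \<in> {b - e..b + e}"
    "Im (l (b + e)) - Im (l (b - e)) = ((b + e) - (b - e)) * Im (trace (matrix_inv (M \<beta>) ** (0 - cplx J0 ** crot (Complex \<beta> e))))"
  proof (rule Im_log_det_mean_value[OF l, of M])
    show "(M has_vector_derivative (0 - cplx J0 ** crot (Complex \<beta> e))) (at \<beta> within {b - e..b + e})" for \<beta>
      unfolding M_def by (intro has_vector_derivative_diff has_vector_derivative_const has_vector_derivative_crot)
  qed (use e inv el in \<open>simp_all add: rot_det_def M_def\<close>)
  have "- trace (matrix_inv (M \<beta>) ** (0 - cplx J0 ** crot (Complex \<beta> e))) = trace (matrix_inv (M \<beta>) ** (cplx J0 ** crot (Complex \<beta> e)))"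
    by (simp add: matrix_mult.minus_right) (simp add: trace_def sum_negf)
  also have "\<dots> = trace (matrix_inv (M \<beta>) ** (cplx J0 ** cplx W)) - trace (matrix_inv (M \<beta>) ** (cplx J0 ** M \<beta>))"
    by (simp add: M_def matrix_mult.diff_right trace_sub)
  also have "trace (matrix_inv (M \<beta>) ** (cplx J0 ** M \<beta>)) = trace (cplx (J0 :: 'n sqm))"
    using trace_mul_sym[of "matrix_inv (M \<beta>)" "cplx J0 ** M \<beta>"] matrix_inv_right[OF inv] by (simp flip: matrix_mul_assoc)
  also have "\<dots> = 0" by (simp add: trace_def cplx_def J0_def sum_UNIV_Plus)
  also have "trace (matrix_inv (M \<beta>) ** (cplx J0 ** cplx W)) = trace (cplx W ** (matrix_inv (M \<beta>) ** cplx J0))"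
    using trace_mul_sym[of "matrix_inv (M \<beta>) ** cplx J0" "cplx W"] by (simp add: matrix_mul_assoc)
  finally have "1 / (32 * e) \<le> - Im (trace (matrix_inv (M \<beta>) ** (0 - cplx J0 ** crot (Complex \<beta> e))))"
    using Im_trace_rot_lower_bound[OF W x, of \<beta> e] \<beta>(1) e unfolding uminus_complex.sel(2)[symmetric]
    by (simp add: M_def matrix_mul_assoc abs_le_iff)
  from mult_left_mono[OF this, of "2 * e"] show ?thesis using \<beta>(2) e by simp
qed

section \<open>Causal curves below an elliptic point\<close>

lemma continuous_on_rot_det:
  assumes "continuous_on S f" "continuous_on S g"
  shows "continuous_on S (\<lambda>x. rot_det (f x) (g x))"
  unfolding rot_det_def crot_def
  by (intro continuous_on_det continuous_on_diff continuous_on_add matrix_mult.continuous_on continuous_on_const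
      bounded_linear.continuous_on[OF bounded_linear_cplx] bounded_linear.continuous_on[OF bounded_linear_mat]
      continuous_on_compose2[OF continuous_at_imp_continuous_on[of UNIV cos] assms(1)]
      continuous_on_compose2[OF continuous_at_imp_continuous_on[of UNIV sin] assms(1)] assms(2)) auto

definition rot :: "real \<Rightarrow> 'n::finite sqm" where "rot \<beta> = cos \<beta> *\<^sub>R mat 1 + sin \<beta> *\<^sub>R J0"

lemma rot_vec: "rot \<beta> *v x = cos \<beta> *\<^sub>R x + sin \<beta> *\<^sub>R (J0 *v x)"
  by (simp add: rot_def matrix_vec_linear)

lemma crot_of_real: "crot (complex_of_real \<beta>) = cplx (rot \<beta>)"
proof (rule matrix_eq[THEN iffD2], rule allI)
  fix x :: "'a cvec"
  have "cplx (rot \<beta>) *v x = cos \<beta> *\<^sub>R x + sin \<beta> *\<^sub>R (cplx J0 *v x)"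
    unfolding rot_def bounded_linear.linear[OF bounded_linear_cplx, THEN linear_add]
    by (simp add: bounded_linear.linear[OF bounded_linear_cplx, THEN linear_scale] cplx_one matrix_vec_linear)
  moreover have "crot (complex_of_real \<beta>) *v x = complex_of_real (cos \<beta>) *s x + complex_of_real (sin \<beta>) *s (cplx J0 *v x)"
    by (simp add: crot_def matrix_vec_mult.add_left mat_vec cos_of_real sin_of_real flip: matrix_vector_mul_assoc)
  ultimately show "crot (complex_of_real \<beta>) *v x = cplx (rot \<beta>) *v x"
    by (simp add: vec_eq_iff scaleR_conv_of_real[where 'a = complex])
qed

lemma rot_det_of_real: "rot_det (complex_of_real \<beta>) W = complex_of_real (det (W - rot \<beta>))"
  by (simp add: rot_det_def crot_of_real det_cplx flip: cplx_diff)

lemma Sp_nonneg_det_rot: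
  assumes W: "W \<in> Sp_nonneg" and \<beta>: "\<beta> \<in> {pi<..<2 * pi}"
  shows "det (W - rot \<beta>) \<noteq> 0"
proof -
  have "invertible (W - rot \<beta>)"
    unfolding invertible_iff_kernel
  proof (intro allI impI)
    fix x assume "(W - rot \<beta>) *v x = 0"
    then have "W *v x = rot \<beta> *v x" by (simp add: matrix_vec_mult.diff_left)
    then have "omega0 x (W *v x) = sin \<beta> * (x \<bullet> x)"
      by (simp add: rot_vec omega.add_right omega.scaleR_right omega0_J0_right omega0_self)
    moreover have "omega0 x (W *v x) \<ge> 0" using W by (simp add: Sp_nonneg_def)
    moreover have "sin \<beta> < 0" using \<beta> by (intro sin_lt_zero) auto
    ultimately have "x \<bullet> x \<le> 0" by (simp add: zero_le_mult_iff)
    then show "x = 0" using inner_ge_zero[of x] by (metis inner_eq_zero_iff order_antisym)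
  qed
  then show ?thesis by (simp add: invertible_det_nz)
qed

definition rot_quot :: "complex \<Rightarrow> 'n::finite sqm \<Rightarrow> complex" where
  "rot_quot a W = rot_det a W / rot_det a (mat 1 :: 'n sqm)"

lemma rot_det_nonzero_Sp_nonneg:
  assumes "W \<in> Sp_nonneg" "Re a \<in> {pi<..<2 * pi}" "Im a \<ge> 0"
  shows "rot_det a W \<noteq> 0"
proof (cases "Im a = 0")
  case True
  then have "a = complex_of_real (Re a)" by (simp add: complex_eq_iff)
  then show ?thesis using rot_det_of_real[of "Re a" W] Sp_nonneg_det_rot[OF assms(1,2)] by simp
next
  case False
  then show ?thesis using rot_det_nonzero(2)[of W a] assms by (simp add: Sp_nonneg_def)
qed

lemma nonvanishing_rot_quot:
  assumes "Im a > 0" shows "nonvanishing_on_Sp (rot_quot a :: 'n::finite sqm \<Rightarrow> complex)"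
proof
  have nonzero: "rot_det a (mat 1 :: 'n sqm) \<noteq> 0" by (rule rot_det_nonzero(2)[OF Sp_one assms])
  show "continuous_on Sp (rot_quot a :: 'n sqm \<Rightarrow> complex)" unfolding rot_quot_def
    using nonzero by (intro continuous_on_divide continuous_on_rot_det continuous_on_const continuous_on_id) auto
  show "rot_quot a W \<noteq> 0" if "W \<in> Sp" for W :: "'n sqm"
    using nonzero rot_det_nonzero(2)[OF that assms] by (simp add: rot_quot_def)
  show "rot_quot a (mat 1 :: 'n sqm) = 1" using nonzero by (simp add: rot_quot_def)
qed

definition real_rot_quot :: "real \<Rightarrow> 'n::finite sqm \<Rightarrow> real" where
  "real_rot_quot \<beta> W = det (W - rot \<beta>) / det (mat 1 - rot \<beta> :: 'n sqm)"

lemma rot_quot_of_real: "rot_quot (complex_of_real \<beta>) W = complex_of_real (real_rot_quot \<beta> W)"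
  by (simp add: rot_quot_def real_rot_quot_def rot_det_of_real)

lemma real_rot_quot_Sp_nonneg:
  assumes \<beta>: "\<beta> \<in> {pi<..<2 * pi}"
  shows "W \<in> Sp_nonneg \<Longrightarrow> real_rot_quot \<beta> W \<noteq> 0" "real_rot_quot \<beta> (mat 1 :: 'n::finite sqm) = 1"
    "continuous_on S (real_rot_quot \<beta> :: 'n::finite sqm \<Rightarrow> real)"
  using Sp_nonneg_det_rot[OF Sp_nonneg_one \<beta>, where 'a = 'n] Sp_nonneg_det_rot[OF _ \<beta>, of W] unfolding real_rot_quot_def
  by (auto intro!: continuous_on_divide continuous_on_det continuous_on_diff continuous_on_const continuous_on_id
      simp: Sp_nonneg_det_rot[OF Sp_nonneg_one \<beta>])

lemma real_rot_quot_pos_path: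
  fixes g :: "real \<Rightarrow> 'n::finite sqm"
  assumes g: "continuous_on {0..1} g" "\<And>s. s \<in> {0..1} \<Longrightarrow> g s \<in> Sp_nonneg" "g 0 = mat 1" and \<beta>: "\<beta> \<in> {pi<..<2 * pi}"
    and s: "s \<in> {0..1}"
  shows "real_rot_quot \<beta> (g s) > 0"
proof (rule ccontr)
  assume "\<not> real_rot_quot \<beta> (g s) > 0"
  moreover have "continuous_on {0..s} (\<lambda>s. real_rot_quot \<beta> (g s))"
    by (rule continuous_on_compose2[OF real_rot_quot_Sp_nonneg(3)[OF \<beta>] continuous_on_subset[OF g(1)] subset_refl]) (use s in auto)
  ultimately obtain x where "0 \<le> x" "x \<le> s" "real_rot_quot \<beta> (g x) = 0"
    using IVT2'[of "\<lambda>s. real_rot_quot \<beta> (g s)" s 0 0] s by (auto simp: g(3) real_rot_quot_Sp_nonneg(2)[OF \<beta>])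
  then show False using real_rot_quot_Sp_nonneg(1)[OF \<beta> g(2), of x] s by auto
qed

text \<open>Following a logarithm along the other three sides of the square identifies its value at the corner.\<close>
lemma log_on_rectangle_eq_Ln:
  fixes F :: "real \<times> real \<Rightarrow> complex"
  assumes F: "continuous_on ({0..1} \<times> {0..1}) F" "\<And>p. p \<in> {0..1} \<times> {0..1} \<Longrightarrow> F p \<noteq> 0"
    and left: "\<And>t. t \<in> {0..1} \<Longrightarrow> F (0, t) = 1"
    and bottom: "\<And>s. s \<in> {0..1} \<Longrightarrow> F (s, 0) \<notin> \<real>\<^sub>\<le>\<^sub>0" and right: "\<And>t. t \<in> {0..1} \<Longrightarrow> F (1, t) \<notin> \<real>\<^sub>\<le>\<^sub>0"
    and l: "continuous_on {0..1} l" "l 0 = 0" "\<And>s. s \<in> {0..1} \<Longrightarrow> exp (l s) = F (s, 1)"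
  shows "l 1 = Ln (F (1, 1))"
proof -
  obtain L where L: "\<And>s t. s \<in> {0..1} \<Longrightarrow> t \<in> {0..1} \<Longrightarrow> exp (L s t) = F (s, t)"
    "\<And>t. t \<in> {0..1} \<Longrightarrow> continuous_on {0..1} (\<lambda>s. L s t)" "\<And>s. s \<in> {0..1} \<Longrightarrow> continuous_on {0..1} (L s)"
    by (rule continuous_log_on_rectangle[OF F]) (assumption, rule that)
  have sides: "continuous_on {0..1} (\<lambda>s. F (s, 0))" "continuous_on {0..1} (\<lambda>t. F (1, t))"
    by (auto intro!: continuous_on_compose2[OF F(1)] continuous_intros)
  have "l 1 - L 1 1 = l 0 - L 0 1"
    by (rule log_diff_constant[of "{0..1::real}"]) (use l L in auto)
  moreover have "L 0 1 - 0 = L 0 0 - 0"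
    by (rule log_diff_constant[of "{0..1::real}"]) (use L left in auto)
  moreover have "L 1 0 - Ln (F (1, 0)) = L 0 0 - Ln (F (0, 0))"
    by (rule log_diff_constant[of "{0..1::real}"])
      (use L F(2) bottom in \<open>auto intro!: continuous_on_Ln' sides\<close>)
  moreover have "L 1 1 - Ln (F (1, 1)) = L 1 0 - Ln (F (1, 0))"
    by (rule log_diff_constant[of "{0..1::real}"])
      (use L F(2) right in \<open>auto intro!: continuous_on_Ln' sides\<close>)
  ultimately show ?thesis using l(2) left[of 0] by (simp add: algebra_simps)
qed

text \<open>The spectral parameter is deformed to the real axis, where \<open>rot_quot\<close> is positive along the path.\<close>
lemma log_lift_rot_quot_eq_Ln:
  fixes g :: "real \<Rightarrow> 'n::finite sqm"
  assumes v: "v \<in> SpT" "g \<in> v" and g_nonneg: "\<And>s. s \<in> {0..1} \<Longrightarrow> g s \<in> Sp_nonneg"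
    and a: "Im a > 0" "Re a \<in> {pi<..<2 * pi}" and \<beta>: "\<beta> \<in> {pi<..<2 * pi}"
    and right: "\<And>\<tau>. \<tau> \<in> {0..1} \<Longrightarrow> rot_quot (complex_of_real \<beta> + of_real \<tau> * (a - complex_of_real \<beta>)) (g 1) \<notin> \<real>\<^sub>\<le>\<^sub>0"
  shows "log_lift (rot_quot a) v = Ln (rot_quot a (g 1))"
proof -
  have g: "sp_path g" using SpT_mem[OF v] by auto
  define b where "b \<tau> = complex_of_real \<beta> + of_real \<tau> * (a - complex_of_real \<beta>)" for \<tau>
  have b: "Re (b \<tau>) \<in> {pi<..<2 * pi}" "Im (b \<tau>) \<ge> 0" if "\<tau> \<in> {0..1}" for \<tau>
  proof -
    have "Re (b \<tau>) = (1 - \<tau>) * \<beta> + \<tau> * Re a" by (simp add: b_def algebra_simps)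
    moreover have "(1 - \<tau>) *\<^sub>R \<beta> + \<tau> *\<^sub>R Re a \<in> {pi<..<2 * pi}"
      by (rule convexD[OF _ \<beta> a(2)]) (use that in auto)
    ultimately show "Re (b \<tau>) \<in> {pi<..<2 * pi}" by simp
    show "Im (b \<tau>) \<ge> 0" using a(1) that by (simp add: b_def)
  qed
  have nonzero: "rot_det (b \<tau>) W \<noteq> 0" if "W \<in> Sp_nonneg" "\<tau> \<in> {0..1}" for \<tau> and W :: "'n sqm"
    by (rule rot_det_nonzero_Sp_nonneg[OF that(1) b[OF that(2)]])
  define F where "F p = rot_quot (b (snd p)) (g (fst p))" for p
  obtain l where l: "log_along (rot_quot a) g l"
    by (rule nonvanishing_on_Sp.log_exists[OF nonvanishing_rot_quot[OF a(1)] g])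
  have "l 1 = Ln (F (1, 1))"
  proof (rule log_on_rectangle_eq_Ln)
    show "continuous_on ({0..1} \<times> {0..1}) F"
      unfolding F_def rot_quot_def
      by (intro continuous_on_divide continuous_on_rot_det continuous_on_compose2[OF sp_pathD(6)[OF g]])
        (use nonzero[OF Sp_nonneg_one] in \<open>auto simp: b_def intro!: continuous_intros\<close>)
    show "F p \<noteq> 0" if "p \<in> {0..1} \<times> {0..1}" for p
      using that nonzero[OF Sp_nonneg_one] nonzero[OF g_nonneg] by (auto simp: F_def rot_quot_def)
    show "F (0, t) = 1" if "t \<in> {0..1}" for t
      using nonzero[OF Sp_nonneg_one that] sp_pathD(4)[OF g] by (simp add: F_def rot_quot_def)
    show "F (s, 0) \<notin> \<real>\<^sub>\<le>\<^sub>0" if "s \<in> {0..1}" for s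
      using real_rot_quot_pos_path[OF sp_pathD(6)[OF g] g_nonneg sp_pathD(4)[OF g] \<beta> that]
      by (simp add: F_def b_def rot_quot_of_real complex_nonpos_Reals_iff)
    show "F (1, t) \<notin> \<real>\<^sub>\<le>\<^sub>0" if "t \<in> {0..1}" for t using right[OF that] by (simp add: F_def b_def)
  qed (use l in \<open>auto simp: log_along_def F_def b_def\<close>)
  then show ?thesis
    using nonvanishing_on_Sp.log_lift_eq[OF nonvanishing_rot_quot[OF a(1)] v l] by (simp add: F_def b_def)
qed

lemma Im_Ln_small_near_pos_real:
  fixes \<Phi> :: "'a::metric_space \<Rightarrow> complex"
  assumes \<Phi>: "isCont \<Phi> p" "\<Phi> p = complex_of_real r" "r > 0" and \<eta>: "\<eta> > 0"
  obtains d where "d > 0" "\<And>q. dist q p < d \<Longrightarrow> \<Phi> q \<notin> \<real>\<^sub>\<le>\<^sub>0 \<and> \<bar>Im (Ln (\<Phi> q))\<bar> < \<eta>"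
proof -
  have lim: "(\<Phi> \<longlongrightarrow> complex_of_real r) (nhds p)"
    using \<Phi>(1)[unfolded isCont_def tendsto_at_iff_tendsto_nhds] unfolding \<Phi>(2) .
  have Ln: "((\<lambda>q. \<bar>Im (Ln (\<Phi> q))\<bar>) \<longlongrightarrow> \<bar>Im (Ln (complex_of_real r))\<bar>) (nhds p)"
    by (intro tendsto_intros lim) (use \<Phi>(3) in \<open>simp add: complex_nonpos_Reals_iff\<close>)
  have "\<forall>\<^sub>F q in nhds p. Re (\<Phi> q) > 0 \<and> \<bar>Im (Ln (\<Phi> q))\<bar> < \<eta>"
    by (intro eventually_conj order_tendstoD(1)[OF tendsto_Re[OF lim]] order_tendstoD(2)[OF Ln])
      (use \<Phi>(3) \<eta> in \<open>simp_all add: Ln_of_real\<close>)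
  then obtain d where "d > 0" "\<forall>q. dist q p < d \<longrightarrow> Re (\<Phi> q) > 0 \<and> \<bar>Im (Ln (\<Phi> q))\<bar> < \<eta>"
    unfolding eventually_nhds_metric by blast
  then show ?thesis by (intro that) (auto simp: complex_nonpos_Reals_iff)
qed

lemma real_rot_quot_pos_closure:
  fixes w :: "(real \<Rightarrow> 'n::finite sqm) set"
  assumes w: "w \<in> SpT_top closure_of SpT_ell_plus" and \<beta>: "\<beta> \<in> {pi<..<2 * pi}"
  shows "real_rot_quot \<beta> (proj w) > 0"
proof -
  have "real_rot_quot \<beta> (proj v) \<ge> 0" if v: "v \<in> SpT_ell_plus" for v :: "(real \<Rightarrow> 'n sqm) set"
  proof -
    obtain g where g: "v \<in> SpT" "g \<in> v" "\<And>s. s \<in> {0..1} \<Longrightarrow> g s \<in> Sp_nonneg"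
      by (rule SpT_ell_plus_path[OF v]) (rule that)
    have "sp_path g" using SpT_mem[OF g(1,2)] by auto
    then have "real_rot_quot \<beta> (g 1) > 0" by (intro real_rot_quot_pos_path g(3) \<beta> sp_pathD) simp_all
    then show ?thesis using proj_eq[OF g(1,2)] by (simp add: pathfinish_def)
  qed
  moreover have "closed {W :: 'n sqm. 0 \<le> real_rot_quot \<beta> W}"
    by (intro closed_Collect_le continuous_on_const real_rot_quot_Sp_nonneg(3)[OF \<beta>])
  ultimately have "closure (proj ` SpT_ell_plus) \<subseteq> {W :: 'n sqm. 0 \<le> real_rot_quot \<beta> W}"
    by (intro closure_minimal) auto
  then have "0 \<le> real_rot_quot \<beta> (proj w)" using continuous_map_closure_of_mem_closure[OF w continuous_map_proj] by blast
  then show ?thesis using real_rot_quot_Sp_nonneg(1)[OF \<beta> closure_proj_Sp_nonneg[OF w]] by simp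
qed

lemma Ln_rot_quot_small_near_real:
  fixes W :: "'n::finite sqm"
  assumes \<beta>: "\<beta> \<in> {pi<..<2 * pi}" and W: "real_rot_quot \<beta> W > 0" and \<eta>: "\<eta> > 0"
  obtains d where "d > 0" "\<And>V a. dist (V, a) (W, complex_of_real \<beta>) < d \<Longrightarrow> rot_quot a V \<notin> \<real>\<^sub>\<le>\<^sub>0 \<and> \<bar>Im (Ln (rot_quot a V))\<bar> < \<eta>"
proof -
  have "rot_det (complex_of_real \<beta>) (mat 1 :: 'n sqm) \<noteq> 0" using Sp_nonneg_det_rot[OF Sp_nonneg_one \<beta>] by (simp add: rot_det_of_real)
  moreover have "isCont (\<lambda>p. rot_det (snd p) (f p)) q" if "continuous_on UNIV f" for f :: "'n sqm \<times> complex \<Rightarrow> 'n sqm" and q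
    by (rule continuous_on_eq_continuous_at[THEN iffD1, rule_format, OF open_UNIV _ UNIV_I])
      (intro continuous_on_rot_det continuous_on_snd continuous_on_id that)
  ultimately have "isCont (\<lambda>p. rot_quot (snd p) (fst p)) (W, complex_of_real \<beta>)"
    unfolding rot_quot_def by (auto intro!: continuous_divide continuous_on_fst continuous_on_id continuous_on_const)
  then show thesis
    by (rule Im_Ln_small_near_pos_real[OF _ _ W \<eta>]) (use that in \<open>force simp: rot_quot_of_real\<close>)+
qed

lemma log_lift_rot_quot_small:
  fixes w :: "(real \<Rightarrow> 'n::finite sqm) set"
  assumes w: "w \<in> SpT_top closure_of SpT_ell_plus" and \<beta>: "\<beta> \<in> {pi<..<2 * pi}" and \<eta>: "\<eta> > 0"
  obtains d where "d > 0" "\<And>a. Im a > 0 \<Longrightarrow> dist a (complex_of_real \<beta>) < d \<Longrightarrow> \<bar>Im (log_lift (rot_quot a) w)\<bar> < \<eta>"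
proof -
  let ?\<beta> = "complex_of_real \<beta>"
  obtain d where d: "d > 0" "\<And>V a. dist (V, a) (proj w, ?\<beta>) < d \<Longrightarrow> rot_quot a V \<notin> \<real>\<^sub>\<le>\<^sub>0 \<and> \<bar>Im (Ln (rot_quot a V))\<bar> < \<eta> / 2"
    by (rule Ln_rot_quot_small_near_real[OF \<beta> real_rot_quot_pos_closure[OF w \<beta>] half_gt_zero[OF \<eta>]]) (rule that)
  define \<delta> where "\<delta> = min (d / 2) (min (\<beta> - pi) (2 * pi - \<beta>))"
  show ?thesis
  proof (rule that[of \<delta>])
    show "\<delta> > 0" using d(1) \<beta> by (simp add: \<delta>_def)
    fix a assume a: "Im a > 0" "dist a ?\<beta> < \<delta>"
    have "\<bar>Re a - \<beta>\<bar> < \<delta>" using a(2) abs_Re_le_cmod[of "a - ?\<beta>"] by (simp add: dist_norm)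
    then have Re_a: "Re a \<in> {pi<..<2 * pi}" by (auto simp: \<delta>_def)
    let ?f = "\<lambda>v :: (real \<Rightarrow> 'n sqm) set. (proj v, log_lift (rot_quot a) v)"
    have "continuous_map SpT_top (prod_topology euclidean euclidean) ?f"
      by (intro continuous_map_pairedI continuous_map_proj nonvanishing_on_Sp.continuous_log_lift nonvanishing_rot_quot a(1))
    then have "?f w \<in> closure (?f ` SpT_ell_plus)" by (intro continuous_map_closure_of_mem_closure[OF w]) simp
    then obtain v where v: "v \<in> SpT_ell_plus" "dist (?f v) (?f w) < min (d / 2) (\<eta> / 2)"
      using d(1) \<eta> by (auto simp: closure_approachable dest!: spec[of _ "min (d / 2) (\<eta> / 2)"])
    obtain g where g: "v \<in> SpT" "g \<in> v" "\<And>s. s \<in> {0..1} \<Longrightarrow> g s \<in> Sp_nonneg"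
      by (rule SpT_ell_plus_path[OF v(1)]) (rule that)
    have proj_v: "proj v = g 1" using proj_eq[OF g(1,2)] by (simp add: pathfinish_def)
    have near: "dist (g 1, b) (proj w, ?\<beta>) < d" if "dist b ?\<beta> < \<delta>" for b
    proof -
      have "dist (g 1, b) (proj w, ?\<beta>) \<le> dist (g 1) (proj w) + dist b ?\<beta>"
        unfolding dist_Pair_Pair by (rule sqrt_sum_squares_le_sum) auto
      then show ?thesis using dist_fst_le[of "?f v" "?f w"] v(2) that by (simp add: proj_v \<delta>_def)
    qed
    have "log_lift (rot_quot a) v = Ln (rot_quot a (g 1))"
    proof (rule log_lift_rot_quot_eq_Ln[OF g a(1) Re_a \<beta>])
      fix \<tau> :: real assume \<tau>: "\<tau> \<in> {0..1}"
      let ?b = "?\<beta> + of_real \<tau> * (a - ?\<beta>)"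
      have "dist ?b ?\<beta> = \<tau> * dist a ?\<beta>" using \<tau> by (simp add: dist_norm norm_mult)
      also have "\<dots> \<le> 1 * dist a ?\<beta>" by (rule mult_right_mono) (use \<tau> in auto)
      finally show "rot_quot ?b (g 1) \<notin> \<real>\<^sub>\<le>\<^sub>0" using d(2)[OF near[of ?b]] a(2) by simp
    qed
    moreover have "\<bar>Im (Ln (rot_quot a (g 1)))\<bar> < \<eta> / 2" using d(2)[OF near[OF a(2)]] by simp
    moreover have "\<bar>Im (log_lift (rot_quot a) v - log_lift (rot_quot a) w)\<bar> < \<eta> / 2"
      using v(2) dist_snd_le[of "?f v" "?f w"] abs_Im_le_cmod[of "log_lift (rot_quot a) v - log_lift (rot_quot a) w"]
      by (simp add: dist_norm)
    ultimately show "\<bar>Im (log_lift (rot_quot a) w)\<bar> < \<eta>" by (simp add: abs_if split: if_splits)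
  qed
qed

lemma homogeneous_quotient_minimum:
  fixes f n :: "'a::euclidean_space \<Rightarrow> real"
  assumes cont: "continuous_on UNIV f" "continuous_on UNIV n"
    and hom: "\<And>k v. f (k *\<^sub>R v) = k\<^sup>2 * f v" "\<And>k v. n (k *\<^sub>R v) = k\<^sup>2 * n v"
    and n: "\<And>v. v \<noteq> 0 \<Longrightarrow> n v > 0" and w: "f w < 0"
  obtains v c where "v \<noteq> 0" "c > 0" "f v + c * n v = 0" "\<And>u. f u + c * n u \<ge> 0"
proof -
  have zero: "f 0 = 0" "n 0 = 0" using hom[of 0 0] by simp_all
  then have "w \<noteq> 0" using w by auto
  let ?S = "sphere 0 1 :: 'a set"
  have "n v \<noteq> 0" if "v \<in> ?S" for v using n[of v] that by force
  then have "continuous_on ?S (\<lambda>v. f v / n v)"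
    by (intro continuous_on_divide continuous_on_subset[OF cont(1)] continuous_on_subset[OF cont(2)]) auto
  moreover have "?S \<noteq> {}" using \<open>w \<noteq> 0\<close> by (intro ex_in_conv[THEN iffD1] exI[of _ "(1 / norm w) *\<^sub>R w"]) simp
  ultimately obtain v where v: "v \<in> ?S" "\<And>u. u \<in> ?S \<Longrightarrow> f v / n v \<le> f u / n u"
    using continuous_attains_inf[OF compact_sphere] by blast
  define c where "c = - (f v / n v)"
  have "v \<noteq> 0" using v(1) by auto
  have nonneg: "f u + c * n u \<ge> 0" for u
  proof (cases "u = 0")
    case False
    have "f v / n v \<le> f ((1 / norm u) *\<^sub>R u) / n ((1 / norm u) *\<^sub>R u)" using False by (intro v(2)) simp
    also have "\<dots> = f u / n u" unfolding hom using False by simp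
    finally have "- c \<le> f u / n u" by (simp add: c_def)
    then show ?thesis using n[OF False] by (simp add: pos_le_divide_eq)
  qed (simp add: zero)
  have "c > 0"
  proof (rule ccontr)
    assume "\<not> c > 0"
    then have "c * n w \<le> 0" using n[OF \<open>w \<noteq> 0\<close>] by (simp add: mult_le_0_iff)
    then show False using nonneg[of w] w by simp
  qed
  moreover have "f v + c * n v = 0" using n[OF \<open>v \<noteq> 0\<close>] by (simp add: c_def)
  ultimately show ?thesis using that \<open>v \<noteq> 0\<close> nonneg by blast
qed

text \<open>The Euler--Lagrange equation; it factorises as \<open>(W + 2 c J)\<^sup>2 v = (1 - 4 c\<^sup>2) v\<close>.\<close>
lemma Sp_form_minimum_equation:
  assumes W: "W \<in> Sp"
    and nonneg: "\<And>u. omega0 u (W *v u) + c * (u \<bullet> u + (W *v u) \<bullet> (W *v u)) \<ge> 0"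
    and v: "omega0 v (W *v v) + c * (v \<bullet> v + (W *v v) \<bullet> (W *v v)) = 0"
  shows "W *v (W *v v) = v - (2 * c) *\<^sub>R (W *v (J0 *v v)) - (2 * c) *\<^sub>R (J0 *v (W *v v))"
proof -
  define B where "B u x = omega0 u (W *v x) + c * (u \<bullet> x + (W *v u) \<bullet> (W *v x))" for u x
  have "bilinear B"
    unfolding bilinear_def linear_iff
    by (simp add: B_def matrix_vec_linear omega_linear inner_add_left inner_add_right algebra_simps)
  then have kernel: "B v u + B u v = 0" for u
    by (rule psd_form_kernel[OF _ subspace_UNIV]) (use nonneg v in \<open>simp_all add: B_def\<close>)
  define Z where "Z = W *v (W *v v) - v + (2 * c) *\<^sub>R (W *v (J0 *v v) + J0 *v (W *v v))"
  have "omega0 (W *v u) Z = 0" for u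
  proof -
    have "omega0 (W *v u) Z = omega0 u (W *v v) + omega0 v (W *v u) + 2 * c * (u \<bullet> v + (W *v u) \<bullet> (W *v v))"
      using omega0_antisym[of "W *v u" v] by (simp add: Z_def omega_linear Sp_omega0[OF W] omega0_J0_right)
    also have "\<dots> = B v u + B u v" by (simp add: B_def inner_commute algebra_simps)
    finally show ?thesis by (simp add: kernel)
  qed
  then have "Z = 0" by (rule Sp_orthogonal_image_imp_0[OF W])
  then show ?thesis by (simp add: Z_def algebra_simps)
qed

lemma not_Sp_nonneg_imp_rot_eigenvector:
  fixes W :: "'n::finite sqm"
  assumes W: "W \<in> Sp" "W \<notin> Sp_nonneg"
  obtains \<beta> x where "\<beta> \<in> {pi<..<2 * pi}" "x \<noteq> 0" "W *v x = rot \<beta> *v x"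
proof -
  define n where "n v = v \<bullet> v + (W *v v) \<bullet> (W *v v)" for v
  have n: "n v > 0" if "v \<noteq> 0" for v using that by (simp add: n_def add_pos_nonneg)
  obtain v0 where v0: "omega0 v0 (W *v v0) < 0" using W by (auto simp: Sp_nonneg_def not_le)
  obtain v c where v: "v \<noteq> 0" "c > 0" "omega0 v (W *v v) + c * n v = 0" "\<And>u. omega0 u (W *v u) + c * n u \<ge> 0"
  proof (rule homogeneous_quotient_minimum[where f = "\<lambda>v. omega0 v (W *v v)" and n = n and w = v0])
    show "continuous_on UNIV (\<lambda>v. omega0 v (W *v v))" "continuous_on UNIV n" unfolding n_def
      by (intro omega.continuous_on matrix_vec_mult.continuous_on continuous_on_const continuous_on_id continuous_on_add continuous_on_inner)+
  qed (use v0 n in \<open>simp_all add: n_def matrix_vec_linear omega_linear power2_eq_square algebra_simps\<close>)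
  have "- omega0 v (W *v v) \<le> norm v * norm (W *v v)" using omega0_le_norm[of v "W *v v"] by simp
  also have "\<dots> \<le> n v / 2" using sum_squares_bound[of "norm v" "norm (W *v v)"] by (simp add: n_def dot_square_norm)
  finally have "c * n v \<le> 1 / 2 * n v" using v(3) by simp
  then have "c \<le> 1 / 2" by (rule mult_right_le_imp_le) (rule n[OF v(1)])
  then have "(2 * c)\<^sup>2 \<le> 1" using v(2) power_le_one[of "2 * c" 2] by simp
  define s where "s = sqrt (1 - (2 * c)\<^sup>2)"
  have s: "s\<^sup>2 = 1 - (2 * c)\<^sup>2" using \<open>(2 * c)\<^sup>2 \<le> 1\<close> by (simp add: s_def)
  have conclude: thesis if x: "x \<noteq> 0" "W *v x = k *\<^sub>R x - (2 * c) *\<^sub>R (J0 *v x)" and k: "k\<^sup>2 = s\<^sup>2" for k x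
  proof -
    have "k\<^sup>2 + (- (2 * c))\<^sup>2 = 1" using k s by simp
    then obtain t where t: "0 \<le> t" "t < 2 * pi" "k = cos t" "- (2 * c) = sin t" by (rule sincos_total_2pi)
    have "\<not> t \<le> pi" using sin_ge_zero[of t] t v(2) by auto
    moreover have "W *v x = rot t *v x" by (simp add: x(2) rot_vec t(3)) (simp add: t(4)[symmetric])
    ultimately show thesis using \<open>x \<noteq> 0\<close> t(2) by (intro \<open>\<And>\<beta> x. \<beta> \<in> {pi<..<2 * pi} \<Longrightarrow> x \<noteq> 0 \<Longrightarrow> W *v x = rot \<beta> *v x \<Longrightarrow> thesis\<close>[of t x]) auto
  qed
  define z where "z = W *v v + (2 * c) *\<^sub>R (J0 *v v) + s *\<^sub>R v"
  show thesis
  proof (cases "z = 0")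
    case True
    then have "W *v v = (- s) *\<^sub>R v - (2 * c) *\<^sub>R (J0 *v v)" by (simp add: z_def algebra_simps eq_neg_iff_add_eq_0)
    then show thesis using conclude[OF v(1), of "- s"] by simp
  next
    case False
    have "W *v z + (2 * c) *\<^sub>R (J0 *v z) - s *\<^sub>R z = (1 - (2 * c)\<^sup>2 - s\<^sup>2) *\<^sub>R v"
      using Sp_form_minimum_equation[OF W(1) v(4,3)[unfolded n_def]]
      by (simp add: z_def matrix_vec_linear algebra_simps power2_eq_square)
    then have "W *v z = s *\<^sub>R z - (2 * c) *\<^sub>R (J0 *v z)" by (simp add: s algebra_simps)
    then show thesis by (rule conclude[OF False]) simp
  qed
qed

lemma log_lift_rot_quot_lower_bound:
  fixes w :: "(real \<Rightarrow> 'n::finite sqm) set"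
  assumes c: "weakly_causal c D" "w \<in> SpT" "c \<in> w" and t: "t \<in> {0..1}"
    and x: "cplx (c t) *v x = crot (complex_of_real b) *v x" "x \<noteq> 0" and e: "0 < e" "e \<le> 1 / 4"
    and l: "continuous_on {b - e..b + e} l" "\<And>\<beta>. \<beta> \<in> {b - e..b + e} \<Longrightarrow> exp (l \<beta>) = rot_det (Complex \<beta> e) (mat 1 :: 'n sqm)"
  shows "Im (l (b + e)) - Im (l (b - e)) + 1 / 16 \<le> Im (log_lift (rot_quot (Complex (b - e) e)) w)"
proof -
  have path: "sp_path c" using SpT_mem[OF c(2,3)] by auto
  have ends: "b - e \<in> {b - e..b + e}" "b + e \<in> {b - e..b + e}" using e(1) by auto
  obtain H where H: "\<And>s \<beta>. s \<in> {0..1} \<Longrightarrow> \<beta> \<in> {b - e..b + e} \<Longrightarrow> exp (H s \<beta>) = rot_det (Complex \<beta> e) (c s)"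
    and H_cont: "\<And>\<beta>. \<beta> \<in> {b - e..b + e} \<Longrightarrow> continuous_on {0..1} (\<lambda>s. H s \<beta>)" "\<And>s. s \<in> {0..1} \<Longrightarrow> continuous_on {b - e..b + e} (H s)"
  proof (rule continuous_log_on_rectangle[of 0 1 "b - e" "b + e" "\<lambda>p. rot_det (Complex (snd p) e) (c (fst p))"])
    show "continuous_on ({0..1} \<times> {b - e..b + e}) (\<lambda>p. rot_det (Complex (snd p) e) (c (fst p)))"
      unfolding Complex_eq
      by (intro continuous_on_rot_det continuous_on_compose2[OF sp_pathD(6)[OF path]]) (auto intro!: continuous_intros)
    show "rot_det (Complex (snd p) e) (c (fst p)) \<noteq> 0" if "p \<in> {0..1} \<times> {b - e..b + e}" for p
      by (rule rot_det_nonzero(2)) (use that sp_pathD(5)[OF path] e(1) in auto)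
  qed (rule that, simp_all)
  have mono: "Im (H s \<beta>) \<le> Im (H s' \<beta>)" if "0 \<le> s" "s \<le> s'" "s' \<le> 1" "\<beta> \<in> {b - e..b + e}" for s s' \<beta>
    by (rule rot_det_mono[OF c(1) _ H_cont(1)[OF that(4)]]) (use that H e(1) in auto)
  have "Im (H 0 (b + e)) \<le> Im (H t (b + e))" by (rule mono) (use t ends in auto)
  also have "\<dots> + 1 / 16 \<le> Im (H t (b - e))"
    by (rule rot_det_drop[OF sp_pathD(5)[OF path t] x e H_cont(2)[OF t] H[OF t]])
  also have "\<dots> \<le> Im (H 1 (b - e))" by (rule mono) (use t ends in auto)
  finally have "Im (H 0 (b + e)) + 1 / 16 \<le> Im (H 1 (b - e))" by simp
  moreover have "H 0 (b - e) - l (b - e) = H 0 (b + e) - l (b + e)"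
    by (rule log_diff_constant[of "{b - e..b + e}"]) (use H H_cont l ends sp_pathD(4)[OF path] in auto)
  moreover have "log_along (rot_quot (Complex (b - e) e)) c (\<lambda>s. H s (b - e) - H 0 (b - e))"
    unfolding log_along_def using H ends sp_pathD(4)[OF path]
    by (auto simp: exp_diff rot_quot_def intro!: continuous_intros H_cont(1))
  from nonvanishing_on_Sp.log_lift_eq[OF nonvanishing_rot_quot c(2,3) this]
  have "log_lift (rot_quot (Complex (b - e) e)) w = H 1 (b - e) - H 0 (b - e)" using e(1) by simp
  ultimately show ?thesis by (simp add: complex_eq_iff)
qed

text \<open>If the curve left \<open>Sp_nonneg\<close>, the argument of \<open>rot_det\<close> would drop across the eigenvalue \<open>b\<close> by more than
  the small change of the lift allows.\<close>
theorem weakly_causal_in_Sp_nonneg: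
  fixes w :: "(real \<Rightarrow> 'n::finite sqm) set"
  assumes w: "w \<in> SpT_top closure_of SpT_ell_plus" and c: "weakly_causal c D" "c \<in> w" and t: "t \<in> {0..1}"
  shows "c t \<in> Sp_nonneg"
proof (rule ccontr)
  assume outside: "c t \<notin> Sp_nonneg"
  have w_SpT: "w \<in> SpT" using w by (simp add: in_closure_of topspace_SpT_top)
  have "c t \<in> Sp" using SpT_mem(2)[OF w_SpT c(2)] t by (simp add: sp_pathD(5))
  then obtain b x where b: "b \<in> {pi<..<2 * pi}" "x \<noteq> 0" "c t *v x = rot b *v x"
    using outside by (rule not_Sp_nonneg_imp_rot_eigenvector)
  let ?b = "complex_of_real b" and ?one = "mat 1 :: 'n sqm"
  have x: "cplx (c t) *v of_real_vec x = crot ?b *v of_real_vec x" "of_real_vec x \<noteq> 0"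
    using b(2,3) by (simp_all add: crot_of_real cplx_of_real_vec of_real_vec_eq_0)
  obtain d1 where d1: "d1 > 0" "\<And>a. Im a > 0 \<Longrightarrow> dist a ?b < d1 \<Longrightarrow> \<bar>Im (log_lift (rot_quot a) w)\<bar> < 1 / 64"
    by (rule log_lift_rot_quot_small[OF w b(1), of "1 / 64"]) simp_all
  define f where "f a = rot_det a ?one / rot_det ?b ?one" for a
  have nonzero: "rot_det ?b ?one \<noteq> 0" using Sp_nonneg_det_rot[OF Sp_nonneg_one b(1), where 'a = 'n] by (simp add: rot_det_of_real)
  have f_cont: "continuous_on S f" for S unfolding f_def using nonzero
    by (intro continuous_on_divide continuous_on_rot_det continuous_on_const continuous_on_id) auto
  from f_cont[of UNIV] have "isCont f ?b" by (simp add: continuous_on_eq_continuous_at)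
  then obtain d2 where d2: "d2 > 0" "\<And>a. dist a ?b < d2 \<Longrightarrow> f a \<notin> \<real>\<^sub>\<le>\<^sub>0 \<and> \<bar>Im (Ln (f a))\<bar> < 1 / 64"
    by (rule Im_Ln_small_near_pos_real[where \<Phi> = f and r = 1 and \<eta> = "1 / 64"]) (simp_all add: f_def nonzero)
  define e where "e = min (1 / 4) (min d1 d2 / 3)"
  have e: "0 < e" "e \<le> 1 / 4" "3 * e \<le> d1" "3 * e \<le> d2" using d1 d2 by (auto simp: e_def min_def)
  let ?a = "\<lambda>\<beta>. Complex \<beta> e"
  have near: "dist (?a \<beta>) ?b < 3 * e" if "\<beta> \<in> {b - e..b + e}" for \<beta>
    using cmod_le[of "?a \<beta> - ?b"] that e(1) by (auto simp: dist_norm)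
  have Ln_f: "f (?a \<beta>) \<notin> \<real>\<^sub>\<le>\<^sub>0 \<and> \<bar>Im (Ln (f (?a \<beta>)))\<bar> < 1 / 64" if "\<beta> \<in> {b - e..b + e}" for \<beta>
    using near[OF that] e(4) by (intro d2(2)) simp
  have ends: "b - e \<in> {b - e..b + e}" "b + e \<in> {b - e..b + e}" using e(1) by auto
  have "Im (Ln (f (?a (b + e))) + Ln (rot_det ?b ?one)) - Im (Ln (f (?a (b - e))) + Ln (rot_det ?b ?one)) + 1 / 16
      \<le> Im (log_lift (rot_quot (?a (b - e))) w)"
  proof (rule log_lift_rot_quot_lower_bound[OF c(1) w_SpT c(2) t x e(1,2)])
    have "continuous_on {b - e..b + e} (\<lambda>\<beta>. f (?a \<beta>))"
      unfolding Complex_eq by (intro continuous_on_compose2[OF f_cont[of UNIV]] continuous_intros) simp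
    then show "continuous_on {b - e..b + e} (\<lambda>\<beta>. Ln (f (?a \<beta>)) + Ln (rot_det ?b ?one))"
      using Ln_f by (intro continuous_on_add continuous_on_Ln' continuous_on_const) auto
    show "exp (Ln (f (?a \<beta>)) + Ln (rot_det ?b ?one)) = rot_det (?a \<beta>) ?one" if "\<beta> \<in> {b - e..b + e}" for \<beta>
    proof -
      have "f (?a \<beta>) \<noteq> 0" using Ln_f[OF that] by auto
      then show ?thesis using nonzero by (simp add: exp_add f_def)
    qed
  qed
  moreover have "\<bar>Im (log_lift (rot_quot (?a (b - e))) w)\<bar> < 1 / 64"
    using near[OF ends(1)] e(1,3) by (intro d1(2)) auto
  ultimately show False using Ln_f[OF ends(1)] Ln_f[OF ends(2)] by (simp add: abs_if split: if_splits)
qed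

section \<open>Length bound for positive elliptic curves\<close>

primrec matrix_pow :: "real^'m^'m \<Rightarrow> nat \<Rightarrow> real^'m^'m" where
  "matrix_pow Y 0 = mat 1"
| "matrix_pow Y (Suc k) = Y ** matrix_pow Y k"

lemma matrix_pow_commute: "Z ** Y = Y ** Z \<Longrightarrow> Z ** matrix_pow Y k = matrix_pow Y k ** Z"
proof (induction k)
  case (Suc k)
  have "Z ** matrix_pow Y (Suc k) = (Z ** Y) ** matrix_pow Y k" by (simp add: matrix_mul_assoc)
  also have "\<dots> = Y ** (Z ** matrix_pow Y k)" by (simp add: Suc.prems matrix_mul_assoc)
  also have "\<dots> = matrix_pow Y (Suc k) ** Z" by (simp add: Suc.IH[OF Suc.prems] matrix_mul_assoc)
  finally show ?case .
qed simp

lemma has_vector_derivative_matrix_pow_trace: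
  fixes Y :: "real \<Rightarrow> real^'m^'m"
  assumes Y: "(Y has_vector_derivative Y') (at t within S)"
  shows "\<exists>D. ((\<lambda>s. matrix_pow (Y s) k) has_vector_derivative D) (at t within S) \<and>
     (\<forall>Z. Z ** Y t = Y t ** Z \<longrightarrow> trace (Z ** D) = real k * trace (Z ** matrix_pow (Y t) (k - 1) ** Y'))"
proof (induction k)
  case 0
  show ?case by (intro exI[of _ 0]) (simp add: trace_def)
next
  case (Suc k)
  then obtain D where D: "((\<lambda>s. matrix_pow (Y s) k) has_vector_derivative D) (at t within S)"
    "\<And>Z. Z ** Y t = Y t ** Z \<Longrightarrow> trace (Z ** D) = real k * trace (Z ** matrix_pow (Y t) (k - 1) ** Y')" by blast
  have "trace (Z ** (Y t ** D + Y' ** matrix_pow (Y t) k)) = real (Suc k) * trace (Z ** matrix_pow (Y t) k ** Y')"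
    if Z: "Z ** Y t = Y t ** Z" for Z
  proof -
    have "(Z ** Y t) ** Y t = Y t ** (Z ** Y t)" by (simp only: Z matrix_mul_assoc[symmetric])
    then have "trace (Z ** (Y t ** D)) = real k * trace ((Z ** Y t) ** matrix_pow (Y t) (k - 1) ** Y')"
      using D(2) by (simp add: matrix_mul_assoc)
    also have "\<dots> = real k * trace (Z ** matrix_pow (Y t) k ** Y')"
      by (cases k) (simp_all add: matrix_mul_assoc)
    finally have left: "trace (Z ** (Y t ** D)) = real k * trace (Z ** matrix_pow (Y t) k ** Y')" .
    have "trace (Z ** (Y' ** matrix_pow (Y t) k)) = trace (matrix_pow (Y t) k ** (Z ** Y'))"
      using trace_mul_sym[of "Z ** Y'" "matrix_pow (Y t) k"] by (simp add: matrix_mul_assoc)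
    also have "\<dots> = trace (Z ** matrix_pow (Y t) k ** Y')" by (simp add: matrix_mul_assoc matrix_pow_commute[OF Z])
    finally show ?thesis using left by (simp add: matrix_mult.add_right trace_add algebra_simps)
  qed
  moreover have "((\<lambda>s. matrix_pow (Y s) (Suc k)) has_vector_derivative Y t ** D + Y' ** matrix_pow (Y t) k) (at t within S)"
    unfolding matrix_pow.simps by (rule matrix_mult.has_vector_derivative[OF Y D(1)])
  ultimately show ?case by (intro exI[of _ "Y t ** D + Y' ** matrix_pow (Y t) k"] conjI allI impI) simp_all
qed

lemma bounded_linear_trace: "bounded_linear (trace :: real^'m^'m \<Rightarrow> real)"
  unfolding linear_conv_bounded_linear[symmetric] by (rule linearI) (simp_all add: trace_def sum.distrib sum_distrib_left)

lemma has_vector_derivative_trace_matrix_pow: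
  fixes Y :: "real \<Rightarrow> real^'m^'m"
  assumes Y: "(Y has_vector_derivative Y') (at t within S)"
  shows "((\<lambda>s. trace (matrix_pow (Y s) k)) has_vector_derivative real k * trace (matrix_pow (Y t) (k - 1) ** Y')) (at t within S)"
proof -
  obtain D where D: "((\<lambda>s. matrix_pow (Y s) k) has_vector_derivative D) (at t within S)"
    "\<And>Z. Z ** Y t = Y t ** Z \<Longrightarrow> trace (Z ** D) = real k * trace (Z ** matrix_pow (Y t) (k - 1) ** Y')"
    using has_vector_derivative_matrix_pow_trace[OF Y, of k] by blast
  show ?thesis using bounded_linear.has_vector_derivative[OF bounded_linear_trace D(1)] D(2)[of "mat 1"] by simp
qed

definition doubled :: "('n \<Rightarrow> 'b) \<Rightarrow> 'n + 'n \<Rightarrow> 'b" where "doubled f k = (case k of Inl j \<Rightarrow> f j | Inr j \<Rightarrow> f j)"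

lemma doubled_simps [simp]: "doubled f (Inl j) = f j" "doubled f (Inr j) = f j"
  by (simp_all add: doubled_def)

lemma doubled_mult: "(\<lambda>k. doubled f k * doubled g k) = doubled (\<lambda>j. f j * g j)"
  by (auto simp: doubled_def fun_eq_iff split: sum.split)

definition cos_part :: "'n::finite sqm \<Rightarrow> 'n sqm" where "cos_part W = (1 / 2) *\<^sub>R (W + matrix_inv W)"

context
  fixes W M :: "'n::finite sqm" and \<theta> :: "'n \<Rightarrow> real"
  assumes W: "W \<in> Sp" and M: "M \<in> Sp" and nf: "W ** M = M ** block_rot \<theta>"
begin

lemma matrix_inv_normal_form: "matrix_inv W ** M = M ** block_rot (\<lambda>j. - \<theta> j)"
proof -
  have rot_inverse: "block_rot \<theta> ** block_rot (\<lambda>j. - \<theta> j) = mat 1"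
    unfolding matrix_eq
  proof
    fix u :: "real^('n+'n)"
    have cos_sin: "cos x * (cos x * y) + sin x * (sin x * y) = y" for x y :: real
      by (metis distrib_right mult.assoc mult_1 sin_cos_squared_add3)
    show "(block_rot \<theta> ** block_rot (\<lambda>j. - \<theta> j)) *v u = mat 1 *v u"
      by (simp add: vec_sum_eq_iff block_rot_vec algebra_simps cos_sin flip: matrix_vector_mul_assoc)
  qed
  have "matrix_inv W ** M = matrix_inv W ** (M ** block_rot \<theta>) ** block_rot (\<lambda>j. - \<theta> j)"
    by (simp add: rot_inverse flip: matrix_mul_assoc)
  also have "\<dots> = M ** block_rot (\<lambda>j. - \<theta> j)"
    unfolding nf[symmetric] using matrix_inv_left[OF Sp_invertible[OF W]] by (simp add: matrix_mul_assoc)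
  finally show ?thesis .
qed

lemma cos_part_normal_form: "cos_part W ** M = M ** diag_matrix (doubled (\<lambda>j. cos (\<theta> j)))"
proof -
  have "(1 / 2) *\<^sub>R (block_rot \<theta> + block_rot (\<lambda>j. - \<theta> j)) = diag_matrix (doubled (\<lambda>j. cos (\<theta> j)))"
    unfolding matrix_eq vec_sum_eq_iff by (simp add: matrix_vec_linear block_rot_vec diag_matrix_vec)
  then show ?thesis
    by (simp add: cos_part_def matrix_mult.scaleR_left matrix_mult.add_left nf matrix_inv_normal_form
        matrix_mult.scaleR_right[symmetric] matrix_mult.add_right[symmetric])
qed

lemma sin_part_normal_form: "(W - matrix_inv W) ** M = M ** (diag_matrix (doubled (\<lambda>j. 2 * sin (\<theta> j))) ** J0)"
proof -
  have "block_rot \<theta> - block_rot (\<lambda>j. - \<theta> j) = diag_matrix (doubled (\<lambda>j. 2 * sin (\<theta> j))) ** J0"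
    unfolding matrix_eq vec_sum_eq_iff
    by (simp add: matrix_vec_mult.diff_left block_rot_vec diag_matrix_vec J0_mult_vec flip: matrix_vector_mul_assoc)
  then show ?thesis
    by (simp add: matrix_mult.diff_left nf matrix_inv_normal_form matrix_mult.diff_right[symmetric])
qed

lemma matrix_pow_normal_form: "matrix_pow (cos_part W) k ** M = M ** diag_matrix (doubled (\<lambda>j. cos (\<theta> j) ^ k))"
proof (induction k)
  case 0
  have "doubled (\<lambda>j::'n. 1::real) = (\<lambda>i. 1)" by (auto simp: doubled_def fun_eq_iff split: sum.split)
  then show ?case by (simp add: diag_matrix_1)
next
  case (Suc k)
  have "matrix_pow (cos_part W) (Suc k) ** M = cos_part W ** (matrix_pow (cos_part W) k ** M)" by (simp add: matrix_mul_assoc)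
  also have "\<dots> = (cos_part W ** M) ** diag_matrix (doubled (\<lambda>j. cos (\<theta> j) ^ k))" by (simp add: Suc.IH matrix_mul_assoc)
  also have "\<dots> = M ** diag_matrix (doubled (\<lambda>j. cos (\<theta> j) ^ Suc k))"
    by (simp add: cos_part_normal_form diag_matrix_mult doubled_mult flip: matrix_mul_assoc)
  finally show ?case .
qed

lemma trace_conj_Sp: "trace A = trace (matrix_inv M ** (A ** M))"
  using trace_mul_sym[of "matrix_inv M" "A ** M"] matrix_inv_right[OF Sp_invertible[OF M]]
  by (simp flip: matrix_mul_assoc)

lemma matrix_inv_left_cancel: "matrix_inv M ** (M ** A) = A"
  using matrix_inv_left[OF Sp_invertible[OF M]] by (simp add: matrix_mul_assoc)

lemma trace_matrix_pow_cos_part: "trace (matrix_pow (cos_part W) k) = 2 * (\<Sum>j\<in>UNIV. cos (\<theta> j) ^ k)"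
  using trace_diag_matrix_mult[of "doubled (\<lambda>j. cos (\<theta> j) ^ k)" "mat 1 :: 'n sqm"]
  by (simp add: trace_conj_Sp[of "matrix_pow (cos_part W) k"] matrix_pow_normal_form matrix_inv_left_cancel sum_UNIV_Plus) (simp add: mat_def)

lemma trace_matrix_pow_sin:
  "trace (matrix_pow (cos_part W) k ** (W - matrix_inv W) ** X)
    = - (\<Sum>i\<in>UNIV. doubled (\<lambda>j. 2 * (cos (\<theta> j) ^ k * sin (\<theta> j))) i * (transpose M ** form_matrix X ** M) $ i $ i)"
proof -
  let ?K = "matrix_pow (cos_part W) k ** (W - matrix_inv W)" and ?d = "doubled (\<lambda>j. 2 * (cos (\<theta> j) ^ k * sin (\<theta> j)))"
  have diag: "diag_matrix (doubled (\<lambda>j. cos (\<theta> j) ^ k)) ** diag_matrix (doubled (\<lambda>j. 2 * sin (\<theta> j))) = diag_matrix ?d"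
    by (simp add: diag_matrix_mult doubled_mult mult_ac)
  have "?K ** M = (matrix_pow (cos_part W) k ** M) ** (diag_matrix (doubled (\<lambda>j. 2 * sin (\<theta> j))) ** J0)"
    by (simp only: matrix_mul_assoc[symmetric] sin_part_normal_form)
  also have "\<dots> = M ** (diag_matrix ?d ** J0)" unfolding matrix_pow_normal_form diag[symmetric] by (simp only: matrix_mul_assoc)
  finally have K: "?K ** M = M ** (diag_matrix ?d ** J0)" .
  have "?K = ?K ** (M ** matrix_inv M)" by (simp only: matrix_inv_right[OF Sp_invertible[OF M]] matrix_mul_rid)
  also have "\<dots> = ?K ** M ** matrix_inv M" by (simp only: matrix_mul_assoc)
  finally have "?K = M ** (diag_matrix ?d ** J0) ** matrix_inv M" by (simp only: K)
  then have "trace (?K ** X) = trace (matrix_inv M ** (M ** (diag_matrix ?d ** (J0 ** matrix_inv M ** X ** M))))"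
    using trace_conj_Sp[of "?K ** X"] by (simp add: matrix_mul_assoc)
  also have "\<dots> = trace (diag_matrix ?d ** (transpose M ** J0 ** X ** M))" by (simp only: matrix_inv_left_cancel J0_mult_matrix_inv_Sp[OF M])
  also have "transpose M ** J0 ** X ** M = - (transpose M ** form_matrix X ** M)"
    by (simp add: form_matrix_def matrix_mult.minus_left matrix_mult.minus_right matrix_mul_assoc)
  finally show ?thesis by (simp add: trace_diag_matrix_mult sum_negf)
qed

lemma trace_polynomial_sin:
  "(\<Sum>k\<le>m. a k * trace (matrix_pow (cos_part W) k ** (W - matrix_inv W) ** X))
    = - 2 * (\<Sum>i\<in>UNIV. doubled (\<lambda>j. (\<Sum>k\<le>m. a k * cos (\<theta> j) ^ k) * sin (\<theta> j)) i * (transpose M ** form_matrix X ** M) $ i $ i)"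
proof -
  let ?Q = "\<lambda>i. (transpose M ** form_matrix X ** M) $ i $ i"
  have "(\<Sum>k\<le>m. a k * - (doubled (\<lambda>j. 2 * (cos (\<theta> j) ^ k * sin (\<theta> j))) i * ?Q i))
      = - 2 * (doubled (\<lambda>j. (\<Sum>k\<le>m. a k * cos (\<theta> j) ^ k) * sin (\<theta> j)) i * ?Q i)" for i :: "'n + 'n"
    by (cases i) (simp_all add: sum_distrib_left sum_distrib_right sum_negf mult_ac)
  then show ?thesis
    unfolding trace_matrix_pow_sin sum_distrib_left sum_negf[symmetric] by (subst sum.swap) (simp flip: sum_distrib_left)
qed

lemma G_le_trace_polynomial_sin:
  assumes X: "X \<in> closure sp_plus" and a: "\<And>j. 1 - e \<le> - (\<Sum>k\<le>m. a k * cos (\<theta> j) ^ k) * sin (\<theta> j)" and e: "e \<le> 1"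
  shows "(1 - e) * (real CARD('n) * G X) \<le> (\<Sum>k\<le>m. a k * trace (matrix_pow (cos_part W) k ** (W - matrix_inv W) ** X)) / 4"
proof -
  define Q where "Q = transpose M ** form_matrix X ** M"
  have diagonal: "Q $ i $ i \<ge> 0" for i
  proof -
    have "Q $ i $ i = axis i 1 \<bullet> (Q *v axis i 1)" by (simp add: inner_axis' matrix_vector_mult_axis)
    also have "\<dots> = omega0 (M *v axis i 1) (X *v (M *v axis i 1))"
      unfolding Q_def matrix_vector_mul_assoc[symmetric] by (simp only: inner_transpose form_matrix_inner)
    finally show ?thesis using X by (simp add: closure_sp_plus)
  qed
  have "(1 - e) * (2 * real CARD('n) * G X) \<le> (1 - e) * trace Q"
    using G_le_trace[OF X M] e by (intro mult_left_mono) (simp_all add: Q_def)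
  also have "\<dots> = (\<Sum>i\<in>UNIV. (1 - e) * Q $ i $ i)" by (simp add: trace_def sum_distrib_left)
  also have "\<dots> \<le> (\<Sum>i\<in>UNIV. - doubled (\<lambda>j. (\<Sum>k\<le>m. a k * cos (\<theta> j) ^ k) * sin (\<theta> j)) i * Q $ i $ i)"
  proof (intro sum_mono mult_right_mono diagonal)
    show "1 - e \<le> - doubled (\<lambda>j. (\<Sum>k\<le>m. a k * cos (\<theta> j) ^ k) * sin (\<theta> j)) i" for i using a by (cases i) simp_all
  qed
  finally show ?thesis unfolding trace_polynomial_sin Q_def[symmetric] by (simp add: sum_negf algebra_simps)
qed

end

lemma cos_part_commute: "W \<in> Sp \<Longrightarrow> W ** cos_part W = cos_part W ** W"
  using matrix_inv_left[OF Sp_invertible, of W] matrix_inv_right[OF Sp_invertible, of W]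
  by (simp add: cos_part_def matrix_mult.scaleR_left matrix_mult.scaleR_right matrix_mult.add_left matrix_mult.add_right)

lemma has_vector_derivative_trace_matrix_pow_cos_part:
  assumes c: "Sp_curve c D" and t: "t \<in> {0..1}"
  shows "((\<lambda>s. trace (matrix_pow (cos_part (c s)) (Suc k))) has_vector_derivative
     real (Suc k) / 2 * trace (matrix_pow (cos_part (c t)) k ** (c t - matrix_inv (c t)) ** logder c t)) (at t within {0..1})"
proof -
  note C = Sp_curveD[OF c]
  let ?W = "c t" and ?X = "logder c t" and ?Q = "matrix_pow (cos_part (c t)) k"
  let ?Y' = "(1 / 2) *\<^sub>R (D t + - (matrix_inv ?W ** D t ** matrix_inv ?W))"
  have W: "?W \<in> Sp" by (rule C(2)[OF t])
  have inv: "invertible (c s)" if "s \<in> {0..1}" for s by (rule Sp_invertible[OF C(2)[OF that]])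
  have D: "D t ** matrix_inv ?W = ?X" "?X ** ?W = D t"
    using C(3)[OF t] matrix_inv_left[OF inv[OF t]] by (simp_all flip: matrix_mul_assoc)
  have "((\<lambda>s. cos_part (c s)) has_vector_derivative ?Y') (at t within {0..1})"
    unfolding cos_part_def
    by (intro bounded_linear.has_vector_derivative[OF bounded_linear_scaleR_right] has_vector_derivative_add
        C(6) has_vector_derivative_matrix_inv[OF C(6) _ inv C(4)] t)
  from has_vector_derivative_trace_matrix_pow[OF this, of "Suc k"]
  have deriv: "((\<lambda>s. trace (matrix_pow (cos_part (c s)) (Suc k))) has_vector_derivative real (Suc k) * trace (?Q ** ?Y')) (at t within {0..1})"
    by (simp only: diff_Suc_1)
  have "trace (?Q ** ?Y') = (trace (?Q ** D t) - trace (?Q ** (matrix_inv ?W ** D t ** matrix_inv ?W))) / 2"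
    by (simp add: matrix_mult.scaleR_right matrix_mult.add_right matrix_mult.minus_right matrix_mult.diff_right trace_sub
        linear_scale[OF bounded_linear.linear[OF bounded_linear_trace]])
  also have "trace (?Q ** D t) = trace (?Q ** ?W ** ?X)"
    using trace_mul_sym[of "?Q ** ?X" ?W] matrix_pow_commute[OF cos_part_commute[OF W], of k]
    by (simp add: D(2)[symmetric] matrix_mul_assoc)
  also have "?Q ** (matrix_inv ?W ** D t ** matrix_inv ?W) = ?Q ** matrix_inv ?W ** ?X"
    by (simp add: D(1)[symmetric] matrix_mul_assoc)
  also have "(trace (?Q ** ?W ** ?X) - trace (?Q ** matrix_inv ?W ** ?X)) / 2 = trace (?Q ** (?W - matrix_inv ?W) ** ?X) / 2"
    by (simp add: matrix_mult.diff_right matrix_mult.diff_left trace_sub)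
  finally show ?thesis using deriv by (simp only: times_divide_eq_right times_divide_eq_left)
qed

lemma antiderivative_arccos_bound:
  assumes r: "0 \<le> r" "r < 1" and x: "\<bar>x\<bar> \<le> r"
    and close: "\<And>y. \<bar>y\<bar> \<le> r \<Longrightarrow> \<bar>(\<Sum>k\<le>m. a k * y ^ k) + 1 / sqrt (1 - y\<^sup>2)\<bar> \<le> e"
  shows "\<bar>(\<Sum>k\<le>m. a k / real (Suc k) * x ^ Suc k) - (arccos x - pi / 2)\<bar> \<le> e"
proof -
  define h where "h x = (\<Sum>k\<le>m. a k / real (Suc k) * x ^ Suc k) - (arccos x - pi / 2)" for x
  have "norm (h x - h 0) \<le> e * norm (x - 0)"
  proof (rule field_differentiable_bound[of "{-r..r}" h "\<lambda>y. (\<Sum>k\<le>m. a k * y ^ k) + 1 / sqrt (1 - y\<^sup>2)"])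
    fix y assume "y \<in> {-r..r}"
    then have y: "\<bar>y\<bar> \<le> r" "- 1 < y" "y < 1" using r by auto
    have power_deriv: "((\<lambda>x. x ^ Suc n) has_real_derivative real (Suc n) * y ^ n) (at y)" for n
      using DERIV_pow[of "Suc n" y UNIV] by (simp del: power_Suc of_nat_Suc)
    have "(h has_real_derivative
       (\<Sum>k\<le>m. a k / real (Suc k) * (real (Suc k) * y ^ k)) - (inverse (- sqrt (1 - y\<^sup>2)) - 0)) (at y)"
      unfolding h_def by (intro DERIV_diff DERIV_sum DERIV_cmult DERIV_const DERIV_arccos y power_deriv)
    then have "(h has_real_derivative (\<Sum>k\<le>m. a k * y ^ k) + 1 / sqrt (1 - y\<^sup>2)) (at y)" by (simp add: inverse_eq_divide)
    then show "(h has_field_derivative (\<Sum>k\<le>m. a k * y ^ k) + 1 / sqrt (1 - y\<^sup>2)) (at y within {-r..r})"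
      by (rule has_field_derivative_at_within)
    show "norm ((\<Sum>k\<le>m. a k * y ^ k) + 1 / sqrt (1 - y\<^sup>2)) \<le> e" using close[OF y(1)] by simp
  qed (use x r in auto)
  also have "\<dots> \<le> e * 1" using x r close[OF x] by (intro mult_left_mono) auto
  finally show ?thesis by (simp add: h_def)
qed

lemma Weierstrass_arccos:
  assumes r: "0 \<le> r" "r < 1" and e: "e > 0"
  obtains a m where "\<And>x. \<bar>x\<bar> \<le> r \<Longrightarrow> 1 - e \<le> - (\<Sum>k\<le>m. a k * x ^ k) * sqrt (1 - x\<^sup>2)"
    "\<And>x. \<bar>x\<bar> \<le> r \<Longrightarrow> \<bar>(\<Sum>k\<le>m. a k / real (Suc k) * x ^ Suc k) - (arccos x - pi / 2)\<bar> \<le> e"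
proof -
  have sq: "x\<^sup>2 < 1" if "\<bar>x\<bar> \<le> r" for x using that r by (simp add: abs_square_less_1)
  have "continuous_on {-r..r} (\<lambda>x. - (1 / sqrt (1 - x\<^sup>2)))"
    by (intro continuous_intros ballI) (use sq in \<open>force simp: abs_le_iff\<close>)
  then obtain g where g: "real_polynomial_function g" "\<And>x. x \<in> {-r..r} \<Longrightarrow> \<bar>- (1 / sqrt (1 - x\<^sup>2)) - g x\<bar> < e"
    by (rule Stone_Weierstrass_real_polynomial_function[OF compact_Icc _ e]) (rule that)
  obtain a m where am: "g = (\<lambda>x. \<Sum>k\<le>m. a k * x ^ k)" using g(1) unfolding real_polynomial_function_iff_sum by blast
  have close: "\<bar>(\<Sum>k\<le>m. a k * x ^ k) + 1 / sqrt (1 - x\<^sup>2)\<bar> \<le> e" if "\<bar>x\<bar> \<le> r" for x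
    using g(2)[of x] that unfolding am by (simp add: abs_le_iff abs_less_iff)
  show ?thesis
  proof (rule that[where a = a and m = m])
    fix x assume x: "\<bar>x\<bar> \<le> r"
    have sqrt: "0 < sqrt (1 - x\<^sup>2)" "sqrt (1 - x\<^sup>2) \<le> 1" using sq[OF x] by simp_all
    have "1 / sqrt (1 - x\<^sup>2) - e \<le> - (\<Sum>k\<le>m. a k * x ^ k)" using close[OF x] by (simp add: abs_le_iff)
    then have "(1 / sqrt (1 - x\<^sup>2) - e) * sqrt (1 - x\<^sup>2) \<le> - (\<Sum>k\<le>m. a k * x ^ k) * sqrt (1 - x\<^sup>2)"
      by (rule mult_right_mono) (use sqrt in simp)
    moreover have "(1 / sqrt (1 - x\<^sup>2) - e) * sqrt (1 - x\<^sup>2) = 1 - e * sqrt (1 - x\<^sup>2)" using sqrt by (simp add: field_simps)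
    moreover have "e * sqrt (1 - x\<^sup>2) \<le> e * 1" using sqrt e by (intro mult_left_mono) auto
    ultimately show "1 - e \<le> - (\<Sum>k\<le>m. a k * x ^ k) * sqrt (1 - x\<^sup>2)" by linarith
    show "\<bar>(\<Sum>k\<le>m. a k / real (Suc k) * x ^ Suc k) - (arccos x - pi / 2)\<bar> \<le> e"
      by (rule antiderivative_arccos_bound[OF r x close])
  qed
qed

lemma charpoly_one_mult_minus_one:
  fixes W :: "'n::finite sqm" and \<theta> :: "'n \<Rightarrow> real"
  assumes "\<And>z. charpoly W z = (\<Prod>j\<in>UNIV. (z - cis (\<theta> j)) * (z - cis (- \<theta> j)))"
  shows "charpoly W 1 * charpoly W (-1) = complex_of_real (\<Prod>j\<in>UNIV. 4 * (sin (\<theta> j))\<^sup>2)"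
  unfolding assms cis_quadratic_factor prod.distrib[symmetric] of_real_prod
proof (rule prod.cong)
  fix j
  have "(1\<^sup>2 - 2 * x * 1 + 1) * ((- 1)\<^sup>2 - 2 * x * - 1 + 1) = 4 * (1 - x\<^sup>2)" for x :: complex by (simp add: algebra_simps power2_eq_square)
  then show "(1\<^sup>2 - 2 * complex_of_real (cos (\<theta> j)) * 1 + 1) * ((- 1)\<^sup>2 - 2 * complex_of_real (cos (\<theta> j)) * - 1 + 1)
     = complex_of_real (4 * (sin (\<theta> j))\<^sup>2)"
    by (simp only: sin_squared_eq) simp
qed simp

lemma prod_sin_sq_le: "(\<Prod>j\<in>UNIV. 4 * (sin (\<theta> j))\<^sup>2) \<le> 4 ^ CARD('n) * (sin (\<theta> j))\<^sup>2" for \<theta> :: "'n::finite \<Rightarrow> real"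
proof -
  have "(\<Prod>j\<in>UNIV. 4 * (sin (\<theta> j))\<^sup>2) = 4 * (sin (\<theta> j))\<^sup>2 * (\<Prod>i\<in>UNIV - {j}. 4 * (sin (\<theta> i))\<^sup>2)" by (rule prod.remove) auto
  also have "\<dots> \<le> 4 * (sin (\<theta> j))\<^sup>2 * (\<Prod>i\<in>UNIV - {j}. 4)"
    by (intro mult_left_mono prod_mono) (auto simp: abs_square_le_1)
  also have "\<dots> = 4 ^ CARD('n) * (sin (\<theta> j))\<^sup>2"
    using prod.remove[of "UNIV :: 'n set" j "\<lambda>_. 4 :: real"] by (simp add: algebra_simps)
  finally show ?thesis .
qed

lemma continuous_on_charpoly: "continuous_on S f \<Longrightarrow> continuous_on S (\<lambda>x. charpoly (f x) z)"
  unfolding charpoly_mat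
  by (intro continuous_on_det continuous_on_diff continuous_on_const bounded_linear.continuous_on[OF bounded_linear_cplx])

lemma eigenangles_cos_bound:
  fixes c :: "real \<Rightarrow> 'n::finite sqm" and \<phi> :: "real \<Rightarrow> 'n \<Rightarrow> real"
  assumes c: "continuous_on {0..1} c" and \<phi>: "\<And>t j. t \<in> {0..1} \<Longrightarrow> 0 < \<phi> t j \<and> \<phi> t j < pi"
    and charpoly: "\<And>t z. t \<in> {0..1} \<Longrightarrow> charpoly (c t) z = (\<Prod>j\<in>UNIV. (z - cis (\<phi> t j)) * (z - cis (- \<phi> t j)))"
  obtains r where "0 \<le> r" "r < 1" "\<And>t j. t \<in> {0..1} \<Longrightarrow> \<bar>cos (\<phi> t j)\<bar> \<le> r"
proof -
  define q where "q t = Re (charpoly (c t) 1 * charpoly (c t) (-1))" for t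
  have q: "q t = (\<Prod>j\<in>UNIV. 4 * (sin (\<phi> t j))\<^sup>2)" if "t \<in> {0..1}" for t
    by (simp only: q_def charpoly_one_mult_minus_one[OF charpoly[OF that]] Re_complex_of_real)
  have "continuous_on {0..1} q" unfolding q_def
    by (intro continuous_intros continuous_on_charpoly c)
  then obtain t0 where t0: "t0 \<in> {0..1}" "\<And>t. t \<in> {0..1} \<Longrightarrow> q t0 \<le> q t"
    using continuous_attains_inf[of "{0..1::real}" q] by auto
  define m where "m = q t0 / 4 ^ CARD('n)"
  have sin_pos: "sin (\<phi> t j) > 0" if "t \<in> {0..1}" for t j using \<phi>[OF that] by (intro sin_gt_zero) auto
  have "q t0 > 0" unfolding q[OF t0(1)] by (intro prod_pos) (use sin_pos[OF t0(1)] in \<open>simp add: less_imp_neq[symmetric]\<close>)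
  then have m: "m > 0" by (simp add: m_def)
  have sin: "m \<le> (sin (\<phi> t j))\<^sup>2" if "t \<in> {0..1}" for t j
    using order_trans[OF t0(2)[OF that, unfolded q[OF that]] prod_sin_sq_le] by (simp add: m_def divide_le_eq mult.commute)
  show ?thesis
  proof (rule that[of "sqrt (1 - m)"])
    have "m \<le> 1" using order_trans[OF sin[of 0 undefined], of 1] by (simp add: abs_square_le_1)
    then show "0 \<le> sqrt (1 - m)" "sqrt (1 - m) < 1" using m by simp_all
    show "\<bar>cos (\<phi> t j)\<bar> \<le> sqrt (1 - m)" if "t \<in> {0..1}" for t j
      by (rule real_le_rsqrt) (use sin[OF that, of j] in \<open>simp add: sin_squared_eq\<close>)
  qed
qed

text \<open>\<open>\<Sum>\<^sub>k a\<^sub>k x\<^sup>k\<close> approximates the derivative of \<open>arccos\<close>, so that half the trace of the antiderivative at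
  \<open>cos_part (c t)\<close> approximates the sum of the angles of \<open>c t\<close>.\<close>
lemma length_le_angle_sum_approx:
  fixes c :: "real \<Rightarrow> 'n::finite sqm" and \<phi> :: "real \<Rightarrow> 'n \<Rightarrow> real"
  assumes c: "weakly_causal c D" and M: "\<And>t. t \<in> {0..1} \<Longrightarrow> M t \<in> Sp" "\<And>t. t \<in> {0..1} \<Longrightarrow> c t ** M t = M t ** block_rot (\<phi> t)"
    and \<phi>: "\<And>j. 0 < \<phi> 0 j" and e: "e \<le> 1"
    and deriv: "\<And>t j. t \<in> {0..1} \<Longrightarrow> 1 - e \<le> - (\<Sum>k\<le>m. a k * cos (\<phi> t j) ^ k) * sin (\<phi> t j)"
    and approx: "\<And>t j. t \<in> {0..1} \<Longrightarrow> \<bar>(\<Sum>k\<le>m. a k / real (Suc k) * cos (\<phi> t j) ^ Suc k) - (\<phi> t j - pi / 2)\<bar> \<le> e"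
  shows "(1 - e) * (real CARD('n) * lengthG c) \<le> (\<Sum>j\<in>UNIV. \<phi> 1 j) + real CARD('n) * (2 * e)"
proof -
  have curve: "Sp_curve c D" using c by (simp add: weakly_causal_def)
  note Sp = Sp_curveD(2)[OF curve]
  define P where "P x = (\<Sum>k\<le>m. a k / real (Suc k) * x ^ Suc k)" for x :: real
  define F where "F t = (\<Sum>k\<le>m. a k / real (Suc k) * trace (matrix_pow (cos_part (c t)) (Suc k))) / 2" for t
  define F' where "F' t = (\<Sum>k\<le>m. a k * trace (matrix_pow (cos_part (c t)) k ** (c t - matrix_inv (c t)) ** logder c t)) / 4" for t
  have F: "F t = (\<Sum>j\<in>UNIV. P (cos (\<phi> t j)))" if t: "t \<in> {0..1}" for t
    unfolding F_def P_def trace_matrix_pow_cos_part[OF Sp[OF t] M(1)[OF t] M(2)[OF t]]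
    by (subst sum.swap) (simp add: sum_divide_distrib sum_distrib_left del: of_nat_Suc power_Suc)
  have F'_ge: "(1 - e) * (real CARD('n) * G (logder c t)) \<le> F' t" if t: "t \<in> {0..1}" for t
    unfolding F'_def using weakly_causal_logder[OF curve] c t deriv e
    by (intro G_le_trace_polynomial_sin[OF Sp[OF t] M(1)[OF t] M(2)[OF t]]) auto
  have F': "(F' has_integral F 1 - F 0) {0..1}"
  proof (rule fundamental_theorem_of_calculus)
    fix t :: real assume t: "t \<in> {0..1}"
    have "(F has_vector_derivative (\<Sum>k\<le>m. a k / real (Suc k) *
        (real (Suc k) / 2 * trace (matrix_pow (cos_part (c t)) k ** (c t - matrix_inv (c t)) ** logder c t))) / 2) (at t within {0..1})"
      unfolding F_def
      by (intro has_vector_derivative_divide has_vector_derivative_sum has_vector_derivative_mult_right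
          has_vector_derivative_trace_matrix_pow_cos_part[OF curve t])
    then show "(F has_vector_derivative F' t) (at t within {0..1})" by (simp add: F'_def sum_divide_distrib del: of_nat_Suc)
  qed simp
  have "((\<lambda>t. (1 - e) * (real CARD('n) * G (logder c t))) has_integral (1 - e) * (real CARD('n) * lengthG c)) {0..1}"
    unfolding lengthG_def
    by (intro has_integral_mult_right integrable_integral integrable_continuous_interval continuous_on_G_logder[OF c])
  then have "(1 - e) * (real CARD('n) * lengthG c) \<le> F 1 - F 0" by (rule has_integral_le[OF _ F' F'_ge])
  also have "F 1 - F 0 \<le> (\<Sum>j\<in>UNIV. \<phi> 1 j + 2 * e)"
    unfolding F[of 1, simplified] F[of 0, simplified] sum_subtractf[symmetric]
  proof (rule sum_mono)
    show "P (cos (\<phi> 1 j)) - P (cos (\<phi> 0 j)) \<le> \<phi> 1 j + 2 * e" for j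
      using approx[of 0 j, folded P_def] approx[of 1 j, folded P_def] \<phi>[of j] by (simp add: abs_le_iff)
  qed
  finally show ?thesis by (simp add: sum.distrib)
qed

theorem length_le_Sp_pos:
  fixes c :: "real \<Rightarrow> 'n::finite sqm"
  assumes c: "weakly_causal c D" and pos: "\<And>t. t \<in> {0..1} \<Longrightarrow> c t \<in> Sp_pos" and \<theta>: "spectral_angles (c 1) \<theta>"
  shows "real CARD('n) * lengthG c \<le> (\<Sum>j\<in>UNIV. \<theta> $ j)"
proof -
  have "\<exists>M \<phi>. M \<in> Sp \<and> (\<forall>j::'n. 0 < \<phi> j \<and> \<phi> j < pi) \<and> c t ** M = M ** block_rot \<phi>" if "t \<in> {0..1}" for t
    by (rule normal_form[OF pos[OF that]]) blast
  then obtain M \<phi> where M: "\<And>t. t \<in> {0..1} \<Longrightarrow> M t \<in> Sp" "\<And>t. t \<in> {0..1} \<Longrightarrow> c t ** M t = M t ** block_rot (\<phi> t :: 'n \<Rightarrow> real)"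
    and \<phi>: "\<And>t j. t \<in> {0..1} \<Longrightarrow> 0 < \<phi> t j \<and> \<phi> t j < pi" by metis
  note charpoly = charpoly_normal_form[OF M]
  have "continuous_on {0..1} c" using c Sp_curveD(4) by (auto simp: weakly_causal_def)
  then obtain r where r: "0 \<le> r" "r < 1" "\<And>t j. t \<in> {0..1} \<Longrightarrow> \<bar>cos (\<phi> t j)\<bar> \<le> r"
    by (rule eigenangles_cos_bound[OF _ \<phi> charpoly]) (assumption+, rule that)
  have approx: "(1 - e) * (real CARD('n) * lengthG c) \<le> (\<Sum>j\<in>UNIV. \<phi> 1 j) + real CARD('n) * (2 * e)" if e: "0 < e" "e \<le> 1" for e
  proof -
    obtain a m where a: "\<And>x. \<bar>x\<bar> \<le> r \<Longrightarrow> 1 - e \<le> - (\<Sum>k\<le>m. a k * x ^ k) * sqrt (1 - x\<^sup>2)"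
      "\<And>x. \<bar>x\<bar> \<le> r \<Longrightarrow> \<bar>(\<Sum>k\<le>m. a k / real (Suc k) * x ^ Suc k) - (arccos x - pi / 2)\<bar> \<le> e"
      by (rule Weierstrass_arccos[OF r(1,2) e(1)]) (rule that)
    have "sqrt (1 - (cos (\<phi> t j))\<^sup>2) = sin (\<phi> t j)" "arccos (cos (\<phi> t j)) = \<phi> t j" if "t \<in> {0..1}" for t j
      using \<phi>[OF that, of j] sin_ge_zero[of "\<phi> t j"] by (simp_all add: sin_squared_eq[symmetric] arccos_cos)
    then show ?thesis
      using a(1)[OF r(3)] a(2)[OF r(3)] \<phi>[of 0] by (intro length_le_angle_sum_approx[OF c M _ e(2), where a = a and m = m]) auto
  qed
  have "(1 - 0) * (real CARD('n) * lengthG c) \<le> (\<Sum>j\<in>UNIV. \<phi> 1 j) + real CARD('n) * (2 * 0)"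
  proof (rule tendsto_le[of "at_right (0::real)"])
    show "((\<lambda>e. (\<Sum>j\<in>UNIV. \<phi> 1 j) + real CARD('n) * (2 * e)) \<longlongrightarrow> (\<Sum>j\<in>UNIV. \<phi> 1 j) + real CARD('n) * (2 * 0)) (at_right 0)"
      "((\<lambda>e. (1 - e) * (real CARD('n) * lengthG c)) \<longlongrightarrow> (1 - 0) * (real CARD('n) * lengthG c)) (at_right 0)"
      by (intro tendsto_intros)+
    show "\<forall>\<^sub>F e in at_right 0. (1 - e) * (real CARD('n) * lengthG c) \<le> (\<Sum>j\<in>UNIV. \<phi> 1 j) + real CARD('n) * (2 * e)"
      unfolding eventually_at_right_field using approx by (intro exI[of _ 1]) simp
  qed simp
  moreover have "spectral_angles (c 1) (\<chi> j. \<phi> 1 j)"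
    unfolding spectral_angles_def using \<phi>[of 1] charpoly[of 1] by (simp add: less_imp_le)
  from spectral_angles_sum_unique[OF this \<theta>] have "(\<Sum>j\<in>UNIV. \<phi> 1 j) = (\<Sum>j\<in>UNIV. \<theta> $ j)" by simp
  ultimately show ?thesis by simp
qed

section \<open>Pushing into the interior\<close>

definition push_num :: "real \<Rightarrow> 'n::finite sqm \<Rightarrow> 'n sqm" where "push_num d W = W + d *\<^sub>R J0"

definition push_den :: "real \<Rightarrow> 'n::finite sqm \<Rightarrow> 'n sqm" where "push_den d W = mat 1 - d *\<^sub>R (J0 ** W)"

definition push :: "real \<Rightarrow> 'n::finite sqm \<Rightarrow> 'n sqm" where "push d W = push_num d W ** matrix_inv (push_den d W)"

lemma push_num_vec: "push_num d W *v v = W *v v + d *\<^sub>R (J0 *v v)"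
  by (simp add: push_num_def matrix_vec_linear)

lemma push_den_vec: "push_den d W *v v = v - d *\<^sub>R (J0 *v (W *v v))"
  by (simp add: push_den_def matrix_vec_linear matrix_vector_mul_assoc)

lemma push_form:
  assumes "W \<in> Sp" shows "omega0 (push_num d W *v u) (push_num d W *v v) = omega0 (push_den d W *v u) (push_den d W *v v)"
  by (simp add: push_num_vec push_den_vec omega_linear
      Sp_omega0[OF assms] omega0_J0_left omega0_J0_right algebra_simps flip: omega0_inner)

lemma push_den_invertible:
  assumes W: "W \<in> Sp_nonneg" and d: "d \<ge> 0"
  shows "invertible (push_den d W)"
  unfolding invertible_iff_kernel
proof (intro allI impI)
  fix v assume "push_den d W *v v = 0"
  then have "v = d *\<^sub>R (J0 *v (W *v v))" by (simp add: push_den_vec)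
  then have "v \<bullet> v = d * (v \<bullet> (J0 *v (W *v v)))" by (metis inner_scaleR_right)
  also have "v \<bullet> (J0 *v (W *v v)) = - omega0 v (W *v v)"
    using omega0_antisym[of v "W *v v"] by (simp add: omega0_inner[of "W *v v"] inner_commute)
  finally have "v \<bullet> v \<le> 0" using W d by (simp add: Sp_nonneg_def)
  then show "v = 0" using inner_ge_zero[of v] by (metis inner_eq_zero_iff order_antisym)
qed

lemma push_Sp_pos:
  assumes W: "W \<in> Sp_nonneg" and d: "d > 0"
  shows "push d W \<in> Sp_pos"
proof -
  have S: "W \<in> Sp" using W by (simp add: Sp_nonneg_def)
  have inv: "invertible (push_den d W)" using push_den_invertible[OF W] d by simp
  have "omega0 u (push d W *v u) > 0" if u: "u \<noteq> 0" for u
  proof -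
    define v where "v = matrix_inv (push_den d W) *v u"
    have image: "u = push_den d W *v v" "push d W *v u = push_num d W *v v"
      by (simp_all add: v_def push_def matrix_inv_cancel[OF inv] flip: matrix_vector_mul_assoc)
    then have "v \<noteq> 0" using u by auto
    then have "0 < d * (v \<bullet> v)" using d by simp
    moreover have "0 \<le> d * ((W *v v) \<bullet> (W *v v))" "0 \<le> (1 + d\<^sup>2) * omega0 v (W *v v)" using d W by (simp_all add: Sp_nonneg_def)
    moreover have "omega0 u (push d W *v u) = (1 + d\<^sup>2) * omega0 v (W *v v) + d * (v \<bullet> v) + d * ((W *v v) \<bullet> (W *v v))"
      unfolding image(2) unfolding image(1) using omega0_antisym[of v "W *v v"]
      by (simp add: push_num_vec push_den_vec omega_simps power2_eq_square algebra_simps flip: omega0_inner)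
    ultimately show ?thesis by linarith
  qed
  moreover have "push d W \<in> Sp" unfolding push_def by (rule fractional_Sp[OF inv push_form[OF S]])
  ultimately show ?thesis by (simp add: Sp_pos_def)
qed

lemma push_curve_form:
  fixes c :: "real \<Rightarrow> 'n::finite sqm"
  assumes c: "Sp_curve c D" and S: "\<And>t. t \<in> {0..1} \<Longrightarrow> c t \<in> Sp_nonneg" and d: "0 \<le> d"
  obtains D' where "Sp_curve (\<lambda>t. push d (c t)) D'"
    "\<And>t u v. t \<in> {0..1} \<Longrightarrow> omega0 (push d (c t) *v (push_den d (c t) *v u)) (D' t *v (push_den d (c t) *v v))
       = (1 - d\<^sup>2) * omega0 (c t *v u) (D t *v v)"
proof -
  note C = Sp_curveD[OF c]
  define De' where "De' t = - (d *\<^sub>R (J0 ** D t))" for t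
  have num: "((\<lambda>t. push_num d (c t)) has_vector_derivative D t) (at t within {0..1})" if t: "t \<in> {0..1}" for t
    using has_vector_derivative_add[OF C(6)[OF t] has_vector_derivative_const[of "d *\<^sub>R J0"]] by (simp add: push_num_def)
  have den: "((\<lambda>t. push_den d (c t)) has_vector_derivative De' t) (at t within {0..1})" if t: "t \<in> {0..1}" for t
  proof -
    have "((\<lambda>t. push_den d (c t)) has_vector_derivative 0 - d *\<^sub>R (J0 ** D t)) (at t within {0..1})"
      unfolding push_den_def
      by (intro has_vector_derivative_diff has_vector_derivative_const bounded_linear.has_vector_derivative[OF bounded_linear_scaleR_right]
        bounded_linear.has_vector_derivative[OF matrix_mult.bounded_linear_right] C(6) t)
    then show ?thesis by (simp add: De'_def)
  qed
  have "continuous_on {0..1} De'" unfolding De'_def by (intro continuous_intros matrix_mult.continuous_on C(5))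
  note frac = fractional_curve[OF num den C(5) this push_den_invertible[OF S d] push_form[OF C(2)], folded push_def]
  show ?thesis
  proof (rule that[OF frac(1)])
    fix t :: real and u v assume t: "t \<in> {0..1}"
    have "omega0 (push_num d (c t) *v u) (D t *v v) - omega0 (push_den d (c t) *v u) (De' t *v v)
        = (1 - d\<^sup>2) * omega0 (c t *v u) (D t *v v)"
      by (simp add: push_num_vec push_den_vec De'_def matrix_vec_linear omega_simps
          power2_eq_square algebra_simps flip: matrix_vector_mul_assoc omega0_inner)
    then show "omega0 (push d (c t) *v (push_den d (c t) *v u))
        ((push_num d (c t) ** - (matrix_inv (push_den d (c t)) ** De' t ** matrix_inv (push_den d (c t)))
          + D t ** matrix_inv (push_den d (c t))) *v (push_den d (c t) *v v)) = (1 - d\<^sup>2) * omega0 (c t *v u) (D t *v v)"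
      using frac(2)[OF _ _ _ _ t, of u v] by simp
  qed simp_all
qed

lemma G_logder_conformal:
  fixes c C :: "real \<Rightarrow> 'n::finite sqm"
  assumes c: "weakly_causal c D" and C: "weakly_causal C D'" and t: "t \<in> {0..1}" and E: "invertible E" and k: "k > 0"
    and form: "\<And>u v. omega0 (C t *v (E *v u)) (D' t *v (E *v v)) = k * omega0 (c t *v u) (D t *v v)"
  shows "G (logder C t) = k * ((det E)\<^sup>2) powr (- (1 / real CARD('n + 'n))) * G (logder c t)"
proof -
  let ?X = "logder c t" and ?X' = "logder C t" and ?N = "CARD('n + 'n)"
  have curves: "Sp_curve c D" "Sp_curve C D'" using c C by (simp_all add: weakly_causal_def)
  have X: "?X \<in> closure sp_plus" "?X' \<in> closure sp_plus"
    using weakly_causal_logder[OF curves(1)] weakly_causal_logder[OF curves(2)] c C t by auto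
  have "transpose (C t ** E) ** form_matrix ?X' ** (C t ** E) = k *\<^sub>R (transpose (c t) ** form_matrix ?X ** c t)"
  proof (rule matrix_eqI_inner)
    fix u v
    have "u \<bullet> ((transpose (C t ** E) ** form_matrix ?X' ** (C t ** E)) *v v) = omega0 (C t *v (E *v u)) (?X' *v (C t *v (E *v v)))"
      by (simp only: matrix_vector_mul_assoc[symmetric] inner_transpose form_matrix_inner)
    also have "\<dots> = k * omega0 (c t *v u) (?X *v (c t *v v))"
      by (simp only: form logder_form[OF curves(1) t] logder_form[OF curves(2) t])
    also have "\<dots> = u \<bullet> ((k *\<^sub>R (transpose (c t) ** form_matrix ?X ** c t)) *v v)"
      unfolding matrix_vec_mult.scaleR_left matrix_vector_mul_assoc[symmetric] inner_scaleR_right by (simp only: inner_transpose form_matrix_inner)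
    finally show "u \<bullet> ((transpose (C t ** E) ** form_matrix ?X' ** (C t ** E)) *v v) = u \<bullet> ((k *\<^sub>R (transpose (c t) ** form_matrix ?X ** c t)) *v v)" .
  qed
  from arg_cong[OF this, of det]
  have "det ?X' * (det (C t) * det (C t)) * (det E)\<^sup>2 = k ^ ?N * (det ?X * (det (c t) * det (c t)))"
    by (simp add: det_mul det_transpose det_form_matrix det_scaleR_matrix power2_eq_square mult_ac del: card_sum)
  moreover have E_pos: "(det E)\<^sup>2 > 0" using E by (simp add: invertible_det_nz)
  ultimately have "det ?X' = k ^ ?N * inverse ((det E)\<^sup>2) * det ?X"
    using Sp_det_sq[OF Sp_curveD(2)[OF curves(1) t]] Sp_det_sq[OF Sp_curveD(2)[OF curves(2) t]] by (simp add: field_simps)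
  then have "G ?X' = (k ^ ?N) powr (1 / real ?N) * (inverse ((det E)\<^sup>2)) powr (1 / real ?N) * G ?X"
    using closure_sp_plus_det[OF X(1)] closure_sp_plus_det[OF X(2)] k E_pos by (simp add: powr_mult del: card_sum)
  also have "(k ^ ?N) powr (1 / real ?N) = k" using k by (simp add: powr_powr flip: powr_realpow del: card_sum)
  also have "(inverse ((det E)\<^sup>2)) powr (1 / real ?N) = ((det E)\<^sup>2) powr (- (1 / real ?N))" by (simp only: inverse_powr powr_minus)
  finally show ?thesis .
qed

definition push_factor :: "real \<Rightarrow> 'n::finite sqm \<Rightarrow> real" where
  "push_factor d W = (1 - d\<^sup>2) * ((det (push_den d W))\<^sup>2) powr (- (1 / real CARD('n + 'n)))"

lemma push_curve:
  fixes c :: "real \<Rightarrow> 'n::finite sqm"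
  assumes c: "weakly_causal c D" and S: "\<And>t. t \<in> {0..1} \<Longrightarrow> c t \<in> Sp_nonneg" and d: "0 \<le> d" "d < 1"
  obtains D' where "weakly_causal (\<lambda>t. push d (c t)) D'"
    "\<And>t. t \<in> {0..1} \<Longrightarrow> G (logder (\<lambda>t. push d (c t)) t) = push_factor d (c t) * G (logder c t)"
proof -
  let ?E = "\<lambda>t. push_den d (c t)"
  have curve: "Sp_curve c D" using c by (simp add: weakly_causal_def)
  have factor: "1 - d\<^sup>2 > 0" using d by (simp add: abs_square_less_1)
  obtain D' where D': "Sp_curve (\<lambda>t. push d (c t)) D'" "\<And>t u v. t \<in> {0..1} \<Longrightarrow>
      omega0 (push d (c t) *v (?E t *v u)) (D' t *v (?E t *v v)) = (1 - d\<^sup>2) * omega0 (c t *v u) (D t *v v)"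
    by (rule push_curve_form[OF curve S d(1)]) (assumption, rule that)
  note inv = push_den_invertible[OF S d(1)]
  have causal: "weakly_causal (\<lambda>t. push d (c t)) D'"
    unfolding weakly_causal_def
  proof (intro conjI D'(1) ballI allI)
    fix t :: real and v assume t: "t \<in> {0..1}"
    show "0 \<le> omega0 (push d (c t) *v v) (D' t *v v)"
      using D'(2)[OF t, of "matrix_inv (?E t) *v v" "matrix_inv (?E t) *v v"] c t factor
      by (simp add: matrix_inv_cancel[OF inv[OF t]] weakly_causal_def)
  qed
  then show ?thesis
    by (rule that) (unfold push_factor_def, rule G_logder_conformal[OF c causal _ inv factor D'(2)])
qed

lemma continuous_on_push_den: "continuous_on S f \<Longrightarrow> continuous_on S g \<Longrightarrow> continuous_on S (\<lambda>x. push_den (f x) (g x))"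
  unfolding push_den_def by (intro continuous_intros matrix_mult.continuous_on)

lemma continuous_on_pushed_length:
  fixes c :: "real \<Rightarrow> 'n::finite sqm"
  assumes c: "weakly_causal c D" and S: "\<And>t. t \<in> {0..1} \<Longrightarrow> c t \<in> Sp_nonneg" and I: "I \<subseteq> {0..}"
  shows "continuous_on I (\<lambda>d. integral {0..1} (\<lambda>t. push_factor d (c t) * G (logder c t)))"
proof -
  have "continuous_on {0..1} c" using c Sp_curveD(4) by (auto simp: weakly_causal_def)
  then have "continuous_on (I \<times> {0..1}) (\<lambda>p. c (snd p))"
    by (rule continuous_on_compose2[OF _ continuous_on_snd[OF continuous_on_id]]) auto
  then have den: "continuous_on (I \<times> {0..1}) (\<lambda>p. det (push_den (fst p) (c (snd p))))"
    by (intro continuous_on_det continuous_on_push_den continuous_on_fst continuous_on_id)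
  have G: "continuous_on (I \<times> {0..1}) (\<lambda>p. G (logder c (snd p)))"
    by (rule continuous_on_compose2[OF continuous_on_G_logder[OF c] continuous_on_snd[OF continuous_on_id]]) auto
  have "det (push_den d (c t)) \<noteq> 0" if "d \<in> I" "t \<in> {0..1}" for d t
    using push_den_invertible[OF S[OF that(2)], of d] that(1) I by (auto simp: invertible_det_nz)
  then have "continuous_on (I \<times> cbox 0 1) (\<lambda>(d, t). push_factor d (c t) * G (logder c t))"
    unfolding push_factor_def case_prod_beta box_real(2) by (intro continuous_intros den G) auto
  from integral_continuous_on_param[OF this] show ?thesis by simp
qed

theorem length_le_Sp_nonneg:
  fixes c :: "real \<Rightarrow> 'n::finite sqm"
  assumes c: "weakly_causal c D" and S: "\<And>t. t \<in> {0..1} \<Longrightarrow> c t \<in> Sp_nonneg" and \<theta>: "spectral_angles (c 1) \<theta>"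
  shows "real CARD('n) * lengthG c \<le> (\<Sum>j\<in>UNIV. \<theta> $ j)"
proof -
  let ?I = "{0..1/2::real}"
  define L where "L d = integral {0..1} (\<lambda>t. push_factor d (c t) * G (logder c t))" for d
  have push_0: "push 0 W = W" for W :: "'n sqm"
    using matrix_inv_right[of "mat 1 :: 'n sqm"] by (simp add: push_def push_num_def push_den_def invertible_det_nz)
  have "\<forall>d\<in>?I. \<exists>T. spectral_angles (push d (c 1)) T \<and> (d = 0 \<longrightarrow> T = \<theta>)"
  proof
    show "\<exists>T. spectral_angles (push d (c 1)) T \<and> (d = 0 \<longrightarrow> T = \<theta>)" if "d \<in> ?I" for d
      using \<theta> spectral_angles_Sp_pos[OF push_Sp_pos[OF S, of 1 d]] that by (cases "d = 0") (auto simp: push_0)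
  qed
  then obtain T where "\<forall>d\<in>?I. spectral_angles (push d (c 1)) (T d) \<and> (d = 0 \<longrightarrow> T d = \<theta>)" by (rule bchoice[THEN exE])
  then have T: "\<And>d. d \<in> ?I \<Longrightarrow> spectral_angles (push d (c 1)) (T d)" "T 0 = \<theta>" by auto
  have "continuous_on ?I L" unfolding L_def by (rule continuous_on_pushed_length[OF c S]) auto
  then have L: "(L \<longlongrightarrow> L 0) (at 0 within ?I)" by (auto simp: continuous_on_def)
  have "continuous_on ?I (\<lambda>d. push d (c 1))"
    unfolding push_def push_num_def using push_den_invertible[OF S[of 1]]
    by (intro matrix_mult.continuous_on continuous_on_matrix_inv continuous_on_push_den continuous_intros) auto
  from continuous_on_spectral_angles_sum[OF this T(1)]
  have angles: "((\<lambda>d. \<Sum>j\<in>UNIV. T d $ j) \<longlongrightarrow> (\<Sum>j\<in>UNIV. T 0 $ j)) (at 0 within ?I)" by (auto simp: continuous_on_def)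
  have "real CARD('n) * L d \<le> (\<Sum>j\<in>UNIV. T d $ j)" if d: "d \<in> ?I" "d \<noteq> 0" for d
  proof -
    have bounds: "0 \<le> d" "d < 1" using d(1) by auto
    obtain D' where D': "weakly_causal (\<lambda>t. push d (c t)) D'"
      "\<And>t. t \<in> {0..1} \<Longrightarrow> G (logder (\<lambda>t. push d (c t)) t) = push_factor d (c t) * G (logder c t)"
      by (rule push_curve[OF c S bounds]) (assumption, rule that)
    then have "L d = lengthG (\<lambda>t. push d (c t))" unfolding L_def lengthG_def by (intro integral_cong) simp
    then show ?thesis using length_le_Sp_pos[OF D'(1) push_Sp_pos[OF S] T(1)[OF d(1)]] d by simp
  qed
  then have "\<forall>\<^sub>F d in at 0 within ?I. real CARD('n) * L d \<le> (\<Sum>j\<in>UNIV. T d $ j)"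
    unfolding eventually_at_filter by (intro always_eventually) blast
  then have "real CARD('n) * L 0 \<le> (\<Sum>j\<in>UNIV. T 0 $ j)"
    by (intro tendsto_le[OF _ angles tendsto_mult_left[OF L]]) (simp_all add: at_within_Icc_at_right)
  moreover have "L 0 = lengthG c" by (simp add: L_def lengthG_def push_factor_def push_den_def)
  ultimately show ?thesis by (simp only: T(2))
qed

section \<open>Contraction and first exit\<close>

definition contract_num :: "'n::finite sqm \<Rightarrow> real \<Rightarrow> 'n sqm" where
  "contract_num W s = (W + mat 1) + s *\<^sub>R (W - mat 1) - (1 - s) *\<^sub>R (J0 ** (W - mat 1))"

definition contract_den :: "'n::finite sqm \<Rightarrow> real \<Rightarrow> 'n sqm" where
  "contract_den W s = (W + mat 1) - s *\<^sub>R (W - mat 1) - (1 - s) *\<^sub>R (J0 ** (W - mat 1))"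

definition contract :: "'n::finite sqm \<Rightarrow> real \<Rightarrow> 'n sqm" where "contract W s = contract_num W s ** matrix_inv (contract_den W s)"

lemma contract_num_vec: "contract_num W s *v v = (W *v v + v) + s *\<^sub>R (W *v v - v) - (1 - s) *\<^sub>R (J0 *v (W *v v - v))"
  and contract_den_vec: "contract_den W s *v v = (W *v v + v) - s *\<^sub>R (W *v v - v) - (1 - s) *\<^sub>R (J0 *v (W *v v - v))"
  by (simp_all add: contract_num_def contract_den_def matrix_vec_linear flip: matrix_vector_mul_assoc)

lemma omega0_sum_diff:
  assumes "W \<in> Sp"
  shows "omega0 (W *v v + v) (W *v v - v) = 2 * omega0 v (W *v v)"
    "omega0 (W *v u + u) (W *v v - v) + omega0 (W *v u - u) (W *v v + v) = 0"
  using omega0_antisym[of v "W *v v"]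
  by (simp_all add: omega_linear Sp_omega0[OF assms] omega0_self)

lemma contract_den_invertible:
  assumes W: "W \<in> Sp_nonneg" and s: "s \<in> {0..1}"
  shows "invertible (contract_den W s)"
  unfolding invertible_iff_kernel
proof (intro allI impI)
  fix v assume kernel: "contract_den W s *v v = 0"
  define x y where "x = W *v v + v" and "y = W *v v - v"
  have x: "x = s *\<^sub>R y + (1 - s) *\<^sub>R (J0 *v y)" using kernel unfolding contract_den_vec x_def[symmetric] y_def[symmetric] by (simp add: algebra_simps)
  show "v = 0"
  proof (cases "s = 1")
    case True
    then have "W *v v + v = W *v v - v" using x by (simp add: x_def y_def)
    then have "v + v = 0" by (simp add: algebra_simps eq_diff_eq)
    then show ?thesis by (simp flip: scaleR_2)
  next
    case False
    have "0 \<le> omega0 x y" unfolding x_def y_def using W by (simp add: omega0_sum_diff(1) Sp_nonneg_def)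
    also have "\<dots> = - ((1 - s) * (y \<bullet> y))"
      by (simp add: x omega.add_left omega.scaleR_left omega0_self omega0_J0_left)
    finally have "(1 - s) * (y \<bullet> y) \<le> 0" by simp
    then have "y \<bullet> y \<le> 0" using False s by (simp add: mult_le_0_iff)
    then have "y = 0" using inner_ge_zero[of y] by (metis inner_eq_zero_iff order_antisym)
    moreover then have "x = 0" using x by simp
    ultimately have "v + v = 0" by (simp add: x_def y_def algebra_simps)
    then show ?thesis by (simp flip: scaleR_2)
  qed
qed

lemma contract_form:
  assumes "W \<in> Sp"
  shows "omega0 (contract_num W s *v u) (contract_num W s *v v) = omega0 (contract_den W s *v u) (contract_den W s *v v)"
proof -
  define x y x' y' where "x = W *v u + u" and "y = W *v u - u" and "x' = W *v v + v" and "y' = W *v v - v"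
  have "omega0 x y' + omega0 y x' = 0" unfolding x_def y_def x'_def y'_def by (rule omega0_sum_diff(2)[OF assms])
  then have swap: "omega0 y x' = - omega0 x y'" by simp
  show ?thesis
    unfolding contract_num_vec contract_den_vec x_def[symmetric] y_def[symmetric] x'_def[symmetric] y'_def[symmetric]
    by (simp add: omega_simps swap algebra_simps flip: omega0_inner)
qed

lemma contract_Sp_nonneg:
  assumes W: "W \<in> Sp_nonneg" and s: "s \<in> {0..1}"
  shows "contract W s \<in> Sp_nonneg"
proof -
  have S: "W \<in> Sp" using W by (simp add: Sp_nonneg_def)
  note inv = contract_den_invertible[OF W s]
  have "omega0 u (contract W s *v u) \<ge> 0" for u
  proof -
    define v where "v = matrix_inv (contract_den W s) *v u"
    define x y where "x = W *v v + v" and "y = W *v v - v"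
    have image: "u = contract_den W s *v v" "contract W s *v u = contract_num W s *v v"
      by (simp_all add: v_def contract_def matrix_inv_cancel[OF inv] flip: matrix_vector_mul_assoc)
    have "omega0 u (contract W s *v u) = 2 * s * (omega0 x y + (1 - s) * (y \<bullet> y))"
      unfolding image(2) unfolding image(1) contract_num_vec contract_den_vec x_def[symmetric] y_def[symmetric]
      using omega0_antisym[of y x]
      by (simp add: omega_simps inner_commute algebra_simps flip: omega0_inner)
    moreover have "omega0 x y \<ge> 0" unfolding x_def y_def omega0_sum_diff(1)[OF S] using W by (simp add: Sp_nonneg_def)
    ultimately show ?thesis using s by simp
  qed
  moreover have "contract W s \<in> Sp" unfolding contract_def by (rule fractional_Sp[OF inv contract_form[OF S]])
  ultimately show ?thesis by (simp add: Sp_nonneg_def)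
qed

lemma contract_1: "W \<in> Sp_nonneg \<Longrightarrow> contract W 1 = W"
proof -
  have num: "contract_num W 1 = 2 *\<^sub>R W" and den: "contract_den W 1 = 2 *\<^sub>R mat 1" by (simp_all add: contract_num_def contract_den_def scaleR_2 algebra_simps)
  have "(2 *\<^sub>R mat 1 :: 'a sqm) ** ((1 / 2) *\<^sub>R mat 1) = mat 1" by (simp add: matrix_mult.scaleR_left matrix_mult.scaleR_right)
  assume W: "W \<in> Sp_nonneg"
  have "contract_num W 1 = W ** contract_den W 1" by (simp add: num den matrix_mult.scaleR_right)
  then show "contract W 1 = W" unfolding contract_def using matrix_inv_right[OF contract_den_invertible[OF W, of 1]] by (simp flip: matrix_mul_assoc)
qed

lemma contract_0: "W \<in> Sp_nonneg \<Longrightarrow> contract W 0 = mat 1"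
  unfolding contract_def using matrix_inv_right[OF contract_den_invertible, of W 0] by (simp add: contract_num_def contract_den_def)

lemma continuous_on_contract:
  assumes f: "continuous_on S f" and g: "continuous_on S g" and fS: "\<And>x. x \<in> S \<Longrightarrow> f x \<in> Sp_nonneg" and gS: "\<And>x. x \<in> S \<Longrightarrow> g x \<in> {0..1}"
  shows "continuous_on S (\<lambda>x. contract (f x) (g x))"
proof -
  have "continuous_on S (\<lambda>x. contract_num (f x) (g x))" "continuous_on S (\<lambda>x. contract_den (f x) (g x))"
    unfolding contract_num_def contract_den_def by (intro continuous_intros matrix_mult.continuous_on f g)+
  then show ?thesis unfolding contract_def
    by (intro matrix_mult.continuous_on continuous_on_matrix_inv) (use contract_den_invertible[OF fS gS] in auto)
qed

lemma contract_curve: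
  fixes W :: "'n::finite sqm"
  assumes W: "W \<in> Sp_nonneg"
  obtains E where "weakly_causal (contract W) E"
proof -
  have S: "W \<in> Sp" using W by (simp add: Sp_nonneg_def)
  let ?B = "W - mat 1"
  have num: "((\<lambda>s. contract_num W s) has_vector_derivative ?B + J0 ** ?B) (at t within {0..1})" for t
    unfolding contract_num_def by (auto intro!: derivative_eq_intros)
  have den: "((\<lambda>s. contract_den W s) has_vector_derivative - ?B + J0 ** ?B) (at t within {0..1})" for t
    unfolding contract_den_def by (auto intro!: derivative_eq_intros)
  note frac = fractional_curve[OF num den continuous_on_const continuous_on_const contract_den_invertible[OF W] contract_form[OF S], folded contract_def]
  define E where "E t = contract_num W t ** (- (matrix_inv (contract_den W t) ** (- ?B + J0 ** ?B) ** matrix_inv (contract_den W t))) + (?B + J0 ** ?B) ** matrix_inv (contract_den W t)" for t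
  have curve: "Sp_curve (contract W) E" unfolding E_def[abs_def] by (rule frac(1))
  have "weakly_causal (contract W) E"
    unfolding weakly_causal_def
  proof (intro conjI ballI allI)
    show "Sp_curve (contract W) E" by (rule curve)
    fix t :: real and u assume t: "t \<in> {0..1}"
    define v where "v = matrix_inv (contract_den W t) *v u"
    define x y where "x = W *v v + v" and "y = W *v v - v"
    have u: "u = contract_den W t *v v" by (simp add: v_def matrix_inv_cancel[OF contract_den_invertible[OF W t]])
    have "omega0 (contract W t *v u) (E t *v u) = omega0 (contract_num W t *v v) ((?B + J0 ** ?B) *v v) - omega0 (contract_den W t *v v) ((- ?B + J0 ** ?B) *v v)"
      unfolding u E_def by (rule frac(2)[OF _ t])
    also have "\<dots> = omega0 (contract_num W t *v v) (y + J0 *v y) - omega0 (contract_den W t *v v) (- y + J0 *v y)"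
      by (simp add: y_def matrix_vec_linear flip: matrix_vector_mul_assoc)
    also have "\<dots> = 2 * omega0 x y + 2 * (y \<bullet> y)"
      unfolding contract_num_vec contract_den_vec x_def[symmetric] y_def[symmetric]
      by (simp add: omega_simps algebra_simps flip: omega0_inner)
    also have "omega0 x y = 2 * omega0 v (W *v v)" unfolding x_def y_def by (rule omega0_sum_diff(1)[OF S])
    finally show "0 \<le> omega0 (contract W t *v u) (E t *v u)" using W by (simp add: Sp_nonneg_def)
  qed
  then show ?thesis by (rule that)
qed

lemma simply_connected_Sp_nonneg: "simply_connected (Sp_nonneg :: 'n::finite sqm set)"
proof (rule contractible_imp_simply_connected)
  show "contractible (Sp_nonneg :: 'n sqm set)"
    unfolding contractible_def
  proof (intro exI[of _ "mat 1"])
    show "homotopic_with_canon (\<lambda>x. True) Sp_nonneg Sp_nonneg id (\<lambda>x. mat 1 :: 'n sqm)"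
    proof (subst homotopic_with)
      have "continuous_on ({0..1} \<times> (Sp_nonneg :: 'n sqm set)) (\<lambda>p. contract (snd p) (1 - fst p))"
        by (rule continuous_on_contract) (auto intro!: continuous_intros)
      then have "continuous_map (prod_topology (top_of_set {0..1::real}) (top_of_set (Sp_nonneg :: 'n sqm set))) (top_of_set Sp_nonneg) (\<lambda>p. contract (snd p) (1 - fst p))"
        by (auto intro!: contract_Sp_nonneg)
      then show "\<exists>h. continuous_map (prod_topology (top_of_set {0..1::real}) (top_of_set (Sp_nonneg :: 'n sqm set))) (top_of_set Sp_nonneg) h \<and>
          (\<forall>x\<in>topspace (top_of_set Sp_nonneg). h (0, x) = id x) \<and> (\<forall>x\<in>topspace (top_of_set Sp_nonneg). h (1, x) = mat 1) \<and> (\<forall>t\<in>{0..1}. True)"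
        by (intro exI[of _ "\<lambda>p. contract (snd p) (1 - fst p)"] conjI) (simp_all add: contract_0 contract_1)
    qed simp
  qed
qed

definition shear_gen :: "real^('n::finite + 'n) \<Rightarrow> 'n sqm" where "shear_gen u = (\<chi> i j. - ((J0 *v u) $ j) * u $ i)"

lemma shear_gen_vec: "shear_gen u *v y = - (omega0 u y *\<^sub>R u)"
  by (simp add: shear_gen_def matrix_vector_mult_def[of _ y] vec_eq_iff omega0_inner inner_vec_def sum_distrib_left sum_negf mult_ac)

definition shear :: "real^('n::finite + 'n) \<Rightarrow> real \<Rightarrow> 'n sqm" where "shear u k = mat 1 + k *\<^sub>R shear_gen u"

lemma shear_vec: "shear u k *v y = y - (k * omega0 u y) *\<^sub>R u"
  by (simp add: shear_def matrix_vec_linear shear_gen_vec)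

lemma shear_Sp: "shear u k \<in> Sp"
  unfolding Sp_def using omega0_antisym[of _ u]
  by (simp add: shear_vec omega_linear omega0_self)

lemma shear_curve:
  assumes "r \<ge> 0"
  shows "weakly_causal (\<lambda>t. shear u (r * t)) (\<lambda>t. r *\<^sub>R shear_gen u)"
    "omega0 (shear u (r * t) *v y) ((r *\<^sub>R shear_gen u) *v y) = r * (omega0 u y)\<^sup>2"
proof -
  show f: "omega0 (shear u (r * t) *v y) ((r *\<^sub>R shear_gen u) *v y) = r * (omega0 u y)\<^sup>2" for t y
    using omega0_antisym[of y u]
    by (simp add: shear_vec matrix_vec_mult.scaleR_left shear_gen_vec omega_linear
        omega0_self power2_eq_square)
  have "((\<lambda>t. shear u (r * t)) has_vector_derivative r *\<^sub>R shear_gen u) (at t within {0..1})" for t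
    unfolding shear_def by (auto intro!: derivative_eq_intros)
  then show "weakly_causal (\<lambda>t. shear u (r * t)) (\<lambda>t. r *\<^sub>R shear_gen u)"
    unfolding weakly_causal_def Sp_curve_def using f assms by (simp add: shear_Sp)
qed

lemma shear_neg_Sp_nonneg:
  assumes W: "W \<in> Sp_nonneg" and u: "W *v u = - u" and r: "r \<ge> 0"
  shows "shear u (- r) ** W \<in> Sp_nonneg"
proof -
  have S: "W \<in> Sp" using W by (simp add: Sp_nonneg_def)
  have "omega0 u (W *v v) = - omega0 u v" for v
    using Sp_omega0[OF S, of u v] by (simp add: u omega.minus_left)
  then have "omega0 v ((shear u (- r) ** W) *v v) = omega0 v (W *v v) + r * (omega0 u v)\<^sup>2" for v
    using omega0_antisym[of v u]
    by (simp add: shear_vec omega_linear power2_eq_square flip: matrix_vector_mul_assoc)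
  then show ?thesis using W r by (simp add: Sp_nonneg_def Sp_mult shear_Sp)
qed

lemma uniform_form_bound:
  fixes X :: "real \<Rightarrow> 'n::finite sqm"
  assumes X: "continuous_on {0..1} X" and pos: "\<And>t v. t \<in> {0..1} \<Longrightarrow> v \<noteq> 0 \<Longrightarrow> omega0 v (X t *v v) > 0"
  obtains m where "m > 0" "\<And>t v. t \<in> {0..1} \<Longrightarrow> m * (v \<bullet> v) \<le> omega0 v (X t *v v)"
proof -
  let ?Q = "{0..1::real} \<times> sphere (0::real^('n+'n)) 1"
  define f where "f p = omega0 (snd p) (X (fst p) *v snd p)" for p
  have f_cont: "continuous_on ?Q f" unfolding f_def
    by (intro omega.continuous_on matrix_vec_mult.continuous_on continuous_on_snd continuous_on_id
        continuous_on_compose2[OF X continuous_on_fst[OF continuous_on_id]]) auto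
  have "axis undefined 1 \<in> sphere (0::real^('n+'n)) 1" by simp
  then have nonempty: "?Q \<noteq> {}" by fastforce
  have compact: "compact ?Q" by (intro compact_Times compact_Icc compact_sphere)
  obtain p where p: "p \<in> ?Q" "\<And>q. q \<in> ?Q \<Longrightarrow> f p \<le> f q"
    using continuous_attains_inf[OF compact nonempty f_cont] by blast
  show ?thesis
  proof (rule that[of "f p"])
    have "snd p \<noteq> 0" using p(1) by auto
    then show "f p > 0" unfolding f_def using p(1) by (intro pos) auto
    fix t v assume t: "t \<in> {0..1::real}"
    show "f p * (v \<bullet> v) \<le> omega0 v (X t *v v)"
    proof (cases "v = 0")
      case False
      have "f p \<le> f (t, (1 / norm v) *\<^sub>R v)" using False t by (intro p(2)) simp
      also have "\<dots> = omega0 v (X t *v v) / (v \<bullet> v)"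
        by (simp add: f_def omega.scaleR_left omega.scaleR_right matrix_vec_mult.scaleR_right dot_square_norm power2_eq_square)
      finally show ?thesis using False by (simp add: pos_le_divide_eq)
    qed simp
  qed
qed

lemma pos_form_nbhd:
  fixes W :: "'n::finite sqm"
  assumes W: "\<And>v. v \<noteq> 0 \<Longrightarrow> omega0 v (W *v v) > 0"
  obtains e where "e > 0" "\<And>V v. dist V W < e \<Longrightarrow> v \<noteq> 0 \<Longrightarrow> omega0 v (V *v v) > 0"
proof -
  obtain K where K: "K > 0" "\<And>A (v::real^('n+'n)). norm ((A :: 'n sqm) *v v) \<le> norm A * norm v * K"
    using matrix_vec_mult.pos_bounded by blast
  have "\<exists>m>0. \<forall>v. m * (v \<bullet> v) \<le> omega0 v (W *v v)"
  proof (rule uniform_form_bound[where X = "\<lambda>t::real. W"])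
    fix m assume "0 < m" "\<And>t v. t \<in> {0..1::real} \<Longrightarrow> m * (v \<bullet> v) \<le> omega0 v (W *v v)"
    then show ?thesis by (intro exI[of _ m]) force
  qed (use W in auto)
  then obtain m where m: "m > 0" "\<And>v. m * (v \<bullet> v) \<le> omega0 v (W *v v)" by blast
  show ?thesis
  proof (rule that[of "m / K"])
    show "m / K > 0" using m K by simp
    fix V :: "'n sqm" and v :: "real^('n + 'n)" assume V: "dist V W < m / K" and v: "v \<noteq> 0"
    have "- omega0 v ((V - W) *v v) \<le> norm v * norm ((V - W) *v v)" using omega0_le_norm[of v "(V - W) *v v"] by simp
    also have "\<dots> \<le> norm v * (norm (V - W) * norm v * K)" by (intro mult_left_mono K) simp
    also have "\<dots> = (norm (V - W) * K) * (v \<bullet> v)" by (simp add: dot_square_norm power2_eq_square)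
    also have "\<dots> < m * (v \<bullet> v)" using V K v by (intro mult_strict_right_mono) (simp_all add: dist_norm pos_less_divide_eq)
    also have "\<dots> \<le> omega0 v (W *v v)" by (rule m)
    finally show "omega0 v (V *v v) > 0" by (simp add: matrix_vec_mult.diff_left omega.diff_right)
  qed
qed

lemma openin_Sp_pos: "openin (top_of_set Sp) (Sp_pos :: 'n::finite sqm set)"
  unfolding openin_contains_ball
proof (intro conjI ballI)
  fix W :: "'n sqm" assume W: "W \<in> Sp_pos"
  have "\<And>v. v \<noteq> 0 \<Longrightarrow> omega0 v (W *v v) > 0" using W by (simp add: Sp_pos_def)
  then obtain e where "e > 0" "\<And>V v. dist V W < e \<Longrightarrow> v \<noteq> 0 \<Longrightarrow> omega0 v (V *v v) > 0"
    by (rule pos_form_nbhd) blast+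
  then show "\<exists>e>0. ball W e \<inter> Sp \<subseteq> Sp_pos" by (intro exI[of _ e]) (auto simp: Sp_pos_def dist_commute)
qed (auto simp: Sp_pos_def)

lemma timelike_early_Sp_pos:
  fixes c :: "real \<Rightarrow> 'n::finite sqm"
  assumes c: "timelike c D" "c 0 = mat 1"
  obtains d where "d > 0" "\<And>t. 0 < t \<Longrightarrow> t < d \<Longrightarrow> t \<le> 1 \<Longrightarrow> c t \<in> Sp_pos"
proof -
  have curve: "Sp_curve c D" using c(1) by (simp add: timelike_def)
  have "\<And>v. v \<noteq> 0 \<Longrightarrow> omega0 v (D 0 *v v) > 0" using c by (force simp: timelike_def)
  then obtain e where e: "e > 0" "\<And>V v. dist V (D 0) < e \<Longrightarrow> v \<noteq> 0 \<Longrightarrow> omega0 v (V *v v) > 0"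
    by (rule pos_form_nbhd) blast+
  have "((\<lambda>s. (c s - c 0) /\<^sub>R (s - 0)) \<longlongrightarrow> D 0) (at 0 within {0..1})"
    using Sp_curveD(6)[OF curve, of 0] unfolding has_vector_derivative_within_iff_tendsto by simp
  then obtain d where d: "d > 0" "\<And>s. s \<in> {0..1} \<Longrightarrow> 0 < dist s 0 \<Longrightarrow> dist s 0 < d \<Longrightarrow> dist ((c s - c 0) /\<^sub>R (s - 0)) (D 0) < e"
    using e(1) unfolding Lim_within by blast
  show ?thesis
  proof (rule that[OF d(1)])
    fix t :: real assume t: "0 < t" "t < d" "t \<le> 1"
    have "omega0 v (c t *v v) > 0" if v: "v \<noteq> 0" for v
    proof -
      have "0 < omega0 v (((c t - c 0) /\<^sub>R (t - 0)) *v v)" using t by (intro e(2) d(2) v) auto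
      also have "\<dots> = omega0 v (c t *v v) / t"
        by (simp add: matrix_vec_linear omega.scaleR_right omega.diff_right c(2) omega0_self field_simps)
      finally show ?thesis using t by (simp add: zero_less_divide_iff)
    qed
    then show "c t \<in> Sp_pos" using Sp_curveD(2)[OF curve, of t] t by (simp add: Sp_pos_def)
  qed
qed

lemma timelike_exit_time:
  fixes c :: "real \<Rightarrow> 'n::finite sqm"
  assumes c: "timelike c D" "c 0 = mat 1" and exit: "t0 \<in> {0<..1}" "c t0 \<notin> Sp_pos"
  obtains T where "0 < T" "T \<le> 1" "\<And>t. 0 < t \<Longrightarrow> t < T \<Longrightarrow> c t \<in> Sp_pos" "c T \<notin> Sp_pos"
proof -
  have curve: "Sp_curve c D" using c(1) by (simp add: timelike_def)
  obtain d where d: "d > 0" "\<And>t. 0 < t \<Longrightarrow> t < d \<Longrightarrow> t \<le> 1 \<Longrightarrow> c t \<in> Sp_pos" by (rule timelike_early_Sp_pos[OF c]) (rule that)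
  define E where "E = {d..1} \<inter> c -` (Sp - Sp_pos)"
  have "closedin (top_of_set Sp) (Sp - Sp_pos :: 'n sqm set)" using openin_Sp_pos by (intro closedin_diff) auto
  moreover have "continuous_on {d..1} c" using continuous_on_subset[OF Sp_curveD(4)[OF curve]] d(1) by simp
  moreover have "c \<in> {d..1} \<rightarrow> Sp" using Sp_curveD(2)[OF curve] d(1) by auto
  ultimately have "closedin (top_of_set {d..1}) E" unfolding E_def by (intro continuous_closedin_preimage_gen)
  then have "compact E" by (rule closedin_compact[OF compact_Icc])
  have E_iff: "t \<in> E \<longleftrightarrow> c t \<notin> Sp_pos" if "0 < t" "t \<le> 1" for t
    using that d(2)[OF that(1) _ that(2)] Sp_curveD(2)[OF curve, of t] by (force simp: E_def not_le)
  then have "E \<noteq> {}" using exit by auto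
  from compact_attains_inf[OF \<open>compact E\<close> this] obtain T where T: "T \<in> E" "\<forall>t\<in>E. T \<le> t" by blast
  then have "0 < T" "T \<le> 1" using d(1) by (auto simp: E_def)
  moreover have "c t \<in> Sp_pos" if "0 < t" "t < T" for t using E_iff[of t] T(2) that \<open>T \<le> 1\<close> by force
  ultimately show ?thesis using that T(1) by (auto simp: E_def)
qed

lemma Sp_nonneg_boundary:
  assumes W: "W \<in> Sp_nonneg" "W \<notin> Sp_pos"
  obtains v where "v \<noteq> 0" "omega0 v (W *v v) = 0" "W *v (W *v v) = v"
proof -
  have S: "W \<in> Sp" and nonneg: "\<And>u. 0 \<le> omega0 u (W *v u)" using W(1) by (auto simp: Sp_nonneg_def)
  obtain v where v: "v \<noteq> 0" "omega0 v (W *v v) \<le> 0" using W(2) S by (auto simp: Sp_pos_def not_less)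
  then have null: "omega0 v (W *v v) = 0" using nonneg[of v] by simp
  have "omega0 (W *v u) (W *v (W *v v) - v) = 0" for u
    using omega0_form_kernel[OF nonneg null, of u] omega0_antisym[of v "W *v u"] by (simp add: omega.diff_right Sp_omega0[OF S])
  then have "W *v (W *v v) - v = 0" by (rule Sp_orthogonal_image_imp_0[OF S])
  then show ?thesis using that v(1) null by simp
qed

text \<open>If the null vector \<open>v\<close> of the form at the exit were fixed, \<open>\<omega>(v, c v)\<close> would be increasing there.\<close>
lemma timelike_first_exit:
  fixes c :: "real \<Rightarrow> 'n::finite sqm"
  assumes c: "timelike c D" "c 0 = mat 1" and exit: "t0 \<in> {0<..1}" "c t0 \<notin> Sp_pos"
  obtains T u where "0 < T" "T \<le> 1" "\<And>t. 0 < t \<Longrightarrow> t < T \<Longrightarrow> c t \<in> Sp_pos" "c T \<in> Sp_nonneg" "u \<noteq> 0" "c T *v u = - u"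
proof -
  have curve: "Sp_curve c D" using c(1) by (simp add: timelike_def)
  obtain T where T: "0 < T" "T \<le> 1" and before: "\<And>t. 0 < t \<Longrightarrow> t < T \<Longrightarrow> c t \<in> Sp_pos" and "c T \<notin> Sp_pos"
    by (rule timelike_exit_time[OF c exit]) (rule that)
  have "c ` closure {0<..<T} \<subseteq> Sp_nonneg"
    by (rule image_closure_subset[OF _ closed_Sp_nonneg])
      (use T before Sp_pos_subset_Sp_nonneg continuous_on_subset[OF Sp_curveD(4)[OF curve]] in auto)
  then have cT: "c T \<in> Sp_nonneg" using T(1) by auto
  then obtain v where v: "v \<noteq> 0" "omega0 v (c T *v v) = 0" "c T *v (c T *v v) = v"
    using \<open>c T \<notin> Sp_pos\<close> by (rule Sp_nonneg_boundary)
  have "c T *v v \<noteq> v"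
  proof
    assume fixed: "c T *v v = v"
    have "T \<in> {0..1}" using T by simp
    have "((\<lambda>t. omega0 v (c t *v v)) has_real_derivative omega0 v (D T *v v)) (at T within {0..1})"
      unfolding has_real_derivative_iff_has_vector_derivative
      by (rule bounded_linear.has_vector_derivative[OF omega.bounded_linear_right
          bounded_linear.has_vector_derivative[OF matrix_vec_mult.bounded_linear_left Sp_curveD(6)[OF curve \<open>T \<in> {0..1}\<close>]]])
    moreover have "0 < omega0 v (D T *v v)" using c(1) v(1) fixed \<open>T \<in> {0..1}\<close> by (metis timelike_def)
    ultimately obtain r where r: "r > 0" "\<And>h. 0 < h \<Longrightarrow> T - h \<in> {0..1} \<Longrightarrow> h < r \<Longrightarrow> omega0 v (c (T - h) *v v) < omega0 v (c T *v v)"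
      using has_real_derivative_pos_inc_left by blast
    define h where "h = min r T / 2"
    have h: "0 < h" "h < r" "h < T" using r(1) T by (auto simp: h_def)
    have "omega0 v (c (T - h) *v v) < 0" using r(2)[of h] h T(2) v(2) by simp
    moreover have "c (T - h) \<in> Sp_pos" using before[of "T - h"] h by simp
    ultimately show False using v(1) by (simp add: Sp_pos_def) (meson less_asym)
  qed
  then show ?thesis
    by (intro that[OF T before cT, of "c T *v v - v"]) (simp_all add: matrix_vec_mult.diff_right v(3))
qed

lemma closure_of_interior_path:
  fixes w :: "(real \<Rightarrow> 'n::finite sqm) set"
  assumes w: "w \<in> SpT" "c \<in> w" and pos: "\<And>t. 0 < t \<Longrightarrow> t < 1 \<Longrightarrow> c t \<in> Sp_pos"
  shows "w \<in> SpT_top closure_of SpT_ell_plus"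
  unfolding in_closure_of
proof (intro conjI allI impI)
  show "w \<in> topspace SpT_top" using w(1) by simp
  have path: "sp_path c" and w_cls: "w = cls (subpath 0 1 c)" using SpT_mem[OF w] by auto
  fix U assume U: "w \<in> U \<and> openin SpT_top U"
  then obtain V where V: "open V" "proj w \<in> V" "nbhd w V \<subseteq> U" unfolding openin_SpT_top by blast
  have "c 1 \<in> V" using V(2) proj_eq[OF w] by (simp add: pathfinish_def)
  then obtain d where d: "d > 0" "\<And>s. s \<in> {0..1} \<Longrightarrow> dist s 1 < d \<Longrightarrow> cls (subpath 0 s c) \<in> nbhd w V"
    using cls_subpath_near[OF path _ V(1), of 1] unfolding w_cls by auto
  define t where "t = 1 - min d 1 / 2"
  have t: "0 < t" "t < 1" "dist t 1 < d" using d(1) by (auto simp: t_def dist_real_def)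
  let ?p = "subpath 0 t c"
  have p: "sp_path ?p" by (rule sp_path_subpath[OF path]) (use t in simp)
  have "cls ?p \<in> U" using V(3) d(2)[of t] t by auto
  moreover have "cls ?p \<in> SpT_ell_plus"
    unfolding SpT_ell_plus_def
  proof (intro CollectI conjI bexI[of _ ?p] ballI)
    show "cls ?p \<in> SpT" "?p \<in> cls ?p" using cls_in_SpT[OF p] cls_self[OF p] by auto
    fix s :: real assume s: "s \<in> {0<..1}"
    have "t * s \<le> t" using s t mult_left_le[of s t] by simp
    then have "t * s < 1" using t(2) by linarith
    then have "c (t * s) \<in> Sp_pos" using s t by (intro pos) auto
    then show "?p s \<in> Sp_ell_plus" by (simp add: Sp_pos_eq_Sp_ell_plus[symmetric] subpath_def)
  qed
  ultimately show "\<exists>y. y \<in> SpT_ell_plus \<and> y \<in> U" by blast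
qed

section \<open>Curves of unbounded length\<close>

lemma homotopic_pathsI:
  fixes h :: "real \<times> real \<Rightarrow> 'a::real_normed_vector"
  assumes "continuous_on ({0..1} \<times> {0..1}) h" "\<And>s t. s \<in> {0..1} \<Longrightarrow> t \<in> {0..1} \<Longrightarrow> h (s, t) \<in> S"
    "\<And>t. t \<in> {0..1} \<Longrightarrow> h (0, t) = p t" "\<And>t. t \<in> {0..1} \<Longrightarrow> h (1, t) = q t"
    "\<And>s. s \<in> {0..1} \<Longrightarrow> h (s, 0) = p 0" "\<And>s. s \<in> {0..1} \<Longrightarrow> h (s, 1) = p 1"
  shows "homotopic_paths S p q"
  unfolding homotopic_paths by (intro exI[of _ h]) (use assms in \<open>auto simp: pathstart_def pathfinish_def\<close>)

lemma shear_0 [simp]: "shear u 0 = mat 1"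
  by (simp add: shear_def)

lemma shear_inverse: "shear u r ** shear u (- r) = mat 1"
  unfolding matrix_eq
  by (simp add: shear_vec omega_linear omega0_self flip: matrix_vector_mul_assoc)

lemma continuous_on_shear: "continuous_on S f \<Longrightarrow> continuous_on S (\<lambda>x. shear u (f x))"
  unfolding shear_def by (intro continuous_intros)

lemma timelike_tail:
  fixes c :: "real \<Rightarrow> 'n::finite sqm"
  assumes c: "timelike c D" and T: "0 < T" "T < 1"
  shows "timelike (\<lambda>t. c (T + t * (1 - T)) ** matrix_inv (c T)) (\<lambda>t. ((1 - T) *\<^sub>R D (T + t * (1 - T))) ** matrix_inv (c T))"
    (is "timelike ?a ?A")
proof -
  let ?f = "\<lambda>t. T + t * (1 - T)" and ?Wi = "matrix_inv (c T)"
  have curve: "Sp_curve c D" using c by (simp add: timelike_def)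
  note C = Sp_curveD[OF curve]
  have f: "?f t \<in> {0..1}" if "t \<in> {0..1}" for t
    using convexD[OF convex_real_interval(5)[of 0 1], of T 1 "1 - t" t] that T by (simp add: algebra_simps)
  have f_image: "?f ` {0..1} \<subseteq> {0..1}" by (rule image_subsetI) (rule f)
  have Wi: "?Wi \<in> Sp" using Sp_inv C(2)[of T] T by simp
  have "omega0 (?a t *v v) (?A t *v v) > 0" if "t \<in> {0..1}" "v \<noteq> 0" for t v
  proof -
    have "omega0 (?a t *v v) (?A t *v v) = (1 - T) * omega0 (c (?f t) *v (?Wi *v v)) (D (?f t) *v (?Wi *v v))"
      by (simp add: matrix_vec_mult.scaleR_left omega.scaleR_right flip: matrix_vector_mul_assoc)
    moreover have "?Wi *v v \<noteq> 0" using Sp_vec_eq_0[OF Wi] that(2) by simp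
    ultimately show ?thesis using c f[OF that(1)] T(2) by (simp add: timelike_def)
  qed
  moreover have "Sp_curve ?a ?A"
    unfolding Sp_curve_def
  proof (intro conjI ballI)
    fix t :: real assume t: "t \<in> {0..1}"
    have "(?f has_vector_derivative (1 - T)) (at t within {0..1})"
      by (auto intro!: derivative_eq_intros)
    moreover have "(c has_vector_derivative D (?f t)) (at (?f t) within ?f ` {0..1})"
      by (rule has_vector_derivative_within_subset[OF C(6)[OF f[OF t]] f_image])
    ultimately have "((c \<circ> ?f) has_vector_derivative (1 - T) *\<^sub>R D (?f t)) (at t within {0..1})"
      by (rule vector_diff_chain_within)
    then show "(?a has_vector_derivative ?A t) (at t within {0..1})"
      unfolding o_def by (rule bounded_linear.has_vector_derivative[OF matrix_mult.bounded_linear_left])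
    show "?a t \<in> Sp" by (rule Sp_mult[OF C(2)[OF f[OF t]] Wi])
  next
    have "continuous_on {0..1} (\<lambda>t. D (?f t))"
      by (rule continuous_on_compose2[OF C(5) _ f_image]) (intro continuous_intros)
    then show "continuous_on {0..1} ?A"
      by (intro matrix_mult.continuous_on continuous_on_scaleR continuous_on_const)
  qed
  ultimately show ?thesis by (simp add: timelike_def)
qed

text \<open>The last factor ends at \<open>(1 - r N) W\<close>, with \<open>N y = - \<omega>(u, y) u\<close>, far from \<open>W\<close>; the shear \<open>1 + r t N\<close>, which
  compensates for this, contributes a multiple of \<open>r\<close> to one eigenvalue of the form.\<close>
definition sheared_curve :: "(real \<Rightarrow> 'n::finite sqm) \<Rightarrow> 'n sqm \<Rightarrow> real^('n + 'n) \<Rightarrow> real \<Rightarrow> real \<Rightarrow> 'n sqm" where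
  "sheared_curve a W u r t = a t ** (shear u (r * t) ** contract (shear u (- r) ** W) t)"

lemma sheared_curve_form:
  fixes a :: "real \<Rightarrow> 'n::finite sqm"
  assumes a: "timelike a A" and W: "W \<in> Sp_nonneg" "W *v u = - u" and r: "r \<ge> 0"
  obtains P' where "weakly_causal (sheared_curve a W u r) P'"
    "\<And>t z. t \<in> {0..1} \<Longrightarrow> omega0 z (logder (sheared_curve a W u r) t *v z)
       \<ge> omega0 z (logder a t *v z) + r * (omega0 u (matrix_inv (a t) *v z))\<^sup>2"
proof -
  let ?f = "shear u (- r) ** W" and ?P = "sheared_curve a W u r"
  have a_curve: "Sp_curve a A" and a_causal: "weakly_causal a A" using a timelike_imp_weakly_causal by (auto simp: timelike_def)
  obtain E where E: "weakly_causal (contract ?f) E" by (rule contract_curve[OF shear_neg_Sp_nonneg[OF W r]])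
  define S' where "S' t = shear u (r * t) ** E t + (r *\<^sub>R shear_gen u) ** contract ?f t" for t
  define P' where "P' t = a t ** S' t + A t ** (shear u (r * t) ** contract ?f t)" for t
  note shear = shear_curve[OF r, of u]
  note S = weakly_causal_mult[OF shear(1) E, folded S'_def]
  have P: "weakly_causal ?P P'"
    unfolding sheared_curve_def[abs_def] P'_def[abs_def] by (rule weakly_causal_mult(1)[OF a_causal S(1)])
  then have P_curve: "Sp_curve ?P P'" by (simp add: weakly_causal_def)
  have "omega0 z (logder ?P t *v z) \<ge> omega0 z (logder a t *v z) + r * (omega0 u (matrix_inv (a t) *v z))\<^sup>2" if t: "t \<in> {0..1}" for t z
  proof -
    define v where "v = matrix_inv (?P t) *v z"
    define e where "e = contract ?f t *v v"
    define y where "y = shear u (r * t) *v e"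
    have z: "z = ?P t *v v" by (simp add: v_def matrix_inv_cancel[OF Sp_invertible[OF Sp_curveD(2)[OF P_curve t]]])
    have y: "(shear u (r * t) ** contract ?f t) *v v = y" by (simp add: y_def e_def matrix_vector_mul_assoc)
    have z_a: "z = a t *v y" by (simp add: z sheared_curve_def y[symmetric] matrix_vector_mul_assoc)
    have "omega0 z (logder ?P t *v z) = omega0 (?P t *v v) (P' t *v v)" unfolding z by (rule logder_form[OF P_curve t])
    also have "\<dots> = omega0 y (S' t *v v) + omega0 (a t *v y) (A t *v y)"
      unfolding sheared_curve_def P'_def weakly_causal_mult(2)[OF a_causal S(1) t] y ..
    also have "omega0 (a t *v y) (A t *v y) = omega0 z (logder a t *v z)" unfolding z_a by (rule logder_form[OF a_curve t, symmetric])
    also have "omega0 y (S' t *v v) = omega0 e (E t *v v) + r * (omega0 u e)\<^sup>2"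
      using S(2)[OF t, of v] unfolding y e_def[symmetric] shear(2) .
    also have "omega0 u e = omega0 u (matrix_inv (a t) *v z)"
      unfolding z_a matrix_inv_cancel(2)[OF Sp_invertible[OF Sp_curveD(2)[OF a_curve t]]]
      by (simp add: y_def shear_vec omega.diff_right omega.scaleR_right omega0_self)
    finally show ?thesis using E t by (simp add: e_def weakly_causal_def)
  qed
  with P show ?thesis by (rule that)
qed

lemma G_lower_bound_rank_one:
  fixes X V :: "'n::finite sqm"
  assumes X: "X \<in> sp" and V: "V \<in> Sp" and u: "u \<noteq> 0" and m: "m > 0" and r: "r \<ge> 0"
    and form: "\<And>z. omega0 z (X *v z) \<ge> m * (z \<bullet> z) + r * (omega0 u (matrix_inv V *v z))\<^sup>2"
    and k: "norm (V *v (J0 *v u)) \<le> k"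
  shows "(m ^ (CARD('n + 'n) - 1) * (r * (u \<bullet> u)\<^sup>2 / k\<^sup>2)) powr (1 / real CARD('n + 'n)) \<le> G X"
proof -
  define v where "v = V *v (J0 *v u)"
  have "norm (J0 *v u) \<noteq> 0" using u by (simp only: norm_J0 norm_eq_zero not_False_eq_True)
  then have v: "v \<noteq> 0" unfolding v_def using Sp_vec_eq_0[OF V, of "J0 *v u"] by (metis norm_zero)
  then have "0 < norm (V *v (J0 *v u))" by (simp only: v_def zero_less_norm_iff not_False_eq_True)
  with k have "k > 0" by linarith
  have "v \<bullet> v \<le> k\<^sup>2" using k power_mono[OF k, of 2] by (simp add: v_def dot_square_norm)
  then have "r * (u \<bullet> u)\<^sup>2 / k\<^sup>2 * (v \<bullet> v) \<le> r * (u \<bullet> u)\<^sup>2 / k\<^sup>2 * k\<^sup>2" using r by (intro mult_left_mono) simp_all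
  also have "\<dots> = r * (omega0 u (matrix_inv V *v v))\<^sup>2"
    using \<open>k > 0\<close> by (simp add: v_def matrix_inv_cancel[OF Sp_invertible[OF V]] omega0_J0_right)
  also have "\<dots> \<le> m * (v \<bullet> v) + r * (omega0 u (matrix_inv V *v v))\<^sup>2" using m by simp
  also note form[of v]
  finally have "r * (u \<bullet> u)\<^sup>2 / k\<^sup>2 * (v \<bullet> v) \<le> omega0 v (X *v v)" .
  moreover have "m * (z \<bullet> z) \<le> omega0 z (X *v z)" for z
    by (rule order_trans[OF _ form[of z]]) (use r in simp)
  ultimately show ?thesis using r by (intro G_lower_bound[OF X _ m _ v]) simp_all
qed

lemma sheared_curve_long:
  fixes a :: "real \<Rightarrow> 'n::finite sqm"
  assumes a: "timelike a A" and W: "W \<in> Sp_nonneg" "W *v u = - u" and u: "u \<noteq> 0"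
  obtains r where "r \<ge> 0" "timelike_curve (sheared_curve a W u r)" "B \<le> lengthG (sheared_curve a W u r)"
proof -
  let ?N = "CARD('n + 'n)"
  have curve: "Sp_curve a A" using a by (simp add: timelike_def)
  obtain m where m: "m > 0" "\<And>t v. t \<in> {0..1} \<Longrightarrow> m * (v \<bullet> v) \<le> omega0 v (logder a t *v v)"
    by (rule uniform_form_bound[OF continuous_on_logder[OF curve]])
      (use timelike_logder[OF curve] a in \<open>auto simp: sp_plus_def\<close>)
  have "compact ((\<lambda>t. a t *v (J0 *v u)) ` {0..1})"
    by (intro compact_continuous_image matrix_vec_mult.continuous_on Sp_curveD(4)[OF curve] continuous_on_const) simp
  then obtain k where k: "k > 0" "\<And>t. t \<in> {0..1} \<Longrightarrow> norm (a t *v (J0 *v u)) \<le> k"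
    by (auto dest!: compact_imp_bounded simp: bounded_pos)
  define b where "b = \<bar>B\<bar> + 1"
  define r where "r = b ^ ?N * k\<^sup>2 / (m ^ (?N - 1) * (u \<bullet> u)\<^sup>2)"
  have b: "b > 0" "B \<le> b" by (auto simp: b_def)
  have r: "r \<ge> 0" using b k m by (simp add: r_def)
  let ?P = "sheared_curve a W u r"
  obtain P' where P: "weakly_causal ?P P'" and form: "\<And>t z. t \<in> {0..1} \<Longrightarrow>
      omega0 z (logder ?P t *v z) \<ge> omega0 z (logder a t *v z) + r * (omega0 u (matrix_inv (a t) *v z))\<^sup>2"
    by (rule sheared_curve_form[OF a W r]) (rule that)
  have P_curve: "Sp_curve ?P P'" using P by (simp add: weakly_causal_def)
  have form_m: "omega0 z (logder ?P t *v z) \<ge> m * (z \<bullet> z) + r * (omega0 u (matrix_inv (a t) *v z))\<^sup>2" if "t \<in> {0..1}" for t z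
    using form[OF that, of z] m(2)[OF that, of z] by linarith
  have "omega0 z (logder ?P t *v z) > 0" if "t \<in> {0..1}" "z \<noteq> 0" for t z
    by (rule less_le_trans[OF _ form_m[OF that(1)]]) (use m(1) r that(2) in \<open>simp add: add_pos_nonneg\<close>)
  then have "timelike_curve ?P"
    using Sp_curveD(1,2)[OF P_curve] logder_sp[OF P_curve] by (simp add: timelike_curve_def sp_plus_def)
  moreover have "b \<le> G (logder ?P t)" if t: "t \<in> {0..1}" for t
  proof -
    have "m ^ (?N - 1) * (r * (u \<bullet> u)\<^sup>2 / k\<^sup>2) = b ^ ?N" using m(1) k(1) u by (simp add: r_def field_simps del: card_sum)
    then have "(b ^ ?N) powr (1 / real ?N) \<le> G (logder ?P t)"
      using G_lower_bound_rank_one[OF logder_sp[OF P_curve t] Sp_curveD(2)[OF curve t] u m(1) r form_m[OF t] k(2)[OF t]] by simp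
    then show ?thesis using b by (simp add: powr_powr flip: powr_realpow del: card_sum)
  qed
  then have "integral {0..1} (\<lambda>t::real. b) \<le> lengthG ?P"
    unfolding lengthG_def
    by (intro integral_le integrable_continuous_interval continuous_on_G_logder[OF P] continuous_on_const) auto
  then have "B \<le> lengthG ?P" using b by simp
  ultimately show ?thesis using that r by blast
qed

lemma homotopic_sheared_curve:
  fixes a :: "real \<Rightarrow> 'n::finite sqm"
  assumes a: "continuous_on {0..1} a" "\<And>t. t \<in> {0..1} \<Longrightarrow> a t \<in> Sp" and W: "W \<in> Sp_nonneg" "W *v u = - u" and r: "r \<ge> 0"
  shows "homotopic_paths Sp (sheared_curve a W u 0) (sheared_curve a W u r)"
proof (rule homotopic_pathsI[where h = "\<lambda>p. sheared_curve a W u (fst p * r) (snd p)"])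
  let ?Q = "{0..1::real} \<times> {0..1::real}"
  have f: "shear u (- (s * r)) ** W \<in> Sp_nonneg" if "s \<in> {0..1}" for s
    using that r by (intro shear_neg_Sp_nonneg[OF W]) simp
  have "continuous_on ?Q (\<lambda>p. a (snd p))"
    by (rule continuous_on_compose2[OF a(1) continuous_on_snd[OF continuous_on_id]]) auto
  then show "continuous_on ?Q (\<lambda>p. sheared_curve a W u (fst p * r) (snd p))"
    unfolding sheared_curve_def
    by (intro matrix_mult.continuous_on continuous_on_shear continuous_on_contract continuous_intros) (use f in auto)
  show "sheared_curve a W u (fst (s, t) * r) (snd (s, t)) \<in> Sp" if "s \<in> {0..1}" "t \<in> {0..1}" for s t
    using contract_Sp_nonneg[OF f[OF that(1)] that(2)] that a(2)
    by (simp add: sheared_curve_def Sp_mult shear_Sp Sp_nonneg_def)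
  have ends: "sheared_curve a W u (s * r) 0 = a 0" "sheared_curve a W u (s * r) 1 = a 1 ** W" if "s \<in> {0..1}" for s
    using shear_inverse[of u "s * r"] by (simp_all add: sheared_curve_def contract_0[OF f[OF that]] contract_1[OF f[OF that]] matrix_mul_assoc)
  show "sheared_curve a W u (fst (s, 0) * r) (snd (s, 0)) = sheared_curve a W u 0 0" if "s \<in> {0..1}" for s
    using ends(1)[OF that] ends(1)[of 0] by simp
  show "sheared_curve a W u (fst (s, 1) * r) (snd (s, 1)) = sheared_curve a W u 0 1" if "s \<in> {0..1}" for s
    using ends(2)[OF that] ends(2)[of 0] by simp
qed simp_all

lemma homotopic_paths_mult_left:
  fixes a :: "real \<Rightarrow> 'n::finite sqm"
  assumes a: "continuous_on {0..1} a" "\<And>t. t \<in> {0..1} \<Longrightarrow> a t \<in> Sp" and hom: "homotopic_paths Sp p q"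
  shows "homotopic_paths Sp (\<lambda>t. a t ** p t) (\<lambda>t. a t ** q t)"
proof -
  let ?Q = "{0..1::real} \<times> {0..1::real}"
  obtain H where H: "continuous_on ?Q H" "H \<in> ?Q \<rightarrow> Sp" "\<forall>x\<in>{0..1}. H (0, x) = p x" "\<forall>x\<in>{0..1}. H (1, x) = q x"
    "\<forall>t\<in>{0..1}. pathstart (H \<circ> Pair t) = pathstart p \<and> pathfinish (H \<circ> Pair t) = pathfinish p"
    using hom unfolding homotopic_paths by blast
  show ?thesis
  proof (rule homotopic_pathsI[where h = "\<lambda>p. a (snd p) ** H p"])
    have "continuous_on ?Q (\<lambda>p. a (snd p))"
      by (rule continuous_on_compose2[OF a(1) continuous_on_snd[OF continuous_on_id]]) auto
    then show "continuous_on ?Q (\<lambda>p. a (snd p) ** H p)" by (intro matrix_mult.continuous_on H(1))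
    show "a (snd (s, t)) ** H (s, t) \<in> Sp" if "s \<in> {0..1}" "t \<in> {0..1}" for s t
      using H(2) that by (simp add: Sp_mult a(2) Pi_iff)
  qed (use H(3-5) in \<open>simp_all add: pathstart_def pathfinish_def\<close>)
qed

text \<open>The product of two paths, as opposed to their concatenation, runs along the diagonal of the unit square.\<close>
lemma homotopic_mult_concatenation:
  fixes a b :: "real \<Rightarrow> 'n::finite sqm"
  assumes a: "continuous_on {0..1} a" "\<And>t. t \<in> {0..1} \<Longrightarrow> a t \<in> Sp"
    and b: "continuous_on {0..1} b" "\<And>t. t \<in> {0..1} \<Longrightarrow> b t \<in> Sp" and T: "0 < T" "T < 1"
  shows "homotopic_paths Sp (\<lambda>t. a t ** b t) (\<lambda>t. a (max 0 ((t - T) / (1 - T))) ** b (min 1 (t / T)))"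
proof -
  let ?Q = "{0..1::real} \<times> {0..1::real}" and ?m = "\<lambda>q. a (fst q) ** b (snd q)"
  define p where "p t = (max 0 ((t - T) / (1 - T)), min 1 (t / T))" for t
  have "homotopic_paths ?Q (\<lambda>t. (t, t)) p"
  proof (rule homotopic_paths_linear)
    show "path (\<lambda>t::real. (t, t))" "path p" unfolding path_def p_def using T by (auto intro!: continuous_intros)
    show "pathstart p = pathstart (\<lambda>t. (t, t))" "pathfinish p = pathfinish (\<lambda>t. (t, t))"
      using T by (simp_all add: p_def pathstart_def pathfinish_def max_def min_def divide_le_0_iff)
    show "closed_segment (t, t) (p t) \<subseteq> ?Q" if "t \<in> {0..1}" for t
      by (rule closed_segment_subset) (use that T in \<open>auto simp: p_def divide_le_eq intro: convex_Times\<close>)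
  qed
  then have "homotopic_paths Sp (?m \<circ> (\<lambda>t. (t, t))) (?m \<circ> p)"
  proof (rule homotopic_paths_continuous_image)
    show "continuous_on ?Q ?m"
      by (intro matrix_mult.continuous_on continuous_on_compose2[OF a(1)] continuous_on_compose2[OF b(1)] continuous_intros) auto
    show "?m \<in> ?Q \<rightarrow> Sp" by (intro Pi_I Sp_mult a(2) b(2)) auto
  qed
  then show ?thesis by (simp add: o_def p_def)
qed

lemma homotopic_contract_path:
  fixes p :: "real \<Rightarrow> 'n::finite sqm"
  assumes p: "continuous_on {0..1} p" "\<And>t. t \<in> {0..1} \<Longrightarrow> p t \<in> Sp_nonneg" "p 0 = mat 1"
  shows "homotopic_paths Sp p (contract (p 1))"
proof -
  have W: "p 1 \<in> Sp_nonneg" using p(2) by simp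
  have "path (contract (p 1))" unfolding path_def
    using continuous_on_contract[of "{0..1}" "\<lambda>t. p 1" "\<lambda>t. t"] W by auto
  moreover have "path_image (contract (p 1)) \<subseteq> Sp_nonneg" "path_image p \<subseteq> Sp_nonneg"
    using contract_Sp_nonneg[OF W] p(2) by (auto simp: path_image_def)
  moreover have "pathstart (contract (p 1)) = pathstart p" "pathfinish (contract (p 1)) = pathfinish p"
    by (simp_all add: pathstart_def pathfinish_def contract_0[OF W] contract_1[OF W] p(3))
  ultimately have "homotopic_paths Sp_nonneg p (contract (p 1))"
    using p(1) unfolding path_def[symmetric]
    by (intro simply_connected_Sp_nonneg[unfolded simply_connected_eq_homotopic_paths, THEN conjunct2, rule_format] conjI)
  then show ?thesis by (rule homotopic_paths_subset) (auto simp: Sp_nonneg_def)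
qed

lemma homotopic_sheared_tail:
  fixes c :: "real \<Rightarrow> 'n::finite sqm"
  assumes c: "sp_path c" and T: "0 < T" "T < 1" and before: "\<And>t. t \<in> {0..T} \<Longrightarrow> c t \<in> Sp_nonneg"
    and u: "c T *v u = - u" and r: "r \<ge> 0"
  shows "homotopic_paths Sp c (sheared_curve (\<lambda>t. c (T + t * (1 - T)) ** matrix_inv (c T)) (c T) u r)"
proof -
  let ?a = "\<lambda>t. c (T + t * (1 - T)) ** matrix_inv (c T)" and ?b = "\<lambda>t. c (T * t)"
  have W: "c T \<in> Sp_nonneg" "c T \<in> Sp" using before[of T] T(1) by (auto simp: Sp_nonneg_def)
  note Wi = matrix_inv_left[OF Sp_invertible[OF W(2)]] matrix_inv_right[OF Sp_invertible[OF W(2)]]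
  have f: "T + t * (1 - T) \<in> {0..1}" if "t \<in> {0..1}" for t
    using convexD[OF convex_real_interval(5)[of 0 1], of T 1 "1 - t" t] that T by (simp add: algebra_simps)
  have a: "continuous_on {0..1} ?a"
    using f by (intro matrix_mult.continuous_on continuous_on_compose2[OF sp_pathD(6)[OF c]] continuous_intros image_subsetI)
  have a_Sp: "?a t \<in> Sp" if "t \<in> {0..1}" for t
    by (rule Sp_mult[OF sp_pathD(5)[OF c f[OF that]] Sp_inv[OF W(2)]])
  have Tt: "T * t \<in> {0..T}" if "t \<in> {0..1}" for t using that T mult_left_le[of t T] by simp
  have b: "continuous_on {0..1} ?b"
    using Tt T(2) by (intro continuous_on_compose2[OF sp_pathD(6)[OF c]] continuous_intros image_subsetI) force
  have b_nonneg: "?b t \<in> Sp_nonneg" if "t \<in> {0..1}" for t using before[OF Tt[OF that]] .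
  let ?p = "\<lambda>t. ?a (max 0 ((t - T) / (1 - T))) ** ?b (min 1 (t / T))"
  have product: "homotopic_paths Sp (\<lambda>t. ?a t ** ?b t) ?p"
    by (rule homotopic_mult_concatenation[OF a a_Sp b _ T]) (use b_nonneg in \<open>auto simp: Sp_nonneg_def\<close>)
  have "homotopic_paths Sp ?p c"
  proof (rule homotopic_paths_eq)
    show "path ?p" "path_image ?p \<subseteq> Sp" using homotopic_paths_imp_path[OF product] homotopic_paths_imp_subset[OF product] by auto
    fix t :: real assume t: "t \<in> {0..1}"
    show "?p t = c t"
    proof (cases "t \<le> T")
      case True
      then have "(t - T) / (1 - T) \<le> 0" "t / T \<le> 1" using T by (simp_all add: divide_le_0_iff divide_le_eq)
      then show ?thesis using T by (simp add: max_absorb1 min_absorb2 Wi)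
    next
      case False
      then have "0 \<le> (t - T) / (1 - T)" "1 \<le> t / T" using T by (simp_all add: le_divide_eq)
      moreover have "T + (t - T) / (1 - T) * (1 - T) = t" using T by simp
      ultimately show ?thesis by (simp add: max_absorb2 min_absorb1 Wi flip: matrix_mul_assoc)
    qed
  qed
  from homotopic_paths_trans[OF product this] have "homotopic_paths Sp c (\<lambda>t. ?a t ** ?b t)" by (rule homotopic_paths_sym)
  also have "homotopic_paths Sp (\<lambda>t. ?a t ** ?b t) (sheared_curve ?a (c T) u 0)"
    using homotopic_paths_mult_left[OF a a_Sp homotopic_contract_path[OF b b_nonneg]] sp_pathD(4)[OF c]
    by (simp add: sheared_curve_def[abs_def])
  also (homotopic_paths_trans) have "homotopic_paths Sp (sheared_curve ?a (c T) u 0) (sheared_curve ?a (c T) u r)"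
    by (rule homotopic_sheared_curve[OF a a_Sp W(1) u r])
  finally (homotopic_paths_trans) show ?thesis .
qed

theorem long_timelike_curves:
  fixes w :: "(real \<Rightarrow> 'n::finite sqm) set"
  assumes w: "w \<in> SpT" "c \<in> w" "w \<notin> SpT_top closure_of SpT_ell_plus" and c: "timelike c D"
  obtains P where "timelike_curve P" "P \<in> w" "B \<le> lengthG P"
proof -
  have path: "sp_path c" and w_cls: "w = cls c" using SpT_mem[OF w(1,2)] by auto
  have c0: "c 0 = mat 1" by (rule sp_pathD(4)[OF path])
  note interior = closure_of_interior_path[OF w(1,2)]
  obtain t0 where t0: "t0 \<in> {0<..1}" "c t0 \<notin> Sp_pos" using interior w(3) by (meson greaterThanAtMost_iff less_imp_le)
  obtain T u where T: "0 < T" "T \<le> 1" and before: "\<And>t. 0 < t \<Longrightarrow> t < T \<Longrightarrow> c t \<in> Sp_pos"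
    and cT: "c T \<in> Sp_nonneg" and u: "u \<noteq> 0" "c T *v u = - u"
    by (rule timelike_first_exit[OF c c0 t0]) (rule that)
  have "T \<noteq> 1" using interior before w(3) by blast
  then have T1: "T < 1" using T(2) by simp
  have nonneg: "c t \<in> Sp_nonneg" if "t \<in> {0..T}" for t
  proof -
    have "t = 0 \<or> t = T \<or> 0 < t \<and> t < T" using that by force
    then show ?thesis using c0 cT Sp_nonneg_one before Sp_pos_subset_Sp_nonneg by auto
  qed
  let ?P = "sheared_curve (\<lambda>t. c (T + t * (1 - T)) ** matrix_inv (c T)) (c T) u"
  obtain r where r: "r \<ge> 0" "timelike_curve (?P r)" "B \<le> lengthG (?P r)"
    by (rule sheared_curve_long[OF timelike_tail[OF c T(1) T1] cT u(2,1)])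
  have hom: "homotopic_paths Sp c (?P r)" by (rule homotopic_sheared_tail[OF path T(1) T1 nonneg u(2) r(1)])
  then have "sp_path (?P r)"
    using homotopic_paths_imp_path[OF hom] homotopic_paths_imp_subset[OF hom] homotopic_paths_imp_pathstart[OF hom] sp_pathD(3)[OF path]
    by (simp add: sp_path_def)
  then have "?P r \<in> w" using hom by (simp add: w_cls cls_def)
  then show ?thesis using that r(2,3) by blast
qed

section \<open>Lorentzian distance from the identity\<close>

lemma timelike_imp_causal: "timelike_curve (c :: real \<Rightarrow> 'n::finite sqm) \<Longrightarrow> causal_curve c"
proof -
  have "X \<noteq> 0 \<and> X \<in> closure sp_plus" if "X \<in> sp_plus" for X :: "'n sqm"
  proof
    show "X \<in> closure sp_plus" using that closure_subset by blast
    have "axis undefined 1 \<noteq> (0 :: real^('n + 'n))" by (simp add: axis_eq_0_iff)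
    then have "0 < omega0 (axis undefined 1) (X *v axis undefined 1)" using that unfolding sp_plus_def by blast
    then show "X \<noteq> 0" by (auto simp: omega.zero_right)
  qed
  then show "timelike_curve c \<Longrightarrow> causal_curve c" unfolding timelike_curve_def causal_curve_def by blast
qed

lemma causal_curve_weakly_causal:
  assumes c: "causal_curve c"
  shows "weakly_causal c (\<lambda>t. vector_derivative c (at t within {0..1}))" "path c" "path_image c \<subseteq> Sp"
proof -
  have curve: "Sp_curve c (\<lambda>t. vector_derivative c (at t within {0..1}))" by (rule C1_curve_Sp_curve) (use c in \<open>auto simp: causal_curve_def\<close>)
  then show "weakly_causal c (\<lambda>t. vector_derivative c (at t within {0..1}))"
    using weakly_causal_logder[OF curve] c by (simp add: causal_curve_def)
  show "path c" "path_image c \<subseteq> Sp" using Sp_curveD(2,4)[OF curve] by (auto simp: path_def path_image_def)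
qed

lemma timelike_curve_imp_timelike:
  assumes "timelike_curve c" shows "timelike c (\<lambda>t. vector_derivative c (at t within {0..1}))"
  using timelike_logder[OF C1_curve_Sp_curve[of c]] assms by (simp add: timelike_curve_def)

lemma causal_curve_from_idT_iff: "w \<in> SpT \<Longrightarrow> causal_curve c \<Longrightarrow> curve_from_to c idT w \<longleftrightarrow> c \<in> w"
  using curve_from_idT_iff causal_curve_weakly_causal(2,3) by blast

lemma distG_idT_le:
  assumes w: "w \<in> SpT" and B: "0 \<le> B" and length: "\<And>c. causal_curve c \<Longrightarrow> c \<in> w \<Longrightarrow> lengthG c \<le> B"
  shows "distG idT w \<le> ereal B"
proof -
  have "Sup ({0} \<union> {ereal (lengthG c) | c. causal_curve c \<and> curve_from_to c idT w}) \<le> ereal B"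
    by (rule Sup_least) (use B length causal_curve_from_idT_iff[OF w] in auto)
  then show ?thesis using B by (simp add: distG_def)
qed

lemma distG_idT_infinite:
  assumes w: "w \<in> SpT" and long: "\<And>B. \<exists>c. causal_curve c \<and> c \<in> w \<and> B \<le> lengthG c"
  shows "distG idT w = \<infinity>"
proof -
  let ?lengths = "{0} \<union> {ereal (lengthG c) | c. causal_curve c \<and> curve_from_to c idT w}"
  have "Sup ?lengths = \<infinity>"
  proof (rule ereal_top)
    fix B
    obtain c where c: "causal_curve c" "c \<in> w" "B \<le> lengthG c" using long by blast
    then have "ereal (lengthG c) \<le> Sup ?lengths" using causal_curve_from_idT_iff[OF w] by (intro Sup_upper) blast
    then show "ereal B \<le> Sup ?lengths" using c(3) by (meson ereal_less_eq(3) order_trans)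
  qed
  moreover have "causal_le idT w" using long causal_curve_from_idT_iff[OF w] by (auto simp: causal_le_def)
  ultimately show ?thesis by (simp add: distG_def)
qed

lemma causal_length_le_angle_sum:
  fixes w :: "(real \<Rightarrow> 'n::finite sqm) set"
  assumes w: "w \<in> SpT" "w \<in> SpT_top closure_of SpT_ell_plus" and c: "causal_curve c" "c \<in> w" and \<theta>: "spectral_angles (proj w) \<theta>"
  shows "lengthG c \<le> (1 / real CARD('n)) * (\<Sum>j\<in>UNIV. \<theta> $ j)"
proof -
  note causal = causal_curve_weakly_causal(1)[OF c(1)]
  have "c 1 = proj w" using proj_eq[OF w(1) c(2)] by (simp add: pathfinish_def)
  then have "real CARD('n) * lengthG c \<le> (\<Sum>j\<in>UNIV. \<theta> $ j)"
    using length_le_Sp_nonneg[OF causal weakly_causal_in_Sp_nonneg[OF w(2) causal c(2)]] \<theta> by simp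
  then show ?thesis by (simp add: field_simps)
qed

theorem theorem4:
  fixes w :: "(real \<Rightarrow> real^('n::finite + 'n)^('n + 'n)) set"
  assumes "w \<in> SpT"
  shows "(w \<in> SpT_top closure_of SpT_ell_plus \<longrightarrow>
            (\<exists>\<theta> :: 'n \<Rightarrow> real.
               (\<forall>j. 0 \<le> \<theta> j \<and> \<theta> j \<le> pi)
             \<and> (\<forall>z. charpoly (proj w) z =
                   (\<Prod>j\<in>UNIV. (z - exp (\<i> * complex_of_real (\<theta> j))) *
                               (z - exp (- \<i> * complex_of_real (\<theta> j)))))
             \<and> distG idT w \<le> ereal (2 * pi / real CARD('n) * maslov w)
             \<and> 2 * pi / real CARD('n) * maslov w = (1 / real CARD('n)) * (\<Sum>j\<in>UNIV. \<theta> j)))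
       \<and> ((\<exists>c. timelike_curve c \<and> curve_from_to c idT w)
             \<and> w \<notin> SpT_top closure_of SpT_ell_plus \<longrightarrow> distG idT w = \<infinity>)"
proof (intro conjI impI)
  assume closure: "w \<in> SpT_top closure_of SpT_ell_plus"
  then obtain \<theta> where \<theta>: "spectral_angles (proj w) \<theta>" "2 * pi * maslov w = (\<Sum>j\<in>UNIV. \<theta> $ j)" by (rule maslov_closure)
  then have maslov: "2 * pi / real CARD('n) * maslov w = (1 / real CARD('n)) * (\<Sum>j\<in>UNIV. \<theta> $ j)" by simp
  have "distG idT w \<le> ereal (2 * pi / real CARD('n) * maslov w)"
    unfolding maslov using spectral_angles_sum_bounds(1)[OF \<theta>(1)]
    by (intro distG_idT_le[OF assms] causal_length_le_angle_sum[OF assms closure _ _ \<theta>(1)]) simp_all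
  with maslov \<theta>(1) show "\<exists>\<theta> :: 'n \<Rightarrow> real. (\<forall>j. 0 \<le> \<theta> j \<and> \<theta> j \<le> pi)
      \<and> (\<forall>z. charpoly (proj w) z = (\<Prod>j\<in>UNIV. (z - exp (\<i> * complex_of_real (\<theta> j))) * (z - exp (- \<i> * complex_of_real (\<theta> j)))))
      \<and> distG idT w \<le> ereal (2 * pi / real CARD('n) * maslov w)
      \<and> 2 * pi / real CARD('n) * maslov w = (1 / real CARD('n)) * (\<Sum>j\<in>UNIV. \<theta> j)"
    by (intro exI[of _ "\<lambda>j. \<theta> $ j"]) (simp add: spectral_angles_def cis_conv_exp)
next
  assume "(\<exists>c. timelike_curve c \<and> curve_from_to c idT w) \<and> w \<notin> SpT_top closure_of SpT_ell_plus"
  then obtain c where c: "timelike_curve c" "c \<in> w" and not_closure: "w \<notin> SpT_top closure_of SpT_ell_plus"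
    using causal_curve_from_idT_iff[OF assms timelike_imp_causal] by blast
  show "distG idT w = \<infinity>"
    by (rule distG_idT_infinite[OF assms], rule long_timelike_curves[OF assms c(2) not_closure timelike_curve_imp_timelike[OF c(1)]])
      (use timelike_imp_causal in blast)
qed

end
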